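(* Let $u_L^*=(v_L^*,w_L^* )\in\mathcal H_1$, $u_R^*=(v_R^*,w_R^* )\in\mathcal H_3$ be such that the Riemann problem with data $u_L^*$ (left), $u_R^*$ (right) is solved by a single phase boundary of speed $V^*$ and no contact discontinuity; if $V^*=c_3$, assume $w_L^*=0$ and $w_R^*=\sqrt{\phi'(c_3)/c_3}$. Let $u_L^0\in BV_{loc}(\mathbb R_-,\mathcal H_1)$, $u_R^0\in BV_{loc}(\mathbb R_+,\mathcal H_3)$ with $\|u_L^0-u_L^*\|_{BV(\mathbb R_-)}+\|u_R^0-u_R^*\|_{BV(\mathbb R_+)}$ sufficiently small, and let $u$ be the limit in $L^1_{loc}$ (along a subsequence $h\to0$) of the functions $u^h$ given by Glimm's scheme with initial data $u_0=u_L^0$ for $x<0$, $u_0=u_R^0$ for $x>0$; let $\chi$ be the corresponding locally uniform limit of the approximate phase boundaries $\chi^h$ (extracting a further subsequence, $\chi^h\to\chi$ locally uniformly and $\frac{d\chi^h}{dt}\to\frac{d\chi}{dt}$ off a countable set of times). Suppose that $V^*\ne0$. Then $u$ satisfies $$\partial_tU(u)+\partial_xF(u)=\nu_t\,\phi\Big(-\frac{\nu_t}{\nu_x}\Big)\,\delta_{x=\chi(t)}$$ $H_1$-almost everywhere on the set $\mathcal B_{sub}(u)$, the equality being understood as an equality between Borel measures on $\mathbb R_+\times\mathbb R$.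
   Context: Notation: $]a,b[$ is the open interval; $\|f\|_{BV(\Omega)}=\|f\|_{L^1(\Omega)}+TV_\Omega(f)$; $H_1$ (as a measure) is one-dimensional Hausdorff measure. System $\partial_tw-\partial_xv=0$, $\partial_tv-\partial_x\sigma(w)=0$, $u=(v,w)$. Let $k_1>k_3>0$, $w_m>w_M>0$, $c_1=\sqrt{k_1}$, $c_3=\sqrt{k_3}$. $\sigma:]-1,\infty[\to\mathbb R$ is $\sigma(w)=k_1w$ for $-1<w\le w_M$, $\sigma(w)=k_3w$ for $w\ge w_m$, and affine on $[w_M,w_m]$ joining these values continuously. $\mathcal H_1=\{(v,w):v\in\mathbb R,-1<w\le w_M\}$, $\mathcal H_3=\{(v,w):v\in\mathbb R,w\ge w_m\}$, $\mathcal H=\mathcal H_1\cup\mathcal H_3$. Entropy pair: $U(u)=\int_0^w\sigma(y)dy+v^2/2$, $F(u)=-\sigma(w)v$. At a point of approximate jump of $u$, $\nu=(\nu_t,\nu_x)$ is the unit normal with $\nu_x>0$, $u_\pm$ the corresponding right/left limits, and $V=-\nu_t/\nu_x$. $\mathcal B_{sub}(u)$ is the set of all points of approximate jump at which $u_-,u_+$ belong to different phases ($\mathcal H_1$ and $\mathcal H_3$) and $|V|\le c_3$. $\delta_{x=\chi(t)}$ denotes $H_1$ restricted to the curve $\{(t,\chi(t))\}$, and $\nu$ on this curve is its unit normal. Entropy dissipation function. $\phi:]-c_3,c_3]\to\mathbb R$ is given with: $\phi\in C^2(]-c_3,0[\cup]0,c_3])$ and $\phi(0\pm),\phi'(0\pm)$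 exist; $\lim_{V\to c_3^-}\phi=\overline\psi(c_3)$ and $\phi'''(c_3-)$ exists; $\lim_{V\to-c_3^+}\phi=-\infty$; $\phi$ is increasing; $\underline\psi(V)\le\phi(V)\le0$ for $V\in]-c_3,0]$ and $0\le\phi(V)\le\overline\psi(V)$ for $V\in[0,c_3]$, where $\underline\psi(V)=\frac{k_1-k_3}2w_M\big(w_m-\frac{k_1-V^2}{k_3-V^2}w_M\big)$ and $\overline\psi(V)=\frac{k_1-k_3}2w_m\big(w_M-\frac{k_3-V^2}{k_1-V^2}w_m\big)$. If $\phi$ jumps at $0$, then at $V=0$ "$=\phi(0)$" is understood as membership in $[\phi(0-),\phi(0+)]$. Riemann solver $R(u_\ell,u_r)$ (self-similar in $x/t$) for states near $u_L^*$ or $u_R^*$. (i) $u_\ell,u_r$ both in $\mathcal H_i$ ($i=1$ or $3$): with $h=\frac{w_\ell+w_r}2+\frac{v_r-v_\ell}{2c_i}$, the states $u_\ell$, $(v_\ell+c_i(h-w_\ell),h)$, $u_r$ separated by contacts of speeds $-c_i,c_i$ (the paper takes for granted that $(\cdot,h)\in\mathcal H_i$ for the states considered, so that no new phase is created). (ii) $u_\ell\in\mathcal H_1$, $u_r\in\mathcal H_3$: let $h=\frac{c_1w_\ell+c_3w_r+v_r-v_\ell}{c_1+c_3}$. If $h>0$: states $u_\ell,u_-\in\mathcal H_1$, $u_+\in\mathcal H_3$, $u_r$ separated by discontinuities of speeds $-c_1<V<c_3$, $V\in]-c_3,c_3[$, where $w_-=\frac{c_3+V}{c_1+V}h$, $v_-=v_\ell+c_1(w_--w_\ell)$,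 $w_+=\frac{c_1-V}{c_3-V}h$, $v_+=v_r+c_3(w_r-w_+)$, and $V$ solves $\frac{k_1-k_3}2\{w_Mw_m-w_-w_+\}=\phi(V)$. If $h\le0$: states $u_\ell,u_-\in\mathcal H_1,u_r$ separated by a contact of speed $-c_1$ and a phase boundary of speed $V\in[c_3,c_1[$, determined by the Rankine–Hugoniot relations. Glimm's scheme. Mesh sizes $\tau,h>0$ with $h/\tau$ constant and $\tau c_1<h$; $\{a_n\}_{n\ge1}\subset]-1,1[$ is an equidistributed sequence. $u^h(0,x)=\frac1{2h}\int_{mh}^{(m+2)h}u_0(y)dy$ for $x\in[mh,(m+2)h[$, $m$ even; $u^h(n\tau+0,x)=u^h(n\tau-0,(m+1+a_n)h-0)$ for $x\in[mh,(m+2)h[$, $m+n$ even; for $n\tau\le t<(n+1)\tau$, $u^h$ is obtained by solving the Riemann problems centered at $x=mh$, $m+n$ even, with the solver $R$. At each time $u^h(t,\cdot)$ has exactly one jump from $\mathcal H_1$ to $\mathcal H_3$; its position $\chi^h(t)$ is the approximate phase boundary ($\chi^h$ is affine on each $[n\tau,(n+1)\tau[$ and may jump at $t=n\tau$). *)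

theory Defs
  imports "HOL-Analysis.Analysis"
begin

text \<open>
  States are pairs \<open>(v, w)\<close> of velocity and strain, space-time points are pairs \<open>(t, x)\<close>.
  The parameters \<open>k1, k3, wM, wm\<close> of the model and the dissipation function \<open>\<phi>\<close> are explicit
  arguments; the sound speeds are \<open>sqrt k1\<close> and \<open>sqrt k3\<close>.
\<close>

type_synonym state = "real \<times> real"
type_synonym point = "real \<times> real"

definition half_plane :: "point set" where
  "half_plane = {0<..} \<times> UNIV"


section \<open>One-dimensional Hausdorff measure\<close>

text \<open>In dimension one the normalising constant is 1, so that the measure of a curve is its length.
  \<open>diameter\<close> is only meaningful on bounded sets.\<close>

definition hausdorff1_outer :: "point set \<Rightarrow> ennreal" where
  "hausdorff1_outer A =
     (SUP \<delta>\<in>{0<..}.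
        INF C\<in>{C. A \<subseteq> (\<Union>i. C i) \<and> (\<forall>i. bounded (C i) \<and> diameter (C i) \<le> \<delta>)}.
          (\<Sum>i::nat. ennreal (diameter (C i))))"

definition hausdorff1 :: "point measure" where
  "hausdorff1 = measure_of UNIV (sets borel) hausdorff1_outer"


section \<open>Functions of bounded variation on an open subset of the line\<close>

definition test_fields :: "real set \<Rightarrow> (real \<Rightarrow> state) set" where
  "test_fields \<Omega> = {\<psi>. \<psi> C1_differentiable_on UNIV \<and> compact (closure {x. \<psi> x \<noteq> 0}) \<and>
     closure {x. \<psi> x \<noteq> 0} \<subseteq> \<Omega> \<and> (\<forall>x. norm (\<psi> x) \<le> 1)}"

text \<open>That \<open>ennreal\<close> cuts off negative values does not change the supremum, because 0 is a test
  field.\<close>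

definition total_variation :: "real set \<Rightarrow> (real \<Rightarrow> state) \<Rightarrow> ennreal" where
  "total_variation \<Omega> f =
     (SUP \<psi>\<in>test_fields \<Omega>. ennreal (LINT x:\<Omega>|lebesgue. f x \<bullet> vector_derivative \<psi> (at x)))"

definition BV_norm :: "real set \<Rightarrow> (real \<Rightarrow> state) \<Rightarrow> ennreal" where
  "BV_norm \<Omega> f = (\<integral>\<^sup>+x\<in>\<Omega>. ennreal (norm (f x)) \<partial>lebesgue) + total_variation \<Omega> f"

definition BV_loc :: "real set \<Rightarrow> (real \<Rightarrow> state) \<Rightarrow> bool" where
  "BV_loc \<Omega> f \<longleftrightarrow> f \<in> borel_measurable (lebesgue_on \<Omega>) \<and>
     (\<forall>K. compact K \<and> K \<subseteq> \<Omega> \<longrightarrow> set_integrable lebesgue K f) \<and>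
     (\<forall>G. open G \<and> bounded G \<and> closure G \<subseteq> \<Omega> \<longrightarrow> total_variation G f < \<infinity>)"


section \<open>The model\<close>

text \<open>Only the values of \<open>stress\<close> on \<open>{-1<..}\<close> matter.\<close>

definition stress :: "real \<Rightarrow> real \<Rightarrow> real \<Rightarrow> real \<Rightarrow> real \<Rightarrow> real" where
  "stress k1 k3 wM wm w =
     (if w \<le> wM then k1 * w
      else if w < wm then k1 * wM + (k3 * wm - k1 * wM) / (wm - wM) * (w - wM)
      else k3 * w)"

definition phase1 :: "real \<Rightarrow> state set" where
  "phase1 wM = {(v, w). -1 < w \<and> w \<le> wM}"

definition phase3 :: "real \<Rightarrow> state set" where
  "phase3 wm = {(v, w). wm \<le> w}"

definition entropy :: "real \<Rightarrow> real \<Rightarrow> real \<Rightarrow> real \<Rightarrow> state \<Rightarrow> real" where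
  "entropy k1 k3 wM wm = (\<lambda>(v, w). (LBINT y=0..ereal w. stress k1 k3 wM wm y) + v\<^sup>2 / 2)"

definition entropy_flux :: "real \<Rightarrow> real \<Rightarrow> real \<Rightarrow> real \<Rightarrow> state \<Rightarrow> real" where
  "entropy_flux k1 k3 wM wm = (\<lambda>(v, w). - (stress k1 k3 wM wm w) * v)"

text \<open>The Rankine--Hugoniot relations \<open>-s[w] - [v] = 0\<close>, \<open>-s[v] - [\<sigma>(w)] = 0\<close> of the system
  \<open>\<partial>\<^sub>t w - \<partial>\<^sub>x v = 0\<close>, \<open>\<partial>\<^sub>t v - \<partial>\<^sub>x \<sigma>(w) = 0\<close> at a discontinuity of speed \<open>s\<close>.\<close>

definition rankine_hugoniot ::
    "real \<Rightarrow> real \<Rightarrow> real \<Rightarrow> real \<Rightarrow> real \<Rightarrow> state \<Rightarrow> state \<Rightarrow> bool" where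
  "rankine_hugoniot k1 k3 wM wm s ul ur \<longleftrightarrow>
     - s * (snd ur - snd ul) - (fst ur - fst ul) = 0 \<and>
     - s * (fst ur - fst ul) - (stress k1 k3 wM wm (snd ur) - stress k1 k3 wM wm (snd ul)) = 0"


section \<open>The entropy dissipation function\<close>

definition psi_lower :: "real \<Rightarrow> real \<Rightarrow> real \<Rightarrow> real \<Rightarrow> real \<Rightarrow> real" where
  "psi_lower k1 k3 wM wm V = (k1 - k3) / 2 * wM * (wm - (k1 - V\<^sup>2) / (k3 - V\<^sup>2) * wM)"

definition psi_upper :: "real \<Rightarrow> real \<Rightarrow> real \<Rightarrow> real \<Rightarrow> real \<Rightarrow> real" where
  "psi_upper k1 k3 wM wm V = (k1 - k3) / 2 * wm * (wM - (k3 - V\<^sup>2) / (k1 - V\<^sup>2) * wm)"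

text \<open>The derivative relative to \<open>]-sqrt k3, 0[ \<union> ]0, sqrt k3]\<close>: at \<open>sqrt k3\<close> it is the left
  derivative, at all other points of this set the usual one.\<close>

definition deriv_phi :: "real \<Rightarrow> (real \<Rightarrow> real) \<Rightarrow> real \<Rightarrow> real" where
  "deriv_phi k3 f V = vector_derivative f (at V within ({- sqrt k3<..sqrt k3} - {0}))"

text \<open>\<open>f(a-)\<close>, \<open>f(a+)\<close> denote one-sided limits throughout, also for \<open>f = \<phi>'\<close> and \<open>f = \<phi>'''\<close>.
  The two sign conditions together give \<open>\<phi> 0 = 0\<close>; if \<open>\<phi>\<close> jumps at 0, only \<open>\<phi>(0\<plusminus>)\<close> enter below.\<close>

definition dissipation_function ::
    "real \<Rightarrow> real \<Rightarrow> real \<Rightarrow> real \<Rightarrow> (real \<Rightarrow> real) \<Rightarrow> bool" where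
  "dissipation_function k1 k3 wM wm \<phi> \<longleftrightarrow>
     (let c3 = sqrt k3;
          D = {- c3<..c3} - {0};
          \<phi>' = deriv_phi k3 \<phi>;
          \<phi>'' = deriv_phi k3 \<phi>'
      in (\<forall>V\<in>D. \<phi> differentiable (at V within D)) \<and>
         (\<forall>V\<in>D. \<phi>' differentiable (at V within D)) \<and>
         continuous_on D \<phi>'' \<and>
         (\<exists>l. (\<phi> \<longlongrightarrow> l) (at_left 0)) \<and> (\<exists>l. (\<phi> \<longlongrightarrow> l) (at_right 0)) \<and>
         (\<exists>l. (\<phi>' \<longlongrightarrow> l) (at_left 0)) \<and> (\<exists>l. (\<phi>' \<longlongrightarrow> l) (at_right 0)) \<and>
         (\<phi> \<longlongrightarrow> psi_upper k1 k3 wM wm c3) (at_left c3) \<and>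
         (\<forall>\<^sub>F V in at_left c3. \<phi>'' differentiable (at V)) \<and>
         (\<exists>l. (deriv \<phi>'' \<longlongrightarrow> l) (at_left c3)) \<and>
         filterlim \<phi> at_bot (at_right (- c3)) \<and>
         mono_on {- c3<..c3} \<phi> \<and>
         (\<forall>V\<in>{- c3<..0}. psi_lower k1 k3 wM wm V \<le> \<phi> V \<and> \<phi> V \<le> 0) \<and>
         (\<forall>V\<in>{0..c3}. 0 \<le> \<phi> V \<and> \<phi> V \<le> psi_upper k1 k3 wM wm V))"

text \<open>\<open>y = \<phi> V\<close>, with \<open>\<phi>\<close> regarded as the maximal monotone graph at 0.\<close>

definition phi_value :: "(real \<Rightarrow> real) \<Rightarrow> real \<Rightarrow> real \<Rightarrow> bool" where
  "phi_value \<phi> V y \<longleftrightarrow>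
     (if V = 0 then Lim (at_left 0) \<phi> \<le> y \<and> y \<le> Lim (at_right 0) \<phi> else y = \<phi> V)"


section \<open>The Riemann solver\<close>

definition fan2 :: "real \<Rightarrow> state \<Rightarrow> state \<Rightarrow> real \<Rightarrow> state" where
  "fan2 s ul ur \<xi> = (if \<xi> < s then ul else ur)"

definition fan3 :: "real \<Rightarrow> real \<Rightarrow> state \<Rightarrow> state \<Rightarrow> state \<Rightarrow> real \<Rightarrow> state" where
  "fan3 s1 s2 u1 u2 u3 \<xi> = (if \<xi> < s1 then u1 else if \<xi> < s2 then u2 else u3)"

definition fan4 ::
    "real \<Rightarrow> real \<Rightarrow> real \<Rightarrow> state \<Rightarrow> state \<Rightarrow> state \<Rightarrow> state \<Rightarrow> real \<Rightarrow> state" where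
  "fan4 s1 s2 s3 u1 u2 u3 u4 \<xi> =
     (if \<xi> < s1 then u1 else if \<xi> < s2 then u2 else if \<xi> < s3 then u3 else u4)"

text \<open>Data in one phase \<open>H\<close> with sound speed \<open>c\<close>; the intermediate state must lie in \<open>H\<close> again.\<close>

definition riemann_one_phase ::
    "real \<Rightarrow> state set \<Rightarrow> state \<Rightarrow> state \<Rightarrow> (real \<Rightarrow> state) \<Rightarrow> bool" where
  "riemann_one_phase c H ul ur r \<longleftrightarrow> ul \<in> H \<and> ur \<in> H \<and>
     (let z = (snd ul + snd ur) / 2 + (fst ur - fst ul) / (2 * c);
          um = (fst ul + c * (z - snd ul), z)
      in um \<in> H \<and> r = fan3 (- c) c ul um ur)"

definition riemann_two_phase ::
    "real \<Rightarrow> real \<Rightarrow> real \<Rightarrow> real \<Rightarrow> (real \<Rightarrow> real) \<Rightarrow> state \<Rightarrow> state \<Rightarrow> (real \<Rightarrow> state) \<Rightarrow> bool" where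
  "riemann_two_phase k1 k3 wM wm \<phi> ul ur r \<longleftrightarrow> ul \<in> phase1 wM \<and> ur \<in> phase3 wm \<and>
     (let c1 = sqrt k1; c3 = sqrt k3;
          z = (c1 * snd ul + c3 * snd ur + fst ur - fst ul) / (c1 + c3)
      in if z > 0 then
           (\<exists>V. - c3 < V \<and> V < c3 \<and>
             (let w1 = (c3 + V) / (c1 + V) * z; u1 = (fst ul + c1 * (w1 - snd ul), w1);
                  w2 = (c1 - V) / (c3 - V) * z; u2 = (fst ur + c3 * (snd ur - w2), w2)
              in u1 \<in> phase1 wM \<and> u2 \<in> phase3 wm \<and>
                 phi_value \<phi> V ((k1 - k3) / 2 * (wM * wm - w1 * w2)) \<and>
                 r = fan4 (- c1) V c3 ul u1 u2 ur))
         else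
           (\<exists>V u1. c3 \<le> V \<and> V < c1 \<and> u1 \<in> phase1 wM \<and>
             rankine_hugoniot k1 k3 wM wm (- c1) ul u1 \<and>
             rankine_hugoniot k1 k3 wM wm V u1 ur \<and>
             r = fan3 (- c1) V ul u1 ur))"

text \<open>\<open>r\<close> is the self-similar solution, as a function of \<open>x / t\<close>, that the solver assigns to the
  data \<open>ul\<close>, \<open>ur\<close>.\<close>

definition riemann_solution ::
    "real \<Rightarrow> real \<Rightarrow> real \<Rightarrow> real \<Rightarrow> (real \<Rightarrow> real) \<Rightarrow> state \<Rightarrow> state \<Rightarrow> (real \<Rightarrow> state) \<Rightarrow> bool" where
  "riemann_solution k1 k3 wM wm \<phi> ul ur r \<longleftrightarrow>
     riemann_one_phase (sqrt k1) (phase1 wM) ul ur r \<or>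
     riemann_one_phase (sqrt k3) (phase3 wm) ul ur r \<or>
     riemann_two_phase k1 k3 wM wm \<phi> ul ur r"


section \<open>Glimm's scheme\<close>

definition equidistributed :: "(nat \<Rightarrow> real) \<Rightarrow> bool" where
  "equidistributed a \<longleftrightarrow>
     (\<forall>n\<ge>1. -1 < a n \<and> a n < 1) \<and>
     (\<forall>\<alpha> \<beta>. -1 \<le> \<alpha> \<and> \<alpha> \<le> \<beta> \<and> \<beta> \<le> 1 \<longrightarrow>
        (\<lambda>N. real (card {n\<in>{1..N}. \<alpha> \<le> a n \<and> a n \<le> \<beta>}) / real N) \<longlonglongrightarrow> (\<beta> - \<alpha>) / 2)"

text \<open>The function \<open>g\<close> is \<open>uh(n\<tau>-0, \<cdot>)\<close>. The Riemann problem centred at \<open>(n\<tau>, mh)\<close> has the data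
  \<open>uh(n\<tau>, \<cdot>)\<close> takes on \<open>[(m-2)h, mh[\<close> (represented by the point \<open>(m-1)h\<close>) and on \<open>[mh, (m+2)h[\<close>;
  by the condition \<open>\<tau> sqrt k1 < h\<close> its solution is used on \<open>[(m-1)h, (m+1)h[\<close>.\<close>

definition glimm_scheme ::
    "real \<Rightarrow> real \<Rightarrow> real \<Rightarrow> real \<Rightarrow> (real \<Rightarrow> real) \<Rightarrow> real \<Rightarrow> real \<Rightarrow> (nat \<Rightarrow> real) \<Rightarrow>
     (real \<Rightarrow> state) \<Rightarrow> (point \<Rightarrow> state) \<Rightarrow> bool" where
  "glimm_scheme k1 k3 wM wm \<phi> \<tau> h a u0 uh \<longleftrightarrow>
     (\<forall>m::int. even m \<longrightarrow> (\<forall>x\<in>{of_int m * h..<of_int (m + 2) * h}.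
        uh (0, x) = (1 / (2 * h)) *\<^sub>R (LINT y:{of_int m * h..of_int (m + 2) * h}|lebesgue. u0 y))) \<and>
     (\<forall>n::nat. n \<ge> 1 \<longrightarrow>
        (\<exists>g. (\<forall>y. ((\<lambda>t. uh (t, y)) \<longlongrightarrow> g y) (at_left (real n * \<tau>))) \<and>
             (\<forall>m::int. even (m + int n) \<longrightarrow> (\<forall>x\<in>{of_int m * h..<of_int (m + 2) * h}.
                (g \<longlongrightarrow> uh (real n * \<tau>, x)) (at_left ((of_int m + 1 + a n) * h)))))) \<and>
     (\<forall>(n::nat) (m::int). even (m + int n) \<longrightarrow>
        (\<exists>r. riemann_solution k1 k3 wM wm \<phi> (uh (real n * \<tau>, of_int (m - 1) * h)) (uh (real n * \<tau>, of_int m * h)) r \<and>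
             (\<forall>t\<in>{real n * \<tau><..<real (n + 1) * \<tau>}. \<forall>x\<in>{of_int (m - 1) * h..<of_int (m + 1) * h}.
                uh (t, x) = r ((x - of_int m * h) / (t - real n * \<tau>)))))"

definition jump_13 :: "real \<Rightarrow> real \<Rightarrow> (real \<Rightarrow> state) \<Rightarrow> real \<Rightarrow> bool" where
  "jump_13 wM wm f x \<longleftrightarrow>
     (\<exists>ul\<in>phase1 wM. \<exists>ur\<in>phase3 wm. (f \<longlongrightarrow> ul) (at_left x) \<and> (f \<longlongrightarrow> ur) (at_right x))"

definition approx_phase_boundary ::
    "real \<Rightarrow> real \<Rightarrow> (point \<Rightarrow> state) \<Rightarrow> (real \<Rightarrow> real) \<Rightarrow> bool" where
  "approx_phase_boundary wM wm uh \<gamma>h \<longleftrightarrow>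
     (\<forall>t\<ge>0. \<forall>x. jump_13 wM wm (\<lambda>y. uh (t, y)) x \<longleftrightarrow> x = \<gamma>h t)"

definition L1_loc_limit :: "(nat \<Rightarrow> point \<Rightarrow> state) \<Rightarrow> (point \<Rightarrow> state) \<Rightarrow> bool" where
  "L1_loc_limit us u \<longleftrightarrow> u \<in> borel_measurable (lebesgue_on half_plane) \<and>
     (\<forall>K. compact K \<and> K \<subseteq> half_plane \<longrightarrow> set_integrable lebesgue K u \<and>
        (\<lambda>j. \<integral>\<^sup>+p\<in>K. ennreal (norm (us j p - u p)) \<partial>lebesgue) \<longlonglongrightarrow> 0)"

text \<open>The grid times at which some \<open>\<gamma>s j\<close> jumps belong to the countable set \<open>N\<close>.\<close>

definition phase_boundary_limit :: "(nat \<Rightarrow> real \<Rightarrow> real) \<Rightarrow> (real \<Rightarrow> real) \<Rightarrow> bool" where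
  "phase_boundary_limit \<gamma>s \<gamma> \<longleftrightarrow>
     (\<forall>T>0. uniform_limit {0..T} \<gamma>s \<gamma> sequentially) \<and>
     (\<exists>N. countable N \<and> (\<forall>t>0. t \<notin> N \<longrightarrow>
        \<gamma> differentiable (at t) \<and> (\<forall>j. \<gamma>s j differentiable (at t)) \<and>
        (\<lambda>j. deriv (\<gamma>s j) t) \<longlonglongrightarrow> deriv \<gamma> t))"


section \<open>Subsonic phase boundaries and entropy dissipation\<close>

definition half_ball :: "point \<Rightarrow> point \<Rightarrow> real \<Rightarrow> point set" where
  "half_ball \<nu> p r = {q \<in> ball p r. (q - p) \<bullet> \<nu> > 0}"

definition approx_limit :: "(point \<Rightarrow> state) \<Rightarrow> point \<Rightarrow> point \<Rightarrow> state \<Rightarrow> bool" where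
  "approx_limit u \<nu> p z \<longleftrightarrow>
     ((\<lambda>r. (\<integral>\<^sup>+q\<in>half_ball \<nu> p r. ennreal (norm (u q - z)) \<partial>lebesgue) / ennreal (r\<^sup>2))
        \<longlongrightarrow> 0) (at_right 0)"

definition approx_jump :: "(point \<Rightarrow> state) \<Rightarrow> point \<Rightarrow> point \<Rightarrow> state \<Rightarrow> state \<Rightarrow> bool" where
  "approx_jump u p \<nu> um up \<longleftrightarrow> p \<in> half_plane \<and> norm \<nu> = 1 \<and> um \<noteq> up \<and>
     approx_limit u (- \<nu>) p um \<and> approx_limit u \<nu> p up"

definition B_sub :: "real \<Rightarrow> real \<Rightarrow> real \<Rightarrow> (point \<Rightarrow> state) \<Rightarrow> point set" where
  "B_sub k3 wM wm u =
     {p. \<exists>\<nu> um up. approx_jump u p \<nu> um up \<and> snd \<nu> > 0 \<and>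
        (um \<in> phase1 wM \<and> up \<in> phase3 wm \<or> um \<in> phase3 wm \<and> up \<in> phase1 wM) \<and>
        \<bar>- fst \<nu> / snd \<nu>\<bar> \<le> sqrt k3}"

definition test_function ::
    "(point \<Rightarrow> real) \<Rightarrow> (point \<Rightarrow> real) \<Rightarrow> (point \<Rightarrow> real) \<Rightarrow> bool" where
  "test_function \<psi> \<psi>t \<psi>x \<longleftrightarrow> continuous_on UNIV \<psi>t \<and> continuous_on UNIV \<psi>x \<and>
     (\<forall>p. (\<psi> has_derivative (\<lambda>(s, y). \<psi>t p * s + \<psi>x p * y)) (at p)) \<and>
     compact (closure {p. \<psi> p \<noteq> 0}) \<and> closure {p. \<psi> p \<noteq> 0} \<subseteq> half_plane"

text \<open>\<open>\<partial>\<^sub>t f + \<partial>\<^sub>x g = \<mu>p - \<mu>n\<close> in the sense of distributions on the half-plane, where \<open>\<mu>p - \<mu>n\<close> is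
  a signed Radon measure; its restriction to Borel subsets of compact sets is determined by
  \<open>f\<close> and \<open>g\<close>, while the decomposition into \<open>\<mu>p\<close> and \<open>\<mu>n\<close> is not.\<close>

definition divergence_measure ::
    "(point \<Rightarrow> real) \<Rightarrow> (point \<Rightarrow> real) \<Rightarrow> point measure \<Rightarrow> point measure \<Rightarrow> bool" where
  "divergence_measure f g \<mu>p \<mu>n \<longleftrightarrow>
     sets \<mu>p = sets borel \<and> sets \<mu>n = sets borel \<and>
     (\<forall>K. compact K \<and> K \<subseteq> half_plane \<longrightarrow>
        set_integrable lebesgue K f \<and> set_integrable lebesgue K g \<and>
        emeasure \<mu>p K < \<infinity> \<and> emeasure \<mu>n K < \<infinity>) \<and>
     (\<forall>\<psi> \<psi>t \<psi>x. test_function \<psi> \<psi>t \<psi>x \<longrightarrow>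
        - (LINT p|lebesgue. f p * \<psi>t p + g p * \<psi>x p) = (LINT p|\<mu>p. \<psi> p) - (LINT p|\<mu>n. \<psi> p))"

text \<open>Unit normal \<open>(\<nu>\<^sub>t, \<nu>\<^sub>x)\<close> with \<open>\<nu>\<^sub>x > 0\<close> of the curve \<open>x = \<gamma>(t)\<close>; meaningful where \<open>\<gamma>\<close> is
  differentiable.\<close>

definition curve_normal :: "(real \<Rightarrow> real) \<Rightarrow> real \<Rightarrow> point" where
  "curve_normal \<gamma> t = (1 / sqrt (1 + (deriv \<gamma> t)\<^sup>2)) *\<^sub>R (- deriv \<gamma> t, 1)"

definition curve :: "(real \<Rightarrow> real) \<Rightarrow> point set" where
  "curve \<gamma> = {(t, \<gamma> t) |t. t > 0}"

definition dissipation_density :: "(real \<Rightarrow> real) \<Rightarrow> (real \<Rightarrow> real) \<Rightarrow> point \<Rightarrow> real" where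
  "dissipation_density \<phi> \<gamma> p =
     (let \<nu> = curve_normal \<gamma> (fst p) in fst \<nu> * \<phi> (- fst \<nu> / snd \<nu>))"

text \<open>The Borel measures \<open>\<mu>p - \<mu>n\<close> and \<open>\<rho> \<delta>\<close>, with \<open>\<delta>\<close> the restriction of the Hausdorff measure to
  \<open>\<Gamma>\<close>, coincide almost everywhere with respect to the Hausdorff measure on \<open>B\<close>, i.e. on the part of
  \<open>B\<close> outside some null set. As signed Radon measures they are evaluated on relatively compact
  Borel sets.\<close>

definition measures_equal_ae_on ::
    "point set \<Rightarrow> point measure \<Rightarrow> point measure \<Rightarrow> (point \<Rightarrow> real) \<Rightarrow> point set \<Rightarrow> bool" where
  "measures_equal_ae_on B \<mu>p \<mu>n \<rho> \<Gamma> \<longleftrightarrow>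
     (\<exists>N\<in>null_sets hausdorff1. \<forall>E\<in>sets borel.
        E \<subseteq> B - N \<and> compact (closure E) \<and> closure E \<subseteq> half_plane \<longrightarrow>
        set_integrable hausdorff1 (E \<inter> \<Gamma>) \<rho> \<and>
        measure \<mu>p E - measure \<mu>n E = (LINT p:E \<inter> \<Gamma>|hausdorff1. \<rho> p))"

end

theory Submission imports Defs "HOL-Analysis.Analysis" begin

text \<open>In each phase the system is linear, so the entropy and its flux are linear combinations of squares
  of Riemann invariants, each transported with a speed \<open>c = \<plusminus>c1\<close> or \<open>c = \<plusminus>c3\<close>. Glimm sampling shifts such a
  square by \<open>\<plusminus>h\<close> per time step; the average shift is \<open>c \<tau>\<close> because the sequence is equidistributed, and the
  sampled square changes only at the phase boundary, at a rate whose primitives converge, so that the rates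
  converge weak-star to \<open>\<gamma>' - c\<close>. The invariant of the incoming wave on either side of the boundary is an
  invariant of the initial data averaged over a cell that converges to the foot of a characteristic; as that foot
  depends injectively on time and data of bounded variation have limits of averages off a countable set,
  the traces converge off a countable set of times, except where \<open>\<gamma>' = c3\<close>, where the rate for the speed
  \<open>c3\<close> tends to 0 strongly. The limit production is \<open>-\<gamma>' \<phi>(\<gamma>') dt\<close> wherever \<open>\<gamma>' \<le> c3\<close>, and this holds at
  every differentiability point of the curve in the set of subsonic boundary points. The area formula for
  Lipschitz graphs turns it into a density with respect to Hausdorff measure.\<close>

text \<open>A weakly convergent rate may only be multiplied by traces that converge almost
  everywhere. The incoming invariants r- and r+ give z = (r+ - r-)/(c1 + c3), and both traces then
  follow from (c1 + V) w- = (c3 + V) z and (c3 - V) w+ = (c1 - V) z. The second relation degenerates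
  at V = c3: there w+ need not converge, and even its boundedness requires the linear bound K0 -
  \<phi>(V) \<le> C (c3 - V). The cure is that the rate for the speed c3 is nonzero only in steps
  whose sample lies between V and c3, and such steps become rare as V tends to c3. Injectivity of
  the feet rests on -c3 < \<gamma>' < c1 off a countable set; at -c3 this comes from \<phi> tending
  to minus infinity, at c1 from w+ \<ge> wm > 0. In phase 3 the energy is a quadratic form plus the
  constant K0 = K wM wm; adding 2 K0 to each of the two squares there accounts for it, and
  \<phi>(c3) = K0 gives the right production at V = c3.\<close>

lemma fst_snd_borel [measurable]:
  "fst \<in> measurable (borel :: point measure) borel" "snd \<in> measurable (borel :: point measure) borel"
  by (intro borel_measurable_continuous_onI continuous_intros)+

lemma integrable_bounded_Icc:
  fixes f :: "real \<Rightarrow> real"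
  assumes "f \<in> borel_measurable borel" "\<And>t. \<bar>f t\<bar> \<le> B" "\<And>t. t \<notin> {a..b} \<Longrightarrow> f t = 0"
  shows "integrable lborel f"
  by (rule integrableI_bounded_set[where A="{a..b}" and B=B]) (use assms in \<open>auto simp: emeasure_lborel_Icc_eq\<close>)

text \<open>Hinge functions have C1 primitives even at the kink. This serves twice: for the smooth
  ramps that test total variation, and for the primitive of the piecewise affine stress.\<close>

lemma has_derivative_positive_part_square:
  "((\<lambda>x. (max 0 (x - a))\<^sup>2 / 2) has_real_derivative (max 0 (x - a))) (at (x :: real))"
proof -
  consider "x < a" | "x > a" | "x = a" by linarith
  then show ?thesis
  proof cases
    case 1
    have "((\<lambda>_. 0) has_real_derivative (max 0 (x - a))) (at x)" using 1 by simp
    then show ?thesis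
      by (rule has_field_derivative_transform_within_open[of _ _ _ "{..<a}"]) (use 1 in auto)
  next
    case 2
    have "((\<lambda>x. (x - a)\<^sup>2 / 2) has_real_derivative (max 0 (x - a))) (at x)" using 2
      by (auto intro!: derivative_eq_intros)
    then show ?thesis
      by (rule has_field_derivative_transform_within_open[of _ _ _ "{a<..}"]) (use 2 in auto)
  next
    case 3
    have "((\<lambda>h. (max 0 (x + h - a))\<^sup>2 / 2 / h) \<longlongrightarrow> 0) (at 0)"
    proof (rule tendsto_0_le[OF tendsto_ident_at, where K="1/2"], rule always_eventually, rule allI)
      fix h :: real
      have "\<bar>(max 0 h)\<^sup>2\<bar> \<le> \<bar>h\<bar> * \<bar>h\<bar>" by (auto simp: max_def power2_eq_square)
      then show "norm ((max 0 (x + h - a))\<^sup>2 / 2 / h) \<le> norm h * (1/2)" using 3 by (cases "h = 0") (auto simp: field_simps abs_mult)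
    qed
    then show ?thesis using 3 by (simp add: DERIV_def)
  qed
qed

lemma compact_support_uniformly_continuous:
  fixes f :: "point \<Rightarrow> real"
  assumes cont: "continuous_on UNIV f" and K: "compact K" "\<And>p. p \<notin> K \<Longrightarrow> f p = 0" and e: "e > 0"
  shows "\<exists>\<delta>>0. \<forall>p p'. dist p p' \<le> \<delta> \<longrightarrow> \<bar>f p - f p'\<bar> \<le> e"
proof -
  obtain R where R: "\<forall>p\<in>K. norm p \<le> R" using compact_imp_bounded[OF K(1)] unfolding bounded_iff by blast
  have "uniformly_continuous_on (cball 0 (R + 1)) f"
    by (rule compact_uniformly_continuous) (auto intro: continuous_on_subset[OF cont])
  then obtain \<delta> where \<delta>: "\<delta> > 0" "\<And>p p'. p \<in> cball 0 (R + 1) \<Longrightarrow> p' \<in> cball 0 (R + 1) \<Longrightarrow> dist p' p < \<delta> \<Longrightarrow> dist (f p') (f p) < e"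
    unfolding uniformly_continuous_on_def using e by meson
  \<comment> \<open>Two points at distance at most 1, one of them farther out than R + 1, both lie
    outside the ball of radius R that contains K, so both values vanish. All remaining pairs lie in
    one compact ball.\<close>
  have far: "\<bar>f p - f p'\<bar> \<le> e" if "norm p > R + 1" "dist p p' \<le> 1" for p p'
  proof -
    have "norm p \<le> norm p' + dist p p'" using norm_triangle_sub[of p p'] by (simp add: dist_norm)
    then have "norm p' > R" "norm p > R" using that by auto
    then have "p \<notin> K" "p' \<notin> K" using R by auto
    then show ?thesis using K(2) e by simp
  qed
  show ?thesis
  proof (intro exI conjI allI impI)
    show "min 1 (\<delta> / 2) > 0" using \<delta>(1) by simp
    fix p p' :: point assume d: "dist p p' \<le> min 1 (\<delta> / 2)"
    show "\<bar>f p - f p'\<bar> \<le> e"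
    proof (cases "norm p > R + 1 \<or> norm p' > R + 1")
      case True
      then show ?thesis using far[of p p'] far[of p' p] d by (auto simp: dist_commute abs_minus_commute)
    next
      case False
      then have "dist (f p) (f p') < e" using d \<delta>(1) by (intro \<delta>(2)) auto
      then show ?thesis by (simp add: dist_real_def)
    qed
  qed
qed

definition test_box :: "point set \<Rightarrow> real \<Rightarrow> (point \<Rightarrow> real) \<Rightarrow> (point \<Rightarrow> real) \<Rightarrow> (point \<Rightarrow> real) \<Rightarrow> bool" where
  "test_box K T \<psi> \<psi>t \<psi>x \<longleftrightarrow> compact K \<and> K \<subseteq> half_plane \<and> T > 0 \<and> (\<forall>p. p \<notin> K \<longrightarrow> \<psi> p = 0 \<and> \<psi>t p = 0 \<and> \<psi>x p = 0) \<and>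
    (\<forall>t x. (t, x) \<in> K \<longrightarrow> 0 < t \<and> t < T \<and> \<bar>x\<bar> \<le> T)"

lemma test_boxD:
  assumes "test_box K T \<psi> \<psi>t \<psi>x"
  shows "compact K" "K \<subseteq> half_plane" "T > 0"
    "\<And>p. p \<notin> K \<Longrightarrow> \<psi> p = 0" "\<And>p. p \<notin> K \<Longrightarrow> \<psi>t p = 0" "\<And>p. p \<notin> K \<Longrightarrow> \<psi>x p = 0"
    "\<And>t x. (t, x) \<in> K \<Longrightarrow> 0 < t \<and> t < T \<and> \<bar>x\<bar> \<le> T"
  using assms unfolding test_box_def by blast+

lemma ex_test_box:
  assumes test: "test_function \<psi> \<psi>t \<psi>x"
  obtains K T where "test_box K T \<psi> \<psi>t \<psi>x"
proof -
  define K where "K = closure {p. \<psi> p \<noteq> 0}"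
  have K: "compact K" "K \<subseteq> half_plane" and der: "\<And>p. (\<psi> has_derivative (\<lambda>(s, y). \<psi>t p * s + \<psi>x p * y)) (at p)"
    using test unfolding test_function_def K_def by blast+
  obtain R where R: "\<forall>p\<in>K. norm p \<le> R" using compact_imp_bounded[OF K(1)] unfolding bounded_iff by blast
  have z: "\<psi> p = 0 \<and> \<psi>t p = 0 \<and> \<psi>x p = 0" if "p \<notin> K" for p
  proof -
    have e: "\<psi> p' = 0" if "p' \<in> - K" for p' using that closure_subset[of "{p. \<psi> p \<noteq> 0}"] unfolding K_def by blast
    \<comment> \<open>On the open complement of the support \<psi> is identically 0; uniqueness of
      the derivative then kills \<open>\<psi>t\<close> and \<open>\<psi>x\<close>, which are only
      given as coefficients of the derivative.\<close>
    have "(\<psi> has_derivative (\<lambda>_. 0)) (at p)"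
      by (rule has_derivative_transform_within_open[of "\<lambda>_. 0" _ _ _ "- K"])
        (use that e K(1) in \<open>auto simp: compact_imp_closed open_Compl\<close>)
    from has_derivative_unique[OF der this] have eq: "(\<lambda>(s, y). \<psi>t p * s + \<psi>x p * y) = (\<lambda>_. 0)" .
    show ?thesis using fun_cong[OF eq, of "(1, 0)"] fun_cong[OF eq, of "(0, 1)"] e that by simp
  qed
  have "0 < t \<and> t < \<bar>R\<bar> + 1 \<and> \<bar>x\<bar> \<le> \<bar>R\<bar> + 1" if p: "(t, x) \<in> K" for t x
  proof -
    have "0 < t" using p K(2) by (auto simp: half_plane_def)
    moreover have "\<bar>t\<bar> \<le> R" using R p norm_fst_le[of t x] by force
    moreover have "\<bar>x\<bar> \<le> R" using R p norm_snd_le[of x t] by force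
    ultimately show ?thesis by auto
  qed
  then show thesis using K z by (intro that[of K "\<bar>R\<bar> + 1"]) (auto simp: test_box_def)
qed

lemma compact_support_bounded:
  fixes f :: "point \<Rightarrow> real"
  assumes cont: "continuous_on UNIV f" and K: "compact K" "\<And>p. p \<notin> K \<Longrightarrow> f p = 0"
  obtains C where "C \<ge> 0" "\<And>p. \<bar>f p\<bar> \<le> C"
proof -
  have "compact (f ` K)" by (rule compact_continuous_image[OF continuous_on_subset[OF cont] K(1)]) simp
  from compact_imp_bounded[OF this] obtain C where C: "\<forall>y\<in>f ` K. norm y \<le> C" unfolding bounded_iff by blast
  show thesis
  proof (rule that[of "\<bar>C\<bar>"])
    fix p show "\<bar>f p\<bar> \<le> \<bar>C\<bar>"
    proof (cases "p \<in> K")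
      case True
      then have "norm (f p) \<le> C" using C by blast
      then show ?thesis by simp
    qed (simp add: K(2))
  qed simp
qed

lemma test_function_continuous:
  assumes "test_function \<psi> \<psi>t \<psi>x"
  shows "continuous_on S \<psi>" "continuous_on S \<psi>t" "continuous_on S \<psi>x"
proof -
  have c: "continuous_on UNIV \<psi>t" "continuous_on UNIV \<psi>x" and d: "\<And>p. (\<psi> has_derivative (\<lambda>(s, y). \<psi>t p * s + \<psi>x p * y)) (at p)"
    using assms unfolding test_function_def by auto
  show "continuous_on S \<psi>" using has_derivative_continuous[OF d] by (simp add: continuous_at_imp_continuous_on)
  show "continuous_on S \<psi>t" "continuous_on S \<psi>x" using c by (auto intro: continuous_on_subset)
qed

lemma closed_intervals_generate:
  "Int_stable (range (\<lambda>(a, b). {a..b :: real}))" "sigma_sets UNIV (range (\<lambda>(a, b). {a..b :: real})) = sets borel"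
proof -
  show "Int_stable (range (\<lambda>(a, b). {a..b :: real}))"
  proof (rule Int_stableI)
    fix X Y assume "X \<in> range (\<lambda>(a, b). {a..b :: real})" "Y \<in> range (\<lambda>(a, b). {a..b :: real})"
    then obtain a b c d where "X = {a..b}" "Y = {c..d}" by auto
    then have "X \<inter> Y = {max a c..min b d}" by auto
    then show "X \<inter> Y \<in> range (\<lambda>(a, b). {a..b :: real})" by auto
  qed
  show "sigma_sets UNIV (range (\<lambda>(a, b). {a..b :: real})) = sets borel"
    unfolding borel_eq_atLeastAtMost by (simp add: sets_measure_of)
qed

text \<open>The integral of a difference quotient telescopes to the mean of \<open>m j\<close> over
  [y, y + \<tau>] minus its mean over [x, x + \<tau>], and these means inherit the uniform limit.
  Nothing is asked of the differences themselves, so \<open>m j\<close> may be a step function whose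
  quotients converge only weakly. The interval is enlarged by 1 to contain y + \<tau> for small
  \<tau>.\<close>

lemma integral_difference_quotient_tendsto:
  fixes m :: "nat \<Rightarrow> real \<Rightarrow> real" and \<tau> :: "nat \<Rightarrow> real" and f :: "real \<Rightarrow> real"
  assumes m[measurable]: "\<And>j. m j \<in> borel_measurable borel" and cont: "continuous_on UNIV f"
    and tau: "\<And>j. \<tau> j > 0" "\<tau> \<longlonglongrightarrow> 0" and xy: "x \<le> y"
    and unif: "\<And>e. e > 0 \<Longrightarrow> eventually (\<lambda>j. \<forall>t\<in>{x..y + 1}. \<bar>m j t - f t\<bar> \<le> e) sequentially"
    and bnd: "\<And>j T. \<exists>C. \<forall>t\<in>{x..T}. \<bar>m j t\<bar> \<le> C"
  shows "(\<lambda>j. LBINT t. indicator {x..y} t * ((m j (t + \<tau> j) - m j t) / \<tau> j)) \<longlonglongrightarrow> f y - f x"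
proof -
  define I where "I j s t = (LBINT r. indicator {s..t} r * m j r)" for j s t
  have ic: "integrable lborel (\<lambda>r. indicator {s..t} r * c)" for s t c :: real
    by (rule integrable_bounded_Icc[of _ "\<bar>c\<bar>" s t]) (auto simp: indicator_def)
  have int: "integrable lborel (\<lambda>r. indicator {s..t} r * m j r)" if "x \<le> s" for s t j
  proof -
    obtain C where C: "\<forall>r\<in>{x..t}. \<bar>m j r\<bar> \<le> C" using bnd by blast
    have "\<bar>indicator {s..t} r * m j r\<bar> \<le> \<bar>C\<bar>" for r
      using bspec[OF C, of r] that by (cases "r \<in> {s..t}") auto
    then show ?thesis by (intro integrable_bounded_Icc[of _ "\<bar>C\<bar>" s t]) auto
  qed
  have eq: "(LBINT t. indicator {x..y} t * ((m j (t + \<tau> j) - m j t) / \<tau> j)) = I j y (y + \<tau> j) / \<tau> j - I j x (x + \<tau> j) / \<tau> j" for j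
  proof -
    have t0: "\<tau> j > 0" by (rule tau)
    have ip: "integrable lborel (\<lambda>t. indicator {x + \<tau> j..y + \<tau> j} t * m j t)" by (rule int) (use t0 in simp)
    have sh: "indicator {x + \<tau> j..y + \<tau> j} (\<tau> j + 1 * t) * m j (\<tau> j + 1 * t) = indicator {x..y} t * m j (t + \<tau> j)" for t
      by (simp add: indicator_def add.commute)
    have "integrable lborel (\<lambda>t. indicator {x..y} t * m j (t + \<tau> j))"
      using lborel_integrable_real_affine[OF ip, of 1 "\<tau> j"] unfolding sh by simp
    then have "(LBINT t. indicator {x..y} t * ((m j (t + \<tau> j) - m j t) / \<tau> j)) = ((LBINT t. indicator {x..y} t * m j (t + \<tau> j)) - I j x y) / \<tau> j"
      using int[of x y j] by (simp add: I_def right_diff_distrib diff_divide_distrib)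
    also have "(LBINT t. indicator {x..y} t * m j (t + \<tau> j)) = I j (x + \<tau> j) (y + \<tau> j)"
      using lborel_integral_real_affine[of 1 "\<lambda>t. indicator {x + \<tau> j..y + \<tau> j} t * m j t" "\<tau> j"] unfolding sh I_def by simp
    also have "I j (x + \<tau> j) (y + \<tau> j) - I j x y = I j y (y + \<tau> j) - I j x (x + \<tau> j)"
    proof -
      note i = ip int[of x y j] int[of y "y + \<tau> j" j] int[of x "x + \<tau> j" j]
      \<comment> \<open>Off the four endpoints the closed intervals behave as if they were disjoint,
        and the identity between the indicators holds.\<close>
      have "AE t in lborel. t \<noteq> x \<and> t \<noteq> y \<and> t \<noteq> x + \<tau> j \<and> t \<noteq> y + \<tau> j" by (intro AE_conjI AE_lborel_singleton)
      then have "AE t in lborel. indicator {x + \<tau> j..y + \<tau> j} t * m j t - indicator {x..y} t * m j t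
          = indicator {y..y + \<tau> j} t * m j t - indicator {x..x + \<tau> j} t * m j t"
        by eventually_elim (use t0 xy in \<open>auto simp: indicator_def\<close>)
      then have "(LBINT t. indicator {x + \<tau> j..y + \<tau> j} t * m j t - indicator {x..y} t * m j t)
          = (LBINT t. indicator {y..y + \<tau> j} t * m j t - indicator {x..x + \<tau> j} t * m j t)"
        by (intro integral_cong_AE) auto
      then show ?thesis using i xy by (simp add: I_def)
    qed
    finally show ?thesis by (simp add: diff_divide_distrib)
  qed
  have lim: "(\<lambda>j. I j s (s + \<tau> j) / \<tau> j) \<longlonglongrightarrow> f s" if s: "x \<le> s" "s \<le> y" for s
  proof (rule LIMSEQ_I)
    fix r :: real assume r: "r > 0"
    have "isCont f s" using cont by (simp add: continuous_on_eq_continuous_at)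
    then obtain \<delta> where \<delta>: "\<delta> > 0" "\<And>t. \<bar>t - s\<bar> < \<delta> \<Longrightarrow> \<bar>f t - f s\<bar> < r / 4"
      using r unfolding continuous_at_eps_delta by (metis dist_real_def zero_less_divide_iff zero_less_numeral)
    have "eventually (\<lambda>j. \<tau> j < min \<delta> 1) sequentially" using \<delta> by (intro order_tendstoD(2)[OF tau(2)]) auto
    moreover have "eventually (\<lambda>j. \<forall>t\<in>{x..y + 1}. \<bar>m j t - f t\<bar> \<le> r / 4) sequentially" using r by (intro unif) auto
    ultimately have "eventually (\<lambda>j. norm (I j s (s + \<tau> j) / \<tau> j - f s) < r) sequentially"
    proof eventually_elim
      case (elim j)
      let ?J = "{s..s + \<tau> j}"
      have t0: "\<tau> j > 0" by (rule tau)
      have mean: "(LBINT t. indicator ?J t * c) = c * \<tau> j" for c using t0 by simp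
      have "I j s (s + \<tau> j) - f s * \<tau> j = (LBINT t. indicator ?J t * m j t - indicator ?J t * f s)"
        unfolding I_def mean[symmetric] using int[OF s(1), of "s + \<tau> j" j] ic by simp
      also have "\<bar>\<dots>\<bar> \<le> (LBINT t. indicator ?J t * (r / 2))"
      proof (rule integral_abs_bound_integral)
        fix t
        show "\<bar>indicator ?J t * m j t - indicator ?J t * f s\<bar> \<le> indicator ?J t * (r / 2)"
        proof (cases "t \<in> ?J")
          case True
          then have "\<bar>m j t - f t\<bar> \<le> r / 4" "\<bar>f t - f s\<bar> < r / 4" using elim s \<delta>(2)[of t] by auto
          then have "\<bar>m j t - f s\<bar> \<le> r / 2" by linarith
          then show ?thesis using True by simp
        qed simp
      qed (use int[OF s(1)] ic in auto)
      finally have "\<bar>I j s (s + \<tau> j) - f s * \<tau> j\<bar> \<le> r / 2 * \<tau> j" unfolding mean .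
      also have "\<dots> < r * \<tau> j" using r t0 by simp
      finally have "\<bar>I j s (s + \<tau> j) - f s * \<tau> j\<bar> / \<tau> j < r" using t0 by (simp add: pos_divide_less_eq)
      moreover have "I j s (s + \<tau> j) / \<tau> j - f s = (I j s (s + \<tau> j) - f s * \<tau> j) / \<tau> j" using t0 by (simp add: field_simps)
      ultimately show ?case using t0 by (simp only: real_norm_def abs_divide abs_of_pos)
    qed
    then show "\<exists>no. \<forall>j\<ge>no. norm (I j s (s + \<tau> j) / \<tau> j - f s) < r" unfolding eventually_sequentially .
  qed
  show ?thesis unfolding eq by (intro tendsto_diff lim) (use xy in auto)
qed

lemma Lipschitz_real_continuous:
  fixes f :: "real \<Rightarrow> real"
  assumes "\<And>s t. \<bar>f s - f t\<bar> \<le> C * \<bar>s - t\<bar>"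
  shows "continuous_on S f" "f \<in> borel_measurable borel"
proof -
  have "C \<ge> 0" using assms[of 0 1] by simp
  then have "C-lipschitz_on UNIV f" using assms by (auto intro!: lipschitz_onI simp: dist_real_def)
  then have c: "continuous_on UNIV f" by (rule lipschitz_on_continuous_on)
  then show "continuous_on S f" by (rule continuous_on_subset) simp
  show "f \<in> borel_measurable borel" by (rule borel_measurable_continuous_onI[OF c])
qed

lemma Lipschitz_difference_quotient:
  fixes f :: "real \<Rightarrow> real" and e :: "nat \<Rightarrow> real"
  assumes "continuous_on UNIV f" "\<And>n. e n > 0" "e \<longlonglongrightarrow> 0" "a \<le> b"
  shows "(\<lambda>n. LBINT t. indicator {a..b} t * ((f (t + e n) - f t) / e n)) \<longlonglongrightarrow> f b - f a"
proof (rule integral_difference_quotient_tendsto[where m="\<lambda>_. f"])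
  show "\<exists>C. \<forall>t\<in>{a..T}. \<bar>f t\<bar> \<le> C" for T
    using compact_imp_bounded[OF compact_continuous_image[OF continuous_on_subset[OF assms(1)] compact_Icc]] unfolding bounded_iff by fastforce
qed (use assms in \<open>auto intro: borel_measurable_continuous_onI\<close>)

lemma difference_quotient_tendsto:
  fixes f :: "real \<Rightarrow> real" and e :: "nat \<Rightarrow> real"
  assumes "(f has_real_derivative d) (at t)" "\<And>n. e n > 0" "e \<longlonglongrightarrow> 0"
  shows "(\<lambda>n. (f (t + e n) - f t) / e n) \<longlonglongrightarrow> d"
proof -
  have "((\<lambda>h. (f (t + h) - f t) / h) \<longlongrightarrow> d) (at 0)" using assms(1) by (simp add: DERIV_def)
  moreover have "filterlim e (at 0) sequentially" using assms(2,3) by (auto simp: filterlim_at less_imp_neq[symmetric])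
  ultimately show ?thesis by (rule filterlim_compose)
qed

text \<open>The difference quotients are bounded by C and converge almost everywhere to d, so by
  dominated convergence their integrals tend to that of d; by telescoping the same integrals tend to
  the increment of \<gamma>.\<close>

lemma Lipschitz_FTC:
  fixes \<gamma> d :: "real \<Rightarrow> real"
  assumes lip: "\<And>s t. \<bar>\<gamma> s - \<gamma> t\<bar> \<le> C * \<bar>s - t\<bar>"
    and der: "AE t in lborel. (\<gamma> has_real_derivative d t) (at t)"
    and [measurable]: "d \<in> borel_measurable borel" and ab: "a \<le> b"
  shows "set_integrable lborel {a..b} d" "(LINT t:{a..b}|lborel. d t) = \<gamma> b - \<gamma> a"
proof -
  define e where "e n = 1 / real (Suc n)" for n
  have e_pos: "e n > 0" for n by (simp add: e_def)
  have e0: "e \<longlonglongrightarrow> 0" unfolding e_def using LIMSEQ_inverse_real_of_nat by (simp add: inverse_eq_divide)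
  note [measurable] = Lipschitz_real_continuous(2)[OF lip]
  define f where "f n t = (\<gamma> (t + e n) - \<gamma> t) / e n" for n t
  have "\<bar>f n t\<bar> \<le> C" for n t using lip[of "t + e n" t] e_pos[of n] by (simp add: f_def field_simps)
  then have 4: "AE t in lborel. norm (indicator {a..b} t * f n t) \<le> indicator {a..b} t * C" for n by (auto simp: indicator_def)
  have 3: "AE t in lborel. (\<lambda>n. indicator {a..b} t * f n t) \<longlonglongrightarrow> indicator {a..b} t * d t"
    using der unfolding f_def by eventually_elim (intro tendsto_intros difference_quotient_tendsto e_pos e0)
  have dom: "integrable lborel (\<lambda>t. indicator {a..b} t * C)"
    by (intro integrable_mult_left integrable_real_indicator) (auto simp: emeasure_lborel_Icc_eq)
  have 1: "(\<lambda>t. indicator {a..b} t * d t) \<in> borel_measurable lborel" and 2: "\<And>n. (\<lambda>t. indicator {a..b} t * f n t) \<in> borel_measurable lborel"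
    unfolding f_def by measurable
  show "set_integrable lborel {a..b} d"
    using integrable_dominated_convergence[OF 1 2 dom 3 4] by (simp add: set_integrable_def)
  have "(\<lambda>n. LBINT t. indicator {a..b} t * f n t) \<longlonglongrightarrow> (LBINT t. indicator {a..b} t * d t)"
    by (rule integral_dominated_convergence[OF 1 2 dom 3 4])
  moreover have "(\<lambda>n. LBINT t. indicator {a..b} t * f n t) \<longlonglongrightarrow> \<gamma> b - \<gamma> a"
    unfolding f_def by (rule Lipschitz_difference_quotient[OF Lipschitz_real_continuous(1)[OF lip] e_pos e0 ab])
  ultimately show "(LINT t:{a..b}|lborel. d t) = \<gamma> b - \<gamma> a"
    using LIMSEQ_unique by (fastforce simp: set_lebesgue_integral_def)
qed

section \<open>Hausdorff measure on Lipschitz graphs\<close>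

lemma sets_hausdorff1 [measurable_cong, simp]: "sets hausdorff1 = sets borel"
  unfolding hausdorff1_def by (simp add: sets_measure_of_conv sets.sigma_sets_eq[of borel, simplified])

lemma space_hausdorff1 [simp]: "space hausdorff1 = UNIV"
  using sets_eq_imp_space_eq[OF sets_hausdorff1] by simp

text \<open>\<open>measure_of\<close> returns the zero measure when the given set function is not
  countably additive on the Borel sets. The case is carried along here and settled separately in
  \<open>dissipation_on_curve\<close>.\<close>

lemma emeasure_hausdorff1:
  "emeasure hausdorff1 A =
     (if A \<in> sets borel \<and> measure_space UNIV (sets borel) hausdorff1_outer then hausdorff1_outer A else 0)"
  unfolding hausdorff1_def by (simp add: emeasure_measure_of_conv sets.sigma_sets_eq[of borel, simplified])

text \<open>\<Lambda> plays the part of arc length. The images of N equal subintervals cover the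
  path, each has diameter at most the increment of \<Lambda>, and the increments telescope; the
  Lipschitz bound on \<Lambda> pushes all diameters below \<delta> for large N. The covering
  sequence is padded with empty sets.\<close>

lemma hausdorff1_outer_path_le:
  fixes \<Phi> :: "real \<Rightarrow> point"
  assumes ab: "a \<le> b"
    and len: "\<And>x y. a \<le> x \<Longrightarrow> x \<le> y \<Longrightarrow> y \<le> b \<Longrightarrow> dist (\<Phi> x) (\<Phi> y) \<le> \<Lambda> y - \<Lambda> x"
    and lip: "\<And>x y. a \<le> x \<Longrightarrow> x \<le> y \<Longrightarrow> y \<le> b \<Longrightarrow> \<Lambda> y - \<Lambda> x \<le> K * (y - x)"
  shows "hausdorff1_outer (\<Phi> ` {a..b}) \<le> ennreal (\<Lambda> b - \<Lambda> a)"
  unfolding hausdorff1_outer_def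
proof (rule SUP_least)
  fix \<delta> :: real assume "\<delta> \<in> {0<..}"
  then have d: "\<delta> > 0" by simp
  obtain N :: nat where N: "real N > max 1 (K * (b - a) / \<delta>)" using reals_Archimedean2 by blast
  then have N0: "N > 0" "real N > 0" by auto
  have KN: "K * ((b - a) / N) \<le> \<delta>"
  proof -
    have "K * (b - a) < real N * \<delta>" using N d by (simp add: field_simps)
    then show ?thesis using N0 by (simp add: field_simps)
  qed
  define x where "x i = a + real i * ((b - a) / N)" for i :: nat
  have x0: "x 0 = a" and xN: "x N = b" using N0 by (auto simp: x_def)
  have xs: "x (Suc i) - x i = (b - a) / N" for i by (simp only: x_def of_nat_Suc distrib_right)
  have xm: "x i \<le> x j" if "i \<le> j" for i j
    unfolding x_def using that ab N0 by (intro add_left_mono mult_right_mono) auto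
  define C where "C i = (if i < N then \<Phi> ` {x i..x (Suc i)} else {})" for i
  have dC: "diameter (C i) \<le> \<Lambda> (x (Suc i)) - \<Lambda> (x i)" "bounded (C i)" if "i < N" for i
  proof -
    have in_ab: "a \<le> x i" "x (Suc i) \<le> b" "x i \<le> x (Suc i)"
      using xm[of 0 i] xm[of "Suc i" N] xm[of i "Suc i"] that x0 xN by auto
    have *: "dist p q \<le> \<Lambda> (x (Suc i)) - \<Lambda> (x i)" if "p \<in> C i" "q \<in> C i" for p q
    proof -
      have key: "dist (\<Phi> s) (\<Phi> t) \<le> \<Lambda> (x (Suc i)) - \<Lambda> (x i)"
        if "x i \<le> s" "s \<le> t" "t \<le> x (Suc i)" for s t
      proof -
        have "0 \<le> \<Lambda> s - \<Lambda> (x i)" "0 \<le> \<Lambda> (x (Suc i)) - \<Lambda> t"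
          using len[of "x i" s] len[of t "x (Suc i)"] that in_ab zero_le_dist order_trans
          by (metis order_trans zero_le_dist)+
        moreover have "dist (\<Phi> s) (\<Phi> t) \<le> \<Lambda> t - \<Lambda> s" using len[of s t] that in_ab by auto
        ultimately show ?thesis by linarith
      qed
      obtain s t where "p = \<Phi> s" "q = \<Phi> t" "s \<in> {x i..x (Suc i)}" "t \<in> {x i..x (Suc i)}"
        using \<open>i < N\<close> \<open>p \<in> C i\<close> \<open>q \<in> C i\<close> by (auto simp: C_def)
      then show ?thesis using key[of s t] key[of t s] by (cases "s \<le> t") (auto simp: dist_commute)
    qed
    show "diameter (C i) \<le> \<Lambda> (x (Suc i)) - \<Lambda> (x i)"
    proof (rule diameter_le)
      show "C i \<noteq> {} \<or> 0 \<le> \<Lambda> (x (Suc i)) - \<Lambda> (x i)"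
        using in_ab that by (auto simp: C_def)
    qed (use * in \<open>auto simp: dist_norm\<close>)
    show "bounded (C i)" unfolding bounded_def using *
      by (metis (no_types) bounded_def bounded_two_points)
  qed
  show "(INF C\<in>{C. \<Phi> ` {a..b} \<subseteq> \<Union> (range C) \<and> (\<forall>i. bounded (C i) \<and> diameter (C i) \<le> \<delta>)}. \<Sum>i. ennreal (diameter (C i)))
      \<le> ennreal (\<Lambda> b - \<Lambda> a)"
  proof (rule INF_lower2)
    show "C \<in> {C. \<Phi> ` {a..b} \<subseteq> \<Union> (range C) \<and> (\<forall>i. bounded (C i) \<and> diameter (C i) \<le> \<delta>)}"
    proof (intro CollectI conjI allI)
      show "\<Phi> ` {a..b} \<subseteq> \<Union> (range C)"
      proof (rule image_subsetI)
        fix t assume t: "t \<in> {a..b}"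
        show "\<Phi> t \<in> \<Union> (range C)"
        \<comment> \<open>At t = b the floor would give the index N, whose set is empty; the right
          endpoint belongs to the last piece instead.\<close>
        proof (cases "t = b")
          case True
          have "t \<in> {x (N-1)..x (Suc (N-1))}" using N0 xN xm[of "N-1" N] True by auto
          then have "\<Phi> t \<in> C (N - 1)" using N0 by (auto simp: C_def)
          then show ?thesis by blast
        next
          case False
          then have ba: "b - a > 0" using t by auto
          define i where "i = nat \<lfloor>(t - a) / ((b - a) / N)\<rfloor>"
          have q: "(t - a) / ((b - a) / N) \<ge> 0" using t ba N0 by auto
          have i1: "real i \<le> (t - a) / ((b - a) / N)" "(t - a) / ((b - a) / N) < real i + 1"
            unfolding i_def using q by linarith+
          then have "x i \<le> t" "t \<le> x (Suc i)" using ba N0 by (auto simp: x_def field_simps)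
          moreover have "i < N"
          proof -
            have "(t - a) / ((b - a) / N) < N" using False t ba N0 by (simp add: field_simps)
            then show ?thesis using i1 by linarith
          qed
          ultimately have "\<Phi> t \<in> C i" by (auto simp: C_def)
          then show ?thesis by blast
        qed
      qed
      fix i
      show "bounded (C i)" using dC(2)[of i] by (cases "i < N") (auto simp: C_def)
      show "diameter (C i) \<le> \<delta>"
      proof (cases "i < N")
        case True
        have "diameter (C i) \<le> K * (x (Suc i) - x i)"
          using dC(1)[OF True] lip[of "x i" "x (Suc i)"] xm[of 0 i] xm[of "Suc i" N] xm[of i "Suc i"] True x0 xN by force
        then show ?thesis using KN xs[of i] by simp
      next
        case False then show ?thesis using d by (simp add: C_def)
      qed
    qed
    have "(\<Sum>i. ennreal (diameter (C i))) = (\<Sum>i<N. ennreal (diameter (C i)))"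
      by (rule suminf_finite) (auto simp: C_def)
    also have "\<dots> \<le> (\<Sum>i<N. ennreal (\<Lambda> (x (Suc i)) - \<Lambda> (x i)))"
      using dC by (intro sum_mono ennreal_leI) auto
    also have "\<dots> = ennreal (\<Sum>i<N. \<Lambda> (x (Suc i)) - \<Lambda> (x i))"
    proof (rule sum_ennreal)
      fix i assume "i \<in> {..<N}"
      then have "a \<le> x i" "x (Suc i) \<le> b" "x i \<le> x (Suc i)"
        using xm[of 0 i] xm[of "Suc i" N] xm[of i "Suc i"] x0 xN by auto
      then show "0 \<le> \<Lambda> (x (Suc i)) - \<Lambda> (x i)" using len[of "x i" "x (Suc i)"]
        by (metis order_trans zero_le_dist)
    qed
    also have "(\<Sum>i<N. \<Lambda> (x (Suc i)) - \<Lambda> (x i)) = \<Lambda> b - \<Lambda> a"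
      using sum_lessThan_telescope[of "\<lambda>i. \<Lambda> (x i)" N] x0 xN by simp
    finally show "(\<Sum>i. ennreal (diameter (C i))) \<le> ennreal (\<Lambda> b - \<Lambda> a)" .
  qed
qed

text \<open>Projection onto the direction of the chord does not increase distances, and by the
  intermediate value theorem the projected path fills an interval as long as the chord. Countable
  subadditivity of Lebesgue measure then bounds the diameters of any covering from below.\<close>

lemma hausdorff1_outer_path_ge:
  fixes \<Phi> :: "real \<Rightarrow> point"
  assumes ab: "a \<le> b" and cont: "continuous_on {a..b} \<Phi>"
  shows "ennreal (dist (\<Phi> a) (\<Phi> b)) \<le> hausdorff1_outer (\<Phi> ` {a..b})"
proof -
  define n where "n = dist (\<Phi> a) (\<Phi> b)"
  define e where "e = (1 / n) *\<^sub>R (\<Phi> b - \<Phi> a)"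
  define \<pi> where "\<pi> p = p \<bullet> e" for p :: point
  have "n \<ge> 0" by (simp add: n_def)
  have le: "ennreal n \<le> (\<Sum>i. ennreal (diameter (C i)))"
    if C: "\<Phi> ` {a..b} \<subseteq> (\<Union>i. C i)" "\<And>i. bounded (C i)" for C :: "nat \<Rightarrow> point set"
  proof (cases "n = 0")
    case False
    then have n: "n > 0" using \<open>n \<ge> 0\<close> by simp
    have ne: "norm e = 1" using n by (simp add: e_def n_def dist_norm norm_minus_commute)
    have \<pi>lip: "\<bar>\<pi> p - \<pi> q\<bar> \<le> dist p q" for p q
      using Cauchy_Schwarz_ineq2[of "p - q" e] ne by (simp add: \<pi>_def inner_diff_left dist_norm)
    have "(\<Phi> b - \<Phi> a) \<bullet> e = n" using n
      by (simp add: e_def power2_norm_eq_inner[symmetric] power2_eq_square n_def dist_norm norm_minus_commute)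
    then have \<pi>b: "\<pi> (\<Phi> b) = \<pi> (\<Phi> a) + n" by (simp add: \<pi>_def inner_diff_left)
    have c\<pi>: "continuous_on {a..b} (\<lambda>t. \<pi> (\<Phi> t))" unfolding \<pi>_def by (intro continuous_intros cont)
    have surj: "\<exists>i. y \<in> \<pi> ` C i" if y: "y \<in> {\<pi> (\<Phi> a)..\<pi> (\<Phi> a) + n}" for y
    proof -
      obtain t where "a \<le> t" "t \<le> b" "\<pi> (\<Phi> t) = y"
        using IVT'[of "\<lambda>t. \<pi> (\<Phi> t)" a y b] y \<pi>b ab c\<pi> by auto
      moreover have "\<Phi> t \<in> (\<Union>i. C i)" using C(1) calculation by fastforce
      ultimately show ?thesis by blast
    qed
    \<comment> \<open>The covering sets may be non-measurable; the closed intervals spanned by their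
      projections are measurable and no longer than their diameters.\<close>
    define I where "I i = (if C i = {} then {} else {Inf (\<pi> ` C i)..Sup (\<pi> ` C i)})" for i
    have bd: "bdd_above (\<pi> ` C i)" "bdd_below (\<pi> ` C i)" for i
    proof -
      have "bounded (\<pi> ` C i)" unfolding \<pi>_def by (rule bounded_linear_image[OF C(2) bounded_linear_inner_left])
      then show "bdd_above (\<pi> ` C i)" "bdd_below (\<pi> ` C i)"
        by (auto intro: bounded_imp_bdd_above bounded_imp_bdd_below)
    qed
    have sub: "\<pi> ` C i \<subseteq> I i" for i
    proof
      fix y assume "y \<in> \<pi> ` C i"
      then show "y \<in> I i"
        using cInf_lower[OF _ bd(2), of y i] cSup_upper[OF _ bd(1), of y i] by (auto simp: I_def)
    qed
    have em: "emeasure lborel (I i) \<le> ennreal (diameter (C i))" for i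
    proof (cases "C i = {}")
      case False
      have "Sup (\<pi> ` C i) \<le> Inf (\<pi> ` C i) + diameter (C i)"
      proof (rule cSup_least)
        show "\<pi> ` C i \<noteq> {}" using False by simp
        fix y assume "y \<in> \<pi> ` C i"
        then obtain p where p: "p \<in> C i" "y = \<pi> p" by auto
        have "y - diameter (C i) \<le> Inf (\<pi> ` C i)"
        proof (rule cInf_greatest)
          show "\<pi> ` C i \<noteq> {}" using False by simp
          fix z assume "z \<in> \<pi> ` C i"
          then obtain q where q: "q \<in> C i" "z = \<pi> q" by auto
          then show "y - diameter (C i) \<le> z"
            using \<pi>lip[of p q] diameter_bounded_bound[OF C(2) p(1) q(1)] p by linarith
        qed
        then show "y \<le> Inf (\<pi> ` C i) + diameter (C i)" by simp
      qed
      then show ?thesis using False by (auto simp: I_def emeasure_lborel_Icc_eq intro!: ennreal_leI)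
    qed (simp add: I_def)
    have "ennreal n = emeasure lborel {\<pi> (\<Phi> a)..\<pi> (\<Phi> a) + n}" using n by simp
    also have "\<dots> \<le> emeasure lborel (\<Union>i. I i)"
    proof (rule emeasure_mono)
      show "{\<pi> (\<Phi> a)..\<pi> (\<Phi> a) + n} \<subseteq> (\<Union>i. I i)" using surj sub by blast
      show "(\<Union>i. I i) \<in> sets lborel" by (auto simp: I_def)
    qed
    also have "\<dots> \<le> (\<Sum>i. emeasure lborel (I i))"
      by (rule emeasure_subadditive_countably) (auto simp: I_def)
    also have "\<dots> \<le> (\<Sum>i. ennreal (diameter (C i)))"
      by (intro suminf_le em) auto
    finally show ?thesis .
  qed simp
  show ?thesis unfolding hausdorff1_outer_def n_def[symmetric]
    by (rule SUP_upper2[of 1]) (auto intro!: INF_greatest le)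
qed

text \<open>Area formula for a Lipschitz graph. M is the Hausdorff measure of the graph pushed to
  the time axis. The upper bound uses that a chord is no longer than the integral of L; the lower
  bound differentiates: chords are dominated by increments of M, and their quotients tend to L
  almost everywhere. Agreement on closed intervals determines M.\<close>

lemma hausdorff1_graph:
  fixes \<gamma> d :: "real \<Rightarrow> real"
  assumes ms: "measure_space UNIV (sets borel) hausdorff1_outer"
    and lip: "\<And>s t. \<bar>\<gamma> s - \<gamma> t\<bar> \<le> C * \<bar>s - t\<bar>"
    and der: "AE t in lborel. (\<gamma> has_real_derivative d t) (at t)"
    and dm[measurable]: "d \<in> borel_measurable borel" and dC: "\<And>t. \<bar>d t\<bar> \<le> C"
    and A: "A \<in> sets borel"
  shows "emeasure hausdorff1 {p. fst p \<in> A \<and> snd p = \<gamma> (fst p)}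
       = (\<integral>\<^sup>+t\<in>A. ennreal (sqrt (1 + (d t)\<^sup>2)) \<partial>lborel)"
proof -
  define \<Phi> where "\<Phi> t = (t, \<gamma> t)" for t
  define L where "L t = sqrt (1 + (d t)\<^sup>2)" for t
  have C0: "C \<ge> 0" using dC[of 0] by linarith
  have Lm[measurable]: "L \<in> borel_measurable borel" unfolding L_def by measurable
  define K where "K = 1 + C"
  have K0: "K \<ge> 0" using C0 by (simp add: K_def)
  have sqrt_bound: "0 \<le> sqrt (1 + x\<^sup>2)" "\<bar>x\<bar> \<le> C \<Longrightarrow> sqrt (1 + x\<^sup>2) \<le> 1 + C" for x
    using power_mono[of "\<bar>x\<bar>" C 2] C0 by (auto intro!: real_le_lsqrt simp: power2_sum)
  have L0: "0 \<le> L t" "L t \<le> K" for t using sqrt_bound dC by (simp_all add: L_def K_def)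
  note contg = Lipschitz_real_continuous(1)[OF lip] and gm[measurable] = Lipschitz_real_continuous(2)[OF lip]
  have cont\<Phi>: "continuous_on S \<Phi>" for S unfolding \<Phi>_def by (intro continuous_intros contg)
  have Lint: "set_integrable lborel {x..y} L" for x y
    unfolding set_integrable_def
    by (rule integrableI_bounded_set_indicator[where B=K]) (use L0 in \<open>auto simp: emeasure_lborel_Icc_eq\<close>)
  have dint: "set_integrable lborel {x..y} d" for x y
    unfolding set_integrable_def
    by (rule integrableI_bounded_set_indicator[where B=C]) (use dC in \<open>auto simp: emeasure_lborel_Icc_eq\<close>)
  have chord: "dist (\<Phi> x) (\<Phi> y) \<le> (LINT t:{x..y}|lborel. L t)" if xy: "x \<le> y" for x y
  proof -
    \<comment> \<open>With a and b the increments in time and space, n * n = a * a + b * b is the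
      integral of a + b d, and by Cauchy-Schwarz the integrand is at most n L. Dividing by n bounds
      the chord.\<close>
    define a b n where "a = y - x" and "b = \<gamma> y - \<gamma> x" and "n = dist (\<Phi> x) (\<Phi> y)"
    have n: "n = sqrt (a\<^sup>2 + b\<^sup>2)" by (simp add: n_def a_def b_def \<Phi>_def dist_Pair_Pair dist_real_def power2_commute)
    have "n * n = a * a + b * b" unfolding n by (simp add: power2_eq_square)
    also have "\<dots> = a * (LINT t:{x..y}|lborel. 1) + b * (LINT t:{x..y}|lborel. d t)"
      using Lipschitz_FTC(2)[OF lip der dm xy] xy by (simp add: a_def b_def set_integral_const)
    also have "\<dots> = (LINT t:{x..y}|lborel. a + b * d t)"
    proof -
      have "set_integrable lborel {x..y} (\<lambda>t. 1::real)" by (simp add: set_integrable_def emeasure_lborel_Icc_eq)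
      then have "set_integrable lborel {x..y} (\<lambda>t. a)" using set_integrable_mult_right[of a lborel "{x..y}" "\<lambda>t. 1"] by simp
      then show ?thesis
        using dint[of x y] xy by (subst set_integral_add) (auto simp: set_integral_const)
    qed
    also have "\<dots> \<le> (LINT t:{x..y}|lborel. n * L t)"
    proof (rule set_integral_mono)
      have "set_integrable lborel {x..y} (\<lambda>t. a::real)" by (simp add: set_integrable_def emeasure_lborel_Icc_eq)
      then show "set_integrable lborel {x..y} (\<lambda>t. a + b * d t)" using dint[of x y] by (intro set_integral_add) auto
      show "set_integrable lborel {x..y} (\<lambda>t. n * L t)" using Lint[of x y] by auto
      fix t
      have "a + b * d t \<le> \<bar>(a, b) \<bullet> (1, d t)\<bar>" by simp
      also have "\<dots> \<le> norm (a, b) * norm (1::real, d t)" by (rule Cauchy_Schwarz_ineq2)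
      finally show "a + b * d t \<le> n * L t" by (simp add: n L_def norm_Pair)
    qed
    also have "\<dots> = n * (LINT t:{x..y}|lborel. L t)" by simp
    finally have *: "n * n \<le> n * (LINT t:{x..y}|lborel. L t)" .
    have "0 \<le> (LINT t:{x..y}|lborel. L t)"
      unfolding set_lebesgue_integral_def using L0 by (intro integral_nonneg_AE) auto
    then have "n \<le> (LINT t:{x..y}|lborel. L t)" using * by (cases "n > 0") auto
    then show ?thesis by (simp add: n_def)
  qed
  define \<Gamma> where "\<Gamma> = {p :: point. snd p = \<gamma> (fst p)}"
  have \<Gamma>[measurable]: "\<Gamma> \<in> sets borel"
  proof -
    have "closed {p :: point. snd p = \<gamma> (fst p)}"
      by (intro closed_Collect_eq continuous_intros continuous_on_compose2[OF contg[of UNIV]]) auto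
    then show ?thesis by (simp add: \<Gamma>_def borel_closed)
  qed
  define M where "M = distr (density hausdorff1 (indicator \<Gamma>)) borel fst"
  have Ms[simp]: "sets M = sets borel" by (simp add: M_def)
  have M: "emeasure M B = emeasure hausdorff1 {p. fst p \<in> B \<and> snd p = \<gamma> (fst p)}"
    if [measurable]: "B \<in> sets borel" for B
  proof -
    have "emeasure M B = emeasure (density hausdorff1 (indicator \<Gamma>)) (fst -` B)"
      unfolding M_def by (subst emeasure_distr) (auto simp: space_density)
    also have "\<dots> = (\<integral>\<^sup>+ p. indicator \<Gamma> p * indicator (fst -` B) p \<partial>hausdorff1)"
      using measurable_sets[OF fst_snd_borel(1) that]
      by (subst emeasure_density) auto
    also have "\<dots> = (\<integral>\<^sup>+ p. indicator (\<Gamma> \<inter> fst -` B) p \<partial>hausdorff1)"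
      by (intro nn_integral_cong) (auto simp: indicator_def)
    also have "\<dots> = emeasure hausdorff1 (\<Gamma> \<inter> fst -` B)"
      using measurable_sets[OF fst_snd_borel(1) that] by (subst nn_integral_indicator) auto
    also have "\<Gamma> \<inter> fst -` B = {p. fst p \<in> B \<and> snd p = \<gamma> (fst p)}" by (auto simp: \<Gamma>_def)
    finally show ?thesis .
  qed
  have MI: "emeasure M {x..y} = hausdorff1_outer (\<Phi> ` {x..y})" for x y
  proof -
    have "{p. fst p \<in> {x..y} \<and> snd p = \<gamma> (fst p)} = \<Phi> ` {x..y}" by (force simp: \<Phi>_def)
    moreover have "compact (\<Phi> ` {x..y})" by (intro compact_continuous_image cont\<Phi> compact_Icc)
    ultimately show ?thesis using M[of "{x..y}"] ms by (simp add: emeasure_hausdorff1 borel_compact)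
  qed
  have split: "(LINT t:{x..z}|lborel. L t) = (LINT t:{x..y}|lborel. L t) + (LINT t:{y..z}|lborel. L t)"
    if "x \<le> y" "y \<le> z" for x y z
  proof -
    have "(LINT t:{x..y} \<union> {y..z}|lborel. L t) = (LINT t:{x..y}|lborel. L t) + (LINT t:{y..z}|lborel. L t)"
    proof (rule set_integral_Un_AE)
      have "AE t in lborel. t \<noteq> y" by (rule AE_lborel_singleton)
      then show "AE t in lborel. \<not> (t \<in> {x..y} \<and> t \<in> {y..z})" by eventually_elim auto
    qed (use Lint in auto)
    then show ?thesis using that ivl_disj_un_two_touch(4) by metis
  qed
  have LK: "(LINT t:{x..y}|lborel. L t) \<le> K * (y - x)" if "x \<le> y" for x y
  proof -
    have "(LINT t:{x..y}|lborel. L t) \<le> (LINT t:{x..y}|lborel. K)"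
      by (rule set_integral_mono) (use Lint L0 in \<open>auto simp: set_integrable_def emeasure_lborel_Icc_eq\<close>)
    then show ?thesis using that by (simp add: set_integral_const mult.commute)
  qed
  have upper: "emeasure M {x..y} \<le> ennreal (LINT t:{x..y}|lborel. L t)" if "x \<le> y" for x y
  proof -
    define \<Lambda> where "\<Lambda> z = (LINT t:{x..z}|lborel. L t)" for z
    have dif: "\<Lambda> s' - \<Lambda> s = (LINT t:{s..s'}|lborel. L t)" if "x \<le> s" "s \<le> s'" for s s'
      using split[OF that] by (simp add: \<Lambda>_def)
    have "hausdorff1_outer (\<Phi> ` {x..y}) \<le> ennreal (\<Lambda> y - \<Lambda> x)"
      by (rule hausdorff1_outer_path_le[OF \<open>x \<le> y\<close>, of _ _ K]) (use dif chord LK in auto)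
    then show ?thesis using dif[of x y] that MI by simp
  qed
  have fin: "emeasure M {x..y} < \<infinity>" for x y
    using upper[of x y] by (cases "x \<le> y") (auto simp: less_top[symmetric] top_unique)
  \<comment> \<open>Points carry no mass, so adjacent closed intervals may share endpoints without
    spoiling additivity.\<close>
  have M0: "emeasure M {x} = 0" for x
  proof -
    have "emeasure M {x..x} \<le> ennreal (LINT t:{x..x}|lborel. L t)" by (rule upper) simp
    also have "(LINT t:{x..x}|lborel. L t) \<le> 0" using LK[of x x] by simp
    then have "ennreal (LINT t:{x..x}|lborel. L t) = 0" by (simp add: ennreal_neg)
    finally show ?thesis by simp
  qed
  have main: "emeasure M {a..b} = ennreal (LINT t:{a..b}|lborel. L t)" if ab: "a \<le> b" for a b
  proof (rule antisym[OF upper[OF ab]])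
    define m where "m t = measure M {a..t}" for t
    have mdiff: "m y - m x = measure M {x..y}" if "a \<le> x" "x \<le> y" for x y
    proof -
      have eq: "{a..y} = {a..x} \<union> {x<..y}" "{x..y} = {x} \<union> {x<..y}" using that by auto
      have f: "{x<..y} \<in> fmeasurable M"
        by (rule fmeasurableI2[of "{x..y}"]) (use fin in \<open>auto simp: fmeasurable_def\<close>)
      have "m y = m x + measure M {x<..y}" unfolding m_def eq(1)
        by (rule measure_Union) (use f fin in \<open>auto simp: fmeasurable_def less_top\<close>)
      moreover have "measure M {x..y} = measure M {x} + measure M {x<..y}" unfolding eq(2)
        by (rule measure_Union) (use f fin M0 in \<open>auto simp: fmeasurable_def less_top\<close>)
      moreover have "measure M {x} = 0" using M0 by (simp add: measure_def)
      ultimately show ?thesis by simp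
    qed
    have mK: "0 \<le> m y - m x" "m y - m x \<le> K * (y - x)" if "x \<le> y" for x y
    proof -
      have mup: "measure M {x..y} \<le> K * (y - x)" if "x \<le> y" for x y
        using upper[OF that] LK[OF that] K0 that
        by (simp add: measure_def enn2real_leI order_trans[OF _ ennreal_leI])
      show "0 \<le> m y - m x" unfolding m_def
        using measure_mono_fmeasurable[of "{a..x}" "{a..y}" M] fin that by (auto simp: fmeasurable_def)
      have mm: "m z = 0" if "z \<le> a" for z
        using that M0[of a] by (cases "z = a") (auto simp: m_def measure_def)
      show "m y - m x \<le> K * (y - x)"
      proof (cases "a \<le> x")
        case True then show ?thesis using mdiff[of x y] mup[of x y] that by simp
      next
        case False
        show ?thesis
        proof (cases "a \<le> y")
          case True
          have "m y \<le> K * (y - a)" using mup[OF True] by (simp add: m_def)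
          also have "\<dots> \<le> K * (y - x)" using False K0 by (intro mult_left_mono) auto
          finally show ?thesis using mm[of x] False by simp
        next
          case F2: False then show ?thesis using mm[of x] mm[of y] False K0 that by simp
        qed
      qed
    qed
    have mcont: "continuous_on UNIV m"
    proof (rule Lipschitz_real_continuous(1))
      show "\<bar>m x - m y\<bar> \<le> K * \<bar>x - y\<bar>" for x y
        using mK[of x y] mK[of y x] by (cases "x \<le> y") auto
    qed
    have mmeas[measurable]: "m \<in> borel_measurable borel"
      using mcont borel_measurable_continuous_onI by blast
    define e where "e n = 1 / real (Suc n)" for n
    have e_pos: "e n > 0" for n by (auto simp: e_def)
    have e0: "e \<longlonglongrightarrow> 0" unfolding e_def using LIMSEQ_inverse_real_of_nat by (simp add: inverse_eq_divide)
    have c1: "(\<lambda>n. LBINT t. indicator {a..b} t *\<^sub>R ((m (t + e n) - m t) / e n)) \<longlonglongrightarrow> m b - m a"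
      unfolding real_scaleR_def by (rule Lipschitz_difference_quotient[OF mcont e_pos e0 ab])
    define g where "g n t = dist (\<Phi> t) (\<Phi> (t + e n)) / e n" for n t
    have [measurable]: "\<Phi> \<in> borel_measurable borel" unfolding \<Phi>_def by measurable
    have gmeas[measurable]: "g n \<in> borel_measurable borel" for n unfolding g_def by measurable
    have geq: "g n t = sqrt (1 + ((\<gamma> (t + e n) - \<gamma> t) / e n)\<^sup>2)" for n t
    proof -
      have "dist (\<Phi> t) (\<Phi> (t + e n)) = sqrt ((e n)\<^sup>2 * (1 + ((\<gamma> (t + e n) - \<gamma> t) / e n)\<^sup>2))"
        using e_pos[of n] by (simp add: \<Phi>_def dist_Pair_Pair dist_real_def power2_commute power_divide algebra_simps)
      then show ?thesis using e_pos[of n] by (simp add: g_def real_sqrt_mult)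
    qed
    have glim: "AE t in lborel. (\<lambda>n. g n t) \<longlonglongrightarrow> L t"
      using der unfolding geq L_def by eventually_elim (intro tendsto_intros difference_quotient_tendsto e_pos e0; simp)
    have gb: "g n t \<le> K" "0 \<le> g n t" for n t
    proof -
      have "\<bar>(\<gamma> (t + e n) - \<gamma> t) / e n\<bar> \<le> C" using lip[of "t + e n" t] e_pos[of n] by (simp add: field_simps)
      then show "g n t \<le> K" "0 \<le> g n t" unfolding geq K_def using sqrt_bound by auto
    qed
    have dom: "integrable lborel (\<lambda>t. indicator {a..b} t * K)"
      by (rule integrable_bounded_Icc[of _ K a b]) (use K0 in \<open>auto simp: indicator_def\<close>)
    have c2: "(\<lambda>n. \<integral>t. indicator {a..b} t *\<^sub>R g n t \<partial>lborel) \<longlonglongrightarrow> (LBINT t. indicator {a..b} t *\<^sub>R L t)"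
    proof (rule integral_dominated_convergence[OF _ _ dom])
      show "AE t in lborel. (\<lambda>n. indicator {a..b} t *\<^sub>R g n t) \<longlonglongrightarrow> indicator {a..b} t *\<^sub>R L t"
        using glim by eventually_elim (intro tendsto_intros)
      show "AE t in lborel. norm (indicator {a..b} t *\<^sub>R g n t) \<le> indicator {a..b} t * K" for n
        using gb by (auto simp: indicator_def)
    qed measurable
    \<comment> \<open>Chord quotients lie below quotients of m. The integrals of the former tend to
      the integral of L by domination, those of the latter to m b - m a by telescoping.\<close>
    have "(LINT t:{a..b}|lborel. L t) \<le> m b - m a"
      unfolding set_lebesgue_integral_def
    proof (rule LIMSEQ_le[OF c2 c1], intro exI allI impI integral_mono)
      fix n t
      show "integrable lborel (\<lambda>t. indicator {a..b} t *\<^sub>R g n t)"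
        by (rule integrableI_bounded_set_indicator[where B=K]) (use gb in \<open>auto simp: emeasure_lborel_Icc_eq\<close>)
      show "integrable lborel (\<lambda>t. indicator {a..b} t *\<^sub>R ((m (t + e n) - m t) / e n))"
      proof (rule integrableI_bounded_set_indicator[where B=K])
        have "norm ((m (t + e n) - m t) / e n) \<le> K" for t
          using mK[of t "t + e n"] e_pos[of n] by (simp add: field_simps)
        then show "AE t in lborel. t \<in> {a..b} \<longrightarrow> norm ((m (t + e n) - m t) / e n) \<le> K" by simp
      qed (auto simp: emeasure_lborel_Icc_eq)
      show "indicator {a..b} t *\<^sub>R g n t \<le> indicator {a..b} t *\<^sub>R ((m (t + e n) - m t) / e n)"
      proof (cases "t \<in> {a..b}")
        case True
        have le: "t \<le> t + e n" using e_pos[of n] by simp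
        have "ennreal (dist (\<Phi> t) (\<Phi> (t + e n))) \<le> emeasure M {t..t + e n}"
          unfolding MI by (rule hausdorff1_outer_path_ge[OF le cont\<Phi>])
        also have "\<dots> = ennreal (m (t + e n) - m t)"
          using mdiff[of t "t + e n"] True le fin[of t "t + e n"]
          by (simp add: emeasure_eq_ennreal_measure less_top)
        finally have "dist (\<Phi> t) (\<Phi> (t + e n)) \<le> m (t + e n) - m t"
          using mK[OF le] by (simp add: ennreal_le_iff)
        then show ?thesis using True e_pos[of n] by (simp add: g_def divide_right_mono)
      qed simp
    qed
    then have "ennreal (LINT t:{a..b}|lborel. L t) \<le> ennreal (measure M {a..b})"
      using mdiff[of a b] ab by (intro ennreal_leI) simp
    then show "ennreal (LINT t:{a..b}|lborel. L t) \<le> emeasure M {a..b}"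
      using fin[of a b] by (simp add: emeasure_eq_ennreal_measure less_top)
  qed
  have "M = density lborel (\<lambda>t. ennreal (L t))"
  proof (rule measure_eqI_generator_eq[where \<Omega>=UNIV and E="range (\<lambda>(a, b). {a..b :: real})" and A="\<lambda>n. {- real n..real n}"])
    show "Int_stable (range (\<lambda>(a, b). {a..b :: real}))" by (rule closed_intervals_generate)
    note S = closed_intervals_generate(2)
    show "sets M = sigma_sets UNIV (range (\<lambda>(a, b). {a..b :: real}))"
      "sets (density lborel (\<lambda>t. ennreal (L t))) = sigma_sets UNIV (range (\<lambda>(a, b). {a..b :: real}))" by (simp_all add: S)
    show "range (\<lambda>n. {- real n..real n}) \<subseteq> range (\<lambda>(a, b). {a..b :: real})" by auto
    show "(\<Union>n. {- real n..real n}) = UNIV"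
    proof (intro equalityI subset_UNIV subsetI)
      fix x :: real
      obtain n :: nat where "\<bar>x\<bar> \<le> real n" using real_arch_simple by blast
      then show "x \<in> (\<Union>n. {- real n..real n})" by (auto simp: abs_le_iff) (metis minus_le_iff)
    qed
    show "emeasure M {- real n..real n} \<noteq> \<infinity>" for n using fin[of "- real n" "real n"] by simp
    fix X assume "X \<in> range (\<lambda>(a, b). {a..b :: real})"
    then obtain a b where X: "X = {a..b}" by auto
    show "emeasure M X = emeasure (density lborel (\<lambda>t. ennreal (L t))) X"
    proof (cases "a \<le> b")
      case True
      have "emeasure (density lborel (\<lambda>t. ennreal (L t))) X = (\<integral>\<^sup>+t. ennreal (L t) * indicator {a..b} t \<partial>lborel)"
        unfolding X by (subst emeasure_density) auto
      also have "\<dots> = (\<integral>\<^sup>+t. ennreal (indicator {a..b} t *\<^sub>R L t) \<partial>lborel)"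
        by (intro nn_integral_cong) (auto simp: indicator_def)
      also have "\<dots> = ennreal (LINT t:{a..b}|lborel. L t)" unfolding set_lebesgue_integral_def
        by (rule nn_integral_eq_integral) (use Lint[of a b] L0 in \<open>auto simp: set_integrable_def\<close>)
      finally show ?thesis using main[OF True] X by simp
    qed (simp add: X)
  qed auto
  then have "emeasure M A = (\<integral>\<^sup>+t. ennreal (L t) * indicator A t \<partial>lborel)"
    using A by (simp add: emeasure_density)
  then show ?thesis using M[OF A] by (simp add: L_def)
qed

section \<open>Averages of functions of bounded variation\<close>

definition average :: "real \<Rightarrow> real \<Rightarrow> (real \<Rightarrow> state) \<Rightarrow> state" where
  "average a b f = (1 / (b - a)) *\<^sub>R (LINT y:{a..b}|lebesgue. f y)"

lemma integral_lebesgue_subinterval: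
  fixes f :: "real \<Rightarrow> state"
  assumes "set_integrable lebesgue \<Omega> f" "{a<..<b} \<subseteq> \<Omega>"
  shows "set_integrable lebesgue {a..b} f"
proof -
  have 1: "set_integrable lebesgue {a<..<b} f"
    using assms by (intro set_integrable_subset[OF assms(1)]) auto
  show ?thesis
    by (rule absolutely_integrable_spike_set[OF 1]; rule negligible_subset[of "{a, b}"]) auto
qed

lemma set_integrable_continuous_scaleR:
  fixes f :: "real \<Rightarrow> state"
  assumes k: "continuous_on UNIV k" and f: "set_integrable lebesgue {a..b} f"
  shows "set_integrable lebesgue {a..b} (\<lambda>x. k x *\<^sub>R f x)"
proof -
  have "bounded (k ` {a..b})"
    by (intro compact_imp_bounded compact_continuous_image continuous_on_subset[OF k]) auto
  then obtain B where B: "\<And>x. x \<in> {a..b} \<Longrightarrow> \<bar>k x\<bar> \<le> B" by (auto simp: bounded_iff simp del: atLeastAtMost_iff)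
  have km[measurable]: "k \<in> borel_measurable lebesgue"
    using borel_measurable_continuous_onI[OF k] by (simp add: measurable_completion)
  have fm[measurable]: "(\<lambda>x. indicator {a..b} x *\<^sub>R f x) \<in> borel_measurable lebesgue"
    using f by (simp add: set_integrable_def)
  show ?thesis
    unfolding set_integrable_def
  proof (rule Bochner_Integration.integrable_bound)
    show "integrable lebesgue (\<lambda>x. B *\<^sub>R (indicator {a..b} x *\<^sub>R f x))"
      using f unfolding set_integrable_def by (rule integrable_scaleR_right)
    have "(\<lambda>x. k x *\<^sub>R (indicator {a..b} x *\<^sub>R f x)) \<in> borel_measurable lebesgue" by measurable
    then show "(\<lambda>x. indicator {a..b} x *\<^sub>R k x *\<^sub>R f x) \<in> borel_measurable lebesgue"
      by (simp add: mult.commute)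
    have "norm (indicator {a..b} x *\<^sub>R k x *\<^sub>R f x) \<le> norm (B *\<^sub>R (indicator {a..b} x *\<^sub>R f x))" for x
    proof (cases "x \<in> {a..b}")
      case True
      have "\<bar>k x\<bar> * norm (f x) \<le> \<bar>B\<bar> * norm (f x)" using B[OF True] by (intro mult_right_mono) auto
      then show ?thesis using True by simp
    qed simp
    then show "AE x in lebesgue. norm (indicator {a..b} x *\<^sub>R k x *\<^sub>R f x) \<le> norm (B *\<^sub>R (indicator {a..b} x *\<^sub>R f x))"
      by simp
  qed
qed

text \<open>A trapezoid of integral 1: it rises on [a + \<eta>, a + 2 \<eta>], is flat, and falls on
  [b - 2 \<eta>, b - \<eta>]. Before normalisation its height is \<eta> and its area \<eta> (b - a -
  3 \<eta>). Its primitive \<open>ramp\<close> is a C1 distribution function that is constant near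
  and beyond the ends of the interval.\<close>

definition ramp_deriv :: "real \<Rightarrow> real \<Rightarrow> real \<Rightarrow> real \<Rightarrow> real" where
  "ramp_deriv a b \<eta> x = (max 0 (x - (a + \<eta>)) - max 0 (x - (a + 2 * \<eta>)) - max 0 (x - (b - 2 * \<eta>)) + max 0 (x - (b - \<eta>)))
     / (\<eta> * (b - a - 3 * \<eta>))"

definition ramp :: "real \<Rightarrow> real \<Rightarrow> real \<Rightarrow> real \<Rightarrow> real" where
  "ramp a b \<eta> x = ((max 0 (x - (a + \<eta>)))\<^sup>2 / 2 - (max 0 (x - (a + 2 * \<eta>)))\<^sup>2 / 2
     - (max 0 (x - (b - 2 * \<eta>)))\<^sup>2 / 2 + (max 0 (x - (b - \<eta>)))\<^sup>2 / 2) / (\<eta> * (b - a - 3 * \<eta>))"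

lemma ramp_has_derivative: "(ramp a b \<eta> has_real_derivative ramp_deriv a b \<eta> x) (at x)"
  unfolding ramp_def[abs_def] ramp_deriv_def
  by (intro DERIV_cdivide DERIV_add DERIV_diff has_derivative_positive_part_square)

lemma ramp_deriv_continuous: "continuous_on S (ramp_deriv a b \<eta>)"
  unfolding ramp_deriv_def[abs_def] divide_inverse by (intro continuous_intros)

lemma ramp_bounds:
  assumes \<eta>: "0 < \<eta>" "4 * \<eta> < b - a"
  shows "0 \<le> ramp_deriv a b \<eta> x" "ramp_deriv a b \<eta> x \<le> 4 / (b - a)" "x \<notin> {a<..<b} \<Longrightarrow> ramp_deriv a b \<eta> x = 0"
    "x \<le> a + \<eta> \<Longrightarrow> ramp a b \<eta> x = 0" "b - \<eta> \<le> x \<Longrightarrow> ramp a b \<eta> x = 1" "0 \<le> ramp a b \<eta> x" "ramp a b \<eta> x \<le> 1"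
proof -
  have D: "\<eta> * (b - a - 3 * \<eta>) > 0" "(b - a) / 4 < b - a - 3 * \<eta>" using \<eta> by simp_all
  define N where "N x = max 0 (x - (a + \<eta>)) - max 0 (x - (a + 2 * \<eta>)) - max 0 (x - (b - 2 * \<eta>)) + max 0 (x - (b - \<eta>))" for x
  have N: "0 \<le> N x" "N x \<le> \<eta>" "x \<notin> {a<..<b} \<Longrightarrow> N x = 0" for x using \<eta> by (auto simp: N_def max_def)
  show d0: "0 \<le> ramp_deriv a b \<eta> x" for x unfolding ramp_deriv_def N_def[symmetric] using N(1) D(1) by simp
  show "x \<notin> {a<..<b} \<Longrightarrow> ramp_deriv a b \<eta> x = 0" unfolding ramp_deriv_def N_def[symmetric] using N(3) by simp
  have "ramp_deriv a b \<eta> x \<le> \<eta> / (\<eta> * (b - a - 3 * \<eta>))"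
    unfolding ramp_deriv_def N_def[symmetric] using N(2) D(1) by (intro divide_right_mono) auto
  also have "\<dots> = 1 / (b - a - 3 * \<eta>)" using \<eta> by simp
  also have "\<dots> \<le> 1 / ((b - a) / 4)" using \<eta> D(2) by (intro divide_left_mono) auto
  finally show "ramp_deriv a b \<eta> x \<le> 4 / (b - a)" by simp
  have z: "ramp a b \<eta> x = 0" if "x \<le> a + \<eta>" for x using that \<eta> by (simp add: ramp_def max_def)
  have o: "ramp a b \<eta> x = 1" if "b - \<eta> \<le> x" for x
  proof -
    have "(x - (a + \<eta>))\<^sup>2 / 2 - (x - (a + 2 * \<eta>))\<^sup>2 / 2 - (x - (b - 2 * \<eta>))\<^sup>2 / 2 + (x - (b - \<eta>))\<^sup>2 / 2 = \<eta> * (b - a - 3 * \<eta>)"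
      by (simp add: power2_eq_square field_simps)
    then show ?thesis using that \<eta> D(1) unfolding ramp_def by (simp add: max_def)
  qed
  have mono: "ramp a b \<eta> x \<le> ramp a b \<eta> y" if "x \<le> y" for x y
    using DERIV_nonneg_imp_nondecreasing[OF that] ramp_has_derivative d0 by blast
  show "0 \<le> ramp a b \<eta> x" using mono[of "min x (a + \<eta>)" x] z[of "min x (a + \<eta>)"] by simp
  show "ramp a b \<eta> x \<le> 1" using mono[of x "max x (b - \<eta>)"] o[of "max x (b - \<eta>)"] by simp
  show "x \<le> a + \<eta> \<Longrightarrow> ramp a b \<eta> x = 0" "b - \<eta> \<le> x \<Longrightarrow> ramp a b \<eta> x = 1" by (fact z o)+
qed

text \<open>The summand 5 keeps four widths below b - a for every n, so that the trapezoid always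
  has a plateau and its height stays below 4 / (b - a).\<close>

definition width :: "real \<Rightarrow> real \<Rightarrow> nat \<Rightarrow> real" where "width a b n = (b - a) / (real n + 5)"

lemma width:
  assumes "a < b"
  shows "0 < width a b n" "4 * width a b n < b - a" "width a b \<longlonglongrightarrow> 0"
proof -
  show "0 < width a b n" using assms by (simp add: width_def)
  have "4 * (b - a) < (real n + 5) * (b - a)" using assms by (intro mult_strict_right_mono) auto
  then show "4 * width a b n < b - a" by (simp add: width_def divide_less_eq mult.commute)
  have "(\<lambda>n. (b - a) * inverse (real (n + 5))) \<longlonglongrightarrow> (b - a) * 0"
    by (intro tendsto_mult tendsto_const LIMSEQ_ignore_initial_segment[OF lim_inverse_n])
  then show "width a b \<longlonglongrightarrow> 0" unfolding width_def[abs_def] by (simp add: divide_inverse)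
qed

lemma ramp_average:
  fixes f :: "real \<Rightarrow> state"
  assumes ab: "a < b" and f: "set_integrable lebesgue {a..b} f"
  shows "(\<lambda>n. LINT x:{a..b}|lebesgue. ramp_deriv a b (width a b n) x *\<^sub>R f x) \<longlonglongrightarrow> average a b f"
proof -
  let ?k = "\<lambda>n. ramp_deriv a b (width a b n)"
  note w = width[OF ab]
  have fi: "integrable lebesgue (\<lambda>x. indicator {a..b} x *\<^sub>R f x)" using f by (simp add: set_integrable_def)
  have "(\<lambda>n. LINT x|lebesgue. indicator {a..b} x *\<^sub>R ?k n x *\<^sub>R f x) \<longlonglongrightarrow> (LINT x|lebesgue. (1 / (b - a)) *\<^sub>R indicator {a..b} x *\<^sub>R f x)"
  proof (rule integral_dominated_convergence)
    show "(\<lambda>x. (1 / (b - a)) *\<^sub>R indicator {a..b} x *\<^sub>R f x) \<in> borel_measurable lebesgue"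
      by (intro borel_measurable_scaleR borel_measurable_const borel_measurable_integrable[OF fi])
    show "(\<lambda>x. indicator {a..b} x *\<^sub>R ?k n x *\<^sub>R f x) \<in> borel_measurable lebesgue" for n
      using set_integrable_continuous_scaleR[OF ramp_deriv_continuous f] by (simp add: set_integrable_def borel_measurable_integrable)
    show "integrable lebesgue (\<lambda>x. 4 / (b - a) * norm (indicator {a..b} x *\<^sub>R f x))" using fi by (simp del: norm_scaleR)
    have "norm (?k n x *\<^sub>R f x) \<le> 4 / (b - a) * norm (f x)" for n x
      using mult_right_mono[OF ramp_bounds(2)[OF w(1,2), of n x] norm_ge_zero[of "f x"]] ramp_bounds(1)[OF w(1,2), of n x] by simp
    then show "AE x in lebesgue. norm (indicator {a..b} x *\<^sub>R ?k n x *\<^sub>R f x) \<le> 4 / (b - a) * norm (indicator {a..b} x *\<^sub>R f x)" for n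
      by (intro AE_I2) (simp add: indicator_def)
    have "AE x in lebesgue. x \<noteq> a" "AE x in lebesgue. x \<noteq> b" by (rule AE_completion[OF AE_lborel_singleton])+
    then show "AE x in lebesgue. (\<lambda>n. indicator {a..b} x *\<^sub>R ?k n x *\<^sub>R f x) \<longlonglongrightarrow> (1 / (b - a)) *\<^sub>R indicator {a..b} x *\<^sub>R f x"
    proof eventually_elim
      case (elim x)
      show ?case
      proof (cases "x \<in> {a..b}")
        case True
        \<comment> \<open>Once twice the width is below the distance of x to both ends, x lies on
          the plateau, where the height tends to 1 / (b - a).\<close>
        have "eventually (\<lambda>n. width a b n < min (x - a) (b - x) / 2) sequentially"
          by (rule order_tendstoD(2)[OF w(3)]) (use True elim in auto)
        then have "eventually (\<lambda>n. 1 / (b - a - 3 * width a b n) = ?k n x) sequentially"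
        proof eventually_elim
          case (elim n)
          then have "max 0 (x - (a + width a b n)) - max 0 (x - (a + 2 * width a b n)) - max 0 (x - (b - 2 * width a b n)) + max 0 (x - (b - width a b n)) = width a b n"
            using w(1)[of n] by (auto simp: max_def)
          then show ?case using w(1)[of n] unfolding ramp_deriv_def by simp
        qed
        moreover have "(\<lambda>n. 1 / (b - a - 3 * width a b n)) \<longlonglongrightarrow> 1 / (b - a - 3 * 0)" by (intro tendsto_intros w(3)) (use ab in simp)
        ultimately have "(\<lambda>n. ?k n x) \<longlonglongrightarrow> 1 / (b - a)" by (auto intro: Lim_transform_eventually)
        then show ?thesis using True by (auto intro: tendsto_intros)
      qed simp
    qed
  qed
  then show ?thesis unfolding average_def set_lebesgue_integral_def integral_scaleR_right .
qed

lemma total_variation_ge: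
  assumes "\<psi> \<in> test_fields \<Omega>"
  shows "ennreal (LINT x:\<Omega>|lebesgue. f x \<bullet> vector_derivative \<psi> (at x)) \<le> total_variation \<Omega> f"
  unfolding total_variation_def using assms by (rule SUP_upper)

text \<open>The test field is \<open>(K - L) e\<close>, where \<open>K\<close> and \<open>L\<close> are smoothed distribution functions of the
  uniform distributions on the two intervals.\<close>

lemma average_diff_le_total_variation:
  fixes f :: "real \<Rightarrow> state"
  assumes ab: "a < b" and cd: "c < d" and sub: "{min a c<..<max b d} \<subseteq> \<Omega>"
    and f: "set_integrable lebesgue \<Omega> f" and TV: "total_variation \<Omega> f \<le> ennreal r" and r: "r \<ge> 0"
  shows "norm (average a b f - average c d f) \<le> r"
proof -
  have dir: "(average a b f - average c d f) \<bullet> e \<le> r" if e: "norm e = 1" for e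
  proof -
    define k l where "k n = ramp_deriv a b (width a b n)" and "l n = ramp_deriv c d (width c d n)" for n
    have kc: "continuous_on UNIV (k n)" "continuous_on UNIV (l n)" for n unfolding k_def l_def by (rule ramp_deriv_continuous)+
    have fab: "set_integrable lebesgue {a..b} f" and fcd: "set_integrable lebesgue {c..d} f"
      by (rule integral_lebesgue_subinterval[OF f], use sub in force)+
    have bound: "((LINT x:{a..b}|lebesgue. k n x *\<^sub>R f x) - (LINT x:{c..d}|lebesgue. l n x *\<^sub>R f x)) \<bullet> e \<le> r" for n
    proof -
      define p q where "p = width a b n" and "q = width c d n"
      define K L where "K = ramp a b p" and "L = ramp c d q"
      have p: "p > 0" "4 * p < b - a" and q: "q > 0" "4 * q < d - c" unfolding p_def q_def using width[OF ab] width[OF cd] by auto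
      note K = ramp_bounds[OF p, folded K_def] and L = ramp_bounds[OF q, folded L_def]
      have k3: "k n x = 0" if "x \<notin> {a<..<b}" for x using K(3)[OF that] by (simp add: k_def p_def)
      have l3: "l n x = 0" if "x \<notin> {c<..<d}" for x using L(3)[OF that] by (simp add: l_def q_def)
      have KD: "(K has_real_derivative k n x) (at x)" "(L has_real_derivative l n x) (at x)" for x
        unfolding K_def L_def k_def l_def p_def q_def by (rule ramp_has_derivative)+
      define r' where "r' = min p q"
      define \<psi> where "\<psi> x = (K x - L x) *\<^sub>R e" for x
      have der: "(\<psi> has_vector_derivative ((k n x - l n x) *\<^sub>R e)) (at x)" for x
        unfolding \<psi>_def
      proof -
        have "((\<lambda>x. (K x - L x) *\<^sub>R e) has_vector_derivative ((K x - L x) *\<^sub>R 0 + (k n x - l n x) *\<^sub>R e)) (at x)"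
          by (intro has_vector_derivative_scaleR DERIV_diff KD has_vector_derivative_const)
        then show "((\<lambda>x. (K x - L x) *\<^sub>R e) has_vector_derivative ((k n x - l n x) *\<^sub>R e)) (at x)"
          by (simp only: scaleR_zero_right add_0)
      qed
      \<comment> \<open>To the left of both intervals both ramps are 0, to the right of both they
        are 1; in either case the difference vanishes, so its support is compact inside the hull of
        the two intervals.\<close>
      have supp: "closure {x. \<psi> x \<noteq> 0} \<subseteq> {min a c + r'..max b d - r'}"
      proof (rule closure_minimal)
        have "\<psi> x = 0" if "x \<notin> {min a c + r'..max b d - r'}" for x
        proof -
          have "x \<le> a + p \<and> x \<le> c + q \<or> x \<ge> b - p \<and> x \<ge> d - q" using that by (auto simp: r'_def min_def max_def split: if_splits)
          then show ?thesis using K(4,5)[of x] L(4,5)[of x] by (auto simp: \<psi>_def)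
        qed
        then show "{x. \<psi> x \<noteq> 0} \<subseteq> {min a c + r'..max b d - r'}" by blast
      qed simp
      have "\<psi> \<in> test_fields \<Omega>"
        unfolding test_fields_def
      proof (intro CollectI conjI allI)
        show "\<psi> C1_differentiable_on UNIV"
          unfolding C1_differentiable_on_def
        proof (intro exI conjI ballI)
          show "(\<psi> has_vector_derivative ((k n x - l n x) *\<^sub>R e)) (at x)" for x by (rule der)
          show "continuous_on UNIV (\<lambda>x. (k n x - l n x) *\<^sub>R e)" by (intro continuous_intros kc)
        qed
        have "bounded (closure {x. \<psi> x \<noteq> 0})" by (rule bounded_subset[OF _ supp]) simp
        then show "compact (closure {x. \<psi> x \<noteq> 0})" by (simp add: compact_eq_bounded_closed)
        have "{min a c + r'..max b d - r'} \<subseteq> {min a c<..<max b d}" using p(1) q(1) by (auto simp: r'_def)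
        then show "closure {x. \<psi> x \<noteq> 0} \<subseteq> \<Omega>" using supp sub by blast
        have "\<bar>K x - L x\<bar> \<le> 1" for x using K(6,7)[of x] L(6,7)[of x] by (simp add: abs_le_iff)
        then show "norm (\<psi> x) \<le> 1" for x by (simp add: \<psi>_def e)
      qed
      from total_variation_ge[OF this, of f] TV
      have "ennreal (LINT x:\<Omega>|lebesgue. f x \<bullet> vector_derivative \<psi> (at x)) \<le> ennreal r" by (rule order_trans)
      then have le: "(LINT x:\<Omega>|lebesgue. f x \<bullet> vector_derivative \<psi> (at x)) \<le> r" using r by (simp add: ennreal_le_iff)
      have vd: "vector_derivative \<psi> (at x) = (k n x - l n x) *\<^sub>R e" for x
        by (rule vector_derivative_at[OF der])
      have ik: "set_integrable lebesgue {a..b} (\<lambda>x. k n x *\<^sub>R f x)"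
        by (rule set_integrable_continuous_scaleR[OF kc(1) fab])
      have il: "set_integrable lebesgue {c..d} (\<lambda>x. l n x *\<^sub>R f x)"
        by (rule set_integrable_continuous_scaleR[OF kc(2) fcd])
      have pw: "indicator \<Omega> x *\<^sub>R (f x \<bullet> ((k n x - l n x) *\<^sub>R e))
          = (indicator {a..b} x *\<^sub>R k n x *\<^sub>R f x - indicator {c..d} x *\<^sub>R l n x *\<^sub>R f x) \<bullet> e" for x
      proof -
        have 1: "indicator {a..b} x *\<^sub>R k n x *\<^sub>R f x = k n x *\<^sub>R f x"
          using k3[of x] by (cases "x \<in> {a<..<b}") simp_all
        have 2: "indicator {c..d} x *\<^sub>R l n x *\<^sub>R f x = l n x *\<^sub>R f x"
          using l3[of x] by (cases "x \<in> {c<..<d}") simp_all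
        have 3: "indicator \<Omega> x * (k n x - l n x) = k n x - l n x"
        proof (cases "x \<in> \<Omega>")
          case False
          then have "x \<notin> {min a c<..<max b d}" using sub by blast
          then have "x \<notin> {a<..<b}" "x \<notin> {c<..<d}" by auto
          then show ?thesis using k3[of x] l3[of x] by simp
        qed simp
        have "indicator \<Omega> x *\<^sub>R (f x \<bullet> ((k n x - l n x) *\<^sub>R e)) = (indicator \<Omega> x * (k n x - l n x)) * (f x \<bullet> e)" by simp
        then show ?thesis unfolding 1 2 3 by (simp add: inner_diff_left left_diff_distrib)
      qed
      have "(LINT x:\<Omega>|lebesgue. f x \<bullet> vector_derivative \<psi> (at x))
          = (LINT x|lebesgue. (indicator {a..b} x *\<^sub>R k n x *\<^sub>R f x - indicator {c..d} x *\<^sub>R l n x *\<^sub>R f x) \<bullet> e)"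
        unfolding set_lebesgue_integral_def vd pw ..
      also have "\<dots> = (LINT x|lebesgue. (indicator {a..b} x *\<^sub>R k n x *\<^sub>R f x - indicator {c..d} x *\<^sub>R l n x *\<^sub>R f x)) \<bullet> e"
        using ik il by (intro integral_inner_left) (simp add: set_integrable_def)
      also have "(LINT x|lebesgue. (indicator {a..b} x *\<^sub>R k n x *\<^sub>R f x - indicator {c..d} x *\<^sub>R l n x *\<^sub>R f x))
          = (LINT x:{a..b}|lebesgue. k n x *\<^sub>R f x) - (LINT x:{c..d}|lebesgue. l n x *\<^sub>R f x)"
        using ik il by (simp add: set_integrable_def set_lebesgue_integral_def)
      finally show ?thesis using le by simp
    qed
    have "(\<lambda>n. ((LINT x:{a..b}|lebesgue. k n x *\<^sub>R f x) - (LINT x:{c..d}|lebesgue. l n x *\<^sub>R f x)) \<bullet> e)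
        \<longlonglongrightarrow> (average a b f - average c d f) \<bullet> e"
      unfolding k_def l_def by (intro tendsto_intros ramp_average ab cd fab fcd)
    then show ?thesis by (rule LIMSEQ_le_const2) (use bound in blast)
  qed
  \<comment> \<open>Testing in the direction of the difference itself recovers its Euclidean
    norm.\<close>
  define v where "v = average a b f - average c d f"
  show ?thesis
  proof (cases "v = 0")
    case False
    have "v \<bullet> ((1 / norm v) *\<^sub>R v) \<le> r" unfolding v_def by (rule dir) (use False in \<open>simp add: v_def\<close>)
    moreover have "v \<bullet> ((1 / norm v) *\<^sub>R v) = norm v"
      using False by (simp add: power2_norm_eq_inner[symmetric] power2_eq_square)
    ultimately show ?thesis by (simp add: v_def)
  qed (use r in \<open>simp add: v_def\<close>)
qed

lemma test_fields_bounded_derivative: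
  assumes "\<psi> \<in> test_fields \<Omega>"
  shows "\<exists>B. \<forall>x. norm (vector_derivative \<psi> (at x)) \<le> B"
    "continuous_on UNIV (\<lambda>x. vector_derivative \<psi> (at x))"
    "\<And>x. x \<notin> \<Omega> \<Longrightarrow> vector_derivative \<psi> (at x) = 0"
proof -
  define S where "S = closure {x. \<psi> x \<noteq> 0}"
  have psi: "\<psi> C1_differentiable_on UNIV" "compact S" "S \<subseteq> \<Omega>" using assms by (auto simp: test_fields_def S_def)
  then have cont: "continuous_on UNIV (\<lambda>x. vector_derivative \<psi> (at x))"
    by (auto simp: C1_differentiable_on_eq)
  have z: "vector_derivative \<psi> (at x) = 0" if "x \<notin> S" for x
  proof (rule vector_derivative_at)
    have "((\<lambda>x. 0) has_vector_derivative 0) (at x)" by simp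
    then show "(\<psi> has_vector_derivative 0) (at x)"
      by (rule has_vector_derivative_transform_within_open[of _ _ _ "- S"])
        (use that closure_subset[of "{x. \<psi> x \<noteq> 0}"] in \<open>auto simp: S_def\<close>)
  qed
  have "bounded ((\<lambda>x. vector_derivative \<psi> (at x)) ` S)"
    by (intro compact_imp_bounded compact_continuous_image continuous_on_subset[OF cont] psi) auto
  then obtain B where B: "\<And>x. x \<in> S \<Longrightarrow> norm (vector_derivative \<psi> (at x)) \<le> B" by (auto simp: bounded_iff)
  have "norm (vector_derivative \<psi> (at x)) \<le> max B 0" for x using B[of x] z[of x] by (cases "x \<in> S") auto
  then show "\<exists>B. \<forall>x. norm (vector_derivative \<psi> (at x)) \<le> B" by blast
  show "x \<notin> \<Omega> \<Longrightarrow> vector_derivative \<psi> (at x) = 0" for x using z[of x] psi by blast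
  show "continuous_on UNIV (\<lambda>x. vector_derivative \<psi> (at x))" by (rule cont)
qed

text \<open>Test fields supported in disjoint sets can be added: at each point one of them is 0, so
  the sum still has norm at most 1.\<close>

lemma total_variation_superadditive:
  fixes f :: "real \<Rightarrow> state"
  assumes f: "set_integrable lebesgue \<Omega> f" and sub: "A \<subseteq> \<Omega>" "B \<subseteq> \<Omega>" and disj: "A \<inter> B = {}"
  shows "total_variation A f + total_variation B f \<le> total_variation \<Omega> f"
proof -
  have int_eq: "(LINT x:S|lebesgue. f x \<bullet> vector_derivative \<psi> (at x)) = (LINT x|lebesgue. (indicator \<Omega> x *\<^sub>R f x) \<bullet> vector_derivative \<psi> (at x))"
    and int: "integrable lebesgue (\<lambda>x. (indicator \<Omega> x *\<^sub>R f x) \<bullet> vector_derivative \<psi> (at x))"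
    if \<psi>: "\<psi> \<in> test_fields S" and S: "S \<subseteq> \<Omega>" for S \<psi>
  proof -
    note C' = test_fields_bounded_derivative[OF \<psi>]
    obtain C where "\<And>x. norm (vector_derivative \<psi> (at x)) \<le> C" using C'(1) by blast
    note C = this C'(2,3)
    have "indicator S x *\<^sub>R (f x \<bullet> vector_derivative \<psi> (at x)) = (indicator \<Omega> x *\<^sub>R f x) \<bullet> vector_derivative \<psi> (at x)" for x
      using C(3)[of x] S by (cases "x \<in> S") (auto simp: indicator_def)
    then show "(LINT x:S|lebesgue. f x \<bullet> vector_derivative \<psi> (at x)) = (LINT x|lebesgue. (indicator \<Omega> x *\<^sub>R f x) \<bullet> vector_derivative \<psi> (at x))"
      by (simp only: set_lebesgue_integral_def)
    have [measurable]: "(\<lambda>x. vector_derivative \<psi> (at x)) \<in> borel_measurable lebesgue"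
      using borel_measurable_continuous_onI[OF C(2)] by (simp add: measurable_completion)
    have [measurable]: "(\<lambda>x. indicator \<Omega> x *\<^sub>R f x) \<in> borel_measurable lebesgue"
      using f by (simp add: set_integrable_def)
    show "integrable lebesgue (\<lambda>x. (indicator \<Omega> x *\<^sub>R f x) \<bullet> vector_derivative \<psi> (at x))"
    proof (rule Bochner_Integration.integrable_bound)
      show "integrable lebesgue (\<lambda>x. C * norm (indicator \<Omega> x *\<^sub>R f x))"
        using f by (simp add: set_integrable_def del: norm_scaleR)
      have "\<bar>(indicator \<Omega> x *\<^sub>R f x) \<bullet> vector_derivative \<psi> (at x)\<bar> \<le> \<bar>C * norm (indicator \<Omega> x *\<^sub>R f x)\<bar>" for x
      proof -
        have "\<bar>(indicator \<Omega> x *\<^sub>R f x) \<bullet> vector_derivative \<psi> (at x)\<bar>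
            \<le> norm (indicator \<Omega> x *\<^sub>R f x) * norm (vector_derivative \<psi> (at x))" by (rule Cauchy_Schwarz_ineq2)
        also have "\<dots> \<le> norm (indicator \<Omega> x *\<^sub>R f x) * C" by (intro mult_left_mono C) auto
        also have "\<dots> \<le> \<bar>C * norm (indicator \<Omega> x *\<^sub>R f x)\<bar>" by (simp add: mult.commute)
        finally show ?thesis .
      qed
      then show "AE x in lebesgue. norm ((indicator \<Omega> x *\<^sub>R f x) \<bullet> vector_derivative \<psi> (at x)) \<le> norm (C * norm (indicator \<Omega> x *\<^sub>R f x))"
        by simp
    qed measurable
  qed
  have key: "ennreal (LINT x:A|lebesgue. f x \<bullet> vector_derivative \<psi> (at x)) + ennreal (LINT x:B|lebesgue. f x \<bullet> vector_derivative \<eta> (at x))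
      \<le> total_variation \<Omega> f" if \<psi>: "\<psi> \<in> test_fields A" and \<eta>: "\<eta> \<in> test_fields B" for \<psi> \<eta>
  proof -
    have z: "\<psi> x = 0 \<or> \<eta> x = 0" for x
      using \<psi> \<eta> disj closure_subset[of "{x. \<psi> x \<noteq> 0}"] closure_subset[of "{x. \<eta> x \<noteq> 0}"] unfolding test_fields_def by blast
    have sum: "(\<lambda>x. \<psi> x + \<eta> x) \<in> test_fields \<Omega>"
      unfolding test_fields_def
    proof (intro CollectI conjI allI)
      show "(\<lambda>x. \<psi> x + \<eta> x) C1_differentiable_on UNIV"
        using \<psi> \<eta> unfolding test_fields_def by (intro C1_differentiable_on_add) blast+
      have "closure {x. \<psi> x + \<eta> x \<noteq> 0} \<subseteq> closure ({x. \<psi> x \<noteq> 0} \<union> {x. \<eta> x \<noteq> 0})"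
        by (rule closure_mono) auto
      then have c: "closure {x. \<psi> x + \<eta> x \<noteq> 0} \<subseteq> closure {x. \<psi> x \<noteq> 0} \<union> closure {x. \<eta> x \<noteq> 0}"
        by simp
      moreover have "closure {x. \<psi> x \<noteq> 0} \<subseteq> A" "closure {x. \<eta> x \<noteq> 0} \<subseteq> B" using \<psi> \<eta> unfolding test_fields_def by blast+
      ultimately show "closure {x. \<psi> x + \<eta> x \<noteq> 0} \<subseteq> \<Omega>" using sub by blast
      have "compact (closure {x. \<psi> x \<noteq> 0} \<union> closure {x. \<eta> x \<noteq> 0})"
        using \<psi> \<eta> unfolding test_fields_def by (intro compact_Un) blast+
      from compact_Int_closed[OF this closed_closure, of "{x. \<psi> x + \<eta> x \<noteq> 0}"]
      show "compact (closure {x. \<psi> x + \<eta> x \<noteq> 0})" unfolding inf.absorb2[OF c] .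
      have "norm (\<psi> x) \<le> 1" "norm (\<eta> x) \<le> 1" for x using \<psi> \<eta> unfolding test_fields_def by blast+
      then show "norm (\<psi> x + \<eta> x) \<le> 1" for x using z[of x] by (metis add_0 add_0_right)
    qed
    have d1: "\<psi> differentiable (at x)" for x using \<psi> unfolding test_fields_def C1_differentiable_on_eq by blast
    have d2: "\<eta> differentiable (at x)" for x using \<eta> unfolding test_fields_def C1_differentiable_on_eq by blast
    have vd: "vector_derivative (\<lambda>x. \<psi> x + \<eta> x) (at x) = vector_derivative \<psi> (at x) + vector_derivative \<eta> (at x)" for x
      by (rule vector_derivative_add_at[OF d1 d2])
    define I J where "I = (LINT x:A|lebesgue. f x \<bullet> vector_derivative \<psi> (at x))"
      and "J = (LINT x:B|lebesgue. f x \<bullet> vector_derivative \<eta> (at x))"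
    have "(LINT x:\<Omega>|lebesgue. f x \<bullet> vector_derivative (\<lambda>x. \<psi> x + \<eta> x) (at x)) = I + J"
      unfolding I_def J_def int_eq[OF \<psi> sub(1)] int_eq[OF \<eta> sub(2)]
      by (subst int_eq[OF sum subset_refl], unfold vd inner_add_right, rule Bochner_Integration.integral_add[OF int[OF \<psi> sub(1)] int[OF \<eta> sub(2)]])
    then have s: "ennreal (I + J) \<le> total_variation \<Omega> f" using total_variation_ge[OF sum, of f] by simp
    have mono: "ennreal I \<le> total_variation \<Omega> f"
    proof -
      have "\<psi> \<in> test_fields \<Omega>" using \<psi> sub(1) unfolding test_fields_def by blast
      from total_variation_ge[OF this, of f] show ?thesis
        unfolding I_def int_eq[OF \<psi> sub(1)] int_eq[OF \<open>\<psi> \<in> test_fields \<Omega>\<close> subset_refl] .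
    qed
    have mono2: "ennreal J \<le> total_variation \<Omega> f"
    proof -
      have "\<eta> \<in> test_fields \<Omega>" using \<eta> sub(2) unfolding test_fields_def by blast
      from total_variation_ge[OF this, of f] show ?thesis
        unfolding J_def int_eq[OF \<eta> sub(2)] int_eq[OF \<open>\<eta> \<in> test_fields \<Omega>\<close> subset_refl] .
    qed
    have "ennreal I + ennreal J \<le> total_variation \<Omega> f"
    \<comment> \<open>A negative integral counts as 0 in \<open>ennreal\<close>, and then the other
      field alone has to be used as a test field on \<Omega>.\<close>
    proof (cases "I \<ge> 0 \<and> J \<ge> 0")
      case True
      then show ?thesis using s by (simp add: ennreal_plus)
    next
      case False
      then show ?thesis using mono mono2 by (cases "I \<ge> 0") (auto simp: ennreal_neg)
    qed
    then show ?thesis by (simp add: I_def J_def)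
  qed
  have ne: "test_fields S \<noteq> {}" for S
  proof -
    have "(\<lambda>x. 0) \<in> test_fields S" by (simp add: test_fields_def)
    then show ?thesis by blast
  qed
  show ?thesis
    unfolding total_variation_def[of A] total_variation_def[of B]
      ennreal_SUP_add_left[OF ne, symmetric] ennreal_SUP_add_right[OF ne]
    by (intro SUP_least key)
qed

text \<open>The intervals shrink to y but need not contain it: the initial cell to which a sampled
  characteristic leads converges to the foot y without having to contain y.\<close>

definition intervals_at :: "real \<Rightarrow> (real \<times> real) filter" where
  "intervals_at y = inf (nhds (y, y)) (principal {(a, b). a < b})"

lemma eventually_intervals_at:
  "eventually P (intervals_at y) \<longleftrightarrow> (\<exists>d>0. \<forall>a b. y - d < a \<and> a < b \<and> b < y + d \<longrightarrow> P (a, b))"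
proof
  assume "eventually P (intervals_at y)"
  then obtain d where d: "d > 0" "\<And>p. dist p (y, y) < d \<Longrightarrow> fst p < snd p \<Longrightarrow> P p"
    unfolding intervals_at_def eventually_inf_principal eventually_nhds_metric by (auto simp: case_prod_unfold)
  have "P (a, b)" if "y - d / 2 < a \<and> a < b \<and> b < y + d / 2" for a b
    using that sqrt_sum_squares_le_sum_abs[of "a - y" "b - y"] by (intro d(2)) (auto simp: dist_Pair_Pair dist_real_def)
  then show "\<exists>d>0. \<forall>a b. y - d < a \<and> a < b \<and> b < y + d \<longrightarrow> P (a, b)" using d(1) by (intro exI[of _ "d / 2"]) auto
next
  assume "\<exists>d>0. \<forall>a b. y - d < a \<and> a < b \<and> b < y + d \<longrightarrow> P (a, b)"
  then obtain d where d: "d > 0" "\<And>a b. y - d < a \<and> a < b \<and> b < y + d \<Longrightarrow> P (a, b)" by blast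
  have "P p" if "dist p (y, y) < d" "fst p < snd p" for p
  proof -
    have "y - d < fst p \<and> fst p < snd p \<and> snd p < y + d"
      using that dist_fst_le[of p "(y, y)"] dist_snd_le[of p "(y, y)"] by (auto simp: dist_real_def)
    from d(2)[OF this] show ?thesis by simp
  qed
  then show "eventually P (intervals_at y)"
    unfolding intervals_at_def eventually_inf_principal eventually_nhds_metric using d(1) by (auto simp: case_prod_unfold)
qed

definition average_converges :: "(real \<Rightarrow> state) \<Rightarrow> real \<Rightarrow> bool" where
  "average_converges f y \<longleftrightarrow> (\<exists>l. ((\<lambda>(a, b). average a b f) \<longlongrightarrow> l) (intervals_at y))"

text \<open>The variation to the left of y is a monotone function m of y, hence continuous off a
  countable set. Where m is continuous, averages over two small nearby intervals differ by at most
  the variation in a small neighbourhood, so they form a Cauchy filter.\<close>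

lemma BV_averages_converge:
  fixes f :: "real \<Rightarrow> state"
  assumes f: "set_integrable lebesgue \<Omega> f" and fin: "total_variation \<Omega> f < \<infinity>" and op: "open \<Omega>"
  shows "countable {y \<in> \<Omega>. \<not> average_converges f y}"
proof -
  define m where "m y = enn2real (total_variation (\<Omega> \<inter> {..<y}) f)" for y
  have int: "set_integrable lebesgue S f" if "S \<subseteq> \<Omega>" "S \<in> sets lebesgue" for S
    using f that by (intro set_integrable_subset[OF f]) auto
  have Os: "\<Omega> \<in> sets lebesgue" using op by auto
  have fin': "total_variation S f \<noteq> \<infinity>" if "S \<subseteq> \<Omega>" for S
  proof -
    have "total_variation S f + total_variation {} f \<le> total_variation \<Omega> f"
      by (rule total_variation_superadditive[OF f]) (use that in auto)
    then show ?thesis using fin by (auto simp: top_unique)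
  qed
  have key: "total_variation (\<Omega> \<inter> {x<..<y}) f \<le> ennreal (m y - m x)" "m x \<le> m y" if "x \<le> y" for x y
  proof -
    have "total_variation (\<Omega> \<inter> {..<x}) f + total_variation (\<Omega> \<inter> {x<..<y}) f \<le> total_variation (\<Omega> \<inter> {..<y}) f"
      by (rule total_variation_superadditive[OF int]) (use that Os in auto)
    moreover obtain p where p: "total_variation (\<Omega> \<inter> {..<x}) f = ennreal p" "p \<ge> 0"
      using fin'[of "\<Omega> \<inter> {..<x}"] by (cases "total_variation (\<Omega> \<inter> {..<x}) f") auto
    moreover obtain q where q: "total_variation (\<Omega> \<inter> {..<y}) f = ennreal q" "q \<ge> 0"
      using fin'[of "\<Omega> \<inter> {..<y}"] by (cases "total_variation (\<Omega> \<inter> {..<y}) f") auto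
    moreover obtain r where r: "total_variation (\<Omega> \<inter> {x<..<y}) f = ennreal r" "r \<ge> 0"
      using fin'[of "\<Omega> \<inter> {x<..<y}"] by (cases "total_variation (\<Omega> \<inter> {x<..<y}) f") auto
    ultimately have "p + r \<le> q" by (simp add: ennreal_plus[symmetric] ennreal_le_iff del: ennreal_plus)
    then show "total_variation (\<Omega> \<inter> {x<..<y}) f \<le> ennreal (m y - m x)" "m x \<le> m y"
      using p q r by (auto simp: m_def intro!: ennreal_leI)
  qed
  have "mono m" using key(2) by (auto simp: mono_def)
  from mono_ctble_discont[OF this] have C: "countable {y. \<not> isCont m y}" .
  have "average_converges f y" if y: "y \<in> \<Omega>" and cy: "isCont m y" for y
  proof -
    obtain d0 where d0: "d0 > 0" "ball y d0 \<subseteq> \<Omega>" using op y by (meson open_contains_ball)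
    have osc: "\<exists>d>0. \<forall>a b a' b'. y - d < a \<and> a < b \<and> b < y + d \<and> y - d < a' \<and> a' < b' \<and> b' < y + d
      \<longrightarrow> norm (average a b f - average a' b' f) \<le> e" if e: "e > 0" for e
    proof -
      obtain d1 where d1: "d1 > 0" "\<And>x. \<bar>x - y\<bar> < d1 \<Longrightarrow> \<bar>m x - m y\<bar> < e / 2"
        using cy e unfolding continuous_at_eps_delta dist_real_def by (meson half_gt_zero)
      define d where "d = min d0 d1 / 2"
      have d: "d > 0" "d < d0" "d < d1" using d0 d1 by (auto simp: d_def)
      have "norm (average a b f - average a' b' f) \<le> e"
        if "y - d < a" "a < b" "b < y + d" "y - d < a'" "a' < b'" "b' < y + d" for a b a' b'
      proof (rule average_diff_le_total_variation[where \<Omega>="\<Omega> \<inter> {y - d<..<y + d}"])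
        have "{y - d<..<y + d} \<subseteq> ball y d0" using d by (auto simp: ball_def dist_real_def)
        then have "{y - d<..<y + d} \<subseteq> \<Omega>" using d0 by blast
        then show "{min a a'<..<max b b'} \<subseteq> \<Omega> \<inter> {y - d<..<y + d}" using that by (auto simp: subset_iff min_def max_def split: if_splits)
        show "set_integrable lebesgue (\<Omega> \<inter> {y - d<..<y + d}) f" by (rule int) (use Os in auto)
        have "m (y + d) - m (y - d) \<le> e" using d1(2)[of "y + d"] d1(2)[of "y - d"] d by (simp add: abs_if split: if_splits)
        then show "total_variation (\<Omega> \<inter> {y - d<..<y + d}) f \<le> ennreal e"
          using key(1)[of "y - d" "y + d"] d by (auto intro: order_trans ennreal_leI)
      qed (use that e in auto)
      then show ?thesis using d by (intro exI[of _ d]) auto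
    qed
    have ne: "intervals_at y \<noteq> bot"
      unfolding trivial_limit_def eventually_intervals_at
    proof (intro notI, elim exE conjE)
      fix d :: real assume d: "d > 0" "\<forall>a b. y - d < a \<and> a < b \<and> b < y + d \<longrightarrow> False"
      from spec[OF spec[OF d(2), of "y - d / 2"], of y] d(1) show False by simp
    qed
    have "cauchy_filter (filtermap (\<lambda>(a, b). average a b f) (intervals_at y))"
      unfolding cauchy_filter_metric_filtermap
    proof (intro allI impI)
      fix e :: real assume e: "e > 0"
      obtain d where d: "d > 0" "\<And>a b a' b'. y - d < a \<Longrightarrow> a < b \<Longrightarrow> b < y + d \<Longrightarrow> y - d < a' \<Longrightarrow> a' < b' \<Longrightarrow> b' < y + d
        \<Longrightarrow> norm (average a b f - average a' b' f) \<le> e / 2" using osc[of "e / 2"] e by auto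
      show "\<exists>P. eventually P (intervals_at y) \<and> (\<forall>p p'. P p \<and> P p' \<longrightarrow> dist (case p of (a, b) \<Rightarrow> average a b f) (case p' of (a, b) \<Rightarrow> average a b f) < e)"
      proof (intro exI conjI)
        show "eventually (\<lambda>(a, b). y - d < a \<and> a < b \<and> b < y + d) (intervals_at y)"
          unfolding eventually_intervals_at using d(1) by (intro exI[of _ d]) auto
      qed (use d(2) e in \<open>force simp: dist_norm\<close>)
    qed
    from cauchy_filter_complete_converges[OF this complete_UNIV] ne show ?thesis
      by (auto simp: average_converges_def filterlim_def filtermap_bot_iff)
  qed
  then have "{y \<in> \<Omega>. \<not> average_converges f y} \<subseteq> {y. \<not> isCont m y}" by blast
  then show ?thesis using C by (rule countable_subset)
qed

text \<open>All averages are compared with that over one fixed interval; convexity of \<Omega> keeps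
  the hull of the two intervals inside.\<close>

lemma BV_averages_bounded:
  fixes f :: "real \<Rightarrow> state"
  assumes f: "set_integrable lebesgue \<Omega> f" and fin: "total_variation \<Omega> f < \<infinity>" and int: "is_interval \<Omega>"
  shows "\<exists>B. \<forall>a b. a < b \<and> {a<..<b} \<subseteq> \<Omega> \<longrightarrow> norm (average a b f) \<le> B"
proof (cases "\<exists>a b. a < b \<and> {a<..<b} \<subseteq> \<Omega>")
  case True
  then obtain c d where cd: "c < d" "{c<..<d} \<subseteq> \<Omega>" by blast
  obtain r where r: "total_variation \<Omega> f = ennreal r" "r \<ge> 0" using fin by (cases "total_variation \<Omega> f") auto
  have "norm (average a b f) \<le> norm (average c d f) + r" if ab: "a < b" "{a<..<b} \<subseteq> \<Omega>" for a b
  proof -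
    have "{min a c<..<max b d} \<subseteq> \<Omega>"
    proof
      fix x assume x: "x \<in> {min a c<..<max b d}"
      obtain p where "p \<in> {a<..<b} \<union> {c<..<d}" "p \<le> x"
        using x ab(1) cd(1) dense[of a "min x b"] dense[of c "min x d"] by (fastforce simp: min_def split: if_splits)
      moreover obtain p' where "p' \<in> {a<..<b} \<union> {c<..<d}" "x \<le> p'"
        using x ab(1) cd(1) dense[of "max x a" b] dense[of "max x c" d] by (fastforce simp: max_def split: if_splits)
      ultimately show "x \<in> \<Omega>" using int ab(2) cd(2) unfolding is_interval_1 by blast
    qed
    from average_diff_le_total_variation[OF ab(1) cd(1) this f _ r(2)] r(1) have "norm (average a b f - average c d f) \<le> r" by simp
    then show ?thesis using norm_triangle_sub[of "average a b f" "average c d f"] by linarith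
  qed
  then show ?thesis by blast
qed blast

section \<open>Riemann fans and sampled cells\<close>

text \<open>In a phase with sound speed c the combination v - c w is transported with velocity +c.
  The argument is a signed velocity: -c gives the other family.\<close>

definition riemann_inv :: "real \<Rightarrow> state \<Rightarrow> real" where
  "riemann_inv c u = fst u - c * snd u"

locale phase_model =
  fixes k1 k3 wM wm :: real and \<phi> :: "real \<Rightarrow> real"
  assumes k3_pos: "0 < k3" and k31: "k3 < k1" and wM_pos: "0 < wM" and wMm: "wM < wm"
    and dissip: "dissipation_function k1 k3 wM wm \<phi>"
begin

definition "c1 = sqrt k1"
definition "c3 = sqrt k3"
definition "K = (k1 - k3) / 2"
text \<open>A threshold strictly between the phases. Limit states stay away from it, which makes
  quantities defined by a case distinction on the phase continuous at them.\<close>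

definition "wc = (wM + wm) / 2"

lemma c_pos: "0 < c3" "c3 < c1" "0 < c1" "c1\<^sup>2 = k1" "c3\<^sup>2 = k3"
  using k3_pos k31 by (auto simp: c1_def c3_def)

lemma K_pos: "0 < K" using k31 by (simp add: K_def)

lemma phases_disjoint: "u \<in> phase1 wM \<Longrightarrow> u \<in> phase3 wm \<Longrightarrow> False"
  using wMm by (auto simp: phase1_def phase3_def)

lemma phase_wc: "u \<in> phase1 wM \<Longrightarrow> snd u < wc" "u \<in> phase3 wm \<Longrightarrow> \<not> snd u < wc"
  using wMm by (auto simp: phase1_def phase3_def wc_def)

text \<open>In the subsonic and in the supersonic regime alike the two linear relations express the
  Rankine--Hugoniot conditions through the invariants of the incoming waves.\<close>

definition "boundary_trace V um up \<longleftrightarrow>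
   (let z = (riemann_inv (- c3) up - riemann_inv c1 um) / (c1 + c3)
    in um \<in> phase1 wM \<and> up \<in> phase3 wm \<and> - c3 < V \<and> V < c1 \<and>
       (c1 + V) * snd um = (c3 + V) * z \<and> (c3 - V) * snd up = (c1 - V) * z \<and>
       (V < c3 \<longrightarrow> phi_value \<phi> V (K * (wM * wm - snd um * snd up))))"

text \<open>For c3 \<le> V the sector between V and c3 is empty and \<open>up\<close> never shows in
  \<open>fan4\<close>; putting \<open>up = ur\<close> then lets one formula describe both regimes of
  the solver.\<close>

definition "boundary_fan ul ur V um up r \<longleftrightarrow> boundary_trace V um up \<and>
   riemann_inv c1 um = riemann_inv c1 ul \<and> riemann_inv (- c3) up = riemann_inv (- c3) ur \<and>
   (c3 \<le> V \<longrightarrow> up = ur) \<and> r = fan4 (- c1) V c3 ul um up ur"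

text \<open>In the subsonic case the relations are the formulas of the solver cleared of
  denominators. In the supersonic case they follow from the two jump conditions by eliminating the
  velocities, with z again expressed by the incoming invariants.\<close>

lemma two_phase_boundary_fan:
  assumes "riemann_two_phase k1 k3 wM wm \<phi> ul ur r"
  shows "\<exists>V um up. boundary_fan ul ur V um up r"
proof -
  define z where "z = (c1 * snd ul + c3 * snd ur + fst ur - fst ul) / (c1 + c3)"
  have z: "z = (riemann_inv (- c3) ur - riemann_inv c1 ul) / (c1 + c3)"
    by (simp add: z_def riemann_inv_def algebra_simps)
  show ?thesis
  proof (cases "z > 0")
    case True
    then obtain V where V: "- c3 < V" "V < c3"
      and *: "let w1 = (c3 + V) / (c1 + V) * z; u1 = (fst ul + c1 * (w1 - snd ul), w1);
                  w2 = (c1 - V) / (c3 - V) * z; u2 = (fst ur + c3 * (snd ur - w2), w2)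
              in u1 \<in> phase1 wM \<and> u2 \<in> phase3 wm \<and>
                 phi_value \<phi> V ((k1 - k3) / 2 * (wM * wm - w1 * w2)) \<and>
                 r = fan4 (- c1) V c3 ul u1 u2 ur"
      using assms unfolding riemann_two_phase_def Let_def c1_def[symmetric] c3_def[symmetric] z_def by auto
    define w1 w2 where "w1 = (c3 + V) / (c1 + V) * z" and "w2 = (c1 - V) / (c3 - V) * z"
    define u1 u2 where "u1 = (fst ul + c1 * (w1 - snd ul), w1)" and "u2 = (fst ur + c3 * (snd ur - w2), w2)"
    have r: "u1 \<in> phase1 wM" "u2 \<in> phase3 wm" "phi_value \<phi> V (K * (wM * wm - w1 * w2))" "r = fan4 (- c1) V c3 ul u1 u2 ur"
      using * unfolding Let_def u1_def u2_def w1_def w2_def K_def by auto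
    have i: "riemann_inv c1 u1 = riemann_inv c1 ul" "riemann_inv (- c3) u2 = riemann_inv (- c3) ur"
      by (auto simp: riemann_inv_def u1_def u2_def algebra_simps)
    have nz: "c1 + V \<noteq> 0" "c3 - V \<noteq> 0" using V c_pos by auto
    have "boundary_trace V u1 u2"
      unfolding boundary_trace_def Let_def i z[symmetric]
      using r V c_pos nz by (auto simp: u1_def u2_def w1_def w2_def)
    then have "boundary_fan ul ur V u1 u2 r" unfolding boundary_fan_def using i r V by auto
    then show ?thesis by blast
  next
    case False
    then obtain V u1 where V: "c3 \<le> V" "V < c1" and u1: "u1 \<in> phase1 wM"
      and rh: "rankine_hugoniot k1 k3 wM wm (- c1) ul u1" "rankine_hugoniot k1 k3 wM wm V u1 ur"
      and r: "r = fan3 (- c1) V ul u1 ur"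
      using assms unfolding riemann_two_phase_def Let_def c1_def[symmetric] c3_def[symmetric] z_def by auto
    have ur: "ur \<in> phase3 wm" using assms by (simp add: riemann_two_phase_def)
    have i: "riemann_inv c1 u1 = riemann_inv c1 ul"
      using rh(1) by (simp add: rankine_hugoniot_def riemann_inv_def algebra_simps)
    have s: "stress k1 k3 wM wm (snd u1) = k1 * snd u1" "stress k1 k3 wM wm (snd ur) = k3 * snd ur"
      using u1 ur wMm by (auto simp: stress_def phase1_def phase3_def)
    define wl wr where "wl = snd u1" and "wr = snd ur"
    have A: "fst ur - fst u1 = - V * (wr - wl)" using rh(2) by (simp add: rankine_hugoniot_def wl_def wr_def)
    have B: "- V * (fst ur - fst u1) = k3 * wr - k1 * wl"
      using rh(2) unfolding rankine_hugoniot_def s wl_def wr_def by simp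
    \<comment> \<open>Eliminating the velocity jump gives (c1^2 - V^2) w- = (c3^2 - V^2) w+.
      Together with the expression C for z this is equivalent to the two linear relations, up to the
      factor c1 + c3.\<close>
    have B': "(c1\<^sup>2 - V\<^sup>2) * wl = (c3\<^sup>2 - V\<^sup>2) * wr"
      using B unfolding A c_pos by (simp add: power2_eq_square algebra_simps)
    have C: "(c1 + c3) * z = (c3 - V) * wr + (c1 + V) * wl"
    proof -
      have "(c1 + c3) * z = riemann_inv (- c3) ur - riemann_inv c1 u1"
        using c_pos by (simp add: z i)
      then show ?thesis using A by (simp add: riemann_inv_def wl_def wr_def algebra_simps)
    qed
    have e1: "(c1 + c3) * ((c1 + V) * wl - (c3 + V) * z) = 0"
    proof -
      have "(c1 + c3) * ((c1 + V) * wl - (c3 + V) * z) = (c1 + c3) * (c1 + V) * wl - (c3 + V) * ((c1 + c3) * z)"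
        by (simp add: algebra_simps)
      also have "\<dots> = (c1\<^sup>2 - V\<^sup>2) * wl - (c3\<^sup>2 - V\<^sup>2) * wr" unfolding C by (simp add: power2_eq_square algebra_simps)
      finally show ?thesis using B' by simp
    qed
    have e2: "(c1 + c3) * ((c3 - V) * wr - (c1 - V) * z) = 0"
    proof -
      have "(c1 + c3) * ((c3 - V) * wr - (c1 - V) * z) = (c1 + c3) * (c3 - V) * wr - (c1 - V) * ((c1 + c3) * z)"
        by (simp add: algebra_simps)
      also have "\<dots> = (c3\<^sup>2 - V\<^sup>2) * wr - (c1\<^sup>2 - V\<^sup>2) * wl" unfolding C by (simp add: power2_eq_square algebra_simps)
      finally show ?thesis using B' by simp
    qed
    have "boundary_trace V u1 ur"
      unfolding boundary_trace_def Let_def i z[symmetric]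
      using e1 e2 V u1 ur c_pos by (auto simp: wl_def wr_def)
    moreover have "r = fan4 (- c1) V c3 ul u1 ur ur" unfolding r by (auto simp: fan3_def fan4_def)
    ultimately have "boundary_fan ul ur V u1 ur r" unfolding boundary_fan_def using i by auto
    then show ?thesis by blast
  qed
qed

end

text \<open>The middle state shares the invariant of speed c with the left state and that of speed
  -c with the right one, so each invariant jumps only across its own wave.\<close>

lemma one_phase_fan:
  assumes r: "riemann_one_phase c H ul ur r" and c: "c > 0"
  shows "r \<xi> \<in> H" "riemann_inv c (r \<xi>) = (if \<xi> < c then riemann_inv c ul else riemann_inv c ur)"
    "riemann_inv (- c) (r \<xi>) = (if \<xi> < - c then riemann_inv (- c) ul else riemann_inv (- c) ur)"
proof -
  define z where "z = (snd ul + snd ur) / 2 + (fst ur - fst ul) / (2 * c)"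
  define um where "um = (fst ul + c * (z - snd ul), z)"
  have *: "ul \<in> H" "ur \<in> H" "um \<in> H" "r = fan3 (- c) c ul um ur"
    using r unfolding riemann_one_phase_def Let_def z_def um_def by auto
  have i: "riemann_inv c um = riemann_inv c ul" "riemann_inv (- c) um = riemann_inv (- c) ur"
    using c by (auto simp: riemann_inv_def um_def z_def field_simps)
  show "r \<xi> \<in> H" using * by (simp add: fan3_def)
  show "riemann_inv c (r \<xi>) = (if \<xi> < c then riemann_inv c ul else riemann_inv c ur)"
    using i c by (simp add: * fan3_def)
  show "riemann_inv (- c) (r \<xi>) = (if \<xi> < - c then riemann_inv (- c) ul else riemann_inv (- c) ur)"
    using i c by (simp add: * fan3_def)
qed

context phase_model
begin

lemma riemann_solution_cases:
  assumes "riemann_solution k1 k3 wM wm \<phi> ul ur r"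
  obtains (one) "ul \<in> phase1 wM" "ur \<in> phase1 wM" "riemann_one_phase c1 (phase1 wM) ul ur r"
  | (three) "ul \<in> phase3 wm" "ur \<in> phase3 wm" "riemann_one_phase c3 (phase3 wm) ul ur r"
  | (two) "ul \<in> phase1 wM" "ur \<in> phase3 wm" "\<exists>V um up. boundary_fan ul ur V um up r"
proof -
  have o: "ul \<in> H \<and> ur \<in> H" if "riemann_one_phase c H ul ur r" for c H
    using that unfolding riemann_one_phase_def by blast
  have t: "ul \<in> phase1 wM \<and> ur \<in> phase3 wm" if "riemann_two_phase k1 k3 wM wm \<phi> ul ur r"
    using that unfolding riemann_two_phase_def by blast
  have "riemann_one_phase c1 (phase1 wM) ul ur r \<or> riemann_one_phase c3 (phase3 wm) ul ur r \<or>
      riemann_two_phase k1 k3 wM wm \<phi> ul ur r"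
    using assms unfolding riemann_solution_def c1_def c3_def .
  then show ?thesis using one three two o t two_phase_boundary_fan by blast
qed

end

text \<open>The scheme samples by left limits. On a fan that is constant just to the left of every
  point, such a limit is an actual value of the fan.\<close>

definition locally_const_left :: "(real \<Rightarrow> 'a) \<Rightarrow> bool" where
  "locally_const_left r \<longleftrightarrow> (\<forall>x. \<exists>y. eventually (\<lambda>\<xi>. r \<xi> = y) (at_left x))"

lemma locally_const_left_if:
  assumes "locally_const_left r"
  shows "locally_const_left (\<lambda>\<xi>. if \<xi> < s then u else r \<xi>)"
  unfolding locally_const_left_def
proof
  fix x
  obtain y where y: "eventually (\<lambda>\<xi>. r \<xi> = y) (at_left x)" using assms by (auto simp: locally_const_left_def)
  have "eventually (\<lambda>\<xi>. \<xi> \<in> {min s (x - 1)<..<x}) (at_left x)" "s < x \<Longrightarrow> eventually (\<lambda>\<xi>. \<xi> \<in> {s<..<x}) (at_left x)"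
    by (intro eventually_at_leftI[of "min s (x - 1)"] eventually_at_leftI[of s]; simp)+
  with y have "eventually (\<lambda>\<xi>. (if \<xi> < s then u else r \<xi>) = (if x \<le> s then u else y)) (at_left x)"
    by (cases "x \<le> s") (auto elim: eventually_elim2)
  then show "\<exists>y. eventually (\<lambda>\<xi>. (if \<xi> < s then u else r \<xi>) = y) (at_left x)" by blast
qed

lemma riemann_solution_fan4:
  assumes "riemann_solution k1 k3 wM wm \<phi> ul ur r"
  shows "\<exists>s t p u v w x. r = fan4 s t p u v w x"
proof -
  have f: "fan3 s t u v w = fan4 s t t u v w w" for s t u v w by (auto simp: fan3_def fan4_def)
  have one: ?thesis if "riemann_one_phase c H ul ur r" for c H
    using that unfolding riemann_one_phase_def Let_def f by blast
  have two: ?thesis if "riemann_two_phase k1 k3 wM wm \<phi> ul ur r"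
  proof (cases "(sqrt k1 * snd ul + sqrt k3 * snd ur + fst ur - fst ul) / (sqrt k1 + sqrt k3) > 0")
    case True
    then show ?thesis using that unfolding riemann_two_phase_def Let_def if_P[OF True] by blast
  next
    case False
    then show ?thesis using that unfolding riemann_two_phase_def Let_def if_not_P[OF False] f by blast
  qed
  show ?thesis using assms one two unfolding riemann_solution_def by blast
qed

lemma riemann_solution_locally_const:
  assumes "riemann_solution k1 k3 wM wm \<phi> ul ur r"
  shows "locally_const_left r"
proof -
  have "locally_const_left (\<lambda>_. u)" for u :: state by (auto simp: locally_const_left_def)
  then have "locally_const_left (fan4 s t p u v w x)" for s t p u v w x
    unfolding fan4_def[abs_def] by (intro locally_const_left_if)
  then show ?thesis using riemann_solution_fan4[OF assms] by blast
qed

lemma riemann_solution_measurable: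
  assumes "riemann_solution k1 k3 wM wm \<phi> ul ur r"
  shows "r \<in> borel_measurable borel"
proof -
  have "fan4 s t p u v w x \<in> borel_measurable borel" for s t p u v w x
    unfolding fan4_def[abs_def] by measurable
  then show ?thesis using riemann_solution_fan4[OF assms] by blast
qed

lemma tendsto_unique_left: "(f \<longlongrightarrow> a) (at_left x) \<Longrightarrow> (f \<longlongrightarrow> b) (at_left (x :: real)) \<Longrightarrow> a = (b :: state)"
  by (rule tendsto_unique[of "at_left x"]) auto

lemma tendsto_unique_right: "(f \<longlongrightarrow> a) (at_right x) \<Longrightarrow> (f \<longlongrightarrow> b) (at_right (x :: real)) \<Longrightarrow> a = (b :: state)"
  by (rule tendsto_unique[of "at_right x"]) auto

section \<open>One approximate solution: cells, fans and the boundary\<close>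

locale glimm = phase_model +
  fixes \<tau> h q :: real and a :: "nat \<Rightarrow> real" and u0 :: "real \<Rightarrow> state" and uh :: "point \<Rightarrow> state" and \<gamma>h :: "real \<Rightarrow> real"
  assumes scheme: "glimm_scheme k1 k3 wM wm \<phi> \<tau> h a u0 uh"
    and boundary: "approx_phase_boundary wM wm uh \<gamma>h"
    and h_pos: "0 < h" and tau_pos: "0 < \<tau>" and q: "h / \<tau> = q" and CFL: "\<tau> * c1 < h"
    and a_range: "\<And>n. n \<ge> 1 \<Longrightarrow> -1 < a n \<and> a n < 1"
begin

lemma h_eq: "h = q * \<tau>" and q_gt: "c1 < q" and q_pos: "0 < q"
  using q tau_pos CFL c_pos by (auto simp: field_simps)

lemma scheme_sampling:
  assumes "n \<ge> 1"
  shows "\<exists>g. (\<forall>y. ((\<lambda>t. uh (t, y)) \<longlongrightarrow> g y) (at_left (real n * \<tau>))) \<and>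
           (\<forall>m::int. even (m + int n) \<longrightarrow> (\<forall>x\<in>{of_int m * h..<of_int (m + 2) * h}.
              (g \<longlongrightarrow> uh (real n * \<tau>, x)) (at_left ((of_int m + 1 + a n) * h))))"
  using scheme[unfolded glimm_scheme_def, THEN conjunct2, THEN conjunct1] assms by (simp only:)

lemma scheme_initial:
  assumes "even m" "x \<in> {of_int m * h..<of_int (m + 2) * h}"
  shows "uh (0, x) = (1 / (2 * h)) *\<^sub>R (LINT y:{of_int m * h..of_int (m + 2) * h}|lebesgue. u0 y)"
  using scheme[unfolded glimm_scheme_def, THEN conjunct1] assms by (simp only:)

lemma scheme_strip:
  assumes "even (m + int n)"
  shows "\<exists>r. riemann_solution k1 k3 wM wm \<phi> (uh (real n * \<tau>, of_int (m - 1) * h)) (uh (real n * \<tau>, of_int m * h)) r \<and>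
             (\<forall>t\<in>{real n * \<tau><..<real (n + 1) * \<tau>}. \<forall>x\<in>{of_int (m - 1) * h..<of_int (m + 1) * h}.
                uh (t, x) = r ((x - of_int m * h) / (t - real n * \<tau>)))"
  using scheme[unfolded glimm_scheme_def, THEN conjunct2, THEN conjunct2] assms by (simp only:)

lemma level_const:
  assumes "even (m + int n)" "x \<in> {of_int m * h..<of_int (m + 2) * h}"
  shows "uh (real n * \<tau>, x) = uh (real n * \<tau>, of_int m * h)"
proof -
  have m: "of_int m * h \<in> {of_int m * h..<of_int (m + 2) * h}" using h_pos by auto
  show ?thesis
  proof (cases "n = 0")
    case True
    then have "even m" using assms(1) by simp
    then show ?thesis using scheme_initial[of m x] scheme_initial[of m "of_int m * h"] assms(2) m True by simp
  next
    case False
    then have "n \<ge> 1" by simp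
    from scheme_sampling[OF this] obtain g where g: "\<forall>m::int. even (m + int n) \<longrightarrow> (\<forall>x\<in>{of_int m * h..<of_int (m + 2) * h}.
                (g \<longlongrightarrow> uh (real n * \<tau>, x)) (at_left ((of_int m + 1 + a n) * h)))"
      by (elim exE conjE)
    show ?thesis
      by (rule tendsto_unique[OF _ g[rule_format, OF assms] g[rule_format, OF assms(1) m]]) simp
  qed
qed

definition "cell n m = uh (real n * \<tau>, of_int m * h)"

lemma level_eq_cell:
  assumes "even (m + int n)" "x \<in> {of_int m * h..<of_int (m + 2) * h}"
  shows "uh (real n * \<tau>, x) = cell n m"
  using level_const[OF assms] by (simp add: cell_def)

definition "fan_spec n m r \<longleftrightarrow> riemann_solution k1 k3 wM wm \<phi> (cell n (m - 2)) (cell n m) r \<and>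
   (\<forall>t\<in>{real n * \<tau><..<real (n + 1) * \<tau>}. \<forall>x\<in>{of_int (m - 1) * h..<of_int (m + 1) * h}.
      uh (t, x) = r ((x - of_int m * h) / (t - real n * \<tau>)))"

definition "fan n m = (SOME r. fan_spec n m r)"

lemma fan_spec_fan:
  assumes "even (m + int n)"
  shows "fan_spec n m (fan n m)"
proof -
  \<comment> \<open>The scheme refers to the left data by the point (m - 1) h, which lies in the
    middle of the cell that starts at (m - 2) h.\<close>
  have "uh (real n * \<tau>, of_int (m - 1) * h) = cell n (m - 2)"
    by (rule level_eq_cell) (use assms h_pos in \<open>auto simp: mult_right_mono\<close>)
  moreover have "uh (real n * \<tau>, of_int m * h) = cell n m" by (simp add: cell_def)
  moreover note scheme_strip[OF assms]
  ultimately have "\<exists>r. fan_spec n m r"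
    unfolding fan_spec_def by (simp only:)
  then show ?thesis unfolding fan_def by (rule someI_ex)
qed

lemma fan_solution: "even (m + int n) \<Longrightarrow> riemann_solution k1 k3 wM wm \<phi> (cell n (m - 2)) (cell n m) (fan n m)"
  using fan_spec_fan by (simp add: fan_spec_def)

lemma strip_eq_fan:
  assumes "even (m + int n)" "real n * \<tau> < t" "t < real (Suc n) * \<tau>" "of_int (m - 1) * h \<le> x" "x < of_int (m + 1) * h"
  shows "uh (t, x) = fan n m ((x - of_int m * h) / (t - real n * \<tau>))"
  using fan_spec_fan[OF assms(1)] assms(2-) by (simp add: fan_spec_def)

text \<open>Since h = q \<tau>, the sampling point corresponds to the slope a q in the fan. As a
  left limit is taken, the value is attained at some \<xi> just below a q, and \<xi> can be chosen
  on the same side as a q of finitely many prescribed speeds. Approaching from the left is the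
  reason why \<xi> < c corresponds to the weak inequality for a q.\<close>

lemma cell_sample:
  assumes even: "even (m + int n)" and "finite S"
  shows "\<exists>\<xi>. cell (Suc n) (m - 1) = fan n m \<xi> \<and> (\<forall>c\<in>S. \<xi> < c \<longleftrightarrow> a (Suc n) * q \<le> c)"
proof -
  define A where "A = a (Suc n) * q"
  have a1: "-1 < a (Suc n)" "a (Suc n) < 1" using a_range[of "Suc n"] by auto
  obtain y where "eventually (\<lambda>\<xi>. fan n m \<xi> = y) (at_left A)"
    using riemann_solution_locally_const[OF fan_solution[OF even]] unfolding locally_const_left_def by blast
  then obtain l0 where l0: "l0 < A" "\<And>\<xi>. l0 < \<xi> \<Longrightarrow> \<xi> < A \<Longrightarrow> fan n m \<xi> = y"
    unfolding eventually_at_left_field by blast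
  \<comment> \<open>Lower bounds for \<xi>: where the fan becomes constant, -q so as not to leave
    the strip of this fan, and the speeds in S below the sampled slope.\<close>
  define L where "L = insert l0 (insert (- q) {c \<in> S. c < A})"
  have L: "finite L" "L \<noteq> {}" using \<open>finite S\<close> by (auto simp: L_def)
  define l where "l = Max L"
  have Aq: "- q < A" "A < q" using a1 q_pos by (auto simp: A_def mult_less_cancel_right1)
      (use mult_strict_right_mono[of "-1" "a (Suc n)" q] in simp)
  have l: "l0 \<le> l" "- q \<le> l" "l < A" "\<And>c. c \<in> S \<Longrightarrow> c < A \<Longrightarrow> c \<le> l"
    using Max_ge[OF L(1)] Max_in[OF L] l0(1) Aq(1) unfolding l_def by (auto simp: L_def)
  have even': "even ((m - 1) + int (Suc n))" using even by simp
  have "Suc n \<ge> 1" by simp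
  from scheme_sampling[OF this] obtain g where g: "\<forall>y. ((\<lambda>t. uh (t, y)) \<longlongrightarrow> g y) (at_left (real (Suc n) * \<tau>))"
    "\<forall>m::int. even (m + int (Suc n)) \<longrightarrow> (\<forall>x\<in>{of_int m * h..<of_int (m + 2) * h}.
                (g \<longlongrightarrow> uh (real (Suc n) * \<tau>, x)) (at_left ((of_int m + 1 + a (Suc n)) * h)))"
    by (elim exE conjE)
  have gl: "(g \<longlongrightarrow> cell (Suc n) (m - 1)) (at_left ((of_int m + a (Suc n)) * h))"
  proof -
    have "(g \<longlongrightarrow> uh (real (Suc n) * \<tau>, of_int (m - 1) * h)) (at_left ((of_int (m - 1) + 1 + a (Suc n)) * h))"
      by (rule g(2)[rule_format, OF even']) (use h_pos in auto)
    then show ?thesis by (simp add: cell_def)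
  qed
  have gy: "g x = y" if x: "of_int m * h + l * \<tau> < x" "x < (of_int m + a (Suc n)) * h" for x
  proof -
    define \<xi> where "\<xi> = (x - of_int m * h) / \<tau>"
    have \<xi>: "l < \<xi>" "\<xi> < A" using x tau_pos h_eq by (auto simp: \<xi>_def A_def field_simps)
    have "((\<lambda>t. (x - of_int m * h) / (t - real n * \<tau>)) \<longlongrightarrow> (x - of_int m * h) / (real (Suc n) * \<tau> - real n * \<tau>)) (at_left (real (Suc n) * \<tau>))"
      using tau_pos by (intro tendsto_intros) (auto simp: algebra_simps)
    moreover have "real (Suc n) * \<tau> - real n * \<tau> = \<tau>" by (simp add: algebra_simps)
    ultimately have lim: "((\<lambda>t. (x - of_int m * h) / (t - real n * \<tau>)) \<longlongrightarrow> \<xi>) (at_left (real (Suc n) * \<tau>))"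
      by (simp add: \<xi>_def)
    have "real n * \<tau> < real (Suc n) * \<tau>" using tau_pos by simp
    then have "eventually (\<lambda>t. t \<in> {real n * \<tau><..<real (Suc n) * \<tau>}) (at_left (real (Suc n) * \<tau>))"
      by (intro eventually_at_leftI[of "real n * \<tau>"]) auto
    then have "eventually (\<lambda>t. uh (t, x) = y) (at_left (real (Suc n) * \<tau>))"
      using order_tendstoD(1)[OF lim \<xi>(1)] order_tendstoD(2)[OF lim \<xi>(2)]
    proof eventually_elim
      case (elim t)
      have "- q * \<tau> \<le> l * \<tau>" using l tau_pos by (intro mult_right_mono) auto
      then have "of_int m * h - h < x" using x h_eq by simp
      moreover have "x < of_int m * h + h"
      proof -
        have "a (Suc n) * h < 1 * h" using a1 h_pos by (intro mult_strict_right_mono) auto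
        then show ?thesis using x by (simp add: algebra_simps)
      qed
      ultimately have "uh (t, x) = fan n m ((x - of_int m * h) / (t - real n * \<tau>))"
        using elim by (intro strip_eq_fan even) (auto simp: algebra_simps)
      then show ?case using l0(2) elim l(1) by simp
    qed
    then have "((\<lambda>t. uh (t, x)) \<longlongrightarrow> y) (at_left (real (Suc n) * \<tau>))" by (rule tendsto_eventually)
    then show "g x = y" by (rule tendsto_unique_left[OF g(1)[rule_format]])
  qed
  have "of_int m * h + l * \<tau> < (of_int m + a (Suc n)) * h"
    using l(3) tau_pos h_eq by (simp add: A_def algebra_simps)
  then have "eventually (\<lambda>x. x \<in> {of_int m * h + l * \<tau><..<(of_int m + a (Suc n)) * h}) (at_left ((of_int m + a (Suc n)) * h))"
    by (intro eventually_at_leftI[of "of_int m * h + l * \<tau>"]) auto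
  then have "eventually (\<lambda>x. g x = y) (at_left ((of_int m + a (Suc n)) * h))"
    by eventually_elim (use gy in auto)
  then have "(g \<longlongrightarrow> y) (at_left ((of_int m + a (Suc n)) * h))" by (rule tendsto_eventually)
  then have cy: "cell (Suc n) (m - 1) = y" by (rule tendsto_unique_left[OF gl])
  define \<xi> where "\<xi> = (l + A) / 2"
  have \<xi>: "l < \<xi>" "\<xi> < A" using l(3) by (auto simp: \<xi>_def)
  show ?thesis
  proof (intro exI[of _ \<xi>] conjI ballI)
    show "cell (Suc n) (m - 1) = fan n m \<xi>" using cy l0(2)[of \<xi>] l(1) \<xi> by simp
    fix c assume c: "c \<in> S"
    show "\<xi> < c \<longleftrightarrow> a (Suc n) * q \<le> c" using \<xi> l(4)[OF c] unfolding A_def[symmetric] by linarith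
  qed
qed

lemma cell_phase: "even (m + int n) \<Longrightarrow> cell n m \<in> phase1 wM \<or> cell n m \<in> phase3 wm"
  by (rule riemann_solution_cases[OF fan_solution]) auto

lemma cell_right_phase3: "even (m + int n) \<Longrightarrow> cell n (m - 2) \<in> phase3 wm \<Longrightarrow> cell n m \<in> phase3 wm"
  by (rule riemann_solution_cases[OF fan_solution]) (auto dest: phases_disjoint)

lemma grid_point:
  obtains m :: int where "even (m + int n)" "x \<in> {of_int m * h..<of_int (m + 2) * h}"
proof -
  define k where "k = \<lfloor>x / h\<rfloor>"
  have k: "of_int k * h \<le> x" "x < of_int (k + 1) * h"
    using h_pos floor_divide_lower[of h x] floor_divide_upper[of h x] by (auto simp: k_def)
  have kk: "of_int (k + 1) * h \<le> of_int (k + 2) * h" "of_int (k - 1) * h \<le> of_int k * h"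
    using h_pos by (auto intro!: mult_right_mono)
  show ?thesis
  proof (cases "even (k + int n)")
    case True
    then show ?thesis using that[of k] k kk by auto
  next
    case False
    then have "even ((k - 1) + int n)" by simp
    moreover have "x < of_int ((k - 1) + 2) * h" using k(2) by (simp add: algebra_simps)
    ultimately show ?thesis using that[of "k - 1"] k kk by auto
  qed
qed

definition "is_boundary n b \<longleftrightarrow> even (b + int n) \<and> \<gamma>h (real n * \<tau>) = of_int b * h \<and>
   (\<forall>m. even (m + int n) \<longrightarrow> (m < b \<longrightarrow> cell n m \<in> phase1 wM) \<and> (b \<le> m \<longrightarrow> cell n m \<in> phase3 wm))"

text \<open>The level is constant on cells, so its phase jump sits at a grid point. No branch of the
  solver admits phase 3 on the left of phase 1, so phase 3 propagates to the right from there and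
  phase 1 to the left.\<close>

lemma ex_boundary: "\<exists>b. is_boundary n b"
proof -
  define x where "x = \<gamma>h (real n * \<tau>)"
  have "jump_13 wM wm (\<lambda>y. uh (real n * \<tau>, y)) x"
    using boundary tau_pos unfolding approx_phase_boundary_def x_def by simp
  then obtain ul ur where u: "ul \<in> phase1 wM" "ur \<in> phase3 wm"
    "((\<lambda>y. uh (real n * \<tau>, y)) \<longlongrightarrow> ul) (at_left x)" "((\<lambda>y. uh (real n * \<tau>, y)) \<longlongrightarrow> ur) (at_right x)"
    unfolding jump_13_def by blast
  obtain m where m: "even (m + int n)" "x \<in> {of_int m * h..<of_int (m + 2) * h}" by (rule grid_point)
  have "eventually (\<lambda>y. uh (real n * \<tau>, y) = cell n m) (at_right x)"
    by (rule eventually_at_rightI[of _ "of_int (m + 2) * h"]) (rule level_eq_cell, use m in auto)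
  then have ur: "ur = cell n m" by (intro tendsto_unique_right[OF u(4)] tendsto_eventually)
  have ul: "ul = cell n k" if "even (k + int n)" "of_int k * h < x" "x \<le> of_int (k + 2) * h" for k
  proof -
    have "eventually (\<lambda>y. uh (real n * \<tau>, y) = cell n k) (at_left x)"
      by (rule eventually_at_leftI[of "of_int k * h"]) (rule level_eq_cell, use that in auto)
    then show ?thesis by (intro tendsto_unique_left[OF u(3)] tendsto_eventually)
  qed
  \<comment> \<open>Inside a cell both one-sided limits would be the same state, but they lie in
    different phases.\<close>
  have xm: "x = of_int m * h"
  proof (rule ccontr)
    assume "x \<noteq> of_int m * h"
    then have "ul = cell n m" by (intro ul) (use m in auto)
    then show False using u ur phases_disjoint by blast
  qed
  have ul: "ul = cell n (m - 2)" by (rule ul) (use m(1) xm h_pos in auto)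
  have up: "cell n (m + 2 * int i) \<in> phase3 wm" for i
  proof (induction i)
    case 0 then show ?case using u ur by simp
  next
    case (Suc i)
    have "m + 2 * int (Suc i) - 2 = m + 2 * int i" by simp
    then show ?case using cell_right_phase3[of "m + 2 * int (Suc i)" n] Suc m(1) by simp
  qed
  have down: "cell n (m - 2 - 2 * int i) \<in> phase1 wM" for i
  proof (induction i)
    case 0 then show ?case using u ul by simp
  next
    case (Suc i)
    have "m - 2 - 2 * int i - 2 = m - 2 - 2 * int (Suc i)" by simp
    moreover have "even (m - 2 - 2 * int i + int n)" using m(1) by simp
    ultimately have "cell n (m - 2 - 2 * int (Suc i)) \<notin> phase3 wm"
      using cell_right_phase3[of "m - 2 - 2 * int i" n] Suc phases_disjoint by metis
    moreover have "even ((m - 2 - 2 * int (Suc i)) + int n)" using m(1) by simp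
    ultimately show ?case using cell_phase by blast
  qed
  have "is_boundary n m"
    unfolding is_boundary_def
  proof (intro conjI allI impI)
    show "even (m + int n)" by fact
    show "\<gamma>h (real n * \<tau>) = of_int m * h" using xm by (simp add: x_def)
    fix j assume j: "even (j + int n)"
    then have "even (j - m)" using m(1) by presburger
    then obtain i where i: "j - m = 2 * i" by (rule evenE)
    show "cell n j \<in> phase3 wm" if "m \<le> j"
    proof -
      have "j = m + 2 * int (nat i)" using i that by simp
      then show ?thesis using up[of "nat i"] by simp
    qed
    show "cell n j \<in> phase1 wM" if "j < m"
    proof -
      have "j = m - 2 - 2 * int (nat (- i - 1))" using i that by simp
      then show ?thesis using down[of "nat (- i - 1)"] by simp
    qed
  qed
  then show ?thesis by blast
qed

definition "b n = (SOME b. is_boundary n b)"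

lemma is_boundary_b: "is_boundary n (b n)"
  unfolding b_def using ex_boundary by (rule someI_ex)

lemma b_even: "even (b n + int n)" and \<gamma>h_grid: "\<gamma>h (real n * \<tau>) = of_int (b n) * h"
  and left_cell: "even (m + int n) \<Longrightarrow> m < b n \<Longrightarrow> cell n m \<in> phase1 wM"
  and right_cell: "even (m + int n) \<Longrightarrow> b n \<le> m \<Longrightarrow> cell n m \<in> phase3 wm"
  using is_boundary_b[of n] by (auto simp: is_boundary_def)

definition "boundary_data n = (SOME (V, um, up). boundary_fan (cell n (b n - 2)) (cell n (b n)) V um up (fan n (b n)))"
definition "V n = fst (boundary_data n)"
definition "um n = fst (snd (boundary_data n))"
definition "up n = snd (snd (boundary_data n))"

lemma boundary_fan_b: "boundary_fan (cell n (b n - 2)) (cell n (b n)) (V n) (um n) (up n) (fan n (b n))"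
proof -
  have l: "cell n (b n - 2) \<in> phase1 wM" and r: "cell n (b n) \<in> phase3 wm"
    using left_cell[of "b n - 2" n] right_cell[of "b n" n] b_even[of n] by auto
  have "\<exists>s ul ur. boundary_fan (cell n (b n - 2)) (cell n (b n)) s ul ur (fan n (b n))"
    by (rule riemann_solution_cases[OF fan_solution[OF b_even]]) (use l r phases_disjoint in blast)+
  then have "\<exists>d. case d of (s, ul, ur) \<Rightarrow> boundary_fan (cell n (b n - 2)) (cell n (b n)) s ul ur (fan n (b n))"
    by simp
  from someI_ex[OF this] show ?thesis
    unfolding boundary_data_def[symmetric] V_def um_def up_def by (simp add: case_prod_beta)
qed

lemma left_fan:
  assumes "even (m + int n)" "m < b n"
  shows "riemann_one_phase c1 (phase1 wM) (cell n (m - 2)) (cell n m) (fan n m)"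
  by (rule riemann_solution_cases[OF fan_solution[OF assms(1)]])
    (use left_cell[OF assms] phases_disjoint in blast)+

lemma right_fan:
  assumes "even (m + int n)" "b n < m"
  shows "riemann_one_phase c3 (phase3 wm) (cell n (m - 2)) (cell n m) (fan n m)"
proof -
  have e: "even ((m - 2) + int n)" using assms(1) by simp
  have "m \<noteq> b n + 1" using assms b_even[of n] by auto
  then have "b n \<le> m - 2" using assms by simp
  from right_cell[OF e this] have "cell n (m - 2) \<in> phase3 wm" .
  then show ?thesis
    by (rule_tac riemann_solution_cases[OF fan_solution[OF assms(1)]])
      (use phases_disjoint in blast)+
qed

lemma trace_b: "boundary_trace (V n) (um n) (up n)"
  and fan_b: "fan n (b n) = fan4 (- c1) (V n) c3 (cell n (b n - 2)) (um n) (up n) (cell n (b n))"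
  and inv_um: "riemann_inv c1 (um n) = riemann_inv c1 (cell n (b n - 2))"
  and inv_up: "riemann_inv (- c3) (up n) = riemann_inv (- c3) (cell n (b n))"
  and supersonic: "c3 \<le> V n \<Longrightarrow> up n = cell n (b n)"
  using boundary_fan_b[of n] unfolding boundary_fan_def by blast+

lemma V_bounds: "- c3 < V n" "V n < c1" and um_phase: "um n \<in> phase1 wM" and up_phase: "up n \<in> phase3 wm"
  using trace_b[of n] unfolding boundary_trace_def Let_def by blast+

lemma fan_b_phase:
  "\<xi> < V n \<Longrightarrow> fan n (b n) \<xi> \<in> phase1 wM" "V n \<le> \<xi> \<Longrightarrow> fan n (b n) \<xi> \<in> phase3 wm"
proof -
  have l: "cell n (b n - 2) \<in> phase1 wM" and r: "cell n (b n) \<in> phase3 wm"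
    using left_cell[of "b n - 2" n] right_cell[of "b n" n] b_even[of n] by auto
  show "\<xi> < V n \<Longrightarrow> fan n (b n) \<xi> \<in> phase1 wM" "V n \<le> \<xi> \<Longrightarrow> fan n (b n) \<xi> \<in> phase3 wm"
    using l r um_phase[of n] up_phase[of n] V_bounds[of n] c_pos by (auto simp: fan_b fan4_def)
qed

text \<open>\<open>\<gamma>h t\<close> is the only place with a jump from phase 1 to phase 3, so it
  suffices to find the one-sided limits \<open>um n\<close> and \<open>up n\<close> at the position
  predicted by the speed of the boundary fan.\<close>

lemma \<gamma>h_strip:
  assumes t: "real n * \<tau> < t" "t < real (Suc n) * \<tau>"
  shows "\<gamma>h t = of_int (b n) * h + V n * (t - real n * \<tau>)"
proof -
  define s where "s = t - real n * \<tau>"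
  have s: "s > 0" "s < \<tau>" using t by (auto simp: s_def algebra_simps)
  define x where "x = of_int (b n) * h + V n * s"
  have near: "\<bar>V n * s\<bar> < h"
  proof -
    have "\<bar>V n * s\<bar> \<le> c1 * \<tau>" unfolding abs_mult using V_bounds[of n] c_pos s by (intro mult_mono) auto
    then show ?thesis using CFL by (simp add: mult.commute)
  qed
  define d where "d = h - \<bar>V n * s\<bar>"
  have d: "d > 0" using near by (simp add: d_def)
  have u: "uh (t, y) = fan n (b n) ((y - of_int (b n) * h) / s)" if "\<bar>y - x\<bar> < d" for y
    unfolding s_def by (rule strip_eq_fan[OF b_even t]) (use that in \<open>auto simp: d_def x_def algebra_simps abs_if split: if_splits\<close>)
  have xi: "(y - of_int (b n) * h) / s = V n + (y - x) / s" for y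
    using s by (simp add: x_def field_simps)
  have l: "((\<lambda>y. uh (t, y)) \<longlongrightarrow> um n) (at_left x)"
  proof (rule tendsto_eventually)
    define e where "e = min d ((V n + c1) * s)"
    have "e > 0" using d s V_bounds[of n] c_pos by (simp add: e_def)
    then have "eventually (\<lambda>y. y \<in> {x - e<..<x}) (at_left x)" by (intro eventually_at_leftI[of "x - e"]) auto
    then show "eventually (\<lambda>y. uh (t, y) = um n) (at_left x)"
    proof eventually_elim
      case (elim y)
      then have "x - y < (V n + c1) * s" by (auto simp: e_def)
      then have "(y - x) / s > - (V n + c1)" "(y - x) / s < 0" using s elim by (auto simp: field_simps)
      moreover have "\<bar>y - x\<bar> < d" using elim by (auto simp: e_def)
      ultimately show ?case using u[of y] unfolding xi by (simp add: fan_b fan4_def)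
    qed
  qed
  have r: "((\<lambda>y. uh (t, y)) \<longlongrightarrow> up n) (at_right x)"
  proof (rule tendsto_eventually)
    \<comment> \<open>To the right the state \<open>up n\<close> extends up to the wave of speed c3
      if that is ahead; otherwise the last sector of the fan begins at once and carries the same
      state.\<close>
    define e where "e = (if V n < c3 then min d ((c3 - V n) * s) else d)"
    have "e > 0" using d s by (simp add: e_def)
    then have "eventually (\<lambda>y. y \<in> {x<..<x + e}) (at_right x)" by (intro eventually_at_rightI[of _ "x + e"]) auto
    then show "eventually (\<lambda>y. uh (t, y) = up n) (at_right x)"
    proof eventually_elim
      case (elim y)
      have ud: "\<bar>y - x\<bar> < d" and pos: "(y - x) / s \<ge> 0" using elim s by (auto simp: e_def split: if_splits)
      show ?case
      proof (cases "V n < c3")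
        case True
        then have "y - x < (c3 - V n) * s" using elim by (auto simp: e_def)
        then have "(y - x) / s < c3 - V n" using s by (simp add: field_simps)
        then show ?thesis using u[OF ud] pos V_bounds[of n] c_pos unfolding xi by (auto simp: fan_b fan4_def)
      next
        case False
        then show ?thesis using u[OF ud] pos V_bounds[of n] c_pos supersonic[of n] unfolding xi by (auto simp: fan_b fan4_def)
      qed
    qed
  qed
  have "0 \<le> t" using t tau_pos by (smt (verit) mult_nonneg_nonneg of_nat_0_le_iff)
  moreover have "jump_13 wM wm (\<lambda>y. uh (t, y)) x" unfolding jump_13_def using l r um_phase up_phase by blast
  ultimately have "x = \<gamma>h t" using boundary unfolding approx_phase_boundary_def by blast
  then show ?thesis by (simp add: x_def s_def)
qed

text \<open>The cell sampled from the boundary fan has the phase of the side on which the sample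
  falls. The next cells on either side come from one-phase fans, so the boundary moves by at most
  one cell, and parity excludes that it rests.\<close>

lemma b_Suc: "b (Suc n) = b n + (if a (Suc n) * q \<le> V n then 1 else -1)"
proof -
  have e: "even (b n + 2 + int n)" "even (b n - 2 + int n)" "even ((b n + 1) + int (Suc n))"
    "even ((b n - 1) + int (Suc n))" "even ((b n - 3) + int (Suc n))" using b_even[of n] by auto
  obtain \<xi> where \<xi>: "cell (Suc n) (b n - 1) = fan n (b n) \<xi>" "\<xi> < V n \<longleftrightarrow> a (Suc n) * q \<le> V n"
    using cell_sample[OF b_even, of "{V n}"] by auto
  obtain \<xi>' where "cell (Suc n) (b n + 2 - 1) = fan n (b n + 2) \<xi>'" using cell_sample[OF e(1), of "{}"] by auto
  then have r: "cell (Suc n) (b n + 1) \<in> phase3 wm"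
    using one_phase_fan(1)[OF right_fan[OF e(1)]] c_pos by (simp add: add.commute)
  obtain \<xi>'' where "cell (Suc n) (b n - 2 - 1) = fan n (b n - 2) \<xi>''" using cell_sample[OF e(2), of "{}"] by auto
  then have l: "cell (Suc n) (b n - 3) \<in> phase1 wM"
    using one_phase_fan(1)[OF left_fan[OF e(2)]] c_pos by simp
  have b1: "b (Suc n) \<le> b n + 1" by (rule ccontr) (use phases_disjoint[OF left_cell[OF e(3)] r] in simp)
  have b2: "b n - 3 < b (Suc n)" by (rule ccontr) (use phases_disjoint[OF l right_cell[OF e(5)]] in simp)
  have par: "even (b (Suc n) - b n - 1)" using b_even[of n] b_even[of "Suc n"] by presburger
  show ?thesis
  proof (cases "a (Suc n) * q \<le> V n")
    case True
    then have "cell (Suc n) (b n - 1) \<in> phase1 wM" using \<xi> fan_b_phase(1) by simp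
    then have c: "cell (Suc n) (b n - 1) \<in> phase1 wM" .
    have "b n - 1 < b (Suc n)" by (rule ccontr) (use phases_disjoint[OF c right_cell[OF e(4)]] in simp)
    then have "b (Suc n) = b n \<or> b (Suc n) = b n + 1" using b1 by auto
    then show ?thesis using True par by auto
  next
    case False
    then have "cell (Suc n) (b n - 1) \<in> phase3 wm" using \<xi> fan_b_phase(2)[of n \<xi>] by simp
    then have c: "cell (Suc n) (b n - 1) \<in> phase3 wm" .
    have "b (Suc n) \<le> b n - 1" by (rule ccontr) (use phases_disjoint[OF left_cell[OF e(4)] c] in simp)
    then have "b (Suc n) = b n - 2 \<or> b (Suc n) = b n - 1" using b2 by auto
    then show ?thesis using False par by auto
  qed
qed

text \<open>Away from the boundary Q has a single jump in each fan, at the speed c. In the boundary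
  fan a part F of the jump sits at V instead of c, which the difference of the two step functions
  expresses.\<close>

definition "tracked Q c F \<longleftrightarrow>
  (\<forall>n m \<xi>. even (m + int n) \<longrightarrow>
     Q (fan n m \<xi>) = (if \<xi> < c then Q (cell n (m - 2)) else Q (cell n m))
       + (if m = b n then F n * ((if \<xi> < V n then 1 else 0) - (if \<xi> < c then 1 else 0)) else (0 :: real)))"

definition "shift c n = (if a (Suc n) * q \<le> c then 1 else -1 :: int)"

lemma grid_less_iff:
  assumes x: "x \<in> {of_int m * h..<of_int (m + 2) * h}" and "even (k - m)"
  shows "x < of_int k * h \<longleftrightarrow> m < k"
proof
  assume "x < of_int k * h"
  then have "of_int m * h < of_int k * h" using x by auto
  then show "m < k" using h_pos by simp
next
  assume "m < k"
  then have "m + 2 \<le> k" using assms(2) by presburger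
  then have "of_int (m + 2) * h \<le> of_int k * h" using h_pos by (intro mult_right_mono) auto
  then show "x < of_int k * h" using x by auto
qed

text \<open>Sampling turns comparisons of slopes into shifts by whole cells: what jumps at speed c
  is moved by \<open>shift c n\<close> cells, while the part F jumps at the new boundary. The
  correction is supported between these two positions.\<close>

lemma tracked_Suc:
  assumes tr: "tracked Q c F"
  shows "Q (uh (real (Suc n) * \<tau>, x)) = Q (uh (real n * \<tau>, x - of_int (shift c n) * h))
    + F n * ((if x < of_int (b (Suc n)) * h then 1 else 0) - (if x < of_int (b n + shift c n) * h then 1 else 0))"
proof -
  obtain m' where m': "even (m' + int (Suc n))" "x \<in> {of_int m' * h..<of_int (m' + 2) * h}" by (rule grid_point)
  define m where "m = m' + 1"
  have e: "even (m + int n)" using m'(1) by (simp add: m_def)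
  obtain \<xi> where \<xi>: "cell (Suc n) (m - 1) = fan n m \<xi>" "\<xi> < V n \<longleftrightarrow> a (Suc n) * q \<le> V n" "\<xi> < c \<longleftrightarrow> a (Suc n) * q \<le> c"
    using cell_sample[OF e, of "{V n, c}"] by auto
  have "uh (real (Suc n) * \<tau>, x) = cell (Suc n) (m - 1)" using level_eq_cell[OF m'] by (simp add: m_def)
  then have 1: "Q (uh (real (Suc n) * \<tau>, x)) = (if a (Suc n) * q \<le> c then Q (cell n (m - 2)) else Q (cell n m))
       + (if m = b n then F n * ((if a (Suc n) * q \<le> V n then 1 else 0) - (if a (Suc n) * q \<le> c then 1 else 0)) else 0)"
    using tr e unfolding tracked_def \<xi>(2,3)[symmetric] \<xi>(1) by simp
  have 2: "Q (uh (real n * \<tau>, x - of_int (shift c n) * h)) = (if a (Suc n) * q \<le> c then Q (cell n (m - 2)) else Q (cell n m))"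
  proof -
    have "uh (real n * \<tau>, x - of_int (shift c n) * h) = cell n (m' - shift c n)"
    proof (rule level_eq_cell)
      show "even (m' - shift c n + int n)" using m'(1) by (auto simp: shift_def)
      show "x - of_int (shift c n) * h \<in> {of_int (m' - shift c n) * h..<of_int (m' - shift c n + 2) * h}"
        using m'(2) by (auto simp: algebra_simps)
    qed
    then show ?thesis by (simp add: shift_def m_def)
  qed
  have l1: "x < of_int (b (Suc n)) * h \<longleftrightarrow> m' < b (Suc n)" by (rule grid_less_iff[OF m'(2)]) (use m'(1) b_even[of "Suc n"] in presburger)
  have l2: "x < of_int (b n + shift c n) * h \<longleftrightarrow> m' < b n + shift c n"
    by (rule grid_less_iff[OF m'(2)]) (use m'(1) b_even[of n] in \<open>auto simp: shift_def\<close>)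
  \<comment> \<open>By parity the cell either comes from the boundary fan or is at least two cells
    away from it; in the latter case both step functions agree.\<close>
  have par: "m' + 1 = b n \<or> m' + 1 \<le> b n - 2 \<or> m' + 1 \<ge> b n + 2"
    using e b_even[of n] unfolding m_def by presburger
  show ?thesis unfolding 1 2 l1 l2 unfolding b_Suc using par by (auto simp: m_def shift_def)
qed

text \<open>Between grid times a one-phase fan carries Q exactly at speed c. By the mesh condition a
  characteristic followed back to the last grid time stays within the two cells that feed the fan;
  points within h of the boundary's grid position are left out.\<close>

lemma tracked_strip:
  assumes tr: "tracked Q c F" and c: "\<bar>c\<bar> \<le> c1"
    and t: "real n * \<tau> < t" "t < real (Suc n) * \<tau>" and x: "\<bar>x - of_int (b n) * h\<bar> > h"
  shows "Q (uh (t, x)) = Q (uh (real n * \<tau>, x - c * (t - real n * \<tau>)))"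
proof -
  define s where "s = t - real n * \<tau>"
  have s: "s > 0" "s < \<tau>" using t by (auto simp: s_def algebra_simps)
  obtain m' where m': "even (m' + int (Suc n))" "x \<in> {of_int m' * h..<of_int (m' + 2) * h}" by (rule grid_point)
  define m where "m = m' + 1"
  have e: "even (m + int n)" "even ((m - 2) + int n)" using m'(1) by (auto simp: m_def)
  have x1: "of_int (m - 1) * h \<le> x" "x < of_int (m + 1) * h" using m'(2) by (auto simp: m_def add.assoc)
  have mb: "m \<noteq> b n" using x x1 by (auto simp: algebra_simps abs_if split: if_splits)
  define \<xi> where "\<xi> = (x - of_int m * h) / s"
  have "uh (t, x) = fan n m \<xi>" unfolding \<xi>_def s_def by (rule strip_eq_fan[OF e(1) t x1])
  then have 1: "Q (uh (t, x)) = (if \<xi> < c then Q (cell n (m - 2)) else Q (cell n m))"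
    using tr e(1) mb unfolding tracked_def by simp
  have cs: "\<bar>c * s\<bar> < h"
  proof -
    have "\<bar>c * s\<bar> \<le> c1 * \<tau>" unfolding abs_mult using c s c_pos by (intro mult_mono) auto
    then show ?thesis using CFL by (simp add: mult.commute)
  qed
  have xc: "\<xi> < c \<longleftrightarrow> x - c * s < of_int m * h" using s by (auto simp: \<xi>_def field_simps)
  have "uh (real n * \<tau>, x - c * s) = (if \<xi> < c then cell n (m - 2) else cell n m)"
  proof (cases "\<xi> < c")
    case True
    have "uh (real n * \<tau>, x - c * s) = cell n (m - 2)"
      by (rule level_eq_cell[OF e(2)]) (use True xc x1 cs in \<open>auto simp: algebra_simps abs_if split: if_splits\<close>)
    then show ?thesis using True by simp
  next
    case False
    have "uh (real n * \<tau>, x - c * s) = cell n m"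
      by (rule level_eq_cell[OF e(1)]) (use False xc x1 cs in \<open>auto simp: algebra_simps abs_if split: if_splits\<close>)
    then show ?thesis using False by simp
  qed
  then show ?thesis unfolding 1 s_def[symmetric] by simp
qed

end

section \<open>Quadratic quantities carried by the waves\<close>

context phase_model
begin

definition "K0 = K * wM * wm"
definition "QL c u = (if snd u < wc then (riemann_inv c u)\<^sup>2 else 0)"
text \<open>The entropy in phase 3 is a quarter of the sum of the two squares plus K0, whence 2 K0
  for each of the two summands.\<close>

definition "QR c u = (if snd u < wc then 0 else (riemann_inv c u)\<^sup>2 + 2 * K0)"

lemma K0_pos: "0 < K0" using K_pos wM_pos wMm by (simp add: K0_def)

lemma Q_phase:
  "u \<in> phase1 wM \<Longrightarrow> QL c u = (riemann_inv c u)\<^sup>2" "u \<in> phase1 wM \<Longrightarrow> QR c u = 0"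
  "u \<in> phase3 wm \<Longrightarrow> QL c u = 0" "u \<in> phase3 wm \<Longrightarrow> QR c u = (riemann_inv c u)\<^sup>2 + 2 * K0"
  by (simp_all add: QL_def QR_def phase_wc)

end

context glimm
begin

lemma fan_inv_left:
  assumes "even (m + int n)" "m < b n"
  shows "fan n m \<xi> \<in> phase1 wM" "riemann_inv c1 (fan n m \<xi>) = riemann_inv c1 (if \<xi> < c1 then cell n (m - 2) else cell n m)"
   "riemann_inv (- c1) (fan n m \<xi>) = riemann_inv (- c1) (if \<xi> < - c1 then cell n (m - 2) else cell n m)"
  using one_phase_fan[OF left_fan[OF assms]] c_pos by auto

lemma fan_inv_right:
  assumes "even (m + int n)" "b n < m"
  shows "fan n m \<xi> \<in> phase3 wm" "riemann_inv c3 (fan n m \<xi>) = riemann_inv c3 (if \<xi> < c3 then cell n (m - 2) else cell n m)"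
   "riemann_inv (- c3) (fan n m \<xi>) = riemann_inv (- c3) (if \<xi> < - c3 then cell n (m - 2) else cell n m)"
  using one_phase_fan[OF right_fan[OF assms]] c_pos by auto

lemma cells_left:
  assumes "even (m + int n)" "m < b n"
  shows "cell n (m - 2) \<in> phase1 wM" "cell n m \<in> phase1 wM"
  using left_cell[of "m - 2" n] left_cell[of m n] assms by auto

lemma cells_right:
  assumes "even (m + int n)" "b n < m"
  shows "cell n (m - 2) \<in> phase3 wm" "cell n m \<in> phase3 wm"
proof -
  have "m \<noteq> b n + 1" using assms b_even[of n] by auto
  then show "cell n (m - 2) \<in> phase3 wm" "cell n m \<in> phase3 wm"
    using right_cell[of "m - 2" n] right_cell[of m n] assms by auto
qed

lemma cells_boundary: "cell n (b n - 2) \<in> phase1 wM" "cell n (b n) \<in> phase3 wm"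
  using left_cell[of "b n - 2" n] right_cell[of "b n" n] b_even[of n] by auto

lemma tracked_cases:
  assumes "\<And>n m \<xi>. even (m + int n) \<Longrightarrow> m < b n \<Longrightarrow> Q (fan n m \<xi>) = (if \<xi> < c then Q (cell n (m - 2)) else Q (cell n m))"
    and "\<And>n m \<xi>. even (m + int n) \<Longrightarrow> b n < m \<Longrightarrow> Q (fan n m \<xi>) = (if \<xi> < c then Q (cell n (m - 2)) else Q (cell n m))"
    and "\<And>n \<xi>. Q (fan n (b n) \<xi>) = (if \<xi> < c then Q (cell n (b n - 2)) else Q (cell n (b n)))
       + F n * ((if \<xi> < V n then 1 else 0) - (if \<xi> < c then 1 else 0))"
  shows "tracked Q c F"
  unfolding tracked_def
proof (intro allI impI)
  fix n m \<xi> assume e: "even (m + int n)"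
  consider "m < b n" | "m = b n" | "b n < m" by linarith
  then show "Q (fan n m \<xi>) = (if \<xi> < c then Q (cell n (m - 2)) else Q (cell n m))
       + (if m = b n then F n * ((if \<xi> < V n then 1 else 0) - (if \<xi> < c then 1 else 0)) else 0)"
  proof cases
    case 1 then show ?thesis using assms(1)[OF e] by simp
  next
    case 2 then show ?thesis using assms(3) by simp
  next
    case 3 then show ?thesis using assms(2)[OF e] by simp
  qed
qed

text \<open>Across the boundary the quantity drops from its value at \<open>um n\<close> to 0, which
  is the amplitude. The left-going wave of speed -c1 does not show because \<open>um n\<close> has
  the same incoming invariant as the data on its left.\<close>

lemma tracked_L_in: "tracked (QL c1) c1 (\<lambda>n. (riemann_inv c1 (um n))\<^sup>2)"
proof (rule tracked_cases)
  fix n \<xi>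
  show "QL c1 (fan n (b n) \<xi>) = (if \<xi> < c1 then QL c1 (cell n (b n - 2)) else QL c1 (cell n (b n)))
       + (riemann_inv c1 (um n))\<^sup>2 * ((if \<xi> < V n then 1 else 0) - (if \<xi> < c1 then 1 else 0))"
    using V_bounds[of n] c_pos cells_boundary[of n] um_phase[of n] up_phase[of n]
    unfolding fan_b fan4_def by (auto simp: Q_phase inv_um)
qed (auto simp: Q_phase fan_inv_left fan_inv_right cells_left cells_right)

lemma tracked_L_out: "tracked (QL (- c1)) (- c1) (\<lambda>n. (riemann_inv (- c1) (um n))\<^sup>2)"
proof (rule tracked_cases)
  fix n \<xi>
  show "QL (- c1) (fan n (b n) \<xi>) = (if \<xi> < - c1 then QL (- c1) (cell n (b n - 2)) else QL (- c1) (cell n (b n)))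
       + (riemann_inv (- c1) (um n))\<^sup>2 * ((if \<xi> < V n then 1 else 0) - (if \<xi> < - c1 then 1 else 0))"
    using V_bounds[of n] c_pos cells_boundary[of n] um_phase[of n] up_phase[of n]
    unfolding fan_b fan4_def by (auto simp: Q_phase)
qed (auto simp: Q_phase fan_inv_left fan_inv_right cells_left cells_right)

text \<open>Now the quantity is 0 on the left of the boundary and jumps up to its value at
  \<open>up n\<close>, hence the negative amplitude.\<close>

lemma tracked_R_in: "tracked (QR (- c3)) (- c3) (\<lambda>n. - ((riemann_inv (- c3) (up n))\<^sup>2 + 2 * K0))"
proof (rule tracked_cases)
  fix n \<xi>
  show "QR (- c3) (fan n (b n) \<xi>) = (if \<xi> < - c3 then QR (- c3) (cell n (b n - 2)) else QR (- c3) (cell n (b n)))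
       + - ((riemann_inv (- c3) (up n))\<^sup>2 + 2 * K0) * ((if \<xi> < V n then 1 else 0) - (if \<xi> < - c3 then 1 else 0))"
    using V_bounds[of n] c_pos cells_boundary[of n] um_phase[of n] up_phase[of n]
    unfolding fan_b fan4_def by (auto simp: Q_phase inv_up)
qed (auto simp: Q_phase fan_inv_left fan_inv_right cells_left cells_right)

text \<open>This is the one family whose speed may lie on either side of V. For c3 \<le> V there is
  no outgoing wave, and the formula still holds because \<open>up n\<close> is then the right
  data.\<close>

lemma tracked_R_out: "tracked (QR c3) c3 (\<lambda>n. - ((riemann_inv c3 (up n))\<^sup>2 + 2 * K0))"
proof (rule tracked_cases)
  fix n \<xi>
  show "QR c3 (fan n (b n) \<xi>) = (if \<xi> < c3 then QR c3 (cell n (b n - 2)) else QR c3 (cell n (b n)))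
       + - ((riemann_inv c3 (up n))\<^sup>2 + 2 * K0) * ((if \<xi> < V n then 1 else 0) - (if \<xi> < c3 then 1 else 0))"
    using V_bounds[of n] c_pos cells_boundary[of n] um_phase[of n] up_phase[of n] supersonic[of n]
    unfolding fan_b fan4_def by (auto simp: Q_phase)
qed (auto simp: Q_phase fan_inv_left fan_inv_right cells_left cells_right)

end

section \<open>Bounds on the traces from the dissipation function\<close>

context phase_model
begin

abbreviation "D \<equiv> {- c3<..c3} - {0}"

lemma dissip_facts:
  shows dissip_diff: "V \<in> D \<Longrightarrow> \<phi> differentiable (at V within D)"
    and dissip_lim: "(\<phi> \<longlongrightarrow> psi_upper k1 k3 wM wm c3) (at_left c3)"
    and dissip_bot: "filterlim \<phi> at_bot (at_right (- c3))"
    and dissip_mono: "mono_on {- c3<..c3} \<phi>"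
    and dissip_pos: "V \<in> {0..c3} \<Longrightarrow> 0 \<le> \<phi> V \<and> \<phi> V \<le> psi_upper k1 k3 wM wm V"
  using dissip unfolding dissipation_function_def Let_def c3_def by blast+

lemma dissip_continuous: "V \<in> D \<Longrightarrow> continuous (at V within D) \<phi>"
  using differentiable_imp_continuous_within[OF dissip_diff] .

lemma c3_in_D: "c3 \<in> D" using c_pos by auto

lemma at_c3_D: "at c3 within D = at_left c3"
proof -
  have "at c3 within D = at c3 within {..<c3}"
  proof (rule at_within_nhd[of _ "{0<..<c3 + 1}"])
    show "c3 \<in> {0<..<c3 + 1}" using c_pos by auto
    show "D \<inter> {0<..<c3 + 1} - {c3} = {..<c3} \<inter> {0<..<c3 + 1} - {c3}" using c_pos by auto
  qed auto
  then show ?thesis by simp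
qed

text \<open>Relative differentiability at c3 is left differentiability and gives left continuity; in
  the prescribed limit the term with k3 - c3^2 vanishes.\<close>

lemma phi_c3: "\<phi> c3 = K0"
proof -
  have "(\<phi> \<longlongrightarrow> \<phi> c3) (at_left c3)"
    using dissip_continuous[OF c3_in_D] unfolding at_c3_D continuous_within .
  then have "\<phi> c3 = psi_upper k1 k3 wM wm c3"
    using tendsto_unique[OF _ _ dissip_lim] by simp
  then show ?thesis using c_pos by (simp add: psi_upper_def K0_def K_def algebra_simps)
qed

text \<open>Near c3 this is left differentiability with \<phi>(c3) = K0, farther away it is \<phi>
  \<ge> 0. It controls the trace w+ when its linear relation degenerates at V = c3.\<close>

lemma dissip_quotient_bounded: "\<exists>C\<ge>0. \<forall>V. 0 < V \<and> V < c3 \<longrightarrow> K0 - \<phi> V \<le> C * (c3 - V)"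
proof -
  obtain d where "(\<phi> has_real_derivative d) (at c3 within D)"
    using dissip_diff[OF c3_in_D] unfolding real_differentiable_def by blast
  then have "((\<lambda>V. (\<phi> V - \<phi> c3) / (V - c3)) \<longlongrightarrow> d) (at_left c3)"
    unfolding has_field_derivative_iff at_c3_D .
  then have "eventually (\<lambda>V. dist ((\<phi> V - \<phi> c3) / (V - c3)) d < 1) (at_left c3)"
    by (rule tendstoD) simp
  then obtain e where e: "e < c3" "\<And>V. e < V \<Longrightarrow> V < c3 \<Longrightarrow> dist ((\<phi> V - \<phi> c3) / (V - c3)) d < 1"
    unfolding eventually_at_left_field by blast
  \<comment> \<open>The first entry serves V above e, where the difference quotient is within 1 of
    the derivative. The second serves V \<le> e, where K0 - \<phi> V \<le> K0 and c3 - V \<ge> c3 -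
    e.\<close>
  define C where "C = max (\<bar>d\<bar> + 1) (K0 / (c3 - e))"
  have C0: "C \<ge> 0" by (simp add: C_def)
  have "K0 - \<phi> V \<le> C * (c3 - V)" if V: "0 < V" "V < c3" for V
  proof (cases "e < V")
    case True
    have "\<bar>(\<phi> V - \<phi> c3) / (V - c3)\<bar> \<le> \<bar>d\<bar> + 1" using e(2)[OF True V(2)] unfolding dist_real_def by linarith
    then have "\<bar>(\<phi> V - \<phi> c3) / (V - c3)\<bar> \<le> C" by (simp add: C_def le_max_iff_disj)
    then have "\<bar>\<phi> V - \<phi> c3\<bar> \<le> C * \<bar>V - c3\<bar>" using V by (simp add: divide_simps)
    then show ?thesis using V phi_c3 by (simp add: abs_if split: if_splits)
  next
    case False
    have "K0 - \<phi> V \<le> K0" using dissip_pos[of V] V by auto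
    also have "\<dots> = K0 / (c3 - e) * (c3 - e)" using e by simp
    also have "\<dots> \<le> C * (c3 - V)" using False e V K0_pos by (intro mult_mono) (auto simp: C_def)
    finally show ?thesis .
  qed
  then show ?thesis using C0 by blast
qed

text \<open>For V \<le> 0 the relation (c3 - V) w+ = (c1 - V) z bounds w+ directly, the ratio of
  coefficients being at most c1 / c3. For V > 0 the kinetic relation supplies a second factor c3 - V
  which cancels the degenerate one.\<close>

lemma trace_right_bound: "\<exists>W. \<forall>V um up. boundary_trace V um up \<and> V < c3 \<and>
   \<bar>riemann_inv c1 um\<bar> \<le> A \<and> \<bar>riemann_inv (- c3) up\<bar> \<le> A \<longrightarrow> snd up \<le> W"
proof -
  obtain C where C: "C \<ge> 0" "\<And>V. 0 < V \<Longrightarrow> V < c3 \<Longrightarrow> K0 - \<phi> V \<le> C * (c3 - V)"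
    using dissip_quotient_bounded by blast
  define Z where "Z = 2 * A / (c1 + c3)"
  define B where "B = c1\<^sup>2 * (C / K) / c3"
  have "snd up \<le> max (c1 * Z / c3) (1 + B)"
    if tr: "boundary_trace V um up" and Vc: "V < c3" and iA: "\<bar>riemann_inv c1 um\<bar> \<le> A" "\<bar>riemann_inv (- c3) up\<bar> \<le> A" for V um up
  proof -
    define z where "z = (riemann_inv (- c3) up - riemann_inv c1 um) / (c1 + c3)"
    define x y where "x = snd um" and "y = snd up"
    have t: "- c3 < V" "(c1 + V) * x = (c3 + V) * z" "(c3 - V) * y = (c1 - V) * z"
      "phi_value \<phi> V (K * (wM * wm - x * y))" "y \<ge> wm"
      using tr Vc unfolding boundary_trace_def Let_def z_def x_def y_def phase3_def by auto
    have zZ: "z \<le> Z" using iA c_pos unfolding z_def Z_def by (intro divide_right_mono) auto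
    show ?thesis
    proof (cases "V \<le> 0")
      case True
      have "c3 * ((c3 - V) * y) \<le> (c3 * (c1 - V)) * Z"
        unfolding t(3) using zZ c_pos True by (simp add: mult_left_mono mult.assoc)
      also have "\<dots> \<le> (c1 * (c3 - V)) * Z"
      proof (rule mult_right_mono)
        have "(c1 - c3) * V \<le> 0" using True c_pos by (intro mult_nonneg_nonpos) auto
        then show "c3 * (c1 - V) \<le> c1 * (c3 - V)" by (simp add: algebra_simps)
        have "A \<ge> 0" using iA by linarith
        then show "0 \<le> Z" using c_pos by (simp add: Z_def)
      qed
      finally have "(c3 - V) * (c3 * y) \<le> (c3 - V) * (c1 * Z)" by (simp add: algebra_simps)
      then have "c3 * y \<le> c1 * Z" using True c_pos by (simp add: mult_le_cancel_left)
      then have "y \<le> c1 * Z / c3" using c_pos by (simp add: pos_le_divide_eq mult.commute)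
      then show ?thesis by (simp add: y_def le_max_iff_disj)
    next
      case False
      then have V: "0 < V" by simp
      have "K * (wM * wm - x * y) = \<phi> V" using t(4) V by (simp add: phi_value_def)
      then have xy: "K * (x * y) = K0 - \<phi> V" by (simp add: K0_def algebra_simps)
      \<comment> \<open>Eliminating z and multiplying by K w+ turns the product w- w+ into (K0 -
        \<phi> V) / K. Both sides then carry the factor c3 - V, and what remains is a bound on the
        square of w+.\<close>
      have "(c3 + V) * ((c3 - V) * y) = (c1 - V) * ((c1 + V) * x)" unfolding t(2,3) by (simp add: algebra_simps)
      then have "(c3 + V) * ((c3 - V) * y) * (K * y) = (c1 - V) * ((c1 + V) * x) * (K * y)" by simp
      then have "(c3 - V) * ((c3 + V) * y\<^sup>2 * K) = (c1\<^sup>2 - V\<^sup>2) * (K * (x * y))"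
        by (simp add: power2_eq_square algebra_simps)
      also have "\<dots> \<le> c1\<^sup>2 * (C * (c3 - V))" unfolding xy
      proof (rule mult_mono)
        show "0 \<le> K0 - \<phi> V" using mono_onD[OF dissip_mono, of V c3] V Vc phi_c3 c_pos by simp
      qed (use C(2)[OF V Vc] in auto)
      finally have "(c3 - V) * ((c3 + V) * y\<^sup>2 * K) \<le> (c3 - V) * (c1\<^sup>2 * C)" by (simp add: algebra_simps)
      then have "(c3 + V) * y\<^sup>2 * K \<le> c1\<^sup>2 * C" using Vc by (simp add: mult_le_cancel_left)
      moreover have "c3 * y\<^sup>2 * K \<le> (c3 + V) * y\<^sup>2 * K" using V K_pos by (intro mult_right_mono) auto
      ultimately have "c3 * y\<^sup>2 * K \<le> c1\<^sup>2 * C" by linarith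
      then have yB: "y\<^sup>2 \<le> B" using c_pos K_pos by (simp add: B_def field_simps)
      have "y \<le> 1 + y\<^sup>2" using zero_le_power2[of "y - 1"] t(5) wM_pos wMm by (simp add: power2_eq_square algebra_simps)
      then show ?thesis using yB by (simp add: y_def)
    qed
  qed
  then show ?thesis by blast
qed

end

section \<open>History of the incoming invariants and uniform bounds\<close>

context glimm
begin

definition "drift c n = (\<Sum>k<n. shift c k)"

lemma drift_simps: "drift c 0 = 0" "drift c (Suc n) = drift c n + shift c n"
  by (simp_all add: drift_def)

lemma even_drift: "even (drift c n + int n)"
  by (induction n) (auto simp: drift_simps shift_def)

text \<open>Since V < c1, a sampled characteristic of speed c1 followed backwards stays to the left
  of the boundary: if a cell was just gained by phase 1, its sample lay below V and hence below c1,
  so its invariant comes from a cell on the left.\<close>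

lemma history_left:
  "even (m + int n) \<Longrightarrow> m < b n \<Longrightarrow>
    m - drift c1 n < b 0 \<and> riemann_inv c1 (cell n m) = riemann_inv c1 (cell 0 (m - drift c1 n))"
proof (induction n arbitrary: m)
  case (Suc n)
  have e: "even (m + 1 + int n)" using Suc.prems by simp
  obtain \<xi> where \<xi>: "cell (Suc n) m = fan n (m + 1) \<xi>" "\<xi> < V n \<longleftrightarrow> a (Suc n) * q \<le> V n" "\<xi> < c1 \<longleftrightarrow> a (Suc n) * q \<le> c1"
    using cell_sample[OF e, of "{V n, c1}"] by auto
  have "m - shift c1 n < b n \<and> riemann_inv c1 (cell (Suc n) m) = riemann_inv c1 (cell n (m - shift c1 n))"
  proof (cases "m + 1 = b n")
    case True
    then have "a (Suc n) * q \<le> V n" using Suc.prems(2) b_Suc[of n] by (auto split: if_splits)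
    then have "a (Suc n) * q \<le> c1" "\<xi> < V n" "m = b n - 1" using V_bounds[of n] \<xi>(2) True by auto
    then show ?thesis using \<xi>(1) inv_um[of n] by (simp add: shift_def fan_b fan4_def)
  next
    case False
    have "even (b n - (m + 1))" using e b_even[of n] by presburger
    moreover have "b (Suc n) \<le> b n + 1" using b_Suc[of n] by simp
    ultimately have m: "m + 1 < b n" using Suc.prems(2) False by presburger
    then show ?thesis using fan_inv_left(2)[OF e m, of \<xi>] \<xi> by (auto simp: shift_def add.commute)
  qed
  moreover have "even (m - shift c1 n + int n)" using Suc.prems by (auto simp: shift_def)
  ultimately show ?case using Suc.IH[of "m - shift c1 n"] by (simp add: drift_simps algebra_simps)
qed (simp add: drift_simps)

text \<open>The mirror image, resting on -c3 < V: a cell just gained by phase 3 has its sample above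
  V, hence above -c3, and its characteristic leads to the right.\<close>

lemma history_right:
  "even (m + int n) \<Longrightarrow> b n \<le> m \<Longrightarrow>
    b 0 \<le> m - drift (- c3) n \<and> riemann_inv (- c3) (cell n m) = riemann_inv (- c3) (cell 0 (m - drift (- c3) n))"
proof (induction n arbitrary: m)
  case (Suc n)
  have e: "even (m + 1 + int n)" using Suc.prems by simp
  obtain \<xi> where \<xi>: "cell (Suc n) m = fan n (m + 1) \<xi>" "\<xi> < V n \<longleftrightarrow> a (Suc n) * q \<le> V n" "\<xi> < - c3 \<longleftrightarrow> a (Suc n) * q \<le> - c3"
    using cell_sample[OF e, of "{V n, - c3}"] by auto
  have "b n \<le> m - shift (- c3) n \<and> riemann_inv (- c3) (cell (Suc n) m) = riemann_inv (- c3) (cell n (m - shift (- c3) n))"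
  proof (cases "m + 1 = b n")
    case True
    then have "\<not> a (Suc n) * q \<le> V n" using Suc.prems(2) b_Suc[of n] by (auto split: if_splits)
    then have "\<not> a (Suc n) * q \<le> - c3" "\<not> \<xi> < V n" "m = b n - 1" using V_bounds[of n] \<xi>(2) True by auto
    then show ?thesis using \<xi>(1) inv_up[of n] V_bounds[of n] c_pos by (auto simp: shift_def fan_b fan4_def)
  next
    case False
    have "even (b n - (m + 1))" using e b_even[of n] by presburger
    moreover have "b n - 1 \<le> b (Suc n)" using b_Suc[of n] by simp
    ultimately have "b n + 2 \<le> m + 1" using Suc.prems(2) False by presburger
    then show ?thesis using fan_inv_right(3)[OF e, of \<xi>] \<xi> by (auto simp: shift_def add.commute)
  qed
  moreover have "even (m - shift (- c3) n + int n)" using Suc.prems by (auto simp: shift_def)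
  ultimately show ?case using Suc.IH[of "m - shift (- c3) n"] by (simp add: drift_simps algebra_simps)
qed (simp add: drift_simps)

lemma cell_0:
  assumes "even m"
  shows "cell 0 m = average (of_int m * h) (of_int (m + 2) * h) u0"
proof -
  have "of_int (m + 2) * h - of_int m * h = 2 * h" by (simp add: algebra_simps)
  moreover have "uh (0, of_int m * h) = (1 / (2 * h)) *\<^sub>R (LINT y:{of_int m * h..of_int (m + 2) * h}|lebesgue. u0 y)"
    by (rule scheme_initial[OF assms]) (use h_pos in auto)
  ultimately show ?thesis by (simp add: cell_def average_def)
qed

lemma trace_left_incoming:
  "riemann_inv c1 (um n) = riemann_inv c1 (cell 0 (b n - drift c1 n - 2))"
  "b n - drift c1 n \<le> b 0" "even (b n - drift c1 n)"
proof -
  show e: "even (b n - drift c1 n)" using b_even[of n] even_drift[of c1 n] by presburger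
  have H: "b n - 2 - drift c1 n < b 0 \<and> riemann_inv c1 (cell n (b n - 2)) = riemann_inv c1 (cell 0 (b n - 2 - drift c1 n))"
    by (rule history_left) (use b_even[of n] in auto)
  show "b n - drift c1 n \<le> b 0" using conjunct1[OF H] e b_even[of 0, simplified] by presburger
  show "riemann_inv c1 (um n) = riemann_inv c1 (cell 0 (b n - drift c1 n - 2))"
    using H unfolding inv_um by (simp add: algebra_simps)
qed

lemma trace_right_incoming:
  "riemann_inv (- c3) (up n) = riemann_inv (- c3) (cell 0 (b n - drift (- c3) n))"
  "b 0 \<le> b n - drift (- c3) n" "even (b n - drift (- c3) n)"
proof -
  show e: "even (b n - drift (- c3) n)" using b_even[of n] even_drift[of "- c3" n] by presburger
  show "b 0 \<le> b n - drift (- c3) n" "riemann_inv (- c3) (up n) = riemann_inv (- c3) (cell 0 (b n - drift (- c3) n))"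
    using history_right[OF b_even order_refl, of n] unfolding inv_up by auto
qed

end

context phase_model
begin

definition "bounded_state M u \<longleftrightarrow>
  u \<in> phase1 wM \<and> \<bar>riemann_inv c1 u\<bar> \<le> M \<and> \<bar>riemann_inv (- c1) u\<bar> \<le> M \<or>
  u \<in> phase3 wm \<and> \<bar>riemann_inv c3 u\<bar> \<le> M \<and> \<bar>riemann_inv (- c3) u\<bar> \<le> M"

lemma bounded_stateD:
  "bounded_state M u \<Longrightarrow> u \<in> phase1 wM \<Longrightarrow> \<bar>riemann_inv c1 u\<bar> \<le> M \<and> \<bar>riemann_inv (- c1) u\<bar> \<le> M"
  "bounded_state M u \<Longrightarrow> u \<in> phase3 wm \<Longrightarrow> \<bar>riemann_inv c3 u\<bar> \<le> M \<and> \<bar>riemann_inv (- c3) u\<bar> \<le> M"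
  unfolding bounded_state_def using phases_disjoint by blast+

end

context glimm
begin

lemma fan_bounded:
  assumes e: "even (m + int n)" and l: "bounded_state M (cell n (m - 2))" and r: "bounded_state M (cell n m)"
    and t: "bounded_state M (um n)" "bounded_state M (up n)"
  shows "bounded_state M (fan n m \<xi>)"
proof -
  consider "m < b n" | "m = b n" | "b n < m" by linarith
  then show ?thesis
  proof cases
    case 1
    show ?thesis using fan_inv_left[OF e 1, of \<xi>] bounded_stateD(1)[OF l cells_left(1)[OF e 1]] bounded_stateD(1)[OF r cells_left(2)[OF e 1]]
      unfolding bounded_state_def by auto
  next
    case 2
    then show ?thesis using l r t by (simp add: fan_b fan4_def)
  next
    case 3
    show ?thesis using fan_inv_right[OF e 3, of \<xi>] bounded_stateD(2)[OF l cells_right(1)[OF e 3]] bounded_stateD(2)[OF r cells_right(2)[OF e 3]]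
      unfolding bounded_state_def by auto
  qed
qed

text \<open>The incoming invariants at the boundary are initial ones, bounded by A. The outgoing
  ones differ from them by 2 c1 w- and 2 c3 w+, where |w-| \<le> 1 + wM by the definition of the
  phase and w+ \<le> W, or else the trace is a cell. Inside a phase invariants are merely passed on,
  so one M serves all levels independently of the mesh.\<close>

lemma states_bounded:
  assumes ini: "\<And>m. even m \<Longrightarrow> bounded_state A (cell 0 m)"
    and W: "\<And>V um up. boundary_trace V um up \<Longrightarrow> V < c3 \<Longrightarrow>
       \<bar>riemann_inv c1 um\<bar> \<le> A \<Longrightarrow> \<bar>riemann_inv (- c3) up\<bar> \<le> A \<Longrightarrow> snd up \<le> W"
    and M: "M = A + 2 * c1 * (1 + wM) + 2 * c3 * \<bar>W\<bar>"
  shows "even (m + int n) \<Longrightarrow> bounded_state M (cell n m)" "bounded_state M (um n)" "bounded_state M (up n)"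
proof -
  have AM: "A \<le> M" using M c_pos wM_pos by simp
  have mono: "bounded_state A u \<Longrightarrow> bounded_state M u" for u using AM unfolding bounded_state_def by auto
  have inl: "\<bar>riemann_inv c1 (um n)\<bar> \<le> A" for n
  proof -
    have "b n - drift c1 n - 2 < b 0" using trace_left_incoming(2)[of n] by simp
    then have "cell 0 (b n - drift c1 n - 2) \<in> phase1 wM" using left_cell[of _ 0] trace_left_incoming(3)[of n] by simp
    then show ?thesis
      using bounded_stateD(1)[OF ini[of "b n - drift c1 n - 2"]] trace_left_incoming[of n] by simp
  qed
  have inr: "\<bar>riemann_inv (- c3) (up n)\<bar> \<le> A" for n
  proof -
    have "cell 0 (b n - drift (- c3) n) \<in> phase3 wm" using right_cell[of _ 0] trace_right_incoming(2,3)[of n] by simp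
    then show ?thesis
      using bounded_stateD(2)[OF ini[of "b n - drift (- c3) n"]] trace_right_incoming[of n] by simp
  qed
  have umb: "bounded_state M (um n)" for n
  proof -
    have w: "\<bar>snd (um n)\<bar> \<le> 1 + wM" using um_phase[of n] wM_pos by (auto simp: phase1_def)
    have "riemann_inv (- c1) (um n) = riemann_inv c1 (um n) + 2 * c1 * snd (um n)" by (simp add: riemann_inv_def)
    moreover have "\<bar>2 * c1 * snd (um n)\<bar> \<le> 2 * c1 * (1 + wM)" unfolding abs_mult using w c_pos by (intro mult_mono) auto
    moreover have "0 \<le> 2 * c3 * \<bar>W\<bar>" using c_pos by simp
    ultimately have "\<bar>riemann_inv (- c1) (um n)\<bar> \<le> M" using inl[of n] M by linarith
    then show ?thesis using inl[of n] AM um_phase[of n] unfolding bounded_state_def by linarith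
  qed
  \<comment> \<open>In the supersonic case \<open>up n\<close> is the right cell itself, so its
    bound comes out of the induction over the levels.\<close>
  have upb: "bounded_state M (up n)" if c: "bounded_state M (cell n (b n))" for n
  proof (cases "V n < c3")
    case True
    have w: "snd (up n) \<le> W" by (rule W[OF trace_b True inl inr])
    have w0: "0 \<le> snd (up n)" using up_phase[of n] wM_pos wMm by (auto simp: phase3_def)
    have "riemann_inv c3 (up n) = riemann_inv (- c3) (up n) - 2 * c3 * snd (up n)" by (simp add: riemann_inv_def)
    moreover have "\<bar>2 * c3 * snd (up n)\<bar> \<le> 2 * c3 * \<bar>W\<bar>" unfolding abs_mult using w w0 c_pos by (intro mult_mono) auto
    moreover have "0 \<le> 2 * c1 * (1 + wM)" using c_pos wM_pos by simp
    ultimately have "\<bar>riemann_inv c3 (up n)\<bar> \<le> M" using inr[of n] M by linarith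
    then show ?thesis using inr[of n] AM up_phase[of n] unfolding bounded_state_def by linarith
  next
    case False
    then show ?thesis using supersonic[of n] c by simp
  qed
  have cells: "\<forall>m. even (m + int n) \<longrightarrow> bounded_state M (cell n m)" for n
  proof (induction n)
    case 0
    then show ?case using ini mono by simp
  next
    case (Suc n)
    show ?case
    proof (intro allI impI)
      fix m assume "even (m + int (Suc n))"
      then have e: "even ((m + 1) + int n)" "even ((m + 1 - 2) + int n)" by auto
      obtain \<xi> where "cell (Suc n) (m + 1 - 1) = fan n (m + 1) \<xi>" using cell_sample[OF e(1), of "{}"] by auto
      moreover have "bounded_state M (fan n (m + 1) \<xi>)"
        by (rule fan_bounded[OF e(1)]) (use Suc e b_even[of n] upb umb in auto)
      ultimately show "bounded_state M (cell (Suc n) m)" by simp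
    qed
  qed
  show "even (m + int n) \<Longrightarrow> bounded_state M (cell n m)" using cells by simp
  show "bounded_state M (um n)" by (rule umb)
  show "bounded_state M (up n)" by (rule upb) (use cells b_even in simp)
qed

lemma time_cases:
  assumes "t \<ge> 0"
  obtains n where "t = real n * \<tau>" | n where "real n * \<tau> < t" "t < real (Suc n) * \<tau>"
proof -
  define n where "n = nat \<lfloor>t / \<tau>\<rfloor>"
  have "t / \<tau> \<ge> 0" using assms tau_pos by simp
  then have "real n \<le> t / \<tau>" "t / \<tau> < real n + 1" unfolding n_def by linarith+
  then have "real n * \<tau> \<le> t" "t < real (Suc n) * \<tau>" using tau_pos by (auto simp: field_simps)
  then show ?thesis using that(1)[of n] that(2)[of n] by (cases "t = real n * \<tau>") (auto simp del: of_nat_Suc)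
qed

lemma uh_cases:
  assumes "t \<ge> 0"
  shows "\<exists>n m. even (m + int n) \<and> (uh (t, x) = cell n m \<or> (\<exists>\<xi>. uh (t, x) = fan n m \<xi>))"
  using assms
proof (cases rule: time_cases)
  case (1 n)
  obtain m where "even (m + int n)" "x \<in> {of_int m * h..<of_int (m + 2) * h}" by (rule grid_point)
  then show ?thesis using level_eq_cell 1 by blast
next
  case (2 n)
  obtain m' where m': "even (m' + int (Suc n))" "x \<in> {of_int m' * h..<of_int (m' + 2) * h}" by (rule grid_point)
  have e: "even ((m' + 1) + int n)" using m'(1) by simp
  have "uh (t, x) = fan n (m' + 1) ((x - of_int (m' + 1) * h) / (t - real n * \<tau>))"
    by (rule strip_eq_fan[OF e 2]) (use m'(2) in \<open>auto simp: add.assoc\<close>)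
  then show ?thesis using e by blast
qed

lemma uh_bounded:
  assumes "\<And>n m. even (m + int n) \<Longrightarrow> bounded_state M (cell n m)"
    "\<And>n. bounded_state M (um n)" "\<And>n. bounded_state M (up n)" and t: "t \<ge> 0"
  shows "bounded_state M (uh (t, x))"
proof -
  obtain n m where nm: "even (m + int n)" "uh (t, x) = cell n m \<or> (\<exists>\<xi>. uh (t, x) = fan n m \<xi>)"
    using uh_cases[OF t] by blast
  have "even ((m - 2) + int n)" using nm by simp
  then show ?thesis using nm fan_bounded[OF nm(1)] assms by auto
qed

lemma \<gamma>h_near:
  assumes "real n * \<tau> \<le> t" "t < real (Suc n) * \<tau>"
  shows "\<bar>\<gamma>h t - of_int (b n) * h\<bar> \<le> h"
proof (cases "t = real n * \<tau>")
  case False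
  then have t: "real n * \<tau> < t" using assms by simp
  define s where "s = t - real n * \<tau>"
  have s: "s > 0" "s < \<tau>" using t assms by (auto simp: s_def algebra_simps)
  have "\<bar>V n * s\<bar> \<le> c1 * \<tau>" unfolding abs_mult using V_bounds[of n] c_pos s by (intro mult_mono) auto
  then have "\<bar>V n * s\<bar> \<le> h" using CFL by (simp add: mult.commute)
  then show ?thesis using \<gamma>h_strip[OF t assms(2)] by (simp add: s_def)
qed (use \<gamma>h_grid[of n] h_pos in simp)

text \<open>Only in the boundary fan is the comparison with V needed. Every other fan occupies a
  strip which, by parity, is separated from the boundary by a grid line.\<close>

lemma uh_phase:
  assumes "t \<ge> 0"
  shows "x < \<gamma>h t \<Longrightarrow> uh (t, x) \<in> phase1 wM" "\<gamma>h t \<le> x \<Longrightarrow> uh (t, x) \<in> phase3 wm"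
proof -
  have "(x < \<gamma>h t \<longrightarrow> uh (t, x) \<in> phase1 wM) \<and> (\<gamma>h t \<le> x \<longrightarrow> uh (t, x) \<in> phase3 wm)"
    using assms
  proof (cases rule: time_cases)
    case (1 n)
    obtain m where m: "even (m + int n)" "x \<in> {of_int m * h..<of_int (m + 2) * h}" by (rule grid_point)
    have "x < \<gamma>h t \<longleftrightarrow> m < b n" unfolding 1 \<gamma>h_grid
      by (rule grid_less_iff[OF m(2)]) (use m(1) b_even[of n] in presburger)
    then show ?thesis using left_cell[OF m(1)] right_cell[OF m(1)] level_eq_cell[OF m] 1 by auto
  next
    case (2 n)
    define s where "s = t - real n * \<tau>"
    have s: "s > 0" using 2 by (simp add: s_def)
    obtain m' where m': "even (m' + int (Suc n))" "x \<in> {of_int m' * h..<of_int (m' + 2) * h}" by (rule grid_point)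
    define m where "m = m' + 1"
    have e: "even (m + int n)" using m'(1) by (simp add: m_def)
    have xm: "of_int (m - 1) * h \<le> x" "x < of_int (m + 1) * h" using m'(2) by (auto simp: m_def add.assoc)
    have u: "uh (t, x) = fan n m ((x - of_int m * h) / s)" unfolding s_def by (rule strip_eq_fan[OF e 2 xm])
    have par: "even (b n - m)" using e b_even[of n] by presburger
    have near: "\<bar>\<gamma>h t - of_int (b n) * h\<bar> \<le> h" by (rule \<gamma>h_near) (use 2 in auto)
    consider "m < b n" | "m = b n" | "b n < m" by linarith
    then show ?thesis
    proof cases
      case 1
      then have "m + 1 \<le> b n - 1" using par by presburger
      then have "of_int (m + 1) * h \<le> of_int (b n - 1) * h" using h_pos by (intro mult_right_mono) auto
      then have "x < \<gamma>h t" using xm near by (simp add: algebra_simps)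
      then show ?thesis using fan_inv_left(1)[OF e 1] u by simp
    next
      case m: 2
      have "x < \<gamma>h t \<longleftrightarrow> (x - of_int m * h) / s < V n"
      proof -
        have g: "\<gamma>h t = of_int m * h + V n * s" using \<gamma>h_strip[OF 2] m by (simp add: s_def)
        show ?thesis unfolding g pos_divide_less_eq[OF s] by linarith
      qed
      then show ?thesis using u m fan_b_phase(1)[of "(x - of_int m * h) / s" n] fan_b_phase(2)[of n "(x - of_int m * h) / s"] by (cases "x < \<gamma>h t") auto
    next
      case 3
      then have "b n + 1 \<le> m - 1" using par by presburger
      then have "of_int (b n + 1) * h \<le> of_int (m - 1) * h" using h_pos by (intro mult_right_mono) auto
      then have "\<gamma>h t \<le> x" using xm near by (simp add: algebra_simps)
      then show ?thesis using fan_inv_right(1)[OF e 3] u by simp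
    qed
  qed
  then show "x < \<gamma>h t \<Longrightarrow> uh (t, x) \<in> phase1 wM" "\<gamma>h t \<le> x \<Longrightarrow> uh (t, x) \<in> phase3 wm" by auto
qed

lemma level_measurable: "(\<lambda>x. uh (real n * \<tau>, x)) \<in> borel_measurable borel"
proof (rule measurable_piecewise_restrict)
  define C where "C = (\<lambda>m. {of_int m * h..<of_int (m + 2) * h}) ` {m::int. even (m + int n)}"
  show "countable C" unfolding C_def by (intro countable_image countableI_type)
  show "\<Omega> \<inter> space borel \<in> sets borel" if "\<Omega> \<in> C" for \<Omega> using that by (auto simp: C_def)
  show "space borel \<subseteq> \<Union> C"
  proof
    fix x :: real
    obtain m where "even (m + int n)" "x \<in> {of_int m * h..<of_int (m + 2) * h}" by (rule grid_point)
    then show "x \<in> \<Union> C" unfolding C_def by blast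
  qed
  show "(\<lambda>x. uh (real n * \<tau>, x)) \<in> borel_measurable (restrict_space borel \<Omega>)" if "\<Omega> \<in> C" for \<Omega>
  proof -
    obtain m where m: "even (m + int n)" "\<Omega> = {of_int m * h..<of_int (m + 2) * h}" using \<open>\<Omega> \<in> C\<close> by (auto simp: C_def)
    have "(\<lambda>x. cell n m) \<in> borel_measurable (restrict_space borel \<Omega>)" by simp
    then show ?thesis by (rule measurable_cong[THEN iffD1, rotated]) (use level_eq_cell[OF m(1)] m(2) in \<open>auto simp: space_restrict_space\<close>)
  qed
qed

lemma uh_measurable: "(\<lambda>p. if fst p > 0 then uh p else 0) \<in> borel_measurable borel"
proof (rule measurable_piecewise_restrict)
  define C1 :: "point set set" where "C1 = range (\<lambda>n::nat. {real n * \<tau>} \<times> UNIV)"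
  define B where "B = (\<lambda>(n, m). {real n * \<tau><..<real (Suc n) * \<tau>} \<times> {of_int (m - 1) * h..<of_int (m + 1) * h})"
  define C2 where "C2 = B ` {(n, m::int). even (m + int n)}"
  define C where "C = insert ({..0} \<times> UNIV) (C1 \<union> C2)"
  show "countable C" unfolding C_def C1_def C2_def by (intro countable_insert countable_Un countable_image countableI_type)
  show "\<Omega> \<inter> space borel \<in> sets borel" if "\<Omega> \<in> C" for \<Omega> using that
    by (auto simp: C_def C1_def C2_def B_def intro!: borel_Times)
  show "space borel \<subseteq> \<Union> C"
  proof
    fix p :: point
    obtain t x where p: "p = (t, x)" by (cases p)
    show "p \<in> \<Union> C"
    proof (cases "t \<le> 0")
      case False
      then have "t \<ge> 0" by simp
      then show ?thesis
      proof (cases rule: time_cases)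
        case (1 n)
        then show ?thesis unfolding p C_def C1_def by blast
      next
        case (2 n)
        obtain m' where m': "even (m' + int (Suc n))" "x \<in> {of_int m' * h..<of_int (m' + 2) * h}" by (rule grid_point)
        have "p \<in> B (n, m' + 1)" using 2 m' by (auto simp: B_def p add.assoc)
        moreover have "(n, m' + 1) \<in> {(n, m::int). even (m + int n)}" using m'(1) by simp
        ultimately show ?thesis unfolding C_def C2_def by blast
      qed
    qed (auto simp: p C_def)
  qed
  have fstm: "fst \<in> measurable (borel :: point measure) borel" and sndm: "snd \<in> measurable (borel :: point measure) borel"
    by (intro borel_measurable_continuous_onI continuous_intros)+
  show "(\<lambda>p. if fst p > 0 then uh p else 0) \<in> borel_measurable (restrict_space borel \<Omega>)" if \<Omega>: "\<Omega> \<in> C" for \<Omega>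
  proof -
    consider "\<Omega> = {..0} \<times> UNIV" | n where "\<Omega> = {real n * \<tau>} \<times> UNIV" | n m where "\<Omega> = B (n, m)" "even (m + int n)"
      using \<Omega> by (auto simp: C_def C1_def C2_def)
    then show ?thesis
    proof cases
      case 1
      have "(\<lambda>p. 0) \<in> borel_measurable (restrict_space borel \<Omega>)" by simp
      then show ?thesis by (rule measurable_cong[THEN iffD1, rotated]) (use 1 in \<open>auto simp: space_restrict_space\<close>)
    next
      case (2 n)
      have "(\<lambda>p :: point. if real n * \<tau> > 0 then uh (real n * \<tau>, snd p) else 0) \<in> borel_measurable borel"
        using measurable_compose[OF sndm level_measurable[of n]] by (cases "real n * \<tau> > 0") auto
      then have "(\<lambda>p. if real n * \<tau> > 0 then uh (real n * \<tau>, snd p) else 0) \<in> borel_measurable (restrict_space borel \<Omega>)"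
        by (rule measurable_restrict_space1)
      then show ?thesis by (rule measurable_cong[THEN iffD1, rotated]) (use 2 in \<open>auto simp: space_restrict_space\<close>)
    next
      case (3 n m)
      note fm = riemann_solution_measurable[OF fan_solution[OF 3(2)]]
      have "(\<lambda>p :: point. (snd p - of_int m * h) / (fst p - real n * \<tau>)) \<in> borel_measurable borel"
        using fstm sndm by measurable
      from measurable_compose[OF this fm]
      have "(\<lambda>p. fan n m ((snd p - of_int m * h) / (fst p - real n * \<tau>))) \<in> borel_measurable (restrict_space borel \<Omega>)"
        by (rule measurable_restrict_space1)
      then show ?thesis
      proof (rule measurable_cong[THEN iffD1, rotated])
        fix p assume "p \<in> space (restrict_space borel \<Omega>)"
        then have p: "real n * \<tau> < fst p" "fst p < real (Suc n) * \<tau>" "of_int (m - 1) * h \<le> snd p" "snd p < of_int (m + 1) * h"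
          using 3(1) by (auto simp: B_def space_restrict_space)
        have "0 \<le> real n * \<tau>" using tau_pos by simp
        then have "fst p > 0" using p by linarith
        then show "fan n m ((snd p - of_int m * h) / (fst p - real n * \<tau>)) = (if fst p > 0 then uh p else 0)"
          using strip_eq_fan[OF 3(2) p] by simp
      qed
    qed
  qed
qed

lemma \<gamma>h_deriv:
  assumes t: "real n * \<tau> < t" "t < real (Suc n) * \<tau>"
  shows "deriv \<gamma>h t = V n"
proof (rule DERIV_imp_deriv)
  have "((\<lambda>t. of_int (b n) * h + V n * (t - real n * \<tau>)) has_real_derivative V n) (at t)"
    by (auto intro!: derivative_eq_intros)
  then show "(\<gamma>h has_real_derivative V n) (at t)"
    by (rule has_field_derivative_transform_within_open[of _ _ _ "{real n * \<tau><..<real (Suc n) * \<tau>}"])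
      (use t \<gamma>h_strip in auto)
qed

lemma b_lipschitz: "\<bar>b (n + k) - b n\<bar> \<le> int k"
  by (induction k) (auto simp: b_Suc)

end

section \<open>Transport of a sampled profile\<close>

lemma integral_fst_snd:
  fixes f :: "point \<Rightarrow> real"
  assumes "integrable lborel f"
  shows "(LBINT p. f p) = (\<integral>t. (LBINT x. f (t, x)) \<partial>lborel)"
    "(LBINT p. f p) = (\<integral>x. (LBINT t. f (t, x)) \<partial>lborel)"
proof -
  have f: "integrable (lborel \<Otimes>\<^sub>M lborel) f" using assms by (simp add: lborel_prod)
  show 1: "(LBINT p. f p) = (\<integral>t. (LBINT x. f (t, x)) \<partial>lborel)"
    using lborel_pair.integral_fst'[OF f] by (simp add: lborel_prod)
  have "integrable (lborel \<Otimes>\<^sub>M lborel) (case_prod (\<lambda>x y. f (x, y)))" using f by simp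
  from lborel_pair.Fubini_integral[OF this]
  show "(LBINT p. f p) = (\<integral>x. (LBINT t. f (t, x)) \<partial>lborel)" unfolding 1 by simp
qed

lemma integrable_bounded_box:
  fixes f :: "point \<Rightarrow> real"
  assumes [measurable]: "f \<in> borel_measurable borel" and B: "\<And>p. \<bar>f p\<bar> \<le> B"
    and supp: "\<And>p. p \<notin> {a..b} \<times> {c..d} \<Longrightarrow> f p = 0"
  shows "integrable lborel f"
proof (rule integrableI_bounded_set[where A="{a..b} \<times> {c..d}" and B=B])
  show "{a..b} \<times> {c..d} \<in> sets lborel" by (simp add: borel_Times)
  have "emeasure (lborel \<Otimes>\<^sub>M lborel) ({a..b} \<times> {c..d}) = emeasure lborel {a..b} * emeasure lborel {c..d}"
    by (rule lborel.emeasure_pair_measure_Times) auto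
  then show "emeasure lborel ({a..b} \<times> {c..d}) < \<infinity>"
    by (simp add: lborel_prod emeasure_lborel_Icc_eq ennreal_mult_less_top)
qed (use B supp in auto)

definition step_index :: "real \<Rightarrow> real \<Rightarrow> nat" where
  "step_index \<tau> t = nat \<lfloor>t / \<tau>\<rfloor>"

lemma step_index_eq:
  assumes "\<tau> > 0" "real n * \<tau> \<le> t" "t < real (Suc n) * \<tau>"
  shows "step_index \<tau> t = n"
proof -
  have "real n \<le> t / \<tau>" "t / \<tau> < real n + 1" using assms by (auto simp: field_simps)
  then have "\<lfloor>t / \<tau>\<rfloor> = int n" by linarith
  then show ?thesis by (simp add: step_index_def)
qed

lemma step_index_bounds:
  assumes "\<tau> > 0" "t \<ge> 0"
  shows "real (step_index \<tau> t) * \<tau> \<le> t" "t < real (Suc (step_index \<tau> t)) * \<tau>"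
proof -
  have "t / \<tau> \<ge> 0" using assms by simp
  then have "real (step_index \<tau> t) \<le> t / \<tau>" "t / \<tau> < real (step_index \<tau> t) + 1" unfolding step_index_def by linarith+
  then show "real (step_index \<tau> t) * \<tau> \<le> t" "t < real (Suc (step_index \<tau> t)) * \<tau>" using assms by (auto simp: field_simps)
qed

lemma step_index_measurable [measurable]: "step_index \<tau> \<in> measurable borel (count_space UNIV)"
  unfolding step_index_def[abs_def] by measurable

abbreviation slab :: "real \<Rightarrow> nat \<Rightarrow> real set" where
  "slab \<tau> n \<equiv> {real n * \<tau>..<real (Suc n) * \<tau>}"

lemma set_integral_steps:
  fixes f :: "real \<Rightarrow> real"
  assumes tau: "\<tau> > 0" and f: "integrable lborel f" and supp: "\<And>t. t \<notin> {0..<real N * \<tau>} \<Longrightarrow> f t = 0"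
  shows "(LBINT t. f t) = (\<Sum>n<N. \<integral>t. indicator (slab \<tau> n) t * f t \<partial>lborel)"
proof -
  have "f t = (\<Sum>n<N. indicator (slab \<tau> n) t * f t)" for t
  proof (cases "t \<in> {0..<real N * \<tau>}")
    case True
    then have t: "t \<ge> 0" by simp
    define m where "m = step_index \<tau> t"
    note m = step_index_bounds[OF tau t, folded m_def]
    have "real m * \<tau> < real N * \<tau>" using m True by (auto intro: le_less_trans)
    then have "m < N" using tau by (simp add: mult_less_cancel_right)
    have ind: "indicator (slab \<tau> n) t * f t = (if n = m then f t else 0)" for n
    proof (cases "t \<in> slab \<tau> n")
      case True
      then have "m = n" unfolding m_def using tau by (intro step_index_eq) auto
      then show ?thesis using True by simp
    next
      case False
      then have "n \<noteq> m" using m by auto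
      then show ?thesis using False by simp
    qed
    show ?thesis unfolding ind using \<open>m < N\<close> by simp
  qed (use supp in simp)
  then have "(LBINT t. f t) = (\<integral>t. (\<Sum>n<N. indicator (slab \<tau> n) t * f t) \<partial>lborel)" by presburger
  also have "\<dots> = (\<Sum>n<N. \<integral>t. indicator (slab \<tau> n) t * f t \<partial>lborel)"
  proof (rule Bochner_Integration.integral_sum)
    fix n
    have "integrable lborel (\<lambda>t. indicator (slab \<tau> n) t *\<^sub>R f t)"
      using f by (intro integrable_mult_indicator) auto
    then show "integrable lborel (\<lambda>t. indicator (slab \<tau> n) t * f t)" by simp
  qed
  finally show ?thesis .
qed

lemma abel_summation:
  fixes G A :: "nat \<Rightarrow> real"
  shows "(\<Sum>n<N. G n * (A (Suc n) - A n)) = G N * A N - G 0 * A 0 - (\<Sum>n<N. (G (Suc n) - G n) * A (Suc n))"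
  by (induction N) (auto simp: algebra_simps)

text \<open>The difference of two step functions is the signed indicator of the interval between B
  and B'. With A almost equal to \<kappa> there, the integral is the signed length times \<kappa> up
  to the oscillation.\<close>

lemma integral_step_difference:
  fixes A :: "real \<Rightarrow> real"
  assumes near: "\<And>Y. min B B' \<le> Y \<Longrightarrow> Y \<le> max B B' \<Longrightarrow> \<bar>A Y - \<kappa>\<bar> \<le> \<omega>"
    and [measurable]: "A \<in> borel_measurable borel"
  shows "integrable lborel (\<lambda>Y. ((if Y < B' then 1 else 0) - (if Y < B then 1 else 0)) * A Y)"
    "\<bar>(LBINT Y. ((if Y < B' then 1 else 0) - (if Y < B then 1 else 0)) * A Y) - (B' - B) * \<kappa>\<bar> \<le> \<bar>B' - B\<bar> * \<omega>"
proof -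
  define I where "I = {min B B'..<max B B'}"
  define \<sigma> where "\<sigma> = (if B \<le> B' then 1 else -1 :: real)"
  have e: "((if Y < B' then 1 else 0) - (if Y < B then 1 else 0)) * A Y = \<sigma> * (indicator I Y * A Y)" for Y
    by (auto simp: \<sigma>_def I_def indicator_def)
  have Ib: "\<bar>A Y\<bar> \<le> \<bar>\<kappa>\<bar> + \<omega>" if "Y \<in> I" for Y using near[of Y] that by (auto simp: I_def)
  have i: "integrable lborel (\<lambda>Y. indicator I Y *\<^sub>R A Y)"
    by (rule integrableI_bounded_set_indicator[where B="\<bar>\<kappa>\<bar> + \<omega>"]) (use Ib in \<open>auto simp: I_def\<close>)
  then have i': "integrable lborel (\<lambda>Y. indicator I Y * A Y)" by simp
  then show "integrable lborel (\<lambda>Y. ((if Y < B' then 1 else 0) - (if Y < B then 1 else 0)) * A Y)" unfolding e by simp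
  have ic: "integrable lborel (\<lambda>Y. indicator I Y * c)" for c :: real
    by (intro integrable_mult_left integrable_real_indicator) (auto simp: I_def)
  have mI: "(LBINT Y. indicator I Y * c) = \<bar>B' - B\<bar> * c" for c
    by (simp add: I_def max_def min_def abs_if)
  have "(B' - B) * \<kappa> = \<sigma> * (LBINT Y. indicator I Y * \<kappa>)" unfolding mI by (auto simp: \<sigma>_def)
  then have "(LBINT Y. ((if Y < B' then 1 else 0) - (if Y < B then 1 else 0)) * A Y) - (B' - B) * \<kappa>
    = \<sigma> * (LBINT Y. indicator I Y * A Y - indicator I Y * \<kappa>)"
    unfolding e using i' ic by (simp add: right_diff_distrib)
  moreover have "\<bar>LBINT Y. indicator I Y * A Y - indicator I Y * \<kappa>\<bar> \<le> (LBINT Y. indicator I Y * \<omega>)"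
  proof (rule integral_abs_bound_integral)
    show "integrable lborel (\<lambda>Y. indicator I Y * A Y - indicator I Y * \<kappa>)" using i' ic by simp
    show "\<bar>indicator I Y * A Y - indicator I Y * \<kappa>\<bar> \<le> indicator I Y * \<omega>" for Y
      using near[of Y] by (auto simp: indicator_def I_def)
  qed (use ic in simp)
  moreover have "\<bar>\<sigma>\<bar> = 1" by (simp add: \<sigma>_def)
  ultimately show "\<bar>(LBINT Y. ((if Y < B' then 1 else 0) - (if Y < B then 1 else 0)) * A Y) - (B' - B) * \<kappa>\<bar> \<le> \<bar>B' - B\<bar> * \<omega>"
    unfolding mI by (simp add: abs_mult)
qed

text \<open>The part of the scheme that the balance law uses, freed from phases and fans, so that it
  can be instantiated for each of the four squares. G is the profile on the grid levels, g the
  function on the half-plane, s the sampled shifts and F the amplitude at the boundary.\<close>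

locale transported =
  fixes h \<tau> q c M :: real and G :: "nat \<Rightarrow> real \<Rightarrow> real" and F :: "nat \<Rightarrow> real"
    and b s :: "nat \<Rightarrow> int" and g :: "point \<Rightarrow> real"
  assumes h_pos: "h > 0" and tau_pos: "\<tau> > 0" and h_eq: "h = q * \<tau>"
    and G_meas[measurable]: "\<And>n. G n \<in> borel_measurable borel"
    and G_bound: "\<And>n x. \<bar>G n x\<bar> \<le> M" and F_bound: "\<And>n. \<bar>F n\<bar> \<le> M" and M0: "M \<ge> 0"
    and G_Suc: "\<And>n x. G (Suc n) x = G n (x - of_int (s n) * h) + F n *
       ((if x < of_int (b (Suc n)) * h then 1 else 0) - (if x < of_int (b n + s n) * h then 1 else 0))"
    and s_bound: "\<And>n. \<bar>s n\<bar> \<le> 1" and b_step: "\<And>n. \<bar>b (Suc n) - b n\<bar> \<le> 1"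
    and g_meas: "(\<lambda>p. if fst p > 0 then g p else 0) \<in> borel_measurable borel"
    and g_bound: "\<And>t x. t > 0 \<Longrightarrow> \<bar>g (t, x)\<bar> \<le> M"
    and g_strip: "\<And>n t x. real n * \<tau> < t \<Longrightarrow> t < real (Suc n) * \<tau> \<Longrightarrow> \<bar>x - of_int (b n) * h\<bar> > h \<Longrightarrow>
       g (t, x) = G n (x - c * (t - real n * \<tau>))"
begin

definition "P n = (\<Sum>k<n. s k)"
text \<open>Position of the boundary in the frame that moves with the sampled characteristics. It
  can oscillate by up to 2 h per step; its velocity \<open>rate\<close> is what converges only
  weakly.\<close>

definition "B n = of_int (b n - P n) * h"
definition "rate t = (B (Suc (step_index \<tau> t)) - B (step_index \<tau> t)) / \<tau>"
definition "amplitude t = F (step_index \<tau> t)"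

lemma P_simps: "P 0 = 0" "P (Suc n) = P n + s n" by (simp_all add: P_def)

lemma G_frame: "G (Suc n) (Y + of_int (P (Suc n)) * h) - G n (Y + of_int (P n) * h)
    = F n * ((if Y < B (Suc n) then 1 else 0) - (if Y < B n then 1 else 0))"
proof -
  have e: "Y + of_int (P (Suc n)) * h < of_int (b (Suc n)) * h \<longleftrightarrow> Y < B (Suc n)"
    "Y + of_int (P (Suc n)) * h < of_int (b n + s n) * h \<longleftrightarrow> Y < B n"
    "Y + of_int (P (Suc n)) * h - of_int (s n) * h = Y + of_int (P n) * h"
    by (auto simp: B_def P_simps algebra_simps)
  show ?thesis using G_Suc[of n "Y + of_int (P (Suc n)) * h"] unfolding e by simp
qed

lemma B_step: "\<bar>B (Suc n) - B n\<bar> \<le> 2 * h"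
proof -
  have "\<bar>(b (Suc n) - P (Suc n)) - (b n - P n)\<bar> \<le> 2" using s_bound[of n] b_step[of n] by (simp add: P_simps)
  then have "\<bar>of_int (b (Suc n) - P (Suc n)) - of_int (b n - P n)\<bar> \<le> (2::real)" by linarith
  moreover have "B (Suc n) - B n = (of_int (b (Suc n) - P (Suc n)) - of_int (b n - P n)) * h"
    by (simp add: B_def algebra_simps)
  ultimately show ?thesis using h_pos by (simp add: abs_mult)
qed

lemma integral_along_characteristic:
  assumes test: "test_function \<psi> \<psi>t \<psi>x" and "t0 \<le> t1"
  shows "(LBINT t. indicator {t0..<t1} t * (\<psi>t (t, Y + c * t) + c * \<psi>x (t, Y + c * t)))
    = \<psi> (t1, Y + c * t1) - \<psi> (t0, Y + c * t0)"
proof -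
  define f where "f t = \<psi>t (t, Y + c * t) + c * \<psi>x (t, Y + c * t)" for t
  have ct: "continuous_on UNIV \<psi>t" and cx: "continuous_on UNIV \<psi>x"
    and d: "\<And>p. (\<psi> has_derivative (\<lambda>(s, y). \<psi>t p * s + \<psi>x p * y)) (at p)"
    using test unfolding test_function_def by auto
  have cf: "continuous_on S f" for S
    unfolding f_def by (intro continuous_intros continuous_on_compose2[OF ct] continuous_on_compose2[OF cx]) auto
  have der: "((\<lambda>t. \<psi> (t, Y + c * t)) has_vector_derivative f t) (at t within S)" for t S
  proof -
    have "((\<lambda>t. (t, Y + c * t)) has_derivative (\<lambda>s. (s, c * s))) (at t within S)"
      by (auto intro!: derivative_eq_intros)
    from has_derivative_compose[OF this d]
    have "((\<lambda>t. \<psi> (t, Y + c * t)) has_derivative (\<lambda>s. \<psi>t (t, Y + c * t) * s + \<psi>x (t, Y + c * t) * (c * s))) (at t within S)"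
      by simp
    then show ?thesis unfolding has_vector_derivative_def f_def
      by (rule has_derivative_eq_rhs) (auto simp: algebra_simps)
  qed
  have "(LBINT t. indicator {t0..<t1} t * f t) = (LBINT t. indicator {t0..t1} t *\<^sub>R f t)"
  proof (rule integral_cong_AE)
    have [measurable]: "f \<in> borel_measurable borel" using cf borel_measurable_continuous_onI by blast
    show "(\<lambda>t. indicator {t0..<t1} t * f t) \<in> borel_measurable lborel" by measurable
    show "(\<lambda>t. indicator {t0..t1} t *\<^sub>R f t) \<in> borel_measurable lborel" by measurable
    show "AE t in lborel. indicator {t0..<t1} t * f t = indicator {t0..t1} t *\<^sub>R f t"
      using AE_lborel_singleton[of t1] by eventually_elim (auto simp: indicator_def)
  qed
  also have "\<dots> = \<psi> (t1, Y + c * t1) - \<psi> (t0, Y + c * t0)"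
    by (rule integral_FTC_atLeastAtMost[OF \<open>t0 \<le> t1\<close> der cf])
  finally show ?thesis by (simp add: f_def)
qed

text \<open>In the frame moving with the sampled characteristics the profile only changes at the boundary,
  so that a summation by parts in time leaves the boundary terms; replacing the sampled characteristics
  by the exact ones costs no more than the modulus of continuity of the test function.\<close>

lemma transport_balance_bound:
  assumes test: "test_function \<psi> \<psi>t \<psi>x" and box: "test_box K T \<psi> \<psi>t \<psi>x"
    and tau1: "\<tau> \<le> 1" and cq: "\<bar>c\<bar> \<le> q"
    and \<eta>: "\<And>p. \<eta> p = \<psi>t p + c * \<psi>x p" and C: "\<And>p. \<bar>\<eta> p\<bar> \<le> C" "\<And>p. \<bar>\<psi> p\<bar> \<le> C"
    and d1: "\<delta> \<le> 1" and drift: "\<And>n. real n * \<tau> \<le> T + 1 \<Longrightarrow> \<bar>of_int (P n) * h - c * (real n * \<tau>)\<bar> \<le> \<delta>"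
    and near: "\<And>n t. real n * \<tau> \<le> t \<Longrightarrow> t < real (Suc n) * \<tau> \<Longrightarrow> t \<le> T + 1 \<Longrightarrow> \<bar>of_int (b n) * h - \<gamma> t\<bar> \<le> \<delta>"
    and uc: "\<And>p p'. dist p p' \<le> \<tau> + 3 * h + 2 * \<delta> \<Longrightarrow> \<bar>\<psi> p - \<psi> p'\<bar> \<le> \<omega> \<and> \<bar>\<eta> p - \<eta> p'\<bar> \<le> \<omega>"
    and gm[measurable]: "\<gamma> \<in> borel_measurable borel"
  shows "\<bar>(LBINT p. g p * \<eta> p) + (LBINT t. rate t * amplitude t * \<psi> (t, \<gamma> t))\<bar>
    \<le> 4 * M * C * T * h + 2 * M * T * (T + \<bar>c\<bar> * T + 1) * \<omega> + 6 * M * q * (T + 1) * \<omega>"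
proof -
  define n where "n t = step_index \<tau> t" for t
  define R where "R = T + \<bar>c\<bar> * T + 1"
  note T = test_boxD(3)[OF box]
  have supp: "0 < t \<and> t < T \<and> \<bar>x\<bar> \<le> T" if "\<psi> (t, x) \<noteq> 0 \<or> \<psi>t (t, x) \<noteq> 0 \<or> \<psi>x (t, x) \<noteq> 0" for t x
    using that test_boxD(4-7)[OF box] by blast
  have C0: "C \<ge> 0" using C(1)[of "(0,0)"] by linarith
  have q0: "q > 0" using h_pos tau_pos h_eq by (metis zero_less_mult_pos2)
  have \<delta>0: "\<delta> \<ge> 0" using drift[of 0] T by simp
  have \<omega>0: "\<omega> \<ge> 0" using uc[of "(0,0)" "(0,0)"] tau_pos h_pos \<delta>0 by auto
  have R0: "R > 0" using T by (simp add: R_def add_pos_nonneg)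
  note cont = test_function_continuous[OF test]
  have [measurable]: "\<psi> \<in> borel_measurable borel" using cont(1) by (rule borel_measurable_continuous_onI)
  have \<eta>m[measurable]: "\<eta> \<in> borel_measurable borel"
    unfolding \<eta>[abs_def] by (intro borel_measurable_continuous_onI continuous_intros cont)
  have \<eta>supp: "0 < t \<and> t < T \<and> \<bar>x\<bar> \<le> T" if "\<eta> (t, x) \<noteq> 0" for t x
  proof -
    have "\<psi>t (t, x) \<noteq> 0 \<or> \<psi>x (t, x) \<noteq> 0" using that by (auto simp: \<eta>)
    then show ?thesis using supp[of t x] by blast
  qed
  have nb: "real (n t) * \<tau> \<le> t" "t < real (Suc (n t)) * \<tau>" if "t \<ge> 0" for t
    using step_index_bounds[OF tau_pos that] by (auto simp: n_def)
  define f1 where "f1 p = g p * \<eta> p" for p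
  \<comment> \<open>The integrand in the moving frame: the profile is displaced by the sampled
    drift, but the test function is evaluated along the exact characteristic, so that its time
    integral can be computed exactly.\<close>
  define f3 where "f3 p = G (n (fst p)) (snd p + of_int (P (n (fst p))) * h) * \<eta> (fst p, snd p + c * fst p)" for p
  have f1m[measurable]: "f1 \<in> borel_measurable borel"
  proof -
    have "f1 = (\<lambda>p. (if fst p > 0 then g p else 0) * \<eta> p)" using \<eta>supp by (fastforce simp: f1_def)
    then show ?thesis using borel_measurable_times[OF g_meas \<eta>m] by simp
  qed
  have f3m[measurable]: "f3 \<in> borel_measurable borel"
  proof -
    have "(\<lambda>p. (\<lambda>i p. G i (snd p + of_int (P i) * h) * \<eta> (fst p, snd p + c * fst p)) (n (fst p)) p) \<in> borel_measurable borel"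
      by (rule measurable_compose_countable) (measurable, simp add: n_def)
    then show ?thesis by (simp add: f3_def[abs_def])
  qed
  have b1: "\<bar>f1 p\<bar> \<le> M * C" for p
  proof (cases "\<eta> p = 0")
    case False
    then show ?thesis using \<eta>supp[of "fst p" "snd p"] g_bound[of "fst p" "snd p"] C(1)[of p] M0 by (simp add: f1_def abs_mult mult_mono)
  qed (use M0 C0 in \<open>simp add: f1_def\<close>)
  have b3: "\<bar>f3 p\<bar> \<le> M * C" for p using G_bound C M0 by (simp add: f3_def abs_mult mult_mono)
  have supp': "0 < t \<and> t < T \<and> \<bar>Y\<bar> \<le> R" if "\<eta> (t, Y + e) \<noteq> 0" "\<bar>e - c * t\<bar> \<le> 1" for t Y e
  proof -
    have 1: "0 < t" "t < T" "\<bar>Y + e\<bar> \<le> T" using \<eta>supp[OF that(1)] by auto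
    then have "\<bar>c * t\<bar> \<le> \<bar>c\<bar> * T" by (simp add: abs_mult mult_left_mono)
    then show ?thesis unfolding R_def using 1 that(2) by linarith
  qed
  have s3: "f3 (t, Y) = 0" if "\<not> (0 < t \<and> t < T \<and> \<bar>Y\<bar> \<le> R)" for t Y
    using supp'[of t Y "c * t"] that by (auto simp: f3_def)
  have i1: "integrable lborel f1"
    by (rule integrable_bounded_box[OF f1m b1, of 0 T "- T" T]) (use \<eta>supp in \<open>fastforce simp: f1_def abs_le_iff\<close>)
  have i3: "integrable lborel f3"
  proof (rule integrable_bounded_box[OF f3m b3, of 0 T "- R" R])
    show "f3 p = 0" if "p \<notin> {0..T} \<times> {- R..R}" for p using s3[of "fst p" "snd p"] that by (cases p) (auto simp: abs_le_iff)
  qed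
  \<comment> \<open>After the translation by e the two integrands agree up to the variation of
    \<eta> over the distance |e - c t|, except on the interval J of length 2 h around the boundary,
    where both are bounded by M C. This gives 2 M R \<omega> and 2 M C times 2 h.\<close>
  have slice: "\<bar>(LBINT x. f1 (t, x)) - (LBINT Y. f3 (t, Y))\<bar> \<le> indicator {0..T} t * (4 * M * C * h + 2 * M * R * \<omega>)"
    if t: "t \<notin> range (\<lambda>k :: nat. real k * \<tau>)" for t
  proof (cases "0 < t \<and> t < T")
    case False
    then have "f1 (t, x) = 0" "f3 (t, x) = 0" for x using \<eta>supp[of t x] s3[of t x] by (auto simp: f1_def)
    then show ?thesis using M0 C0 h_pos R0 \<omega>0 by (simp add: indicator_def)
  next
    case True
    have "real (n t) * \<tau> \<noteq> t" using t by (metis rangeI)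
    then have nt: "real (n t) * \<tau> < t" "t < real (Suc (n t)) * \<tau>" using nb[of t] True by auto
    define e where "e = c * (t - real (n t) * \<tau>) + of_int (P (n t)) * h"
    have "\<bar>of_int (P (n t)) * h - c * (real (n t) * \<tau>)\<bar> \<le> \<delta>" using nt True by (intro drift) linarith
    then have e: "\<bar>e - c * t\<bar> \<le> \<delta>" by (simp add: e_def algebra_simps)
    define J where "J = {of_int (b (n t)) * h - h - e..of_int (b (n t)) * h + h - e}"
    have s1: "f1 (t, Y + e) = 0" if "\<bar>Y\<bar> > R" for Y using supp'[of t Y e] e d1 that by (auto simp: f1_def)
    have j1: "integrable lborel (\<lambda>Y. f1 (t, Y + e))"
      by (rule integrable_bounded_Icc[where a="- R" and b=R and B="M * C"]) (measurable, use b1 s1 in \<open>auto simp: abs_le_iff\<close>)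
    have j3: "integrable lborel (\<lambda>Y. f3 (t, Y))"
      by (rule integrable_bounded_Icc[where a="- R" and b=R and B="M * C"]) (measurable, use b3 s3 in \<open>auto simp: abs_le_iff\<close>)
    have "(LBINT x. f1 (t, x)) = (LBINT Y. f1 (t, Y + e))"
      using lborel_integral_real_affine[of 1 "\<lambda>x. f1 (t, x)" e] by (simp add: add.commute)
    then have "\<bar>(LBINT x. f1 (t, x)) - (LBINT Y. f3 (t, Y))\<bar> = \<bar>LBINT Y. f1 (t, Y + e) - f3 (t, Y)\<bar>" using j1 j3 by simp
    also have "\<dots> \<le> (LBINT Y. indicator J Y * (2 * (M * C)) + indicator {- R..R} Y * (M * \<omega>))"
    proof (rule integral_abs_bound_integral)
      show "integrable lborel (\<lambda>Y. indicator J Y * (2 * (M * C)) + indicator {- R..R} Y * (M * \<omega>))"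
        by (intro Bochner_Integration.integrable_add integrable_mult_left integrable_real_indicator) (auto simp: J_def emeasure_lborel_Icc_eq)
      fix Y
      have M\<omega>: "0 \<le> M * \<omega>" using M0 \<omega>0 by simp
      show "\<bar>f1 (t, Y + e) - f3 (t, Y)\<bar> \<le> indicator J Y * (2 * (M * C)) + indicator {- R..R} Y * (M * \<omega>)"
      proof (cases "Y \<in> J")
        case True
        then show ?thesis using b1[of "(t, Y + e)"] b3[of "(t, Y)"] M\<omega> by (auto simp: indicator_def)
      next
        case F: False
        show ?thesis
        proof (cases "\<bar>Y\<bar> \<le> R")
          case True
          have "\<bar>(Y + e) - of_int (b (n t)) * h\<bar> > h" using F by (auto simp: J_def)
          from g_strip[OF nt this] have "f1 (t, Y + e) - f3 (t, Y) = G (n t) (Y + of_int (P (n t)) * h) * (\<eta> (t, Y + e) - \<eta> (t, Y + c * t))"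
            by (simp add: f1_def f3_def e_def algebra_simps)
          moreover have "\<bar>\<eta> (t, Y + e) - \<eta> (t, Y + c * t)\<bar> \<le> \<omega>"
          proof -
            have "dist (t, Y + e) (t, Y + c * t) \<le> \<tau> + 3 * h + 2 * \<delta>"
              using e tau_pos h_pos \<delta>0 by (simp add: dist_Pair_Pair dist_real_def)
            then show ?thesis using uc by blast
          qed
          ultimately show ?thesis using F True G_bound M0 by (simp add: abs_mult mult_mono abs_le_iff)
        qed (use s1 s3 F in \<open>auto simp: indicator_def\<close>)
      qed
    qed (use j1 j3 in simp)
    also have "\<dots> = 4 * M * C * h + 2 * M * R * \<omega>"
      using h_pos R0 by (subst Bochner_Integration.integral_add) (auto simp: J_def emeasure_lborel_Icc_eq intro!: integrable_mult_left integrable_real_indicator)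
    finally show ?thesis using True by simp
  qed
  have E1: "\<bar>(LBINT p. f1 p) - (LBINT p. f3 p)\<bar> \<le> T * (4 * M * C * h + 2 * M * R * \<omega>)"
  proof -
    have f: "integrable lborel (\<lambda>t. LBINT x. f (t, x))" if "integrable lborel f" for f :: "point \<Rightarrow> real"
      using lborel_pair.integrable_fst'[of f] that by (simp add: lborel_prod)
    note j = f[OF i1] f[OF i3]
    have "\<bar>(LBINT p. f1 p) - (LBINT p. f3 p)\<bar> = \<bar>\<integral>t. (LBINT x. f1 (t, x)) - (LBINT Y. f3 (t, Y)) \<partial>lborel\<bar>"
      using j by (simp add: integral_fst_snd(1)[OF i1] integral_fst_snd(1)[OF i3])
    also have "\<dots> \<le> (\<integral>t. \<bar>(LBINT x. f1 (t, x)) - (LBINT Y. f3 (t, Y))\<bar> \<partial>lborel)" by (rule integral_abs_bound)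
    also have "\<dots> \<le> (LBINT t. indicator {0..T} t * (4 * M * C * h + 2 * M * R * \<omega>))"
    proof (rule integral_mono_AE)
      have "range (\<lambda>k :: nat. real k * \<tau>) \<in> null_sets lborel" by (intro countable_imp_null_set_lborel) simp
      from AE_not_in[OF this] show "AE t in lborel. \<bar>(LBINT x. f1 (t, x)) - (LBINT Y. f3 (t, Y))\<bar> \<le> indicator {0..T} t * (4 * M * C * h + 2 * M * R * \<omega>)"
        by (rule eventually_mono) (rule slice)
    qed (use j in \<open>auto simp: emeasure_lborel_Icc_eq intro!: integrable_mult_left integrable_real_indicator\<close>)
    finally show ?thesis using T by simp
  qed
  \<comment> \<open>The number of steps needed to cover the support in time; rounding up exceeds T
    by at most one step, hence by at most 1.\<close>
  define N where "N = nat \<lceil>T / \<tau>\<rceil>"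
  have "T / \<tau> > 0" using T tau_pos by simp
  then have "T / \<tau> \<le> real N" "real N < T / \<tau> + 1" unfolding N_def by linarith+
  then have N: "T \<le> real N * \<tau>" "real N * \<tau> \<le> T + 1" using tau_pos tau1 by (auto simp: field_simps)
  define A where "A k Y = \<psi> (real k * \<tau>, Y + c * (real k * \<tau>))" for k Y
  define S where "S k Y = ((if Y < B (Suc k) then 1 else 0) - (if Y < B k then 1 else 0)) * A (Suc k) Y" for k Y
  \<comment> \<open>On each slab the profile is frozen and the time integral is a difference of
    values of \<psi>. Summation by parts moves the difference to the profile, which changes only at
    the boundary; the end terms vanish as \<psi> is 0 at time 0 and from time T on.\<close>
  have inner: "(LBINT t. f3 (t, Y)) = - (\<Sum>k<N. F k * S k Y)" for Y
  proof -
    define E where "E k = G k (Y + of_int (P k) * h)" for k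
    have "integrable lborel (\<lambda>t. f3 (t, Y))"
      by (rule integrable_bounded_Icc[where a=0 and b=T and B="M * C"]) (measurable, use b3 s3 in auto)
    then have "(LBINT t. f3 (t, Y)) = (\<Sum>k<N. LBINT t. indicator (slab \<tau> k) t * f3 (t, Y))"
      by (rule set_integral_steps[OF tau_pos]) (use s3 N(1) in force)
    also have "\<dots> = (\<Sum>k<N. E k * (A (Suc k) Y - A k Y))"
    proof (rule sum.cong[OF refl])
      fix k
      have "indicator (slab \<tau> k) t * f3 (t, Y) = E k * (indicator (slab \<tau> k) t * (\<psi>t (t, Y + c * t) + c * \<psi>x (t, Y + c * t)))" for t
        using step_index_eq[OF tau_pos, of k t] by (auto simp: f3_def n_def \<eta> E_def indicator_def simp del: of_nat_Suc)
      moreover have "real k * \<tau> \<le> real (Suc k) * \<tau>" using tau_pos by simp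
      ultimately show "(LBINT t. indicator (slab \<tau> k) t * f3 (t, Y)) = E k * (A (Suc k) Y - A k Y)"
        by (simp only: integral_mult_right_zero integral_along_characteristic[OF test] A_def)
    qed
    also have "\<dots> = - (\<Sum>k<N. (E (Suc k) - E k) * A (Suc k) Y)"
    proof -
      have "A 0 Y = 0" "A N Y = 0" using supp N(1) unfolding A_def by (force simp: not_less)+
      then show ?thesis using abel_summation[of E "\<lambda>k. A k Y" N] by simp
    qed
    also have "\<dots> = - (\<Sum>k<N. F k * S k Y)" unfolding E_def G_frame by (simp add: S_def mult.assoc)
    finally show ?thesis .
  qed
  define \<kappa> where "\<kappa> k = A (Suc k) (B k)" for k
  \<comment> \<open>The distance of the two arguments is at most \<tau> in time; in space 2 h comes
    from Y, h from c \<tau>, and 2 \<delta> from the errors of the boundary position and of the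
    drift.\<close>
  have close: "\<bar>\<psi> (t, \<gamma> t) - A (Suc k) Y\<bar> \<le> \<omega>"
    if k: "k < N" and t: "t \<in> slab \<tau> k" and Y: "\<bar>Y - B k\<bar> \<le> 2 * h" for k t Y
  proof -
    have "real (Suc k) * \<tau> \<le> real N * \<tau>" using k tau_pos by (intro mult_right_mono) auto
    then have kT: "real (Suc k) * \<tau> \<le> T + 1" using N by simp
    then have "real k * \<tau> \<le> T + 1" using tau_pos by (simp add: algebra_simps)
    note d = drift[OF this]
    have tk: "real k * \<tau> \<le> t" "t < real (Suc k) * \<tau>" "t \<le> T + 1" using t kT by auto
    have ctau: "\<bar>c * \<tau>\<bar> \<le> h" using cq tau_pos h_eq by (simp add: abs_mult mult_right_mono)
    have e: "Y + c * (real (Suc k) * \<tau>) - \<gamma> t = (Y - B k) + (of_int (b k) * h - \<gamma> t) - (of_int (P k) * h - c * (real k * \<tau>)) + c * \<tau>"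
      by (simp add: B_def algebra_simps)
    have "\<bar>Y + c * (real (Suc k) * \<tau>) - \<gamma> t\<bar> \<le> 3 * h + 2 * \<delta>"
      unfolding e using near[OF tk] d ctau Y by linarith
    moreover have "\<bar>t - real (Suc k) * \<tau>\<bar> \<le> \<tau>" using tk by (simp add: algebra_simps abs_le_iff)
    ultimately have "dist (t, \<gamma> t) (real (Suc k) * \<tau>, Y + c * (real (Suc k) * \<tau>)) \<le> \<tau> + 3 * h + 2 * \<delta>"
      using sqrt_sum_squares_le_sum_abs[of "t - real (Suc k) * \<tau>" "\<gamma> t - (Y + c * (real (Suc k) * \<tau>))"]
      unfolding dist_Pair_Pair dist_real_def power2_abs by linarith
    then show ?thesis using uc unfolding A_def by blast
  qed
  have Am[measurable]: "A k \<in> borel_measurable borel" for k unfolding A_def[abs_def] by measurable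
  have SN: "integrable lborel (S k)" "\<bar>(LBINT Y. S k Y) - (B (Suc k) - B k) * \<kappa> k\<bar> \<le> \<bar>B (Suc k) - B k\<bar> * (2 * \<omega>)" if k: "k < N" for k
  proof -
    have nearA: "\<bar>A (Suc k) Y - \<kappa> k\<bar> \<le> 2 * \<omega>" if "min (B k) (B (Suc k)) \<le> Y" "Y \<le> max (B k) (B (Suc k))" for Y
    proof -
      have "\<bar>Y - B k\<bar> \<le> 2 * h" using that B_step[of k] by linarith
      then show ?thesis using close[OF k, of "real k * \<tau>" Y] close[OF k, of "real k * \<tau>" "B k"] tau_pos h_pos unfolding \<kappa>_def by auto
    qed
    show "integrable lborel (S k)" "\<bar>(LBINT Y. S k Y) - (B (Suc k) - B k) * \<kappa> k\<bar> \<le> \<bar>B (Suc k) - B k\<bar> * (2 * \<omega>)"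
      unfolding S_def[abs_def] by (rule integral_step_difference[OF nearA]; simp)+
  qed
  have I3: "(LBINT p. f3 p) = - (\<Sum>k<N. F k * (LBINT Y. S k Y))"
    unfolding integral_fst_snd(2)[OF i3] inner using SN(1) by (simp add: Bochner_Integration.integral_sum)
  define r where "r t = rate t * amplitude t * \<psi> (t, \<gamma> t)" for t
  \<comment> \<open>The time integral with \<psi> frozen on each slab at its value at the boundary.
    It matches the sum of the boundary terms exactly, with error 2 M q (T + 1) \<omega> against r;
    the remaining 4 M q (T + 1) \<omega> is the error of \<open>SN\<close>.\<close>
  define s where "s t = indicator {0..<real N * \<tau>} t * (rate t * amplitude t * \<kappa> (n t))" for t
  have ra: "\<bar>rate t * amplitude t\<bar> \<le> 2 * q * M" for t
  proof -
    have "\<bar>rate t\<bar> \<le> 2 * h / \<tau>" unfolding rate_def abs_divide using B_step tau_pos by (simp add: divide_right_mono)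
    then show ?thesis unfolding abs_mult amplitude_def using F_bound tau_pos h_eq q0 by (intro mult_mono) auto
  qed
  have [measurable]: "r \<in> borel_measurable borel" "s \<in> borel_measurable borel"
    unfolding r_def[abs_def] s_def[abs_def] rate_def amplitude_def n_def by measurable
  have rz: "r t = 0" if "t \<notin> {0..<real N * \<tau>}" for t
    using supp[of t "\<gamma> t"] that N(1) by (cases "\<psi> (t, \<gamma> t) = 0") (auto simp: r_def)
  have sz: "s t = 0" if "t \<notin> {0..<real N * \<tau>}" for t using that by (simp add: s_def)
  have rs: "\<bar>rate t * amplitude t * z\<bar> \<le> 2 * q * M * C" if "\<bar>z\<bar> \<le> C" for t z
    unfolding abs_mult[of _ z] using ra that M0 q0 by (intro mult_mono) auto
  have ir: "integrable lborel r"
  proof (rule integrable_bounded_Icc[where a=0 and b="real N * \<tau>" and B="2 * q * M * C"])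
    show "\<bar>r t\<bar> \<le> 2 * q * M * C" for t unfolding r_def by (rule rs[OF C(2)])
  qed (use rz in auto)
  have iss: "integrable lborel s"
    by (rule integrable_bounded_Icc[where a=0 and b="real N * \<tau>" and B="2 * q * M * C"])
      (use sz rs[OF C(2)] M0 q0 C0 in \<open>auto simp: s_def \<kappa>_def A_def indicator_def\<close>)
  have E2: "\<bar>(LBINT t. r t) - (LBINT t. s t)\<bar> \<le> (T + 1) * (2 * q * M * \<omega>)"
  proof -
    have "\<bar>(LBINT t. r t) - (LBINT t. s t)\<bar> = \<bar>LBINT t. r t - s t\<bar>" using ir iss by simp
    also have "\<dots> \<le> (LBINT t. indicator {0..<real N * \<tau>} t * (2 * q * M * \<omega>))"
    proof (rule integral_abs_bound_integral)
      fix t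
      show "\<bar>r t - s t\<bar> \<le> indicator {0..<real N * \<tau>} t * (2 * q * M * \<omega>)"
      proof (cases "t \<in> {0..<real N * \<tau>}")
        case True
        then have t: "real (n t) * \<tau> \<le> t" "t < real (Suc (n t)) * \<tau>" using nb by auto
        then have "real (n t) * \<tau> < real N * \<tau>" using True by (auto intro: le_less_trans)
        then have "n t < N" using tau_pos by (simp add: mult_less_cancel_right)
        then have "\<bar>\<psi> (t, \<gamma> t) - \<kappa> (n t)\<bar> \<le> \<omega>" unfolding \<kappa>_def using t h_pos by (intro close) auto
        then have "\<bar>rate t * amplitude t\<bar> * \<bar>\<psi> (t, \<gamma> t) - \<kappa> (n t)\<bar> \<le> 2 * q * M * \<omega>" using ra M0 q0 by (intro mult_mono) auto
        then show ?thesis using True by (simp add: r_def s_def abs_mult[symmetric] right_diff_distrib)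
      qed (simp add: rz sz)
    qed (use ir iss tau_pos in \<open>auto intro!: integrable_mult_left integrable_real_indicator\<close>)
    also have "\<dots> = real N * \<tau> * (2 * q * M * \<omega>)" using tau_pos by simp
    also have "\<dots> \<le> (T + 1) * (2 * q * M * \<omega>)" using N(2) q0 M0 \<omega>0 by (intro mult_right_mono) auto
    finally show ?thesis .
  qed
  have Is: "(LBINT t. s t) = (\<Sum>k<N. F k * ((B (Suc k) - B k) * \<kappa> k))"
    proof (rule trans[OF set_integral_steps[OF tau_pos iss sz] sum.cong[OF refl]])
    fix k assume k: "k \<in> {..<N}"
    have "indicator (slab \<tau> k) t * s t = indicator (slab \<tau> k) t * ((B (Suc k) - B k) / \<tau> * F k * \<kappa> k)" for t
    proof (cases "t \<in> slab \<tau> k")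
      case True
      then have "real (Suc k) * \<tau> \<le> real N * \<tau>" "0 \<le> t" using k tau_pos by (auto intro: mult_right_mono order_trans[of _ "real k * \<tau>"])
      then show ?thesis using True step_index_eq[OF tau_pos, of k t] by (auto simp: s_def rate_def amplitude_def n_def simp del: of_nat_Suc)
    qed simp
    then have "(LBINT t. indicator (slab \<tau> k) t * s t) = \<tau> * ((B (Suc k) - B k) / \<tau> * F k * \<kappa> k)"
      using tau_pos by (simp add: algebra_simps)
    then show "(LBINT t. indicator (slab \<tau> k) t * s t) = F k * ((B (Suc k) - B k) * \<kappa> k)" using tau_pos by simp
  qed
  have "\<bar>(LBINT p. f3 p) + (LBINT t. s t)\<bar> = \<bar>\<Sum>k<N. F k * ((B (Suc k) - B k) * \<kappa> k - (LBINT Y. S k Y))\<bar>"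
    unfolding I3 Is sum_negf[symmetric] sum.distrib[symmetric] by (simp add: right_diff_distrib)
  also have "\<dots> \<le> (\<Sum>k<N. M * (4 * h * \<omega>))"
  proof (rule order_trans[OF sum_abs], rule sum_mono)
    fix k assume "k \<in> {..<N}"
    then have k: "k < N" by simp
    have "\<bar>B (Suc k) - B k\<bar> * (2 * \<omega>) \<le> 2 * h * (2 * \<omega>)" using B_step[of k] \<omega>0 by (intro mult_right_mono) auto
    then have "\<bar>(B (Suc k) - B k) * \<kappa> k - (LBINT Y. S k Y)\<bar> \<le> 4 * h * \<omega>" using SN(2)[OF k] by linarith
    then show "\<bar>F k * ((B (Suc k) - B k) * \<kappa> k - (LBINT Y. S k Y))\<bar> \<le> M * (4 * h * \<omega>)"
      unfolding abs_mult[of "F k"] by (intro mult_mono F_bound M0) auto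
  qed
  also have "\<dots> = real N * \<tau> * (4 * M * q * \<omega>)" by (simp add: h_eq)
  also have "\<dots> \<le> (T + 1) * (4 * M * q * \<omega>)" using N(2) M0 \<omega>0 q0 by (intro mult_right_mono) auto
  finally have "\<bar>(LBINT p. f3 p) + (LBINT t. r t)\<bar> \<le> 6 * M * q * (T + 1) * \<omega>" using E2 by (simp add: algebra_simps abs_le_iff)
  then show ?thesis using E1 unfolding f1_def r_def R_def by (simp add: algebra_simps abs_le_iff)
qed

end

section \<open>Equidistribution and weak convergence\<close>

text \<open>An error \<eta> N + K valid for all N, not only for large ones, is what a fixed time
  horizon needs: with N of order T / \<tau>, multiplication by h makes the first term of order
  \<eta> T and lets the second vanish with h.\<close>

lemma equidistributed_count:
  assumes a: "equidistributed a" and ab: "-1 \<le> \<alpha>" "\<alpha> \<le> \<beta>" "\<beta> \<le> 1" and e: "\<eta> > (0 :: real)"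
  shows "\<exists>K\<ge>(0::real). \<forall>N. \<bar>real (card {n\<in>{1..N}. \<alpha> \<le> a n \<and> a n \<le> \<beta>}) - (\<beta> - \<alpha>) / 2 * N\<bar> \<le> \<eta> * N + K"
proof -
  define k where "k N = real (card {n\<in>{1..N}. \<alpha> \<le> a n \<and> a n \<le> \<beta>})" for N
  have "(\<lambda>N. k N / real N) \<longlonglongrightarrow> (\<beta> - \<alpha>) / 2"
    using a ab unfolding equidistributed_def k_def by blast
  then have "eventually (\<lambda>N. dist (k N / real N) ((\<beta> - \<alpha>) / 2) < \<eta>) sequentially"
    using e by (rule tendstoD)
  then obtain N0 where N0: "\<And>N. N \<ge> N0 \<Longrightarrow> dist (k N / real N) ((\<beta> - \<alpha>) / 2) < \<eta>"
    by (auto simp: eventually_sequentially)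
  have "\<bar>k N - (\<beta> - \<alpha>) / 2 * N\<bar> \<le> \<eta> * N + 2 * real N0" for N
  proof (cases "N \<ge> N0 \<and> N > 0")
    case True
    then have "\<bar>k N / real N - (\<beta> - \<alpha>) / 2\<bar> \<le> \<eta>" using N0[of N] by (simp add: dist_real_def)
    moreover have "\<bar>k N - (\<beta> - \<alpha>) / 2 * N\<bar> = \<bar>k N / real N - (\<beta> - \<alpha>) / 2\<bar> * real N"
    proof -
      have "k N - (\<beta> - \<alpha>) / 2 * N = (k N / real N - (\<beta> - \<alpha>) / 2) * real N" using True by (simp add: field_simps)
      then show ?thesis by (simp add: abs_mult)
    qed
    ultimately have "\<bar>k N - (\<beta> - \<alpha>) / 2 * N\<bar> \<le> \<eta> * N" by (simp add: mult_right_mono)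
    then show ?thesis by simp
  next
    case False
    then have NN: "N \<le> N0" by auto
    have "card {n\<in>{1..N}. \<alpha> \<le> a n \<and> a n \<le> \<beta>} \<le> card {1..N}" by (rule card_mono) auto
    then have k: "0 \<le> k N" "k N \<le> real N" by (auto simp: k_def)
    have half: "0 \<le> (\<beta> - \<alpha>) / 2" "(\<beta> - \<alpha>) / 2 \<le> 1" using ab by auto
    have "0 \<le> (\<beta> - \<alpha>) / 2 * N" by (rule mult_nonneg_nonneg[OF half(1)]) simp
    moreover have "(\<beta> - \<alpha>) / 2 * N \<le> 1 * real N" by (rule mult_right_mono[OF half(2)]) simp
    ultimately have "\<bar>k N - (\<beta> - \<alpha>) / 2 * N\<bar> \<le> 2 * real N" using k by linarith
    also have "\<dots> \<le> \<eta> * N + 2 * real N0" using NN e by (simp add: add_increasing)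
    finally show ?thesis .
  qed
  then show ?thesis unfolding k_def by (intro exI[of _ "2 * real N0"]) auto
qed

lemma equidistributed_drift:
  assumes a: "equidistributed a" and c: "\<bar>c\<bar> < q" and e: "\<eta> > (0 :: real)"
  shows "\<exists>K\<ge>(0::real). \<forall>N. \<bar>of_int (\<Sum>k<N. if a (Suc k) * q \<le> c then 1 else -1) - c / q * real N\<bar> \<le> \<eta> * real N + K"
proof -
  have q: "q > 0" using c by linarith
  define l where "l = c / q"
  have ll: "\<bar>l\<bar> < 1" using c q by (simp add: l_def abs_if divide_simps split: if_splits)
  \<comment> \<open>A sum of signs is twice the number of positive ones minus the number of terms;
    the positive ones are the samples in [-1, c / q], of density (c / q + 1) / 2, so the mean sign
    is c / q.\<close>
  have sum: "(\<Sum>k<N. if a (Suc k) * q \<le> c then 1 else -1) = 2 * int (card {n\<in>{1..N}. -1 \<le> a n \<and> a n \<le> l}) - int N" for N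
  proof (induction N)
    case (Suc N)
    have "-1 < a (Suc N)" using a unfolding equidistributed_def by simp
    then have m: "a (Suc N) * q \<le> c \<longleftrightarrow> -1 \<le> a (Suc N) \<and> a (Suc N) \<le> l" using q by (auto simp: l_def field_simps)
    have "{n\<in>{1..Suc N}. -1 \<le> a n \<and> a n \<le> l} = (if a (Suc N) * q \<le> c then insert (Suc N) {n\<in>{1..N}. -1 \<le> a n \<and> a n \<le> l} else {n\<in>{1..N}. -1 \<le> a n \<and> a n \<le> l})"
      unfolding m by (auto simp: le_Suc_eq)
    then show ?case using Suc by simp
  qed simp
  obtain K where K: "K \<ge> 0" "\<And>N. \<bar>real (card {n\<in>{1..N}. -1 \<le> a n \<and> a n \<le> l}) - (l - -1) / 2 * N\<bar> \<le> \<eta> / 2 * N + K"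
  proof -
    have "-1 \<le> l" "l \<le> 1" "\<eta> / 2 > 0" using ll e by auto
    from equidistributed_count[OF a order_refl this] show ?thesis using that by blast
  qed
  have "\<bar>of_int (\<Sum>k<N. if a (Suc k) * q \<le> c then 1 else -1) - c / q * real N\<bar> \<le> \<eta> * real N + 2 * K" for N
  proof -
    have dbl: "\<bar>2 * x\<bar> \<le> \<eta> * real N + 2 * K" if "\<bar>x\<bar> \<le> \<eta> / 2 * real N + K" for x
      using that by (simp add: abs_mult)
    have eq: "of_int (\<Sum>k<N. if a (Suc k) * q \<le> c then 1 else -1) - c / q * real N
        = 2 * (real (card {n\<in>{1..N}. -1 \<le> a n \<and> a n \<le> l}) - (l - -1) / 2 * N)"
      unfolding sum l_def[symmetric] by (simp add: algebra_simps)
    show ?thesis unfolding eq by (rule dbl[OF K(2)])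
  qed
  then show ?thesis using K(1) by (intro exI[of _ "2 * K"]) auto
qed

text \<open>Convergence on intervals extends to Borel sets by a Dynkin argument, to simple functions
  by linearity and to integrable f by density, each time thanks to the uniform bound C.\<close>

lemma weak_star_convergence:
  fixes \<rho> :: "nat \<Rightarrow> real \<Rightarrow> real"
  assumes m[measurable]: "\<And>j. \<rho> j \<in> borel_measurable borel" "\<rho>0 \<in> borel_measurable borel"
    and bnd: "\<And>j t. \<bar>\<rho> j t\<bar> \<le> C" "\<And>t. \<bar>\<rho>0 t\<bar> \<le> C"
    and prim: "\<And>a b. 0 \<le> a \<Longrightarrow> a \<le> b \<Longrightarrow> b \<le> T \<Longrightarrow>
       (\<lambda>j. LBINT t. indicator {a..b} t * \<rho> j t) \<longlonglongrightarrow> (LBINT t. indicator {a..b} t * \<rho>0 t)"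
    and f: "integrable lborel f"
  shows "(\<lambda>j. LBINT t. indicator {0..T} t * \<rho> j t * f t) \<longlonglongrightarrow> (LBINT t. indicator {0..T} t * \<rho>0 t * f t)"
proof -
  \<comment> \<open>Index 0 holds the limit and the later indices the sequence, so that
    measurability and bounds are proved once for both.\<close>
  define r where "r j = (case j of 0 \<Rightarrow> \<rho>0 | Suc j \<Rightarrow> \<rho> j)" for j
  have r_simps: "r 0 = \<rho>0" "r (Suc j) = \<rho> j" for j by (simp_all add: r_def)
  have rm[measurable]: "r j \<in> borel_measurable borel" and rb: "\<bar>r j t\<bar> \<le> C" for j t
    using m bnd by (cases j; simp add: r_simps)+
  have C0: "C \<ge> 0" using bnd(2)[of 0] by linarith
  have int: "integrable lborel (\<lambda>t. indicator {0..T} t * r j t * f t)" if "integrable lborel f" for j and f :: "real \<Rightarrow> real"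
  proof (rule Bochner_Integration.integrable_bound)
    show "integrable lborel (\<lambda>t. C * norm (f t))" using that by simp
    have [measurable]: "f \<in> borel_measurable borel" using that by auto
    show "(\<lambda>t. indicator {0..T} t * r j t * f t) \<in> borel_measurable lborel" by measurable
    have "\<bar>r j t\<bar> * \<bar>f t\<bar> \<le> C * \<bar>f t\<bar>" for t using rb by (intro mult_right_mono) auto
    then show "AE t in lborel. norm (indicator {0..T} t * r j t * f t) \<le> norm (C * norm (f t))"
      using C0 by (intro AE_I2) (simp add: abs_mult indicator_def)
  qed
  have intA: "integrable lborel (\<lambda>t. indicator (A \<inter> {0..T}) t * r j t)" if "A \<in> sets borel" for A j
    by (rule integrable_bounded_Icc[of _ C 0 T]) (use rb[of j] C0 that in \<open>auto simp: indicator_def\<close>)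
  define I where "I j A = (LBINT t. indicator (A \<inter> {0..T}) t * r j t)" for j A
  have sets: "(\<lambda>j. I (Suc j) A) \<longlonglongrightarrow> I 0 A" if "A \<in> sets borel" for A
  proof -
    define E where "E = range (\<lambda>(a, b). {a..b :: real})"
    have E: "sigma_sets UNIV E = sets borel" unfolding E_def by (rule closed_intervals_generate)
    have "Int_stable E" unfolding E_def by (rule closed_intervals_generate)
    have "E \<subseteq> Pow UNIV" by simp
    have "A \<in> sigma_sets UNIV E" using that by (simp add: E)
    then show ?thesis
    proof (induction A rule: sigma_sets_induct_disjoint[OF \<open>Int_stable E\<close> \<open>E \<subseteq> Pow UNIV\<close>, consumes 1, case_names basic empty compl union])
      case (basic A)
      then obtain a b where A: "A = {a..b}" by (auto simp: E_def)
      have eq: "A \<inter> {0..T} = {max a 0..min b T}" by (auto simp: A)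
      show ?case unfolding I_def eq r_simps by (cases "max a 0 \<le> min b T") (use prim in auto)
    next
      case (compl A)
      then have A: "A \<in> sets borel" by (simp add: E)
      have eq: "I j (UNIV - A) = I j UNIV - I j A" for j
      proof -
        have "I j (UNIV - A) = (LBINT t. indicator (UNIV \<inter> {0..T}) t * r j t - indicator (A \<inter> {0..T}) t * r j t)"
          unfolding I_def by (intro Bochner_Integration.integral_cong) (auto simp: indicator_def)
        then show ?thesis unfolding I_def using intA[of UNIV j] intA[OF A, of j] by (simp add: Bochner_Integration.integral_diff)
      qed
      have "(\<lambda>j. I (Suc j) UNIV) \<longlonglongrightarrow> I 0 UNIV"
        using prim[of 0 T] by (cases "T \<ge> 0") (simp_all add: I_def r_simps)
      then show ?case unfolding eq by (intro tendsto_diff compl)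
    next
      \<comment> \<open>Limit and infinite sum are exchanged by Tannery's theorem with the summable
        majorant C times the measures of the disjoint pieces in [0, T].\<close>
      case (union A)
      have A: "A i \<in> sets borel" for i using union(2) by (auto simp: E)
      define B where "B i = A i \<inter> {0..T}" for i
      have B: "B i \<in> sets lborel" "i \<noteq> j \<Longrightarrow> B i \<inter> B j = {}" for i j
        using A union(1) by (auto simp: B_def disjoint_family_on_def)
      have UB: "(\<Union>i. B i) = (\<Union>i. A i) \<inter> {0..T}" by (auto simp: B_def)
      have sums: "I j (\<Union>i. A i) = (\<Sum>i. I j (A i))" for j
      proof -
        have "set_integrable lborel (\<Union>i. B i) (r j)" unfolding UB
          using intA[of "\<Union>i. A i" j] A by (simp add: set_integrable_def)
        from lebesgue_integral_countable_add[OF B this] show ?thesis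
          unfolding UB I_def set_lebesgue_integral_def by (simp add: B_def)
      qed
      have fin: "emeasure lborel (D \<inter> {0..T}) < \<infinity>" for D
        by (rule emeasure_bounded_finite) (rule bounded_subset[of "{0..T}"], auto)
      have summ: "summable (\<lambda>i. C * measure lborel (B i))"
      proof (rule summable_mult, rule sums_summable, rule measure_UNION)
        show "emeasure lborel (\<Union>i. B i) \<noteq> \<infinity>" unfolding UB using fin[of "\<Union>i. A i"] by simp
        show "disjoint_family B" using B(2) by (auto simp: disjoint_family_on_def)
      qed (use B in auto)
      have bnd': "norm (I j (A i)) \<le> C * measure lborel (B i)" for j i
      proof -
        have "\<bar>I j (A i)\<bar> \<le> (LBINT t. indicator (B i) t * C)" unfolding I_def
        proof (rule integral_abs_bound_integral[OF intA[OF A]])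
          show "integrable lborel (\<lambda>t. indicator (B i) t * C)"
            using B(1) fin[of "A i"] by (intro integrable_mult_left integrable_real_indicator) (auto simp: B_def)
          show "\<bar>indicator (A i \<inter> {0..T}) t * r j t\<bar> \<le> indicator (B i) t * C" for t
            using rb[of j t] by (auto simp: B_def indicator_def)
        qed
        then show ?thesis using B(1)[of i] by (simp add: mult.commute)
      qed
      have "eventually (\<lambda>j. summable (\<lambda>k. norm (I (Suc j) (A k)))) sequentially \<and> summable (\<lambda>k. norm (I 0 (A k))) \<and>
         (\<lambda>j. \<Sum>k. I (Suc j) (A k)) \<longlonglongrightarrow> (\<Sum>k. I 0 (A k))"
        by (rule tannerys_theorem[OF union(3) _ summ]) (use bnd' in \<open>auto intro: always_eventually\<close>)
      then show ?case unfolding sums by blast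
    qed (simp add: I_def)
  qed
  have "(\<lambda>j. LBINT t. indicator {0..T} t * r (Suc j) t * f t) \<longlonglongrightarrow> (LBINT t. indicator {0..T} t * r 0 t * f t)"
    using f
  proof (induction f rule: integrable_induct)
    case (base A c)
    have "(\<lambda>j. c * I (Suc j) A) \<longlonglongrightarrow> c * I 0 A" using base by (intro tendsto_intros sets) simp
    moreover have "c * I j A = (LBINT t. indicator {0..T} t * r j t * (indicator A t *\<^sub>R c))" for j
      unfolding I_def Bochner_Integration.integral_mult_right_zero[symmetric]
      by (intro Bochner_Integration.integral_cong) (auto simp: indicator_def)
    ultimately show ?case by simp
  next
    case (add f g)
    have "(LBINT t. indicator {0..T} t * r j t * (f t + g t)) = (LBINT t. indicator {0..T} t * r j t * f t) + (LBINT t. indicator {0..T} t * r j t * g t)" for j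
      using int[OF add.hyps(1), of j] int[OF add.hyps(2), of j] by (simp add: distrib_left)
    then show ?case by (simp only:) (intro tendsto_add add.IH)
  next
    case (lim f s)
    have fm[measurable]: "f \<in> borel_measurable lborel" "\<And>i. s i \<in> borel_measurable lborel" using lim.hyps by auto
    have "(\<lambda>i. LBINT t. norm (s i t - f t)) \<longlonglongrightarrow> (\<integral>t. 0 \<partial>(lborel :: real measure))"
    proof (rule integral_dominated_convergence[where w="\<lambda>t. 3 * norm (f t)"])
      show "integrable lborel (\<lambda>t. 3 * norm (f t))" using lim.hyps(4) by simp
      show "AE t in lborel. (\<lambda>i. norm (s i t - f t)) \<longlonglongrightarrow> 0"
        using lim.hyps(2) by (intro AE_I2 tendsto_norm_zero) (simp add: LIM_zero_iff)
      have "norm (s i t - f t) \<le> 3 * norm (f t)" for i t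
        using lim.hyps(3)[of t i] norm_triangle_ineq4[of "s i t" "f t"] by simp
      then show "AE t in lborel. norm (norm (s i t - f t)) \<le> 3 * norm (f t)" for i by simp
    qed measurable
    then have L1: "(\<lambda>i. C * (LBINT t. norm (s i t - f t))) \<longlonglongrightarrow> 0" by (auto intro: tendsto_mult_right_zero)
    have diff: "\<bar>(LBINT t. indicator {0..T} t * r j t * s i t) - (LBINT t. indicator {0..T} t * r j t * f t)\<bar> \<le> C * (LBINT t. norm (s i t - f t))" for j i
    proof -
      have "(LBINT t. indicator {0..T} t * r j t * s i t) - (LBINT t. indicator {0..T} t * r j t * f t) = (LBINT t. indicator {0..T} t * r j t * (s i t - f t))"
        using int[OF lim.hyps(1), of j i] int[OF lim.hyps(4), of j] by (simp add: right_diff_distrib)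
      moreover have "\<bar>\<dots>\<bar> \<le> (LBINT t. C * norm (s i t - f t))"
      proof (rule integral_abs_bound_integral[OF int])
        fix t
        have "\<bar>r j t\<bar> * \<bar>s i t - f t\<bar> \<le> C * \<bar>s i t - f t\<bar>" using rb by (intro mult_right_mono) auto
        then show "\<bar>indicator {0..T} t * r j t * (s i t - f t)\<bar> \<le> C * norm (s i t - f t)" using C0 by (simp add: abs_mult indicator_def)
      qed (use lim.hyps in auto)
      ultimately show ?thesis by simp
    qed
    show ?case
    proof (rule LIMSEQ_I)
      fix e :: real assume "e > 0"
      then have e: "e / 3 > 0" by simp
      obtain i where i: "C * (LBINT t. norm (s i t - f t)) < e / 3"
        using order_tendstoD(2)[OF L1 e] by (auto simp: eventually_sequentially)
      obtain j0 where j0: "\<And>j. j \<ge> j0 \<Longrightarrow> norm ((LBINT t. indicator {0..T} t * r (Suc j) t * s i t) - (LBINT t. indicator {0..T} t * r 0 t * s i t)) < e / 3"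
        using LIMSEQ_D[OF lim.IH[of i] e] by auto
      have "norm ((LBINT t. indicator {0..T} t * r (Suc j) t * f t) - (LBINT t. indicator {0..T} t * r 0 t * f t)) < e" if "j \<ge> j0" for j
        using j0[OF that] diff[of "Suc j" i] diff[of 0 i] i unfolding real_norm_def by linarith
      then show "\<exists>j0. \<forall>j\<ge>j0. norm ((LBINT t. indicator {0..T} t * r (Suc j) t * f t) - (LBINT t. indicator {0..T} t * r 0 t * f t)) < e" by blast
    qed
  qed
  then show ?thesis by (simp add: r_simps)
qed

text \<open>\<rho> F \<zeta> = \<rho> F0 \<zeta> + \<rho> (F - F0) \<zeta>. The first part converges
  by weak-star convergence. In the second, off Z the difference F - F0 tends to 0 in L1 while \<rho>
  is bounded; on Z nothing is known of the limit of F, but \<rho> tends to 0 in L1 there.\<close>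

lemma weak_strong_convergence:
  fixes \<rho> F :: "nat \<Rightarrow> real \<Rightarrow> real"
  assumes m[measurable]: "\<And>j. \<rho> j \<in> borel_measurable borel" "\<rho>0 \<in> borel_measurable borel"
      "\<And>j. F j \<in> borel_measurable borel" "F0 \<in> borel_measurable borel" "\<zeta> \<in> borel_measurable borel" "Z \<in> sets borel"
    and bnd: "\<And>j t. \<bar>\<rho> j t\<bar> \<le> C" "\<And>t. \<bar>\<rho>0 t\<bar> \<le> C"
    and prim: "\<And>a b. 0 \<le> a \<Longrightarrow> a \<le> b \<Longrightarrow> b \<le> T \<Longrightarrow>
       (\<lambda>j. LBINT t. indicator {a..b} t * \<rho> j t) \<longlonglongrightarrow> (LBINT t. indicator {a..b} t * \<rho>0 t)"
    and FM: "\<And>j t. \<bar>F j t\<bar> \<le> M" "\<And>t. \<bar>F0 t\<bar> \<le> M" and \<zeta>: "\<And>t. \<bar>\<zeta> t\<bar> \<le> L" "\<And>t. t \<notin> {0..T} \<Longrightarrow> \<zeta> t = 0"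
    and conv: "AE t in lborel. t \<in> {0..T} \<longrightarrow> t \<notin> Z \<longrightarrow> (\<lambda>j. F j t) \<longlonglongrightarrow> F0 t"
    and Z: "(\<lambda>j. LBINT t. indicator ({0..T} \<inter> Z) t * \<bar>\<rho> j t\<bar>) \<longlonglongrightarrow> 0"
  shows "(\<lambda>j. LBINT t. \<rho> j t * F j t * \<zeta> t) \<longlonglongrightarrow> (LBINT t. \<rho>0 t * F0 t * \<zeta> t)"
proof -
  have C0: "C \<ge> 0" and M0: "M \<ge> 0" using bnd(2)[of 0] FM(2)[of 0] by linarith+
  have mul: "\<bar>x * y\<bar> \<le> a * b" if "\<bar>x\<bar> \<le> a" "\<bar>y\<bar> \<le> b" for x y a b :: real
    unfolding abs_mult using that by (intro mult_mono) auto
  have fi: "integrable lborel (\<lambda>t. F0 t * \<zeta> t)"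
    by (rule integrable_bounded_Icc[of _ "M * L" 0 T]) (use mul[OF FM(2) \<zeta>(1)] \<zeta>(2) in auto)
  have i1: "integrable lborel (\<lambda>t. \<rho> j t * F j t * \<zeta> t)" and i2: "integrable lborel (\<lambda>t. \<rho> j t * F0 t * \<zeta> t)" for j
    by (rule integrable_bounded_Icc[of _ "C * M * L" 0 T]; use mul[OF mul[OF bnd(1) FM(1)] \<zeta>(1)] mul[OF mul[OF bnd(1) FM(2)] \<zeta>(1)] \<zeta>(2) in auto)+
  have ind: "indicator {0..T} t * x * (F0 t * \<zeta> t) = x * F0 t * \<zeta> t" for t x
    using \<zeta>(2)[of t] by (cases "t \<in> {0..T}") auto
  have A: "(\<lambda>j. LBINT t. \<rho> j t * F0 t * \<zeta> t) \<longlonglongrightarrow> (LBINT t. \<rho>0 t * F0 t * \<zeta> t)"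
    unfolding ind[symmetric] by (rule weak_star_convergence[OF m(1,2) bnd prim fi])
  define v where "v j t = indicator ({0..T} - Z) t * \<bar>F j t - F0 t\<bar>" for j t
  have FF: "\<bar>F j t - F0 t\<bar> \<le> 2 * M" for j t using FM(1)[of j t] FM(2)[of t] by linarith
  have vm[measurable]: "v j \<in> borel_measurable borel" for j unfolding v_def by measurable
  have v: "(\<lambda>j. LBINT t. v j t) \<longlonglongrightarrow> (\<integral>t. 0 \<partial>(lborel :: real measure))"
  proof (rule integral_dominated_convergence[where w="\<lambda>t. indicator {0..T} t * (2 * M)"])
    show "AE t in lborel. (\<lambda>j. v j t) \<longlonglongrightarrow> 0"
      using conv
    proof eventually_elim
      case (elim t)
      show ?case
      proof (cases "t \<in> {0..T} - Z")
        case True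
        then show ?thesis using elim by (simp add: v_def LIM_zero_iff tendsto_rabs_zero_iff)
      qed (simp add: v_def)
    qed
    show "AE t in lborel. norm (v j t) \<le> indicator {0..T} t * (2 * M)" for j
      using FF[of j] M0 by (intro AE_I2) (auto simp: v_def indicator_def)
    show "integrable lborel (\<lambda>t. indicator {0..T} t * (2 * M))"
      by (rule integrable_bounded_Icc[of _ "2 * M" 0 T]) (use M0 in \<open>auto simp: indicator_def\<close>)
  qed (use vm in auto)
  have vi: "integrable lborel (v j)" for j
    by (rule integrable_bounded_Icc[of _ "2 * M" 0 T]) (use FF[of j] M0 vm in \<open>auto simp: v_def indicator_def\<close>)
  have Zi: "integrable lborel (\<lambda>t. indicator ({0..T} \<inter> Z) t * \<bar>\<rho> j t\<bar>)" for j
    by (rule integrable_bounded_Icc[of _ C 0 T]) (use bnd C0 in \<open>auto simp: indicator_def\<close>)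
  have le: "\<bar>\<rho> j t * F j t * \<zeta> t - \<rho> j t * F0 t * \<zeta> t\<bar> \<le> C * L * v j t + 2 * M * L * (indicator ({0..T} \<inter> Z) t * \<bar>\<rho> j t\<bar>)" for j t
  proof -
    have e: "\<rho> j t * F j t * \<zeta> t - \<rho> j t * F0 t * \<zeta> t = \<rho> j t * (F j t - F0 t) * \<zeta> t" by (simp add: algebra_simps)
    consider "t \<notin> {0..T}" | "t \<in> {0..T} \<inter> Z" | "t \<in> {0..T} - Z" by blast
    then show ?thesis
    proof cases
      case 2
      then show ?thesis unfolding e using mul[OF mul[OF order_refl FF[of j t]] \<zeta>(1), of "\<rho> j t" t] by (simp add: v_def mult_ac)
    next
      case 3
      then show ?thesis unfolding e using mul[OF mul[OF bnd(1)[of j t] order_refl] \<zeta>(1), of "F j t - F0 t" t] by (simp add: v_def mult_ac)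
    qed (use \<zeta>(2) in \<open>auto simp: v_def\<close>)
  qed
  have "(\<lambda>j. (LBINT t. \<rho> j t * F j t * \<zeta> t) - (LBINT t. \<rho> j t * F0 t * \<zeta> t)) \<longlonglongrightarrow> 0"
  proof (rule Lim_null_comparison[OF always_eventually], rule allI)
    fix j
    have "\<bar>LBINT t. \<rho> j t * F j t * \<zeta> t - \<rho> j t * F0 t * \<zeta> t\<bar> \<le> (LBINT t. C * L * v j t + 2 * M * L * (indicator ({0..T} \<inter> Z) t * \<bar>\<rho> j t\<bar>))"
      by (rule integral_abs_bound_integral) (use i1 i2 vi Zi le in auto)
    then show "norm ((LBINT t. \<rho> j t * F j t * \<zeta> t) - (LBINT t. \<rho> j t * F0 t * \<zeta> t)) \<le> C * L * (LBINT t. v j t) + 2 * M * L * (LBINT t. indicator ({0..T} \<inter> Z) t * \<bar>\<rho> j t\<bar>)"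
      using i1[of j] i2[of j] vi[of j] Zi[of j] by simp
  next
    have "(\<lambda>j. C * L * (LBINT t. v j t) + 2 * M * L * (LBINT t. indicator ({0..T} \<inter> Z) t * \<bar>\<rho> j t\<bar>)) \<longlonglongrightarrow> C * L * (\<integral>t. 0 \<partial>(lborel :: real measure)) + 2 * M * L * 0"
      by (intro tendsto_intros v Z)
    then show "(\<lambda>j. C * L * (LBINT t. v j t) + 2 * M * L * (LBINT t. indicator ({0..T} \<inter> Z) t * \<bar>\<rho> j t\<bar>)) \<longlonglongrightarrow> 0" by simp
  qed
  from tendsto_add[OF this A] show ?thesis by simp
qed

section \<open>The curve at an approximate jump\<close>

text \<open>The squares p + \<rho> (e + [-\<kappa>, \<kappa>]^2), shrinking homothetically to p
  along the direction e: a sector seen through a sequence of boxes whose area is a fixed multiple of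
  \<rho>^2.\<close>

definition square :: "point \<Rightarrow> point \<Rightarrow> real \<Rightarrow> real \<Rightarrow> point set" where
  "square p e \<rho> \<kappa> = {fst p + \<rho> * (fst e - \<kappa>)..fst p + \<rho> * (fst e + \<kappa>)} \<times> {snd p + \<rho> * (snd e - \<kappa>)..snd p + \<rho> * (snd e + \<kappa>)}"

text \<open>If u stays away from z by d on all these squares, the scaled integral over the half ball
  cannot fall below d times the area ratio of square and ball radius squared.\<close>

lemma approx_limit_sector_False:
  assumes lim: "approx_limit u \<nu> p z" and \<nu>: "norm \<nu> = 1" and e: "2 * \<kappa> < e \<bullet> \<nu>" and \<kappa>: "\<kappa> > 0" and d: "d > 0"
    and \<rho>: "\<rho>0 > 0"
    and far: "\<And>\<rho>. 0 < \<rho> \<Longrightarrow> \<rho> < \<rho>0 \<Longrightarrow> AE q in lebesgue.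
       q \<in> square p e \<rho> \<kappa>
       \<longrightarrow> d \<le> norm (u q - z)"
  shows False
proof -
  \<comment> \<open>Points of the square are within \<rho> (norm e + 2 \<kappa>) of p, so the third
    \<kappa> gives strict inclusion in the ball of radius R \<rho>; 2 \<kappa> < e \<bullet> \<nu>
    keeps the square in the half ball.\<close>
  define R where "R = norm e + 3 * \<kappa>"
  have R0: "R > 0" using \<kappa> by (simp add: R_def add_nonneg_pos)
  define c where "c = d * (2 * \<kappa>)\<^sup>2 / R\<^sup>2"
  have c0: "c > 0" using d \<kappa> R0 by (simp add: c_def)
  have low: "ennreal c \<le> (\<integral>\<^sup>+q\<in>half_ball \<nu> p r. ennreal (norm (u q - z)) \<partial>lebesgue) / ennreal (r\<^sup>2)"
    if r: "0 < r" "r < R * \<rho>0" for r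
  proof -
    define \<rho> where "\<rho> = r / R"
    have \<rho>: "0 < \<rho>" "\<rho> < \<rho>0" "r = R * \<rho>" using r R0 by (auto simp: \<rho>_def field_simps)
    define B where "B = square p e \<rho> \<kappa>"
    have Bs: "B \<in> sets borel" by (simp add: B_def square_def borel_Times)
    have "emeasure (lborel \<Otimes>\<^sub>M lborel) B = ennreal (2 * \<kappa> * \<rho>) * ennreal (2 * \<kappa> * \<rho>)"
      unfolding B_def square_def using \<kappa> \<rho>(1)
      by (subst lborel.emeasure_pair_measure_Times) (auto simp: emeasure_lborel_Icc_eq algebra_simps)
    then have em: "emeasure lebesgue B = ennreal ((2 * \<kappa> * \<rho>)\<^sup>2)"
      using Bs \<kappa> \<rho>(1) by (simp add: lborel_prod ennreal_mult[symmetric] power2_eq_square)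
    have sub: "B \<subseteq> half_ball \<nu> p r"
    proof
      fix q assume q: "q \<in> B"
      define w where "w = (q - p) - \<rho> *\<^sub>R e"
      have w: "\<bar>fst w\<bar> \<le> \<rho> * \<kappa>" "\<bar>snd w\<bar> \<le> \<rho> * \<kappa>"
        using q by (auto simp: w_def B_def square_def mem_Times_iff algebra_simps abs_le_iff)
      have "norm w \<le> \<bar>fst w\<bar> + \<bar>snd w\<bar>" unfolding norm_prod_def using sqrt_sum_squares_le_sum_abs[of "fst w" "snd w"] by simp
      then have nw: "norm w \<le> 2 * (\<rho> * \<kappa>)" using w by linarith
      have qp: "q - p = \<rho> *\<^sub>R e + w" by (simp add: w_def)
      have "norm (q - p) \<le> \<rho> * norm e + 2 * (\<rho> * \<kappa>)"
        unfolding qp using norm_triangle_ineq[of "\<rho> *\<^sub>R e" w] nw \<rho>(1) by simp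
      also have "\<dots> < r" using \<kappa> \<rho> by (simp add: R_def algebra_simps)
      finally have 1: "q \<in> ball p r" by (simp add: dist_norm norm_minus_commute)
      have "\<bar>w \<bullet> \<nu>\<bar> \<le> norm w" using Cauchy_Schwarz_ineq2[of w \<nu>] \<nu> by simp
      then have "(q - p) \<bullet> \<nu> \<ge> \<rho> * (e \<bullet> \<nu>) - 2 * (\<rho> * \<kappa>)" unfolding qp using nw by (simp add: inner_add_left)
      moreover have "\<rho> * (e \<bullet> \<nu>) - 2 * (\<rho> * \<kappa>) > 0" using e \<rho>(1) by (simp add: mult_less_cancel_left algebra_simps)
      ultimately show "q \<in> half_ball \<nu> p r" using 1 by (simp add: half_ball_def)
    qed
    have "ennreal d * emeasure lebesgue B = (\<integral>\<^sup>+q. ennreal d * indicator B q \<partial>lebesgue)"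
      using Bs by (subst nn_integral_cmult_indicator) auto
    also have "\<dots> \<le> (\<integral>\<^sup>+q\<in>half_ball \<nu> p r. ennreal (norm (u q - z)) \<partial>lebesgue)"
    proof (rule nn_integral_mono_AE)
      show "AE q in lebesgue. ennreal d * indicator B q \<le> ennreal (norm (u q - z)) * indicator (half_ball \<nu> p r) q"
        using far[OF \<rho>(1,2)]
      proof (rule AE_mp, intro AE_I2 impI)
        fix q assume *: "q \<in> square p e \<rho> \<kappa>
          \<longrightarrow> d \<le> norm (u q - z)"
        show "ennreal d * indicator B q \<le> ennreal (norm (u q - z)) * indicator (half_ball \<nu> p r) q"
        proof (cases "q \<in> B")
          case True
          then have "d \<le> norm (u q - z)" using * by (simp add: B_def)
          moreover have "q \<in> half_ball \<nu> p r" using True sub by blast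
          ultimately show ?thesis using True by (simp add: ennreal_leI)
        qed simp
      qed
    qed
    finally have "ennreal (d * (2 * \<kappa> * \<rho>)\<^sup>2) \<le> (\<integral>\<^sup>+q\<in>half_ball \<nu> p r. ennreal (norm (u q - z)) \<partial>lebesgue)"
      using em d by (simp add: ennreal_mult)
    then have "ennreal (d * (2 * \<kappa> * \<rho>)\<^sup>2) / ennreal (r\<^sup>2) \<le> (\<integral>\<^sup>+q\<in>half_ball \<nu> p r. ennreal (norm (u q - z)) \<partial>lebesgue) / ennreal (r\<^sup>2)"
      by (rule divide_right_mono_ennreal)
    moreover have "ennreal (d * (2 * \<kappa> * \<rho>)\<^sup>2) / ennreal (r\<^sup>2) = ennreal c"
    proof -
      have "ennreal (d * (2 * \<kappa> * \<rho>)\<^sup>2) / ennreal (r\<^sup>2) = ennreal (d * (2 * \<kappa> * \<rho>)\<^sup>2 / r\<^sup>2)"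
        using d r by (intro divide_ennreal) auto
      also have "d * (2 * \<kappa> * \<rho>)\<^sup>2 / r\<^sup>2 = c" using \<rho> R0 by (simp add: c_def power_mult_distrib)
      finally show ?thesis .
    qed
    ultimately show ?thesis by simp
  qed
  have "eventually (\<lambda>r. (\<integral>\<^sup>+q\<in>half_ball \<nu> p r. ennreal (norm (u q - z)) \<partial>lebesgue) / ennreal (r\<^sup>2) < ennreal c) (at_right 0)"
    using lim c0 unfolding approx_limit_def by (intro order_tendstoD(2)) auto
  moreover have "eventually (\<lambda>r. r \<in> {0<..<R * \<rho>0}) (at_right 0)"
    using R0 \<rho> by (intro eventually_at_rightI[of _ "R * \<rho>0"]) auto
  ultimately have "eventually (\<lambda>r :: real. False) (at_right 0)"
  proof eventually_elim
    case (elim r)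
    then show ?case using low[of r] by (auto simp: not_le[symmetric])
  qed
  then show False by simp
qed

lemma sector_on_one_side_of_curve:
  fixes \<gamma> :: "real \<Rightarrow> real" and e :: point
  assumes der: "(\<gamma> has_real_derivative d) (at t)" and t: "t > 0" and s: "\<bar>s\<bar> = 1" "s * (snd e - d * fst e) > 0"
  obtains \<kappa>0 \<rho>0 where "\<kappa>0 > 0" "\<rho>0 > 0"
    "\<And>\<kappa> \<rho> q. \<kappa> \<le> \<kappa>0 \<Longrightarrow> 0 < \<rho> \<Longrightarrow> \<rho> < \<rho>0 \<Longrightarrow> q \<in> square (t, \<gamma> t) e \<rho> \<kappa> \<Longrightarrow> fst q > 0 \<and> s * (snd q - \<gamma> (fst q)) > 0"
proof -
  \<comment> \<open>m is the signed height of e above the tangent, to be scaled by \<rho>. A quarter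
    of it is spent on the width of the square, through \<open>\<kappa>0\<close>, and a quarter on
    the error of the linearisation, through r; the rest stays positive.\<close>
  define m A where "m = s * (snd e - d * fst e)" and "A = \<bar>fst e\<bar> + 1"
  have m: "m > 0" and A: "A > 0" using s by (simp_all add: m_def A_def)
  define \<kappa>0 where "\<kappa>0 = min 1 (m / (4 * (1 + \<bar>d\<bar>)))"
  have "\<kappa>0 \<le> m / (4 * (1 + \<bar>d\<bar>))" unfolding \<kappa>0_def by (rule min.cobounded2)
  then have "\<kappa>0 * (1 + \<bar>d\<bar>) \<le> m / 4" by (simp add: pos_le_divide_eq mult.commute mult.left_commute)
  moreover have "\<kappa>0 > 0" "\<kappa>0 \<le> 1" using m by (auto simp: \<kappa>0_def)
  ultimately have \<kappa>0: "\<kappa>0 > 0" "\<kappa>0 \<le> 1" "\<kappa>0 * (1 + \<bar>d\<bar>) \<le> m / 4" by blast+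
  have "m / (4 * A) > 0" using m A by simp
  then obtain r where r: "r > 0" "\<And>x. \<bar>x - t\<bar> < r \<Longrightarrow> \<bar>\<gamma> x - \<gamma> t - d * (x - t)\<bar> \<le> m / (4 * A) * \<bar>x - t\<bar>"
    using der unfolding has_field_derivative_def has_derivative_at_alt by auto
  show thesis
  proof (rule that[OF \<kappa>0(1)])
    show "min r t / A > 0" using r(1) t A by simp
    fix \<kappa> \<rho> :: real and q assume \<kappa>: "\<kappa> \<le> \<kappa>0" and \<rho>: "0 < \<rho>" "\<rho> < min r t / A"
      and q: "q \<in> square (t, \<gamma> t) e \<rho> \<kappa>"
    define a b where "a = (fst q - t) / \<rho>" and "b = (snd q - \<gamma> t) / \<rho>"
    have qa: "fst q = t + \<rho> * a" "snd q = \<gamma> t + \<rho> * b" using \<rho> by (auto simp: a_def b_def)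
    have ab: "\<bar>a - fst e\<bar> \<le> \<kappa>0" "\<bar>b - snd e\<bar> \<le> \<kappa>0"
      using q \<kappa> \<rho>(1) unfolding square_def mem_Times_iff fst_conv snd_conv qa by (auto simp: abs_le_iff mult_le_cancel_left)
    have "\<bar>a\<bar> \<le> A" using ab(1) \<kappa>0(2) by (simp add: A_def)
    then have \<rho>a: "\<bar>\<rho> * a\<bar> \<le> \<rho> * A" unfolding abs_mult using \<rho>(1) by (intro mult_mono) auto
    have rt: "\<bar>fst q - t\<bar> < r" "\<bar>fst q - t\<bar> < t" using \<rho>a \<rho>(2) A by (auto simp: qa pos_less_divide_eq)
    have "\<bar>\<gamma> (fst q) - \<gamma> t - d * (\<rho> * a)\<bar> \<le> m / (4 * A) * \<bar>\<rho> * a\<bar>" using r(2)[OF rt(1)] by (simp add: qa)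
    also have "\<dots> \<le> m / (4 * A) * (\<rho> * A)" using \<rho>a m A by (intro mult_left_mono) auto
    finally have \<gamma>: "\<bar>\<gamma> (fst q) - \<gamma> t - d * (\<rho> * a)\<bar> \<le> \<rho> * (m / 4)" using A by (simp add: mult.commute)
    have "\<bar>(b - snd e) - d * (a - fst e)\<bar> \<le> \<bar>b - snd e\<bar> + \<bar>d\<bar> * \<bar>a - fst e\<bar>"
      unfolding abs_mult[symmetric] by (rule abs_triangle_ineq4)
    also have "\<dots> \<le> \<kappa>0 + \<bar>d\<bar> * \<kappa>0" using ab by (intro add_mono mult_left_mono) auto
    also have "\<dots> \<le> m / 4" using \<kappa>0(3) by (simp add: algebra_simps)
    finally have "\<bar>s * ((b - snd e) - d * (a - fst e))\<bar> \<le> m / 4" using s(1) by (simp only: abs_mult) simp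
    moreover have "s * (b - d * a) = m + s * ((b - snd e) - d * (a - fst e))" by (simp add: m_def algebra_simps)
    ultimately have "\<rho> * (3 * m / 4) \<le> \<rho> * (s * (b - d * a))" using \<rho>(1) by (intro mult_left_mono) auto
    moreover have "\<bar>s * (\<gamma> (fst q) - \<gamma> t - d * (\<rho> * a))\<bar> \<le> \<rho> * (m / 4)" using \<gamma> s(1) by (simp add: abs_mult)
    moreover have "s * (snd q - \<gamma> (fst q)) = \<rho> * (s * (b - d * a)) - s * (\<gamma> (fst q) - \<gamma> t - d * (\<rho> * a))"
      by (simp add: qa algebra_simps)
    moreover have "\<rho> * m > 0" "\<rho> * (3 * m / 4) = 3 / 4 * (\<rho> * m)" "\<rho> * (m / 4) = 1 / 4 * (\<rho> * m)" using \<rho>(1) m by simp_all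
    ultimately have "s * (snd q - \<gamma> (fst q)) > 0" by linarith
    then show "fst q > 0 \<and> s * (snd q - \<gamma> (fst q)) > 0" using rt(2) by (auto simp: abs_less_iff)
  qed
qed

text \<open>Otherwise a whole sector lies on the right of the tangent line of the jump but on the wrong side of the curve.\<close>

lemma jump_normal_slope:
  fixes \<gamma> :: "real \<Rightarrow> real"
  assumes jump: "approx_jump u (t, \<gamma> t) \<nu> um up" and \<nu>: "snd \<nu> > 0"
    and phases: "um \<in> phase1 wM \<and> up \<in> phase3 wm \<or> um \<in> phase3 wm \<and> up \<in> phase1 wM"
    and wMm: "wM < wm" and der: "(\<gamma> has_real_derivative d) (at t)"
    and ae: "AE q in lebesgue. fst q > 0 \<longrightarrow> (snd q < \<gamma> (fst q) \<longrightarrow> snd (u q) \<le> wM) \<and> (snd q > \<gamma> (fst q) \<longrightarrow> wm \<le> snd (u q))"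
  shows "d \<le> - fst \<nu> / snd \<nu>"
proof (rule ccontr)
  define V where "V = - fst \<nu> / snd \<nu>"
  assume "\<not> d \<le> - fst \<nu> / snd \<nu>"
  then have Vd: "V < d" by (simp add: V_def)
  have t0: "t > 0" and n1: "norm \<nu> = 1" and lim: "approx_limit u \<nu> (t, \<gamma> t) up"
    using jump by (auto simp: approx_jump_def half_plane_def)
  have f\<nu>: "fst \<nu> = - V * snd \<nu>" using \<nu> by (simp add: V_def)
  \<comment> \<open>If \<open>up\<close> is in phase 3, a direction with slope midway between V and
    d lies on the positive side of the jump but below the curve, where u is in phase 1. If
    \<open>up\<close> is in phase 1, the vertical direction lies on the positive side and above the
    curve, where u is in phase 3. Either way u stays away from \<open>up\<close>.\<close>
  obtain e :: point and s :: real where es: "s * (snd e - d * fst e) > 0" "e \<bullet> \<nu> > 0" "s = -1 \<and> wm \<le> snd up \<or> s = 1 \<and> snd up \<le> wM"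
  proof (cases "up \<in> phase3 wm")
    case True
    have "(1, (V + d) / 2) \<bullet> \<nu> = (d - V) * snd \<nu> / 2" by (simp add: inner_prod_def f\<nu> algebra_simps)
    moreover have "(d - V) * snd \<nu> > 0" using Vd \<nu> by simp
    ultimately show thesis using True Vd by (intro that[of "-1" "(1, (V + d) / 2)"]) (auto simp: phase3_def field_simps)
  next
    case False
    then show thesis using phases \<nu> by (intro that[of 1 "(0, 1)"]) (auto simp: phase1_def inner_prod_def)
  qed
  have s: "\<bar>s\<bar> = 1" using es(3) by auto
  obtain \<kappa>0 \<rho>0 where side: "\<kappa>0 > 0" "\<rho>0 > 0"
    "\<And>\<kappa> \<rho> q. \<kappa> \<le> \<kappa>0 \<Longrightarrow> 0 < \<rho> \<Longrightarrow> \<rho> < \<rho>0 \<Longrightarrow> q \<in> square (t, \<gamma> t) e \<rho> \<kappa> \<Longrightarrow> fst q > 0 \<and> s * (snd q - \<gamma> (fst q)) > 0"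
    using sector_on_one_side_of_curve[OF der t0 s es(1)] by metis
  define \<kappa> where "\<kappa> = min \<kappa>0 (e \<bullet> \<nu> / 4)"
  have \<kappa>: "\<kappa> > 0" "\<kappa> \<le> \<kappa>0" "2 * \<kappa> < e \<bullet> \<nu>" using side(1) es(2) by (auto simp: \<kappa>_def)
  have big0: "\<bar>snd w\<bar> \<le> norm w" for w :: "real \<times> real"
    using norm_snd_le[of "snd w" "fst w"] by simp
  show False
  proof (rule approx_limit_sector_False[OF lim n1, where e=e and \<kappa>=\<kappa> and d="wm - wM" and ?\<rho>0.0=\<rho>0])
    fix \<rho> :: real assume \<rho>: "0 < \<rho>" "\<rho> < \<rho>0"
    show "AE q in lebesgue. q \<in> square (t, \<gamma> t) e \<rho> \<kappa> \<longrightarrow> wm - wM \<le> norm (u q - up)"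
      using ae
    proof (rule AE_mp, intro AE_I2 impI)
      fix q assume q0: "fst q > 0 \<longrightarrow> (snd q < \<gamma> (fst q) \<longrightarrow> snd (u q) \<le> wM) \<and> (snd q > \<gamma> (fst q) \<longrightarrow> wm \<le> snd (u q))"
        and q: "q \<in> square (t, \<gamma> t) e \<rho> \<kappa>"
      have "fst q > 0 \<and> s * (snd q - \<gamma> (fst q)) > 0" by (rule side(3)[OF \<kappa>(2) \<rho> q])
      then have "wm - wM \<le> \<bar>snd (u q) - snd up\<bar>" using es(3) q0 by auto
      then show "wm - wM \<le> norm (u q - up)" using big0[of "u q - up"] by simp
    qed
  qed (use wMm \<kappa> side in auto)
qed

text \<open>The stress is a linear function plus two hinges with kinks at wM and wm, so its
  primitive W is a combination of squares. Beyond wm the terms linear in w cancel since m is the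
  slope of the chord, and the constants combine to (k1 - k3) / 2 * wM * wm.\<close>

lemma entropy_phases:
  assumes wM: "0 < wM" and wMm: "wM < wm"
  shows "w \<le> wM \<Longrightarrow> entropy k1 k3 wM wm (v, w) = k1 * w\<^sup>2 / 2 + v\<^sup>2 / 2"
    "wm \<le> w \<Longrightarrow> entropy k1 k3 wM wm (v, w) = k3 * w\<^sup>2 / 2 + (k1 - k3) / 2 * wM * wm + v\<^sup>2 / 2"
proof -
  define m where "m = (k3 * wm - k1 * wM) / (wm - wM)"
  have mm: "m * (wm - wM) = k3 * wm - k1 * wM" using wMm by (simp add: m_def)
  have s: "stress k1 k3 wM wm y = k1 * y + (m - k1) * max 0 (y - wM) + (k3 - m) * max 0 (y - wm)" for y
  proof -
    consider "y \<le> wM" | "wM < y" "y < wm" | "wm \<le> y" by linarith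
    then show ?thesis
    proof cases
      case 3
      then have "stress k1 k3 wM wm y = k3 * y" using wMm by (simp add: stress_def)
      moreover have "k1 * y + (m - k1) * max 0 (y - wM) + (k3 - m) * max 0 (y - wm) = k3 * y + (m * (wm - wM) - (k3 * wm - k1 * wM))"
        using 3 wMm by (simp add: algebra_simps)
      ultimately show ?thesis using mm by simp
    qed (use wMm in \<open>auto simp: stress_def m_def[symmetric] algebra_simps\<close>)
  qed
  define W where "W y = k1 * (y\<^sup>2 / 2) + (m - k1) * ((max 0 (y - wM))\<^sup>2 / 2) + (k3 - m) * ((max 0 (y - wm))\<^sup>2 / 2)" for y
  have der: "(W has_real_derivative stress k1 k3 wM wm y) (at y)" for y
    unfolding W_def[abs_def] s
    by (intro DERIV_add DERIV_cmult has_derivative_positive_part_square) (auto intro!: derivative_eq_intros)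
  have "continuous_on S (stress k1 k3 wM wm)" for S
    unfolding s[abs_def] by (intro continuous_intros)
  then have I: "(LBINT y=0..ereal w. stress k1 k3 wM wm y) = W w - W 0" for w
    unfolding zero_ereal_def
    by (intro interval_integral_FTC_finite) (use der in \<open>auto simp: has_real_derivative_iff_has_vector_derivative intro: has_vector_derivative_at_within\<close>)
  have W0: "W 0 = 0" using wM wMm by (simp add: W_def)
  have "w \<le> wM \<Longrightarrow> W w = k1 * w\<^sup>2 / 2" using wMm by (simp add: W_def)
  then show "w \<le> wM \<Longrightarrow> entropy k1 k3 wM wm (v, w) = k1 * w\<^sup>2 / 2 + v\<^sup>2 / 2"
    by (simp add: entropy_def I W0)
  assume w: "wm \<le> w"
  have "W w = k3 * w\<^sup>2 / 2 + (k1 - k3) / 2 * wM * wm"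
  proof -
    have "2 * W w = k1 * w\<^sup>2 + (m - k1) * (w - wM)\<^sup>2 + (k3 - m) * (w - wm)\<^sup>2" using w wMm by (simp add: W_def)
    also have "\<dots> = k3 * w\<^sup>2 + 2 * w * (m * (wm - wM) + k1 * wM - k3 * wm) - k1 * wM\<^sup>2 + k3 * wm\<^sup>2 - (m * (wm - wM)) * (wm + wM)"
      by (simp add: power2_eq_square algebra_simps)
    also have "\<dots> = k3 * w\<^sup>2 + (k1 - k3) * wM * wm" unfolding mm by (simp add: power2_eq_square algebra_simps)
    finally show ?thesis by simp
  qed
  then show "entropy k1 k3 wM wm (v, w) = k3 * w\<^sup>2 / 2 + (k1 - k3) / 2 * wM * wm + v\<^sup>2 / 2"
    by (simp add: entropy_def I W0)
qed

locale bounded_glimm = glimm +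
  fixes M :: real
  assumes M0: "0 \<le> M"
    and cell_M: "\<And>n m. even (m + int n) \<Longrightarrow> bounded_state M (cell n m)"
    and um_M: "\<And>n. bounded_state M (um n)" and up_M: "\<And>n. bounded_state M (up n)"

context phase_model
begin

definition "QM M = M\<^sup>2 + 2 * K0"

lemma Q_bound:
  assumes "bounded_state M u"
  shows "\<bar>QL c1 u\<bar> \<le> QM M" "\<bar>QL (- c1) u\<bar> \<le> QM M" "\<bar>QR c3 u\<bar> \<le> QM M" "\<bar>QR (- c3) u\<bar> \<le> QM M"
proof -
  have sq: "\<bar>x\<^sup>2\<bar> \<le> M\<^sup>2" if "\<bar>x\<bar> \<le> M" for x :: real
    using power_mono[OF that, of 2] by simp
  have "u \<in> phase1 wM \<or> u \<in> phase3 wm" using assms by (auto simp: bounded_state_def)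
  moreover have "\<bar>QL c1 u\<bar> \<le> QM M \<and> \<bar>QL (- c1) u\<bar> \<le> QM M \<and> \<bar>QR c3 u\<bar> \<le> QM M \<and> \<bar>QR (- c3) u\<bar> \<le> QM M" if p: "u \<in> phase1 wM"
    using bounded_stateD(1)[OF assms p] p K0_pos sq[of "riemann_inv c1 u"] sq[of "riemann_inv (- c1) u"]
    by (simp add: Q_phase QM_def)
  moreover have "\<bar>QL c1 u\<bar> \<le> QM M \<and> \<bar>QL (- c1) u\<bar> \<le> QM M \<and> \<bar>QR c3 u\<bar> \<le> QM M \<and> \<bar>QR (- c3) u\<bar> \<le> QM M" if p: "u \<in> phase3 wm"
    using bounded_stateD(2)[OF assms p] p K0_pos sq[of "riemann_inv c3 u"] sq[of "riemann_inv (- c3) u"]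
    by (simp add: Q_phase QM_def)
  ultimately show "\<bar>QL c1 u\<bar> \<le> QM M" "\<bar>QL (- c1) u\<bar> \<le> QM M" "\<bar>QR c3 u\<bar> \<le> QM M" "\<bar>QR (- c3) u\<bar> \<le> QM M"
    by blast+
qed

lemma Q_measurable: "QL c \<in> borel_measurable borel" "QR c \<in> borel_measurable borel"
proof -
  have [measurable]: "riemann_inv c \<in> borel_measurable borel" unfolding riemann_inv_def[abs_def] by measurable
  show "QL c \<in> borel_measurable borel" "QR c \<in> borel_measurable borel"
    unfolding QL_def[abs_def] QR_def[abs_def] by measurable
qed

text \<open>The case distinction in \<open>QL\<close> and \<open>QR\<close> is locally constant away
  from the threshold, and there both are polynomials in the state.\<close>

lemma Q_continuous:
  assumes "u \<noteq> wc" "(f \<longlongrightarrow> z) F" "snd z = u"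
  shows "((\<lambda>x. QL c (f x)) \<longlongrightarrow> QL c z) F" "((\<lambda>x. QR c (f x)) \<longlongrightarrow> QR c z) F"
proof -
  have s: "((\<lambda>x. snd (f x)) \<longlongrightarrow> snd z) F" "((\<lambda>x. fst (f x)) \<longlongrightarrow> fst z) F" using assms by (auto intro: tendsto_intros)
  have i: "((\<lambda>x. riemann_inv c (f x)) \<longlongrightarrow> riemann_inv c z) F"
    unfolding riemann_inv_def by (intro tendsto_intros s)
  have i2: "((\<lambda>x. (riemann_inv c (f x))\<^sup>2) \<longlongrightarrow> (riemann_inv c z)\<^sup>2) F" by (intro tendsto_intros i)
  have i3: "((\<lambda>x. (riemann_inv c (f x))\<^sup>2 + 2 * K0) \<longlongrightarrow> (riemann_inv c z)\<^sup>2 + 2 * K0) F" by (intro tendsto_intros i)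
  consider "snd z < wc" | "snd z > wc" using assms by fastforce
  then have "((\<lambda>x. QL c (f x)) \<longlongrightarrow> QL c z) F \<and> ((\<lambda>x. QR c (f x)) \<longlongrightarrow> QR c z) F"
  proof cases
    case 1
    then have e: "eventually (\<lambda>x. snd (f x) < wc) F" by (rule order_tendstoD(2)[OF s(1)])
    then have "eventually (\<lambda>x. (riemann_inv c (f x))\<^sup>2 = QL c (f x)) F" "eventually (\<lambda>x. 0 = QR c (f x)) F"
      by (eventually_elim, simp add: QL_def QR_def)+
    then show ?thesis using i2 1 by (auto simp: QL_def[of c z] QR_def[of c z] intro: Lim_transform_eventually)
  next
    case 2
    then have e: "eventually (\<lambda>x. snd (f x) > wc) F" by (rule order_tendstoD(1)[OF s(1)])
    then have "eventually (\<lambda>x. 0 = QL c (f x)) F" "eventually (\<lambda>x. (riemann_inv c (f x))\<^sup>2 + 2 * K0 = QR c (f x)) F"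
      by (eventually_elim, simp add: QL_def QR_def)+
    then show ?thesis using i3 2 by (auto simp: QL_def[of c z] QR_def[of c z] intro: Lim_transform_eventually)
  qed
  then show "((\<lambda>x. QL c (f x)) \<longlongrightarrow> QL c z) F" "((\<lambda>x. QR c (f x)) \<longlongrightarrow> QR c z) F" by blast+
qed

end

context bounded_glimm
begin

lemma uh_M: "t \<ge> 0 \<Longrightarrow> bounded_state M (uh (t, x))"
  by (rule uh_bounded[OF cell_M um_M up_M])

lemma transported_tracked:
  assumes tr: "tracked Q c F" and c: "\<bar>c\<bar> \<le> c1"
    and Qm[measurable]: "Q \<in> borel_measurable borel" and QB: "\<And>u. bounded_state M u \<Longrightarrow> \<bar>Q u\<bar> \<le> B"
    and FB: "\<And>n. \<bar>F n\<bar> \<le> B"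
  shows "transported h \<tau> q c B (\<lambda>n x. Q (uh (real n * \<tau>, x))) F b (shift c) (\<lambda>p. Q (uh p))"
proof
  show "0 < h" "0 < \<tau>" "h = q * \<tau>" by (fact h_pos tau_pos h_eq)+
  fix n :: nat and x t :: real
  show "(\<lambda>x. Q (uh (real n * \<tau>, x))) \<in> borel_measurable borel"
    using measurable_comp[OF level_measurable[of n] Qm] by (simp add: comp_def)
  show "\<bar>Q (uh (real n * \<tau>, x))\<bar> \<le> B" by (rule QB[OF uh_M]) (use tau_pos in simp)
  show "\<bar>F n\<bar> \<le> B" by (rule FB)
  show "0 \<le> B" using FB[of 0] abs_ge_zero[of "F 0"] by linarith
  show "Q (uh (real (Suc n) * \<tau>, x)) = Q (uh (real n * \<tau>, x - of_int (shift c n) * h)) + F n *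
     ((if x < of_int (b (Suc n)) * h then 1 else 0) - (if x < of_int (b n + shift c n) * h then 1 else 0))"
    by (rule tracked_Suc[OF tr])
  show "\<bar>shift c n\<bar> \<le> 1" by (simp add: shift_def)
  show "\<bar>b (Suc n) - b n\<bar> \<le> 1" by (simp add: b_Suc)
  show "(\<lambda>p. if fst p > 0 then Q (uh p) else 0) \<in> borel_measurable borel"
  proof -
    have [measurable]: "(\<lambda>p. Q (if fst p > 0 then uh p else 0)) \<in> borel_measurable borel"
      using measurable_comp[OF uh_measurable Qm] by (simp add: comp_def)
    have "(\<lambda>p. if fst p > 0 then Q (uh p) else 0) = (\<lambda>p. if fst p > 0 then Q (if fst p > 0 then uh p else 0) else 0)" by auto
    then show ?thesis by simp
  qed
  show "\<bar>Q (uh (t, x))\<bar> \<le> B" if "t > 0" by (rule QB[OF uh_M]) (use that in simp)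
  show "Q (uh (t, x)) = Q (uh (real n * \<tau>, x - c * (t - real n * \<tau>)))"
    if "real n * \<tau> < t" "t < real (Suc n) * \<tau>" "\<bar>x - of_int (b n) * h\<bar> > h"
    by (rule tracked_strip[OF tr c that])
qed

end

section \<open>The limit of the phase boundaries\<close>

locale glimm_family = phase_model +
  fixes q :: real and a :: "nat \<Rightarrow> real" and u0 :: "real \<Rightarrow> state" and \<tau> h :: "nat \<Rightarrow> real"
    and uh :: "nat \<Rightarrow> point \<Rightarrow> state" and \<gamma>h :: "nat \<Rightarrow> real \<Rightarrow> real" and u :: "point \<Rightarrow> state" and \<gamma> :: "real \<Rightarrow> real" and M :: real
  assumes each: "\<And>j. bounded_glimm k1 k3 wM wm \<phi> (\<tau> j) (h j) q a u0 (uh j) (\<gamma>h j) M"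
    and equi: "equidistributed a" and h0: "h \<longlonglongrightarrow> 0"
    and L1: "L1_loc_limit uh u" and lim: "phase_boundary_limit \<gamma>h \<gamma>"
begin

sublocale G: bounded_glimm k1 k3 wM wm \<phi> "\<tau> j" "h j" q a u0 "uh j" "\<gamma>h j" M for j
  by (rule each)

lemma q_gt: "c1 < q" "0 < q" by (fact G.q_gt G.q_pos)+

lemma tau0: "\<tau> \<longlonglongrightarrow> 0"
proof -
  have "(\<lambda>j. h j / q) \<longlonglongrightarrow> 0 / q" by (intro tendsto_intros h0) (use q_gt in auto)
  moreover have "(\<lambda>j. h j / q) = \<tau>" using G.h_eq q_gt by (auto simp: fun_eq_iff field_simps)
  ultimately show ?thesis by simp
qed

abbreviation "ix j t \<equiv> step_index (\<tau> j) t"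

lemma ix:
  assumes "t \<ge> 0"
  shows "real (ix j t) * \<tau> j \<le> t" "t < real (Suc (ix j t)) * \<tau> j" "t - \<tau> j < real (ix j t) * \<tau> j"
  using step_index_bounds[OF G.tau_pos[of j] assms] by (auto simp: algebra_simps)

lemma \<gamma>_tendsto: "t \<ge> 0 \<Longrightarrow> (\<lambda>j. \<gamma>h j t) \<longlonglongrightarrow> \<gamma> t"
proof -
  assume t: "t \<ge> 0"
  have "uniform_limit {0..t + 1} \<gamma>h \<gamma> sequentially"
  proof -
    have "\<forall>T>0. uniform_limit {0..T} \<gamma>h \<gamma> sequentially" using lim unfolding phase_boundary_limit_def by (elim conjE)
    then show ?thesis using t by simp
  qed
  then show ?thesis by (rule tendsto_uniform_limitI) (use t in auto)
qed

lemma \<gamma>_uniform: "T > 0 \<Longrightarrow> e > 0 \<Longrightarrow> eventually (\<lambda>j. \<forall>t\<in>{0..T}. \<bar>\<gamma>h j t - \<gamma> t\<bar> < e) sequentially"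
proof -
  assume T: "T > 0" and e: "e > 0"
  have "uniform_limit {0..T} \<gamma>h \<gamma> sequentially" using lim T unfolding phase_boundary_limit_def by blast
  from uniform_limitD[OF this e] show ?thesis by (simp add: dist_real_def)
qed

text \<open>On the grid the boundary moves by h = q \<tau> per step, and up to one extra step may
  occur between s and t. Off the grid \<open>\<gamma>h\<close> is within h of its grid value at each
  end, which makes 3 h altogether.\<close>

lemma \<gamma>h_lipschitz:
  assumes "0 \<le> s" "s \<le> t"
  shows "\<bar>\<gamma>h j t - \<gamma>h j s\<bar> \<le> 3 * h j + q * (t - s)"
proof -
  have le: "ix j s \<le> ix j t"
    unfolding step_index_def using assms G.tau_pos[of j] by (intro nat_mono floor_mono divide_right_mono) auto
  then obtain k where k: "ix j t = ix j s + k" using le_Suc_ex by blast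
  have bl: "\<bar>real_of_int (G.b j (ix j t) - G.b j (ix j s))\<bar> \<le> real k"
    using G.b_lipschitz[of j "ix j s" k] unfolding k by linarith
  have "real k * \<tau> j \<le> t - s + \<tau> j" using ix[of s j] ix[of t j] assms unfolding k by (auto simp: algebra_simps)
  then have kh: "real k * h j \<le> q * (t - s) + h j"
    using mult_left_mono[of "real k * \<tau> j" "t - s + \<tau> j" q] q_gt by (simp add: G.h_eq[of j] algebra_simps)
  have "\<bar>(of_int (G.b j (ix j t)) - of_int (G.b j (ix j s))) * h j\<bar> \<le> real k * h j"
    unfolding abs_mult using bl G.h_pos[of j] by (intro mult_mono) auto
  then have "\<bar>of_int (G.b j (ix j t)) * h j - of_int (G.b j (ix j s)) * h j\<bar> \<le> q * (t - s) + h j"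
    using kh by (simp add: algebra_simps)
  moreover have "\<bar>\<gamma>h j t - of_int (G.b j (ix j t)) * h j\<bar> \<le> h j" "\<bar>\<gamma>h j s - of_int (G.b j (ix j s)) * h j\<bar> \<le> h j"
    using G.\<gamma>h_near ix assms by auto
  ultimately show ?thesis by linarith
qed

lemma \<gamma>_lipschitz0:
  assumes "0 \<le> s" "s \<le> t"
  shows "\<bar>\<gamma> t - \<gamma> s\<bar> \<le> q * (t - s)"
proof (rule LIMSEQ_le[of "\<lambda>j. \<bar>\<gamma>h j t - \<gamma>h j s\<bar>" _ "\<lambda>j. 3 * h j + q * (t - s)"])
  show "(\<lambda>j. \<bar>\<gamma>h j t - \<gamma>h j s\<bar>) \<longlonglongrightarrow> \<bar>\<gamma> t - \<gamma> s\<bar>" by (intro tendsto_intros \<gamma>_tendsto) (use assms in auto)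
  have "(\<lambda>j. 3 * h j + q * (t - s)) \<longlonglongrightarrow> 3 * 0 + q * (t - s)" by (intro tendsto_intros h0)
  then show "(\<lambda>j. 3 * h j + q * (t - s)) \<longlonglongrightarrow> q * (t - s)" by simp
qed (use \<gamma>h_lipschitz[OF assms] in auto)

text \<open>The hypotheses concern nonnegative times. The constant extension gives one Lipschitz
  function on the whole line, as the fundamental theorem and the area formula require.\<close>

definition "g t = \<gamma> (max t 0)"

lemma g_lipschitz: "\<bar>g s - g t\<bar> \<le> q * \<bar>s - t\<bar>"
proof -
  have *: "\<bar>g s - g t\<bar> \<le> q * \<bar>s - t\<bar>" if "s \<le> t" for s t
  proof -
    have "\<bar>\<gamma> (max t 0) - \<gamma> (max s 0)\<bar> \<le> q * (max t 0 - max s 0)" by (rule \<gamma>_lipschitz0) (use that in auto)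
    also have "\<dots> \<le> q * \<bar>s - t\<bar>" using that q_gt by (intro mult_left_mono) auto
    finally show ?thesis by (simp add: g_def abs_minus_commute)
  qed
  show ?thesis using *[of s t] *[of t s] by (cases "s \<le> t") (auto simp: abs_minus_commute)
qed

lemma g_continuous: "continuous_on S g"
proof -
  have "q-lipschitz_on S g" using g_lipschitz q_gt by (auto intro!: lipschitz_onI simp: dist_real_def)
  then show ?thesis by (rule lipschitz_on_continuous_on)
qed

lemma g_measurable [measurable]: "g \<in> borel_measurable borel"
  by (rule borel_measurable_continuous_onI[OF g_continuous])

lemma g_eq: "t \<ge> 0 \<Longrightarrow> g t = \<gamma> t" by (simp add: g_def max_def)

lemma ix_tendsto: "t \<ge> 0 \<Longrightarrow> (\<lambda>j. real (ix j t) * \<tau> j) \<longlonglongrightarrow> t"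
proof (rule real_tendsto_sandwich[of "\<lambda>j. t - \<tau> j" _ _ "\<lambda>_. t"])
  assume t: "t \<ge> 0"
  show "\<forall>\<^sub>F j in sequentially. t - \<tau> j \<le> real (ix j t) * \<tau> j"
    by (rule always_eventually, rule allI, rule less_imp_le, rule ix(3)[OF t])
  show "\<forall>\<^sub>F j in sequentially. real (ix j t) * \<tau> j \<le> t"
    by (rule always_eventually, rule allI, rule ix(1)[OF t])
  have "(\<lambda>j. t - \<tau> j) \<longlonglongrightarrow> t - 0" by (intro tendsto_intros tau0)
  then show "(\<lambda>j. t - \<tau> j) \<longlonglongrightarrow> t" by simp
qed auto

lemma b_near:
  assumes T: "T > 0" and e: "e > 0"
  shows "eventually (\<lambda>j. \<forall>n t. real n * \<tau> j \<le> t \<and> t < real (Suc n) * \<tau> j \<and> t \<le> T \<longrightarrow> \<bar>of_int (G.b j n) * h j - g t\<bar> \<le> e) sequentially"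
proof -
  have e2: "e / 2 > 0" using e by simp
  have "eventually (\<lambda>j. h j < e / 2) sequentially" using h0 e2 by (rule order_tendstoD(2))
  with \<gamma>_uniform[OF T e2] show ?thesis
  proof eventually_elim
    case (elim j)
    show ?case
    proof (intro allI impI, elim conjE)
      fix n t assume t: "real n * \<tau> j \<le> t" "t < real (Suc n) * \<tau> j" "t \<le> T"
      have "0 \<le> real n * \<tau> j" using G.tau_pos[of j] by simp
      then have t0: "0 \<le> t" using t by linarith
      have "\<bar>\<gamma>h j t - of_int (G.b j n) * h j\<bar> \<le> h j" by (rule G.\<gamma>h_near[OF t(1,2)])
      moreover have "\<bar>\<gamma>h j t - g t\<bar> < e / 2" using elim(1) t t0 by (simp add: g_eq)
      ultimately show "\<bar>of_int (G.b j n) * h j - g t\<bar> \<le> e" using elim(2) by linarith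
    qed
  qed
qed

lemma b_tendsto:
  assumes "t \<ge> 0"
  shows "(\<lambda>j. of_int (G.b j (ix j t)) * h j) \<longlonglongrightarrow> g t"
proof -
  have "(\<lambda>j. of_int (G.b j (ix j t)) * h j - \<gamma>h j t) \<longlonglongrightarrow> 0"
  proof (rule Lim_null_comparison[OF _ h0], rule always_eventually, rule allI)
    fix j show "norm (of_int (G.b j (ix j t)) * h j - \<gamma>h j t) \<le> h j"
      using G.\<gamma>h_near[OF ix(1,2)[OF assms, of j]] by (simp add: abs_minus_commute)
  qed
  from tendsto_add[OF this \<gamma>_tendsto[OF assms]] show ?thesis by (simp add: g_eq[OF assms])
qed

lemma drift_near:
  assumes c: "\<bar>c\<bar> \<le> c1" and T: "T \<ge> 0" and e: "e > 0"
  shows "eventually (\<lambda>j. \<forall>n. real n * \<tau> j \<le> T \<longrightarrow> \<bar>of_int (G.drift c n) * h j - c * (real n * \<tau> j)\<bar> \<le> e) sequentially"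
proof -
  \<comment> \<open>Multiplied by h = q \<tau> the linear part of the counting error is at most
    \<eta> q (T + 1) = e / 2, uniformly in n; the constant part K h falls below e / 2 as the mesh
    shrinks.\<close>
  define \<eta> where "\<eta> = e / (2 * q * (T + 1))"
  have \<eta>: "\<eta> > 0" using e T q_gt by (simp add: \<eta>_def)
  have cq: "\<bar>c\<bar> < q" using c q_gt by linarith
  obtain K where K: "K \<ge> (0::real)" "\<And>N. \<bar>of_int (\<Sum>k<N. if a (Suc k) * q \<le> c then 1 else -1) - c / q * real N\<bar> \<le> \<eta> * real N + K"
    using equidistributed_drift[OF equi cq \<eta>] by blast
  have "(\<lambda>j. K * h j) \<longlonglongrightarrow> K * 0" by (intro tendsto_intros h0)
  then have "eventually (\<lambda>j. K * h j < e / 2) sequentially" using e by (intro order_tendstoD(2)[of _ "K * 0"]) auto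
  then show ?thesis
  proof eventually_elim
    case (elim j)
    show ?case
    proof (intro allI impI)
      fix n assume n: "real n * \<tau> j \<le> T"
      have hq: "h j = q * \<tau> j" "h j > 0" by (fact G.h_eq G.h_pos)+
      have "\<bar>of_int (G.drift c n) - c / q * real n\<bar> \<le> \<eta> * real n + K"
        using K(2)[of n] unfolding G.drift_def G.shift_def .
      then have "\<bar>of_int (G.drift c n) - c / q * real n\<bar> * h j \<le> (\<eta> * real n + K) * h j"
        using hq by (intro mult_right_mono) auto
      also have "(\<eta> * real n + K) * h j = \<eta> * q * (real n * \<tau> j) + K * h j" by (simp add: hq algebra_simps)
      also have "\<eta> * q * (real n * \<tau> j) \<le> \<eta> * q * (T + 1)" using n \<eta> q_gt by (intro mult_left_mono) auto
      also have "\<eta> * q * (T + 1) = e / 2"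
      proof -
        have "2 * q * (T + 1) \<noteq> 0" using q_gt T by auto
        then have "\<eta> * (2 * q * (T + 1)) = e" by (simp add: \<eta>_def)
        then show ?thesis by (simp add: algebra_simps)
      qed
      finally have "\<bar>of_int (G.drift c n) - c / q * real n\<bar> * h j \<le> e" using elim by linarith
      moreover have "\<bar>of_int (G.drift c n) - c / q * real n\<bar> * h j = \<bar>(of_int (G.drift c n) - c / q * real n) * h j\<bar>"
        by (simp only: abs_mult abs_of_pos[OF hq(2)])
      moreover have "(of_int (G.drift c n) - c / q * real n) * h j = of_int (G.drift c n) * h j - c * (real n * \<tau> j)"
        using q_gt by (simp add: hq(1) algebra_simps)
      ultimately show "\<bar>of_int (G.drift c n) * h j - c * (real n * \<tau> j)\<bar> \<le> e" by simp
    qed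
  qed
qed

lemma drift_tendsto:
  assumes c: "\<bar>c\<bar> \<le> c1" and t: "t \<ge> 0"
  shows "(\<lambda>j. of_int (G.drift c (ix j t)) * h j) \<longlonglongrightarrow> c * t"
proof -
  have "(\<lambda>j. of_int (G.drift c (ix j t)) * h j - c * (real (ix j t) * \<tau> j)) \<longlonglongrightarrow> 0"
  proof (rule LIMSEQ_I)
    fix r :: real assume r: "r > 0"
    have "r / 2 > 0" using r by simp
    from eventually_sequentially[THEN iffD1, OF drift_near[OF c t this]]
    obtain N where N: "\<And>j n. N \<le> j \<Longrightarrow> real n * \<tau> j \<le> t \<Longrightarrow> \<bar>of_int (G.drift c n) * h j - c * (real n * \<tau> j)\<bar> \<le> r / 2" by blast
    show "\<exists>no. \<forall>j\<ge>no. norm (of_int (G.drift c (ix j t)) * h j - c * (real (ix j t) * \<tau> j) - 0) < r"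
    proof (intro exI[of _ N] allI impI)
      fix j assume "N \<le> j"
      from N[OF this ix(1)[OF t]] r show "norm (of_int (G.drift c (ix j t)) * h j - c * (real (ix j t) * \<tau> j) - 0) < r" by simp
    qed
  qed
  from tendsto_add[OF this tendsto_mult_left[OF ix_tendsto[OF t], of c]] show ?thesis by simp
qed

definition "Vs j t = G.V j (ix j t)"

lemma Vs_measurable [measurable]: "Vs j \<in> borel_measurable borel"
  unfolding Vs_def[abs_def] by measurable

lemma Vs_bounds: "- c3 < Vs j t" "Vs j t < c1" by (simp_all add: Vs_def G.V_bounds)

text \<open>Adding the countably many grid times of all meshes to the exceptional set makes the
  derivative of the approximate boundary equal to the speed of the current fan.\<close>

lemma Vs_tendsto: "\<exists>N. countable N \<and> (\<forall>t>0. t \<notin> N \<longrightarrow> \<gamma> differentiable (at t) \<and> (\<lambda>j. Vs j t) \<longlonglongrightarrow> deriv \<gamma> t)"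
proof -
  obtain N where N: "countable N" "\<forall>t>0. t \<notin> N \<longrightarrow>
        \<gamma> differentiable (at t) \<and> (\<forall>j. \<gamma>h j differentiable (at t)) \<and> (\<lambda>j. deriv (\<gamma>h j) t) \<longlonglongrightarrow> deriv \<gamma> t"
    using lim unfolding phase_boundary_limit_def by (elim conjE exE)
  define N' where "N' = N \<union> (\<Union>j. range (\<lambda>n. real n * \<tau> j))"
  have "countable N'" unfolding N'_def using N(1) by (intro countable_Un countable_UN countable_image) auto
  moreover have "\<gamma> differentiable (at t) \<and> (\<lambda>j. Vs j t) \<longlonglongrightarrow> deriv \<gamma> t" if t: "t > 0" "t \<notin> N'" for t
  proof -
    have "deriv (\<gamma>h j) t = Vs j t" for j
    proof -
      have "t \<noteq> real (ix j t) * \<tau> j" using t(2) unfolding N'_def by blast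
      then have "real (ix j t) * \<tau> j < t" using ix(1)[of t j] t by simp
      then show ?thesis unfolding Vs_def using ix(2)[of t j] t by (intro G.\<gamma>h_deriv) auto
    qed
    moreover have "\<gamma> differentiable (at t) \<and> (\<lambda>j. deriv (\<gamma>h j) t) \<longlonglongrightarrow> deriv \<gamma> t"
      using N(2) t unfolding N'_def by blast
    ultimately show ?thesis by simp
  qed
  ultimately show ?thesis by (intro exI[of _ N'] conjI allI impI) blast+
qed

definition "bad = (SOME N. countable N \<and> (\<forall>t>0. t \<notin> N \<longrightarrow> \<gamma> differentiable (at t) \<and> (\<lambda>j. Vs j t) \<longlonglongrightarrow> deriv \<gamma> t))"

lemma bad: "countable bad" "t > 0 \<Longrightarrow> t \<notin> bad \<Longrightarrow> \<gamma> differentiable (at t)"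
  "t > 0 \<Longrightarrow> t \<notin> bad \<Longrightarrow> (\<lambda>j. Vs j t) \<longlonglongrightarrow> deriv \<gamma> t"
proof -
  have *: "countable bad \<and> (\<forall>t>0. t \<notin> bad \<longrightarrow> \<gamma> differentiable (at t) \<and> (\<lambda>j. Vs j t) \<longlonglongrightarrow> deriv \<gamma> t)"
    unfolding bad_def by (rule someI_ex[OF Vs_tendsto])
  show "countable bad" using * by (elim conjE)
  show "\<gamma> differentiable (at t)" "(\<lambda>j. Vs j t) \<longlonglongrightarrow> deriv \<gamma> t" if "t > 0" "t \<notin> bad"
    using * that by simp_all
qed

text \<open>A version of \<gamma>' defined everywhere; being a pointwise limit of step functions off
  a countable set, it is Borel measurable.\<close>

definition "d t = (if t > 0 \<and> t \<notin> bad then deriv \<gamma> t else 0)"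

lemma bad_borel [measurable]: "bad \<in> sets borel"
  by (rule sets.countable[OF _ bad(1)]) simp

lemma d_measurable [measurable]: "d \<in> borel_measurable borel"
proof (rule borel_measurable_LIMSEQ_real)
  fix t
  show "(\<lambda>j. if t > 0 \<and> t \<notin> bad then Vs j t else 0) \<longlonglongrightarrow> d t" by (auto simp: d_def bad)
next
  fix j show "(\<lambda>t. if t > 0 \<and> t \<notin> bad then Vs j t else 0) \<in> borel_measurable borel" by measurable
qed

lemma d_le: "- c3 \<le> d t" "d t \<le> c1" "\<bar>d t\<bar> \<le> c1" "\<bar>d t\<bar> \<le> q"
proof -
  have "- c3 \<le> d t \<and> d t \<le> c1"
  proof (cases "t > 0 \<and> t \<notin> bad")
    case True
    have "- c3 \<le> deriv \<gamma> t" using True by (intro LIMSEQ_le_const[OF bad(3)] exI allI impI less_imp_le[OF Vs_bounds(1)]) auto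
    moreover have "deriv \<gamma> t \<le> c1" using True by (intro LIMSEQ_le_const2[OF bad(3)] exI allI impI less_imp_le[OF Vs_bounds(2)]) auto
    ultimately show ?thesis using True by (simp add: d_def)
  qed (use c_pos in \<open>auto simp: d_def\<close>)
  then show "- c3 \<le> d t" "d t \<le> c1" "\<bar>d t\<bar> \<le> c1" "\<bar>d t\<bar> \<le> q" using c_pos q_gt by auto
qed

lemma g_has_derivative:
  assumes "t > 0" "t \<notin> bad"
  shows "(g has_real_derivative d t) (at t)"
proof -
  have "(\<gamma> has_real_derivative deriv \<gamma> t) (at t)"
    using bad(2)[OF assms] by (simp add: DERIV_deriv_iff_real_differentiable)
  then have "(g has_real_derivative deriv \<gamma> t) (at t)"
    by (rule has_field_derivative_transform_within_open[of _ _ _ "{0<..}"]) (use assms in \<open>auto simp: g_eq\<close>)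
  then show ?thesis using assms by (simp add: d_def)
qed

lemma countable_AE_lborel: "countable N \<Longrightarrow> AE t in lborel. t \<notin> (N :: real set)"
  by (rule AE_not_in) (simp add: countable_imp_null_set_lborel)

lemma g_AE_derivative: "AE t in lborel. (g has_real_derivative d t) (at t)"
proof -
  have "AE t in lborel. t \<notin> bad" by (rule countable_AE_lborel[OF bad(1)])
  moreover have "AE t in lborel. t \<notin> {0 :: real}" by (rule countable_AE_lborel) simp
  ultimately show ?thesis
  proof eventually_elim
    case (elim t)
    show ?case
    proof (cases "t > 0")
      case True then show ?thesis using elim g_has_derivative by simp
    next
      case False
      then have t: "t < 0" using elim by simp
      have "((\<lambda>_. \<gamma> 0) has_real_derivative 0) (at t)" by simp
      then have "(g has_real_derivative 0) (at t)"
        by (rule has_field_derivative_transform_within_open[of _ _ _ "{..<0}"]) (use t in \<open>auto simp: g_def max_def\<close>)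
      then show ?thesis using t by (simp add: d_def)
    qed
  qed
qed

lemma g_FTC: "x \<le> y \<Longrightarrow> set_integrable lborel {x..y} d" "x \<le> y \<Longrightarrow> (LINT t:{x..y}|lborel. d t) = g y - g x"
  by (fact Lipschitz_FTC[OF g_lipschitz g_AE_derivative d_measurable])+

end

context phase_model
begin

lemma riemann_inv_le:
  assumes "\<bar>c\<bar> \<le> c1"
  shows "\<bar>riemann_inv c s\<bar> \<le> (1 + c1) * norm s"
proof -
  have f: "\<bar>fst s\<bar> \<le> norm s" "\<bar>snd s\<bar> \<le> norm s"
    using norm_fst_le[of "fst s" "snd s"] norm_snd_le[of "snd s" "fst s"] by simp_all
  have "\<bar>c * snd s\<bar> \<le> c1 * norm s" unfolding abs_mult using assms f(2) by (intro mult_mono) auto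
  then show ?thesis using f(1) unfolding riemann_inv_def by (simp add: algebra_simps abs_le_iff)
qed

lemma bounded_state_norm:
  assumes "bounded_state M u"
  shows "norm u \<le> M + M / c3"
proof -
  have *: "norm u \<le> M + M / c3" if i: "\<bar>riemann_inv c u\<bar> \<le> M" "\<bar>riemann_inv (- c) u\<bar> \<le> M" and c: "c3 \<le> c" for c
  proof -
    have "riemann_inv c u + riemann_inv (- c) u = 2 * fst u" "riemann_inv (- c) u - riemann_inv c u = 2 * (c * snd u)"
      by (simp_all add: riemann_inv_def)
    then have f: "\<bar>fst u\<bar> \<le> M" and s: "\<bar>c * snd u\<bar> \<le> M" using i by linarith+
    have "c3 * \<bar>snd u\<bar> \<le> c * \<bar>snd u\<bar>" using c by (rule mult_right_mono) simp
    also have "\<dots> \<le> M" using s c c_pos by (simp add: abs_mult)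
    finally have "\<bar>snd u\<bar> \<le> M / c3" using c_pos by (simp add: pos_le_divide_eq mult.commute)
    then show ?thesis using f norm_Pair_le[of "fst u" "snd u"] by simp
  qed
  have "c3 \<le> c1" using c_pos by simp
  then show ?thesis using assms *[of c1] *[of c3] unfolding bounded_state_def by (elim disjE conjE) simp_all
qed

end

context glimm_family
begin

definition "Bs c j n = of_int (G.b j n - G.drift c n) * h j"
definition "rt c j t = (Bs c j (Suc (ix j t)) - Bs c j (ix j t)) / \<tau> j"

lemma rt_measurable [measurable]: "rt c j \<in> borel_measurable borel"
  unfolding rt_def[abs_def] by measurable

text \<open>The rate takes only the values 0 and \<plusminus>2 q, and it vanishes unless the sample
  a q separates the boundary speed from c.\<close>

lemma rt_eq: "rt c j t = q * ((if a (Suc (ix j t)) * q \<le> Vs j t then 1 else -1) - (if a (Suc (ix j t)) * q \<le> c then 1 else -1))"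
  unfolding rt_def Bs_def G.b_Suc G.drift_simps G.shift_def Vs_def
  using G.tau_pos[of j] by (simp add: G.h_eq[of j] field_simps)

lemma rt_bound: "\<bar>rt c j t\<bar> \<le> 2 * q"
  unfolding rt_eq using q_gt by simp

lemma ix_shift: "t \<ge> 0 \<Longrightarrow> ix j (t + \<tau> j) = Suc (ix j t)"
  by (rule step_index_eq[OF G.tau_pos]) (use ix[of t j] in \<open>auto simp: algebra_simps\<close>)

text \<open>The successor of the step index is the step index at t + \<tau>, so the rate is a
  difference quotient of the frame position, which tends to g t - c t locally uniformly by
  equidistribution. This yields convergence of primitives although the rate itself
  oscillates.\<close>

lemma rt_primitive:
  assumes c: "\<bar>c\<bar> \<le> c1" and xy: "0 \<le> x" "x \<le> y"
  shows "(\<lambda>j. \<integral>t. indicator {x..y} t * rt c j t \<partial>lborel) \<longlonglongrightarrow> (LBINT t. indicator {x..y} t * (d t - c))"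
proof -
  have "(\<lambda>j. \<integral>t. indicator {x..y} t * ((Bs c j (ix j (t + \<tau> j)) - Bs c j (ix j t)) / \<tau> j) \<partial>lborel) \<longlonglongrightarrow> (g y - c * y) - (g x - c * x)"
  proof (rule integral_difference_quotient_tendsto[where f="\<lambda>t. g t - c * t"])
    show "(\<lambda>t. Bs c j (ix j t)) \<in> borel_measurable borel" for j by measurable
    show "continuous_on UNIV (\<lambda>t. g t - c * t)" by (intro continuous_intros g_continuous)
    show "\<tau> j > 0" for j by (rule G.tau_pos)
    show "\<tau> \<longlonglongrightarrow> 0" by (rule tau0)
    show "\<exists>C. \<forall>t\<in>{x..T}. \<bar>Bs c j (ix j t)\<bar> \<le> C" for j T
    proof (intro exI ballI)
      fix t assume t: "t \<in> {x..T}"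
      have "ix j t \<le> ix j T"
        unfolding step_index_def using t G.tau_pos[of j] by (intro nat_mono floor_mono divide_right_mono) auto
      then show "\<bar>Bs c j (ix j t)\<bar> \<le> (\<Sum>n\<le>ix j T. \<bar>Bs c j n\<bar>)"
        by (intro member_le_sum[where f="\<lambda>n. \<bar>Bs c j n\<bar>"]) auto
    qed
    fix e :: real assume e: "e > 0"
    have e3: "e / 3 > 0" using e by simp
    have "(\<lambda>j. c1 * \<tau> j) \<longlonglongrightarrow> c1 * 0" by (intro tendsto_intros tau0)
    then have "eventually (\<lambda>j. c1 * \<tau> j < e / 3) sequentially" using e3 by (intro order_tendstoD(2)[of _ "c1 * 0"]) auto
    moreover have "eventually (\<lambda>j. \<forall>n. real n * \<tau> j \<le> y + 1 \<longrightarrow> \<bar>of_int (G.drift c n) * h j - c * (real n * \<tau> j)\<bar> \<le> e / 3) sequentially"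
      using xy by (intro drift_near c e3) auto
    moreover have "eventually (\<lambda>j. \<forall>n t. real n * \<tau> j \<le> t \<and> t < real (Suc n) * \<tau> j \<and> t \<le> y + 1 \<longrightarrow> \<bar>of_int (G.b j n) * h j - g t\<bar> \<le> e / 3) sequentially"
      using xy by (intro b_near e3) auto
    ultimately show "eventually (\<lambda>j. \<forall>t\<in>{x..y + 1}. \<bar>Bs c j (ix j t) - (g t - c * t)\<bar> \<le> e) sequentially"
    proof eventually_elim
      case (elim j)
      show ?case
      proof
        fix t assume "t \<in> {x..y + 1}"
        then have t: "0 \<le> t" "t \<le> y + 1" using xy by auto
        note i = ix[OF t(1), of j]
        have 1: "\<bar>of_int (G.b j (ix j t)) * h j - g t\<bar> \<le> e / 3" using elim(3) i t by blast
        have 2: "\<bar>of_int (G.drift c (ix j t)) * h j - c * (real (ix j t) * \<tau> j)\<bar> \<le> e / 3"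
          using elim(2) i t by auto
        have "\<bar>c * (t - real (ix j t) * \<tau> j)\<bar> \<le> c1 * \<tau> j" unfolding abs_mult using c i by (intro mult_mono) auto
        then have 3: "\<bar>c * (t - real (ix j t) * \<tau> j)\<bar> \<le> e / 3" using elim(1) by linarith
        have "Bs c j (ix j t) - (g t - c * t) = (of_int (G.b j (ix j t)) * h j - g t)
           - (of_int (G.drift c (ix j t)) * h j - c * (real (ix j t) * \<tau> j)) + c * (t - real (ix j t) * \<tau> j)"
          by (simp add: Bs_def algebra_simps)
        then show "\<bar>Bs c j (ix j t) - (g t - c * t)\<bar> \<le> e" using 1 2 3 by linarith
      qed
    qed
  qed (use xy in auto)
  moreover have "(LBINT t. indicator {x..y} t * ((Bs c j (ix j (t + \<tau> j)) - Bs c j (ix j t)) / \<tau> j)) = (LBINT t. indicator {x..y} t * rt c j t)" for j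
    by (rule Bochner_Integration.integral_cong) (use xy in \<open>auto simp: indicator_def rt_def ix_shift\<close>)
  moreover have "(LBINT t. indicator {x..y} t * (d t - c)) = (g y - c * y) - (g x - c * x)"
  proof -
    have i: "integrable lborel (\<lambda>t. indicator {x..y} t *\<^sub>R d t)" "integrable lborel (\<lambda>t. indicator {x..y} t *\<^sub>R c)"
    proof -
      have "emeasure lborel {x..y} < \<infinity>" by (rule emeasure_bounded_finite) simp
      then have "integrable lborel (indicat_real {x..y})" by (intro integrable_real_indicator) simp_all
      then show "integrable lborel (\<lambda>t. indicator {x..y} t *\<^sub>R d t)" "integrable lborel (\<lambda>t. indicator {x..y} t *\<^sub>R c)"
        using g_FTC(1)[OF xy(2)] by (simp_all add: set_integrable_def)
    qed
    have "(LBINT t. indicator {x..y} t * (d t - c)) = (LBINT t. indicator {x..y} t *\<^sub>R d t - indicator {x..y} t *\<^sub>R c)"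
      by (rule Bochner_Integration.integral_cong) (auto simp: algebra_simps)
    also have "\<dots> = (g y - g x) - (y - x) * c"
      using i g_FTC(2)[OF xy(2)] xy by (simp add: set_lebesgue_integral_def)
    finally show ?thesis by (simp add: algebra_simps)
  qed
  ultimately show ?thesis by simp
qed

lemma uh_plane_measurable: "(\<lambda>p. indicator S p *\<^sub>R uh j p) \<in> borel_measurable borel" if "S \<in> sets borel" "S \<subseteq> half_plane"
proof -
  have [measurable]: "S \<in> sets borel" "(\<lambda>p. if fst p > 0 then uh j p else 0) \<in> borel_measurable borel"
    by (fact that G.uh_measurable)+
  have "(\<lambda>p. indicator S p *\<^sub>R uh j p) = (\<lambda>p. indicator S p *\<^sub>R (if fst p > 0 then uh j p else 0))"
    using that(2) by (auto simp: fun_eq_iff indicator_def half_plane_def)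
  then show ?thesis by simp
qed

lemma AE_subsequence:
  assumes S: "compact S" "S \<subseteq> half_plane"
  shows "\<exists>r. strict_mono r \<and> (AE p in lebesgue. p \<in> S \<longrightarrow> (\<lambda>n. uh (r n) p) \<longlonglongrightarrow> u p)"
proof -
  have Sb[measurable]: "S \<in> sets borel" using S(1) by (simp add: compact_imp_closed)
  have ui: "set_integrable lebesgue S u" and L: "(\<lambda>j. \<integral>\<^sup>+p\<in>S. ennreal (norm (uh j p - u p)) \<partial>lebesgue) \<longlonglongrightarrow> 0"
    using L1 S unfolding L1_loc_limit_def by blast+
  have um[measurable]: "(\<lambda>p. indicator S p *\<^sub>R uh j p) \<in> borel_measurable lebesgue" for j
    using uh_plane_measurable[OF Sb S(2), of j] by (intro measurable_completion) simp
  have uhi: "integrable lebesgue (\<lambda>p. indicator S p *\<^sub>R uh j p)" for j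
  proof (rule integrableI_bounded_set[where A=S and B="M + M / c3"])
    have "emeasure lborel S < \<infinity>" by (rule emeasure_bounded_finite[OF compact_imp_bounded[OF S(1)]])
    then show "emeasure lebesgue S < \<infinity>" by simp
    show "AE p in lebesgue. p \<in> S \<longrightarrow> norm (indicat_real S p *\<^sub>R uh j p) \<le> M + M / c3"
    proof (rule AE_I2, rule impI)
      fix p assume p: "p \<in> S"
      then have "0 \<le> fst p" using S(2) by (auto simp: half_plane_def)
      from bounded_state_norm[OF G.uh_M[OF this, of j "snd p"]] show "norm (indicat_real S p *\<^sub>R uh j p) \<le> M + M / c3"
        using p by simp
    qed
    show "(\<lambda>p. indicator S p *\<^sub>R uh j p) \<in> borel_measurable lebesgue" by (rule um)
  qed auto
  define df where "df j p = indicat_real S p *\<^sub>R uh j p - indicat_real S p *\<^sub>R u p" for j p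
  have Di: "integrable lebesgue (df j)" for j
    unfolding df_def using uhi[of j] ui by (intro Bochner_Integration.integrable_diff) (auto simp: set_integrable_def)
  have e: "ennreal (LINT p|lebesgue. norm (df j p)) = (\<integral>\<^sup>+p\<in>S. ennreal (norm (uh j p - u p)) \<partial>lebesgue)" for j
  proof -
    have "ennreal (LINT p|lebesgue. norm (df j p)) = (\<integral>\<^sup>+p. ennreal (norm (df j p)) \<partial>lebesgue)"
      by (rule nn_integral_eq_integral[symmetric]) (use Di in auto)
    also have "\<dots> = (\<integral>\<^sup>+p\<in>S. ennreal (norm (uh j p - u p)) \<partial>lebesgue)"
      by (rule nn_integral_cong) (auto simp: df_def indicator_def)
    finally show ?thesis .
  qed
  have "(\<lambda>j. \<integral>p. norm (df j p) \<partial>lebesgue) \<longlonglongrightarrow> 0"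
  proof (rule tendsto_ennrealD)
    show "(\<lambda>j. ennreal (LINT p|lebesgue. norm (df j p))) \<longlonglongrightarrow> ennreal 0" unfolding e using L by simp
  qed auto
  from tendsto_L1_AE_subseq[OF Di this] obtain r where r: "strict_mono r" "AE p in lebesgue. (\<lambda>n. df (r n) p) \<longlonglongrightarrow> 0" by blast
  have "AE p in lebesgue. p \<in> S \<longrightarrow> (\<lambda>n. uh (r n) p) \<longlonglongrightarrow> u p"
    using r(2)
  proof eventually_elim
    case (elim p)
    show ?case
    proof
      assume "p \<in> S"
      then have "(\<lambda>n. uh (r n) p - u p) \<longlonglongrightarrow> 0" using elim by (simp add: df_def)
      then show "(\<lambda>n. uh (r n) p) \<longlonglongrightarrow> u p" by (rule LIM_zero_cancel)
    qed
  qed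
  then show ?thesis using r(1) by blast
qed

text \<open>Only closed conditions survive a limit; the strict bound -1 < w of phase 1 is not among
  them. The two inequalities kept suffice to evaluate the entropy in its quadratic form.\<close>

definition "regular_point p \<longleftrightarrow> norm (u p) \<le> M + M / c3 \<and>
   (snd p < g (fst p) \<and> snd (u p) \<le> wM \<or> g (fst p) < snd p \<and> wm \<le> snd (u p))"

lemma AE_off_graph: "AE p in lebesgue. snd p \<noteq> g (fst p)"
proof (rule AE_not_in[of "{p. snd p = g (fst p)}", simplified])
  have S[measurable]: "{p. snd p = g (fst p)} \<in> sets (borel :: point measure)" by measurable
  have "emeasure lborel {p. snd p = g (fst p)} = 0"
  proof -
    have "emeasure (lborel \<Otimes>\<^sub>M lborel) {p. snd p = g (fst p)} = (\<integral>\<^sup>+t. emeasure lborel (Pair t -` {p. snd p = g (fst p)}) \<partial>lborel)"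
    proof (rule lborel.emeasure_pair_measure_alt)
      show "{p. snd p = g (fst p)} \<in> sets (lborel \<Otimes>\<^sub>M lborel)" unfolding lborel_prod using S by simp
    qed
    also have "\<dots> = (\<integral>\<^sup>+(t :: real). 0 \<partial>lborel)"
    proof (rule nn_integral_cong)
      fix t :: real
      have "Pair t -` {p. snd p = g (fst p)} = {g t}" by auto
      then show "emeasure lborel (Pair t -` {p. snd p = g (fst p)}) = 0" by simp
    qed
    finally show ?thesis by (simp add: lborel_prod)
  qed
  then show "{p. snd p = g (fst p)} \<in> null_sets lebesgue"
    using S by (intro null_sets_completionI) (auto simp: null_sets_def)
qed

lemma regular_of_limit:
  assumes r: "strict_mono r" and lim: "(\<lambda>n. uh (r n) p) \<longlonglongrightarrow> u p" and p: "p \<in> half_plane" "snd p \<noteq> g (fst p)"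
  shows "regular_point p"
proof -
  define t x where "t = fst p" and "x = snd p"
  have p_eq: "p = (t, x)" by (simp add: t_def x_def)
  have t: "t > 0" using p(1) by (simp add: p_eq half_plane_def)
  have b: "bounded_state M (uh j p)" for j unfolding p_eq by (rule G.uh_M) (use t in simp)
  have 1: "norm (u p) \<le> M + M / c3"
    by (rule LIMSEQ_le_const2[OF tendsto_norm[OF lim]]) (use bounded_state_norm[OF b] in auto)
  have s: "(\<lambda>n. snd (uh (r n) p)) \<longlonglongrightarrow> snd (u p)" by (intro tendsto_intros lim)
  have \<gamma>: "(\<lambda>n. \<gamma>h (r n) t) \<longlonglongrightarrow> g t"
    using LIMSEQ_subseq_LIMSEQ[OF \<gamma>_tendsto r, of t] t by (simp add: comp_def g_eq)
  consider "x < g t" | "g t < x" using p(2) unfolding p_eq by fastforce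
  then show ?thesis
  proof cases
    case 1
    have "eventually (\<lambda>n. x < \<gamma>h (r n) t) sequentially" by (rule order_tendstoD(1)[OF \<gamma> 1])
    then have "eventually (\<lambda>n. snd (uh (r n) p) \<le> wM) sequentially"
    proof eventually_elim
      case (elim n)
      have "uh (r n) (t, x) \<in> phase1 wM" by (rule G.uh_phase(1)) (use elim t in auto)
      then show ?case unfolding p_eq phase1_def by auto
    qed
    then have "snd (u p) \<le> wM" by (intro tendsto_upperbound[OF s]) auto
    then show ?thesis using \<open>norm (u p) \<le> M + M / c3\<close> 1 unfolding regular_point_def p_eq by simp
  next
    case 2
    have "eventually (\<lambda>n. \<gamma>h (r n) t < x) sequentially" by (rule order_tendstoD(2)[OF \<gamma> 2])
    then have "eventually (\<lambda>n. wm \<le> snd (uh (r n) p)) sequentially"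
    proof eventually_elim
      case (elim n)
      have "uh (r n) (t, x) \<in> phase3 wm" by (rule G.uh_phase(2)) (use elim t in auto)
      then show ?case unfolding p_eq phase3_def by auto
    qed
    then have "wm \<le> snd (u p)" by (intro tendsto_lowerbound[OF s]) auto
    then show ?thesis using \<open>norm (u p) \<le> M + M / c3\<close> 2 unfolding regular_point_def p_eq by simp
  qed
qed

lemma half_plane_exhaustion: "p \<in> half_plane \<Longrightarrow> \<exists>n::nat. p \<in> {1 / real (Suc n)..real n} \<times> {- real n..real n}"
proof -
  assume p: "p \<in> half_plane"
  have "0 < fst p" using p by (auto simp: half_plane_def)
  from reals_Archimedean[OF this] obtain n1 where n1: "1 / real (Suc n1) < fst p" by (auto simp: inverse_eq_divide)
  obtain n2 :: nat where n2: "\<bar>fst p\<bar> + \<bar>snd p\<bar> < real n2" using reals_Archimedean2 by blast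
  note n = n1 n2
  define n where "n = max n1 n2"
  have "1 / real (Suc n) \<le> 1 / real (Suc n1)" by (rule divide_left_mono) (auto simp: n_def)
  moreover have "real n2 \<le> real n" by (simp add: n_def)
  ultimately show ?thesis using n by (intro exI[of _ n]) (auto simp: mem_Times_iff abs_le_iff)
qed

text \<open>The subsequence depends on the compact set, but regularity does not mention it;
  countably many boxes exhaust the half-plane.\<close>

lemma AE_regular: "AE p in lebesgue. p \<in> half_plane \<longrightarrow> regular_point p"
proof -
  have "AE p in lebesgue. p \<in> {1 / real (Suc n)..real n} \<times> {- real n..real n} \<longrightarrow> regular_point p" for n :: nat
  proof -
    have hp: "{1 / real (Suc n)..real n} \<times> {- real n..real n} \<subseteq> half_plane"
    proof
      fix p assume "p \<in> {1 / real (Suc n)..real n} \<times> {- real n..real n}"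
      then have "1 / real (Suc n) \<le> fst p" by (auto simp: mem_Times_iff)
      moreover have "0 < 1 / real (Suc n)" by simp
      ultimately have "0 < fst p" by linarith
      then show "p \<in> half_plane" by (simp add: half_plane_def mem_Times_iff)
    qed
    have "compact ({1 / real (Suc n)..real n} \<times> {- real n..real n})" by (intro compact_Times compact_Icc)
    from AE_subsequence[OF this hp] obtain r where r: "strict_mono r"
      "AE p in lebesgue. p \<in> {1 / real (Suc n)..real n} \<times> {- real n..real n} \<longrightarrow> (\<lambda>k. uh (r k) p) \<longlonglongrightarrow> u p" by blast
    show ?thesis using r(2) AE_off_graph
    proof eventually_elim
      case (elim p)
      then show ?case using regular_of_limit[OF r(1)] hp by blast
    qed
  qed
  then have "AE p in lebesgue. \<forall>n::nat. p \<in> {1 / real (Suc n)..real n} \<times> {- real n..real n} \<longrightarrow> regular_point p"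
    by (intro AE_all_countable[THEN iffD2] allI)
  then show ?thesis
  proof eventually_elim
    case (elim p)
    then show ?case using half_plane_exhaustion[of p] by blast
  qed
qed

text \<open>The order of choices matters: first \<omega> from e, then \<delta> from the uniform
  continuity of \<psi> and \<eta>, and only then the mesh, small enough for drift and boundary to be
  within \<delta>.\<close>

lemma transport_defect:
  assumes tr: "\<And>j. G.tracked j Q c (F j)" and c: "\<bar>c\<bar> \<le> c1"
    and Qm: "Q \<in> borel_measurable borel" and QB: "\<And>z. bounded_state M z \<Longrightarrow> \<bar>Q z\<bar> \<le> B"
    and FB: "\<And>j n. \<bar>F j n\<bar> \<le> B" and test: "test_function \<psi> \<psi>t \<psi>x"
  shows "(\<lambda>j. (LBINT p. Q (uh j p) * (\<psi>t p + c * \<psi>x p)) + (LBINT t. rt c j t * F j (ix j t) * \<psi> (t, g t))) \<longlonglongrightarrow> 0"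
proof -
  obtain S T where box: "test_box S T \<psi> \<psi>t \<psi>x" by (rule ex_test_box[OF test])
  note S = test_boxD[OF box] and cont = test_function_continuous[OF test]
  define \<eta> where "\<eta> p = \<psi>t p + c * \<psi>x p" for p
  have cont\<eta>: "continuous_on UNIV \<eta>" unfolding \<eta>_def by (intro continuous_intros cont)
  have off\<eta>: "\<And>p. p \<notin> S \<Longrightarrow> \<eta> p = 0" using S by (simp add: \<eta>_def)
  obtain C1 where C1: "\<And>p. \<bar>\<eta> p\<bar> \<le> C1" using compact_support_bounded[OF cont\<eta> S(1) off\<eta>] by blast
  obtain C2 where C2: "\<And>p. \<bar>\<psi> p\<bar> \<le> C2" using compact_support_bounded[OF cont(1) S(1,4)] by blast
  define C where "C = max C1 C2"
  have tra: "transported (h j) (\<tau> j) q c B (\<lambda>n x. Q (uh j (real n * \<tau> j, x))) (F j) (G.b j) (G.shift c) (\<lambda>p. Q (uh j p))" for j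
    by (rule G.transported_tracked[OF tr c Qm QB FB])
  have B0: "0 \<le> B" using FB[of 0 0] abs_ge_zero[of "F 0 0"] by linarith
  \<comment> \<open>The sum of the coefficients of \<omega> in
    \<open>transport_balance_bound\<close>; the added 1 makes it positive, so that \<omega> = e / (2
    W) is defined.\<close>
  define W where "W = 2 * B * T * (T + \<bar>c\<bar> * T + 1) + 6 * B * q * (T + 1) + 1"
  have W: "W > 0" unfolding W_def using B0 S(3) q_gt by (intro add_nonneg_pos add_nonneg_nonneg mult_nonneg_nonneg) auto
  show ?thesis
  proof (rule LIMSEQ_I)
    fix e :: real assume e: "e > 0"
    define \<omega> where "\<omega> = e / (2 * W)"
    have \<omega>: "\<omega> > 0" using e W by (simp add: \<omega>_def)
    obtain \<delta>1 where \<delta>1: "\<delta>1 > 0" "\<And>p p'. dist p p' \<le> \<delta>1 \<Longrightarrow> \<bar>\<psi> p - \<psi> p'\<bar> \<le> \<omega>"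
      using compact_support_uniformly_continuous[OF cont(1) S(1,4) \<omega>] by blast
    obtain \<delta>2 where \<delta>2: "\<delta>2 > 0" "\<And>p p'. dist p p' \<le> \<delta>2 \<Longrightarrow> \<bar>\<eta> p - \<eta> p'\<bar> \<le> \<omega>"
      using compact_support_uniformly_continuous[OF cont\<eta> S(1) off\<eta> \<omega>] by blast
    define \<delta>0 where "\<delta>0 = min \<delta>1 \<delta>2"
    \<comment> \<open>The distance \<tau> + 3 h + 2 \<delta> has to stay below
      \<open>\<delta>0\<close>: one half is left to the mesh, the other to 2 \<delta>.\<close>
    define \<delta> where "\<delta> = min 1 (\<delta>0 / 4)"
    have \<delta>0: "\<delta>0 > 0" using \<delta>1(1) \<delta>2(1) by (simp add: \<delta>0_def)
    then have \<delta>: "\<delta> > 0" "\<delta> \<le> 1" "\<delta> \<le> \<delta>0 / 4" by (auto simp: \<delta>_def)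
    have T1: "T + 1 > 0" "T + 1 \<ge> 0" using S(3) by auto
    have "(\<lambda>j. \<tau> j + 3 * h j) \<longlonglongrightarrow> 0 + 3 * 0" by (intro tendsto_intros tau0 h0)
    then have ev1: "eventually (\<lambda>j. \<tau> j + 3 * h j < min 1 (\<delta>0 / 2)) sequentially"
      using \<delta>0 by (intro order_tendstoD(2)[of _ "0 + 3 * 0"]) auto
    have "(\<lambda>j. 4 * B * C * T * h j) \<longlonglongrightarrow> 4 * B * C * T * 0" by (intro tendsto_intros h0)
    then have ev2: "eventually (\<lambda>j. 4 * B * C * T * h j < e / 2) sequentially"
      using e by (intro order_tendstoD(2)[of _ "4 * B * C * T * 0"]) auto
    have "eventually (\<lambda>j. norm ((LBINT p. Q (uh j p) * (\<psi>t p + c * \<psi>x p)) + (LBINT t. rt c j t * F j (ix j t) * \<psi> (t, g t)) - 0) < e) sequentially"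
      using ev1 ev2 drift_near[OF c T1(2) \<delta>(1)] b_near[OF T1(1) \<delta>(1)]
    proof eventually_elim
      case (elim j)
      interpret tr: transported "h j" "\<tau> j" q c B "\<lambda>n x. Q (uh j (real n * \<tau> j, x))" "F j" "G.b j" "G.shift c" "\<lambda>p. Q (uh j p)"
        by (rule tra)
      have P: "tr.P n = G.drift c n" for n by (simp add: tr.P_def G.drift_def)
      have rate: "tr.rate t = rt c j t" for t by (simp add: tr.rate_def tr.B_def rt_def Bs_def P)
      have hp: "h j > 0" "\<tau> j > 0" by (fact G.h_pos G.tau_pos)+
      have "\<bar>(LBINT p. Q (uh j p) * \<eta> p) + (LBINT t. tr.rate t * tr.amplitude t * \<psi> (t, g t))\<bar>
         \<le> 4 * B * C * T * h j + 2 * B * T * (T + \<bar>c\<bar> * T + 1) * \<omega> + 6 * B * q * (T + 1) * \<omega>"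
      proof (rule tr.transport_balance_bound[OF test box])
        show "\<tau> j \<le> 1" using elim(1) hp by linarith
        show "\<bar>c\<bar> \<le> q" using c q_gt by linarith
        show "\<eta> p = \<psi>t p + c * \<psi>x p" for p by (rule \<eta>_def)
        show "\<bar>\<eta> p\<bar> \<le> C" "\<bar>\<psi> p\<bar> \<le> C" for p using C1[of p] C2[of p] by (auto simp: C_def)
        show "\<delta> \<le> 1" by (rule \<delta>(2))
        show "\<bar>of_int (tr.P n) * h j - c * (real n * \<tau> j)\<bar> \<le> \<delta>" if "real n * \<tau> j \<le> T + 1" for n
          unfolding P using elim(3) that by blast
        show "\<bar>of_int (G.b j n) * h j - g t\<bar> \<le> \<delta>" if "real n * \<tau> j \<le> t" "t < real (Suc n) * \<tau> j" "t \<le> T + 1" for n t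
          using elim(4) that by blast
        show "\<bar>\<psi> p - \<psi> p'\<bar> \<le> \<omega> \<and> \<bar>\<eta> p - \<eta> p'\<bar> \<le> \<omega>" if "dist p p' \<le> \<tau> j + 3 * h j + 2 * \<delta>" for p p'
        proof -
          have "dist p p' \<le> \<delta>0" using that elim(1) \<delta>(3) by linarith
          then show ?thesis using \<delta>1(2)[of p p'] \<delta>2(2)[of p p'] by (simp add: \<delta>0_def)
        qed
        show "g \<in> borel_measurable borel" by simp
      qed
      also have "\<dots> \<le> 4 * B * C * T * h j + W * \<omega>" using \<omega> by (simp add: W_def algebra_simps)
      also have "W * \<omega> = e / 2" using W by (simp add: \<omega>_def)
      finally have "\<bar>(LBINT p. Q (uh j p) * \<eta> p) + (LBINT t. tr.rate t * tr.amplitude t * \<psi> (t, g t))\<bar> < e"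
        using elim(2) by linarith
      then show ?case unfolding rate tr.amplitude_def \<eta>_def by simp
    qed
    then show "\<exists>no. \<forall>j\<ge>no. norm ((LBINT p. Q (uh j p) * (\<psi>t p + c * \<psi>x p)) + (LBINT t. rt c j t * F j (ix j t) * \<psi> (t, g t)) - 0) < e"
      unfolding eventually_sequentially .
  qed
qed

lemma AE_in_half_plane:
  assumes "S \<subseteq> half_plane"
  shows "AE p in lebesgue. p \<in> S \<longrightarrow> regular_point p"
  using AE_regular by eventually_elim (use assms in blast)

lemma regular_wc: "regular_point p \<Longrightarrow> snd (u p) \<noteq> wc"
  using wMm unfolding regular_point_def by (auto simp: wc_def)

text \<open>Q is discontinuous at the threshold between the phases, but almost every limit state
  avoids it, so convergence almost everywhere along a subsequence passes through Q and dominated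
  convergence applies.\<close>

lemma Q_limit:
  fixes Q :: "state \<Rightarrow> real" and \<eta> :: "point \<Rightarrow> real"
  assumes S: "compact S" "S \<subseteq> half_plane"
    and Qm[measurable]: "Q \<in> borel_measurable borel" and QB: "\<And>z. bounded_state M z \<Longrightarrow> \<bar>Q z\<bar> \<le> B"
    and Qc: "\<And>f z. f \<longlonglongrightarrow> z \<Longrightarrow> snd z \<noteq> wc \<Longrightarrow> (\<lambda>n. Q (f n)) \<longlonglongrightarrow> Q z"
    and cont: "continuous_on UNIV \<eta>" and off: "\<And>p. p \<notin> S \<Longrightarrow> \<eta> p = 0"
  shows "integrable lebesgue (\<lambda>p. Q (u p) * \<eta> p)"
    "\<exists>r. strict_mono r \<and> (\<lambda>n. \<integral>p. Q (uh (r n) p) * \<eta> p \<partial>lborel) \<longlonglongrightarrow> (LINT p|lebesgue. Q (u p) * \<eta> p)"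
proof -
  obtain C where C: "C \<ge> 0" "\<And>p. \<bar>\<eta> p\<bar> \<le> C" using compact_support_bounded[OF cont S(1) off] by blast
  have Sb[measurable]: "S \<in> sets borel" using S(1) by (simp add: compact_imp_closed)
  have [measurable]: "\<eta> \<in> borel_measurable borel" by (rule borel_measurable_continuous_onI[OF cont])
  have B0: "0 \<le> B"
    using QB[OF G.um_M[of 0 0]] abs_ge_zero[of "Q (G.um 0 0)"] by linarith
  obtain r where r: "strict_mono r" "AE p in lebesgue. p \<in> S \<longrightarrow> (\<lambda>n. uh (r n) p) \<longlonglongrightarrow> u p"
    using AE_subsequence[OF S] by blast
  have um: "(\<lambda>p. indicator S p *\<^sub>R u p) \<in> borel_measurable lebesgue"
    using L1 S unfolding L1_loc_limit_def set_integrable_def by (blast dest: borel_measurable_integrable)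
  have \<eta>m: "\<eta> \<in> borel_measurable lebesgue" by (intro measurable_completion) simp
  have fm: "(\<lambda>p. Q (f p) * \<eta> p) \<in> borel_measurable lebesgue" if "(\<lambda>p. indicator S p *\<^sub>R f p) \<in> borel_measurable lebesgue" for f
  proof -
    have "(\<lambda>p. Q (indicator S p *\<^sub>R f p)) \<in> borel_measurable lebesgue"
      using measurable_compose[OF that Qm] .
    then have "(\<lambda>p. Q (indicator S p *\<^sub>R f p) * \<eta> p) \<in> borel_measurable lebesgue" using \<eta>m by (rule borel_measurable_times)
    moreover have "(\<lambda>p. Q (indicator S p *\<^sub>R f p) * \<eta> p) = (\<lambda>p. Q (f p) * \<eta> p)"
      by (auto simp: fun_eq_iff indicator_def off)
    ultimately show ?thesis by simp
  qed
  have bm: "(\<lambda>p. Q (uh j p) * \<eta> p) \<in> borel_measurable borel" for j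
  proof -
    have "(\<lambda>p. Q (indicator S p *\<^sub>R uh j p)) \<in> borel_measurable borel"
      using measurable_compose[OF uh_plane_measurable[OF Sb S(2)] Qm] .
    then have "(\<lambda>p. Q (indicator S p *\<^sub>R uh j p) * \<eta> p) \<in> borel_measurable borel" by measurable
    moreover have "(\<lambda>p. Q (indicator S p *\<^sub>R uh j p) * \<eta> p) = (\<lambda>p. Q (uh j p) * \<eta> p)"
      by (auto simp: fun_eq_iff indicator_def off)
    ultimately show ?thesis by simp
  qed
  have bound: "norm (Q (uh j p) * \<eta> p) \<le> B * C * indicator S p" for j p
  proof (cases "p \<in> S")
    case True
    then have "0 \<le> fst p" using S(2) by (auto simp: half_plane_def)
    from QB[OF G.uh_M[OF this, of j "snd p"]] have "\<bar>Q (uh j p)\<bar> \<le> B" by simp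
    then have "\<bar>Q (uh j p) * \<eta> p\<bar> \<le> B * C" unfolding abs_mult using C B0 by (intro mult_mono) auto
    then show ?thesis using True by simp
  qed (simp add: off)
  have emS: "emeasure lborel S < \<infinity>" by (rule emeasure_bounded_finite[OF compact_imp_bounded[OF S(1)]])
  have w: "integrable lebesgue (\<lambda>p. B * C * indicator S p :: real)"
    using emS by (intro integrable_mult_right integrable_real_indicator) auto
  have lim: "AE p in lebesgue. (\<lambda>n. Q (uh (r n) p) * \<eta> p) \<longlonglongrightarrow> Q (u p) * \<eta> p"
    using r(2) AE_in_half_plane[OF S(2)]
  proof eventually_elim
    case (elim p)
    show ?case
    proof (cases "p \<in> S")
      case True
      then have "(\<lambda>n. Q (uh (r n) p)) \<longlonglongrightarrow> Q (u p)" using elim by (intro Qc regular_wc) auto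
      then show ?thesis by (intro tendsto_intros)
    qed (simp add: off)
  qed
  have uhm: "(\<lambda>p. Q (uh j p) * \<eta> p) \<in> borel_measurable lebesgue" for j
    using bm by (intro measurable_completion) simp
  show "integrable lebesgue (\<lambda>p. Q (u p) * \<eta> p)"
    by (rule integrable_dominated_convergence[OF fm[OF um] uhm w lim]) (use bound in auto)
  have "(\<lambda>n. \<integral>p. Q (uh (r n) p) * \<eta> p \<partial>lebesgue) \<longlonglongrightarrow> (LINT p|lebesgue. Q (u p) * \<eta> p)"
    by (rule integral_dominated_convergence[OF fm[OF um] uhm w lim]) (use bound in auto)
  moreover have "(LINT p|lebesgue. Q (uh j p) * \<eta> p) = (LBINT p. Q (uh j p) * \<eta> p)" for j
    by (rule integral_completion) (use bm in simp)
  ultimately show "\<exists>r. strict_mono r \<and> (\<lambda>n. \<integral>p. Q (uh (r n) p) * \<eta> p \<partial>lborel) \<longlonglongrightarrow> (LINT p|lebesgue. Q (u p) * \<eta> p)"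
    using r(1) by auto
qed

text \<open>The boundary integral converges along the whole sequence and thus, by the vanishing
  defect, so does the integral over the half-plane; its limit is identified along the subsequence of
  \<open>Q_limit\<close>. The set Z collects the times where the amplitude need not
  converge.\<close>

lemma transport_limit:
  assumes tr: "\<And>j. G.tracked j Q c (F j)" and c: "\<bar>c\<bar> \<le> c1"
    and Qm: "Q \<in> borel_measurable borel" and QB: "\<And>z. bounded_state M z \<Longrightarrow> \<bar>Q z\<bar> \<le> B"
    and Qc: "\<And>f z. f \<longlonglongrightarrow> z \<Longrightarrow> snd z \<noteq> wc \<Longrightarrow> (\<lambda>n. Q (f n)) \<longlonglongrightarrow> Q z"
    and FB: "\<And>j n. \<bar>F j n\<bar> \<le> B" and F0: "F0 \<in> borel_measurable borel" "\<And>t. \<bar>F0 t\<bar> \<le> B"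
    and conv: "AE t in lborel. t > 0 \<longrightarrow> t \<notin> Z \<longrightarrow> (\<lambda>j. F j (ix j t)) \<longlonglongrightarrow> F0 t"
    and Z: "Z \<in> sets borel"
      "\<And>T. T > 0 \<Longrightarrow> (\<lambda>j. \<integral>t. indicator ({0..T} \<inter> Z) t * \<bar>rt c j t\<bar> \<partial>lborel) \<longlonglongrightarrow> 0"
    and test: "test_function \<psi> \<psi>t \<psi>x"
  shows "integrable lebesgue (\<lambda>p. Q (u p) * (\<psi>t p + c * \<psi>x p))"
    "(LINT p|lebesgue. Q (u p) * (\<psi>t p + c * \<psi>x p)) = - (LBINT t. (d t - c) * F0 t * \<psi> (t, g t))"
proof -
  obtain S T where box: "test_box S T \<psi> \<psi>t \<psi>x" by (rule ex_test_box[OF test])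
  note S = test_boxD[OF box] and cont = test_function_continuous[OF test]
  have cont\<eta>: "continuous_on UNIV (\<lambda>p. \<psi>t p + c * \<psi>x p)" by (intro continuous_intros cont)
  obtain L where L: "L \<ge> 0" "\<And>p. \<bar>\<psi> p\<bar> \<le> L" using compact_support_bounded[OF cont(1) S(1,4)] by blast
  have off\<eta>: "\<psi>t p + c * \<psi>x p = 0" if "p \<notin> S" for p using S that by simp
  note Ql = Q_limit[OF S(1,2) Qm QB Qc cont\<eta> off\<eta>]
  show "integrable lebesgue (\<lambda>p. Q (u p) * (\<psi>t p + c * \<psi>x p))" by (rule Ql(1))
  obtain r where r: "strict_mono r" "(\<lambda>n. \<integral>p. Q (uh (r n) p) * (\<psi>t p + c * \<psi>x p) \<partial>lborel) \<longlonglongrightarrow> (LINT p|lebesgue. Q (u p) * (\<psi>t p + c * \<psi>x p))"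
    using Ql(2) by blast
  have "(\<lambda>t. (t, g t)) \<in> measurable borel (borel :: point measure)"
    by (intro borel_measurable_continuous_onI continuous_intros g_continuous)
  from measurable_compose[OF this borel_measurable_continuous_onI[OF cont(1)]]
  have \<psi>m: "(\<lambda>t. \<psi> (t, g t)) \<in> borel_measurable borel" .
  have "(\<lambda>j. \<integral>t. rt c j t * F j (ix j t) * \<psi> (t, g t) \<partial>lborel) \<longlonglongrightarrow> (LBINT t. (d t - c) * F0 t * \<psi> (t, g t))"
  proof (rule weak_strong_convergence[where C="2 * q" and M=B and L=L and T=T and Z=Z])
    show "rt c j \<in> borel_measurable borel" for j by measurable
    show "(\<lambda>t. d t - c) \<in> borel_measurable borel" by measurable
    show "(\<lambda>t. F j (ix j t)) \<in> borel_measurable borel" for j by measurable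
    show "\<bar>rt c j t\<bar> \<le> 2 * q" for j t by (rule rt_bound)
    show "\<bar>d t - c\<bar> \<le> 2 * q" for t using d_le(4)[of t] c q_gt by linarith
    show "(\<lambda>j. \<integral>t. indicator {x..y} t * rt c j t \<partial>lborel) \<longlonglongrightarrow> (LBINT t. indicator {x..y} t * (d t - c))" if "0 \<le> x" "x \<le> y" for x y
      by (rule rt_primitive[OF c that])
    show "\<psi> (t, g t) = 0" if "t \<notin> {0..T}" for t
    proof -
      have "(t, g t) \<notin> S" using S(7)[of t "g t"] that by auto
      then show ?thesis by (rule S(4))
    qed
    have "AE t in lborel. t \<notin> {0 :: real}" by (rule countable_AE_lborel) simp
    with conv show "AE t in lborel. t \<in> {0..T} \<longrightarrow> t \<notin> Z \<longrightarrow> (\<lambda>j. F j (ix j t)) \<longlonglongrightarrow> F0 t"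
      by eventually_elim auto
  qed (use F0 FB L Z S(3) \<psi>m in auto)
  from tendsto_diff[OF transport_defect[OF tr c Qm QB FB test] this]
  have "(\<lambda>j. \<integral>p. Q (uh j p) * (\<psi>t p + c * \<psi>x p) \<partial>lborel) \<longlonglongrightarrow> - (LBINT t. (d t - c) * F0 t * \<psi> (t, g t))" by simp
  from LIMSEQ_subseq_LIMSEQ[OF this r(1)]
  have "(\<lambda>n. \<integral>p. Q (uh (r n) p) * (\<psi>t p + c * \<psi>x p) \<partial>lborel) \<longlonglongrightarrow> - (LBINT t. (d t - c) * F0 t * \<psi> (t, g t))"
    by (simp add: comp_def)
  from LIMSEQ_unique[OF r(2) this]
  show "(LINT p|lebesgue. Q (u p) * (\<psi>t p + c * \<psi>x p)) = - (LBINT t. (d t - c) * F0 t * \<psi> (t, g t))" .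
qed

end

section \<open>Convergence of the boundary traces\<close>

lemma integral_pos_interval:
  fixes f :: "real \<Rightarrow> real"
  assumes f: "set_integrable lborel {s..t} f" and pos: "AE x in lborel. x \<in> {s..t} \<longrightarrow> 0 < f x" and st: "s < t"
  shows "0 < (LINT x:{s..t}|lborel. f x)"
proof -
  have i: "integrable lborel (\<lambda>x. indicator {s..t} x *\<^sub>R f x)" using f by (simp add: set_integrable_def)
  have n: "AE x in lborel. 0 \<le> indicator {s..t} x *\<^sub>R f x"
    using pos by eventually_elim (auto simp: indicator_def)
  have "(LINT x:{s..t}|lborel. f x) \<noteq> 0"
  proof
    assume "(LINT x:{s..t}|lborel. f x) = 0"
    then have "AE x in lborel. indicator {s..t} x *\<^sub>R f x = 0"
      using integral_nonneg_eq_0_iff_AE[OF i n] by (simp add: set_lebesgue_integral_def)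
    with pos have "AE x in lborel. x \<notin> {s..t}" by eventually_elim (auto simp: indicator_def)
    then have "{s..t} \<in> null_sets lborel" by (subst (asm) AE_iff_null_sets[symmetric]) auto
    then show False using st by (simp add: null_sets_def)
  qed
  moreover have "0 \<le> (LINT x:{s..t}|lborel. f x)"
    unfolding set_lebesgue_integral_def by (rule integral_nonneg_AE[OF n])
  ultimately show ?thesis by simp
qed

locale glimm_traces = glimm_family +
  assumes b0: "\<And>j. G.b j 0 = 0"
    and data: "countable {y. y \<noteq> 0 \<and> \<not> average_converges u0 y}"
begin

definition "uml j t = G.um j (ix j t)"
definition "upl j t = G.up j (ix j t)"
definition "ilj j t = riemann_inv c1 (uml j t)"
definition "irj j t = riemann_inv (- c3) (upl j t)"
text \<open>The quantity h of the two-phase Riemann solver, written through the incoming invariants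
  alone.\<close>

definition "zj j t = (irj j t - ilj j t) / (c1 + c3)"
definition "R = M + M / c3"

lemma trace_measurable [measurable]:
  "(\<lambda>t. ilj j t) \<in> borel_measurable borel" "(\<lambda>t. irj j t) \<in> borel_measurable borel"
  unfolding ilj_def irj_def uml_def upl_def by measurable

lemma trace_rel:
  "(c1 + Vs j t) * snd (uml j t) = (c3 + Vs j t) * zj j t"
  "(c3 - Vs j t) * snd (upl j t) = (c1 - Vs j t) * zj j t"
  "Vs j t < c3 \<Longrightarrow> phi_value \<phi> (Vs j t) (K * (wM * wm - snd (uml j t) * snd (upl j t)))"
  "\<bar>ilj j t\<bar> \<le> M" "\<bar>irj j t\<bar> \<le> M" "-1 < snd (uml j t)" "snd (uml j t) \<le> wM" "wm \<le> snd (upl j t)" "snd (upl j t) \<le> R"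
proof -
  note tr = G.trace_b[of j "ix j t", unfolded boundary_trace_def Let_def]
  show "(c1 + Vs j t) * snd (uml j t) = (c3 + Vs j t) * zj j t" "(c3 - Vs j t) * snd (upl j t) = (c1 - Vs j t) * zj j t"
    "Vs j t < c3 \<Longrightarrow> phi_value \<phi> (Vs j t) (K * (wM * wm - snd (uml j t) * snd (upl j t)))"
    using tr unfolding Vs_def uml_def upl_def zj_def ilj_def irj_def by blast+
  have p: "uml j t \<in> phase1 wM" "upl j t \<in> phase3 wm" unfolding uml_def upl_def by (fact G.um_phase G.up_phase)+
  show "\<bar>ilj j t\<bar> \<le> M" "\<bar>irj j t\<bar> \<le> M"
    using bounded_stateD(1)[OF G.um_M G.um_phase, of j "ix j t"]
      bounded_stateD(2)[OF G.up_M G.up_phase, of j "ix j t"] by (simp_all add: ilj_def irj_def uml_def upl_def)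
  show "-1 < snd (uml j t)" "snd (uml j t) \<le> wM" "wm \<le> snd (upl j t)" using p unfolding phase1_def phase3_def by auto
  have "norm (upl j t) \<le> R" unfolding upl_def R_def by (rule bounded_state_norm[OF G.up_M])
  moreover have "\<bar>snd (upl j t)\<bar> \<le> norm (upl j t)" using norm_snd_le[of "snd (upl j t)" "fst (upl j t)"] by simp
  ultimately show "snd (upl j t) \<le> R" by linarith
qed

lemma zj_bound: "\<bar>zj j t\<bar> \<le> 2 * M / (c1 + c3)"
proof -
  have "\<bar>irj j t - ilj j t\<bar> \<le> 2 * M" using trace_rel(4,5)[of j t] by linarith
  then show ?thesis unfolding zj_def abs_divide using c_pos by (simp add: divide_right_mono)
qed

text \<open>If the speeds tended to c1, then (c1 - V) z = (c3 - V) w+ would tend to 0, although V -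
  c3 stays positive and w+ \<ge> wm. If they tended to -c3, then \<phi>(V) would tend to minus
  infinity, although it equals K (wM wm - w- w+) with bounded traces.\<close>

lemma d_strict:
  assumes t: "t > 0" "t \<notin> bad"
  shows "- c3 < d t" "d t < c1"
proof -
  have V: "(\<lambda>j. Vs j t) \<longlonglongrightarrow> d t" using bad(3)[OF t] t by (simp add: d_def)
  have "d t \<noteq> c1"
  proof
    assume e: "d t = c1"
    have "(\<lambda>j. (c1 - Vs j t) * zj j t) \<longlonglongrightarrow> 0"
    proof (rule Lim_null_comparison)
      show "\<forall>\<^sub>F j in sequentially. norm ((c1 - Vs j t) * zj j t) \<le> \<bar>c1 - Vs j t\<bar> * (2 * M / (c1 + c3))"
        by (rule always_eventually, rule allI, simp only: real_norm_def abs_mult, rule mult_left_mono[OF zj_bound]) simp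
      have "(\<lambda>j. \<bar>c1 - Vs j t\<bar> * (2 * M / (c1 + c3))) \<longlonglongrightarrow> \<bar>c1 - d t\<bar> * (2 * M / (c1 + c3))" by (intro tendsto_intros V)
      then show "(\<lambda>j. \<bar>c1 - Vs j t\<bar> * (2 * M / (c1 + c3))) \<longlonglongrightarrow> 0" by (simp add: e)
    qed
    then have "(\<lambda>j. (c3 - Vs j t) * snd (upl j t)) \<longlonglongrightarrow> 0" by (simp add: trace_rel(2))
    moreover have "eventually (\<lambda>j. (c3 - Vs j t) * snd (upl j t) \<le> - ((c1 - c3) / 2) * wm) sequentially"
    proof -
      have "eventually (\<lambda>j. (c1 + c3) / 2 < Vs j t) sequentially" by (rule order_tendstoD(1)[OF V]) (use e c_pos in simp)
      then show ?thesis
      proof eventually_elim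
        case (elim j)
        have 1: "(c1 - c3) / 2 \<le> Vs j t - c3" using elim by simp
        have "(c1 - c3) / 2 * wm \<le> (Vs j t - c3) * snd (upl j t)"
          by (rule mult_mono) (use 1 trace_rel(8) wMm wM_pos c_pos in auto)
        then show ?case by (simp add: algebra_simps)
      qed
    qed
    ultimately have "0 \<le> - ((c1 - c3) / 2) * wm" by (rule tendsto_upperbound) simp
    moreover have "(c1 - c3) / 2 * wm > 0" using c_pos wMm wM_pos by simp
    ultimately show False by simp
  qed
  then show "d t < c1" using d_le(2)[of t] by simp
  have "d t \<noteq> - c3"
  proof
    assume e: "d t = - c3"
    have "filterlim (\<lambda>j. Vs j t) (at_right (- c3)) sequentially"
    proof -
      have "Vs j t \<in> {- c3<..} \<and> Vs j t \<noteq> - c3" for j using Vs_bounds(1)[of j t] by simp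
      then show ?thesis using V unfolding e filterlim_at by simp
    qed
    from filterlim_compose[OF dissip_bot this] have "filterlim (\<lambda>j. \<phi> (Vs j t)) at_bot sequentially" .
    then have "eventually (\<lambda>j. \<phi> (Vs j t) \<le> K * (wM * wm - wM * R) - 1) sequentially" by (simp add: filterlim_at_bot)
    moreover have "eventually (\<lambda>j. Vs j t < 0) sequentially" by (rule order_tendstoD(2)[OF V]) (use e c_pos in simp)
    ultimately have "eventually (\<lambda>j :: nat. False) sequentially"
    proof eventually_elim
      case (elim j)
      have "phi_value \<phi> (Vs j t) (K * (wM * wm - snd (uml j t) * snd (upl j t)))"
        by (rule trace_rel(3)) (use elim c_pos in linarith)
      then have f: "\<phi> (Vs j t) = K * (wM * wm - snd (uml j t) * snd (upl j t))" using elim by (simp add: phi_value_def)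
      have "snd (uml j t) * snd (upl j t) \<le> wM * snd (upl j t)"
        using trace_rel(7,8)[of j t] wM_pos wMm by (intro mult_right_mono) auto
      also have "\<dots> \<le> wM * R" using trace_rel(9)[of j t] wM_pos by (intro mult_left_mono) auto
      finally have "K * (wM * wm - wM * R) \<le> \<phi> (Vs j t)" unfolding f using K_pos by (intro mult_left_mono) auto
      then show False using elim by linarith
    qed
    then show False by simp
  qed
  then show "- c3 < d t" using d_le(1)[of t] by simp
qed

lemma g_strict:
  assumes "0 \<le> s" "s < t"
  shows "g t - g s < c1 * (t - s)" "- c3 * (t - s) < g t - g s"
proof -
  have st: "s \<le> t" using assms by simp
  have ci: "set_integrable lborel {s..t} (\<lambda>_. c)" for c :: real
    using integrable_real_indicator[of "{s..t}" lborel] st by (simp add: set_integrable_def)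
  have ci2: "(LINT x:{s..t}|lborel. c) = c * (t - s)" for c :: real
    using st by (simp add: set_lebesgue_integral_def)
  have str: "AE x in lborel. x \<in> {s..t} \<longrightarrow> - c3 < d x \<and> d x < c1"
  proof -
    have "AE x in lborel. x \<notin> bad" "AE x in lborel. x \<notin> {0 :: real}" by (rule countable_AE_lborel, use bad in simp)+
    then show ?thesis by eventually_elim (use assms d_strict in auto)
  qed
  have "0 < (LINT x:{s..t}|lborel. c1 - d x)"
    by (rule integral_pos_interval[OF set_integral_diff(1)[OF ci g_FTC(1)[OF st]]])
      (use str assms in \<open>auto elim: eventually_mono\<close>)
  then show "g t - g s < c1 * (t - s)"
    using set_integral_diff(2)[OF ci g_FTC(1)[OF st], of c1] by (simp add: ci2 g_FTC(2)[OF st])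
  have "0 < (LINT x:{s..t}|lborel. d x - (- c3))"
    by (rule integral_pos_interval[OF set_integral_diff(1)[OF g_FTC(1)[OF st] ci]])
      (use str assms in \<open>auto elim: eventually_mono\<close>)
  then show "- c3 * (t - s) < g t - g s"
    using set_integral_diff(2)[OF g_FTC(1)[OF st] ci, of "- c3"] by (simp add: ci2 g_FTC(2)[OF st])
qed

lemma g0: "g 0 = 0"
proof -
  have "(\<lambda>j. of_int (G.b j (ix j 0)) * h j) \<longlonglongrightarrow> g 0" by (rule b_tendsto) simp
  moreover have "ix j 0 = 0" for j by (simp add: step_index_def)
  ultimately have "(\<lambda>j. 0) \<longlonglongrightarrow> g 0" by (simp add: b0)
  then show ?thesis by (simp add: LIMSEQ_const_iff)
qed

text \<open>\<alpha> t is the foot of the characteristic that arrives at the boundary at time t.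
  Averages of the data converge at all feet but countably many, and injectivity turns exceptional
  feet into countably many exceptional times. The foot 0 is avoided because the initial jump sits
  there.\<close>

lemma incoming_converges:
  assumes inj: "inj_on \<alpha> {0<..}" and nz: "\<And>t. t > 0 \<Longrightarrow> \<alpha> t \<noteq> 0"
    and m: "\<And>j t. even (m j t)" "\<And>t. t > 0 \<Longrightarrow> (\<lambda>j. of_int (m j t) * h j) \<longlonglongrightarrow> \<alpha> t"
  shows "countable {t. t > 0 \<and> \<not> convergent (\<lambda>j. riemann_inv c (G.cell j 0 (m j t)))}"
proof -
  let ?C = "{y. y \<noteq> 0 \<and> \<not> average_converges u0 y}"
  have "inj_on \<alpha> (\<alpha> -` ?C \<inter> {0<..})" using inj by (rule inj_on_subset) simp
  moreover have "countable (\<alpha> ` (\<alpha> -` ?C \<inter> {0<..}))" by (rule countable_subset[OF _ data]) auto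
  ultimately have "countable (\<alpha> -` ?C \<inter> {0<..})" by (rule countable_image_inj_on[rotated])
  moreover have "convergent (\<lambda>j. riemann_inv c (G.cell j 0 (m j t)))" if t: "t > 0" "\<alpha> t \<notin> ?C" for t
  proof -
    obtain l where l: "((\<lambda>(a, b). average a b u0) \<longlongrightarrow> l) (intervals_at (\<alpha> t))"
      using t nz[OF t(1)] unfolding average_converges_def by blast
    have "(\<lambda>j. of_int (m j t) * h j + 2 * h j) \<longlonglongrightarrow> \<alpha> t + 2 * 0" by (intro tendsto_intros m t h0)
    then have "(\<lambda>j. of_int (m j t + 2) * h j) \<longlonglongrightarrow> \<alpha> t" by (simp add: algebra_simps)
    then have "filterlim (\<lambda>j. (of_int (m j t) * h j, of_int (m j t + 2) * h j)) (intervals_at (\<alpha> t)) sequentially"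
      unfolding intervals_at_def filterlim_inf filterlim_principal
      by (intro conjI tendsto_Pair m t always_eventually) (simp_all add: G.h_pos)
    from filterlim_compose[OF l this] have "(\<lambda>j. G.cell j 0 (m j t)) \<longlonglongrightarrow> l" by (simp add: G.cell_0[OF m(1)])
    then have "(\<lambda>j. riemann_inv c (G.cell j 0 (m j t))) \<longlonglongrightarrow> riemann_inv c l"
      unfolding riemann_inv_def by (intro tendsto_intros)
    then show ?thesis by (rule convergentI)
  qed
  then have "{t. t > 0 \<and> \<not> convergent (\<lambda>j. riemann_inv c (G.cell j 0 (m j t)))} \<subseteq> \<alpha> -` ?C \<inter> {0<..}" by blast
  ultimately show ?thesis by (rule countable_subset[rotated])
qed

text \<open>The boundary is strictly slower than c1, so the foot g t - c1 t strictly decreases from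
  0. The shift by two cells to the left neighbour is lost in the limit.\<close>

lemma incoming_left: "countable {t. t > 0 \<and> \<not> convergent (\<lambda>j. ilj j t)}"
  unfolding ilj_def uml_def G.trace_left_incoming(1)
proof (rule incoming_converges[where \<alpha>="\<lambda>t. g t - c1 * t"])
  have mono: "g t - c1 * t < g s - c1 * s" if "0 \<le> s" "s < t" for s t using g_strict(1)[OF that] by (simp add: algebra_simps)
  show "inj_on (\<lambda>t. g t - c1 * t) {0<..}"
    by (rule inj_onI) (metis greaterThan_iff less_imp_le less_irrefl linorder_less_linear mono)
  show "g t - c1 * t \<noteq> 0" if "t > 0" for t using mono[of 0 t] that by (simp add: g0)
  fix t :: real assume "t > 0"
  then have "(\<lambda>j. of_int (G.b j (ix j t)) * h j - of_int (G.drift c1 (ix j t)) * h j - 2 * h j) \<longlonglongrightarrow> g t - c1 * t - 2 * 0"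
    by (intro tendsto_intros b_tendsto drift_tendsto h0) (use c_pos in simp_all)
  then show "(\<lambda>j. of_int (G.b j (ix j t) - G.drift c1 (ix j t) - 2) * h j) \<longlonglongrightarrow> g t - c1 * t" by (simp add: algebra_simps)
qed (use G.trace_left_incoming(3) in auto)

lemma incoming_right: "countable {t. t > 0 \<and> \<not> convergent (\<lambda>j. irj j t)}"
  unfolding irj_def upl_def G.trace_right_incoming(1)
proof (rule incoming_converges[where \<alpha>="\<lambda>t. g t - (- c3) * t"])
  have mono: "g s - (- c3) * s < g t - (- c3) * t" if "0 \<le> s" "s < t" for s t using g_strict(2)[OF that] by (simp add: algebra_simps)
  show "inj_on (\<lambda>t. g t - (- c3) * t) {0<..}"
    by (rule inj_onI) (metis greaterThan_iff less_imp_le less_irrefl linorder_less_linear mono)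
  show "g t - (- c3) * t \<noteq> 0" if "t > 0" for t using mono[of 0 t] that by (simp add: g0)
  fix t :: real assume "t > 0"
  then have "(\<lambda>j. of_int (G.b j (ix j t)) * h j - of_int (G.drift (- c3) (ix j t)) * h j) \<longlonglongrightarrow> g t - (- c3) * t"
    by (intro tendsto_intros b_tendsto drift_tendsto h0) (use c_pos in simp_all)
  then show "(\<lambda>j. of_int (G.b j (ix j t) - G.drift (- c3) (ix j t)) * h j) \<longlonglongrightarrow> g t - (- c3) * t" by (simp add: algebra_simps)
qed (use G.trace_right_incoming(3) in auto)

definition "good t \<longleftrightarrow> t > 0 \<and> t \<notin> bad \<and> convergent (\<lambda>j. ilj j t) \<and> convergent (\<lambda>j. irj j t)"

lemma countable_not_good: "countable {t. t > 0 \<and> \<not> good t}"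
proof -
  have "{t. t > 0 \<and> \<not> good t} \<subseteq> bad \<union> ({t. t > 0 \<and> \<not> convergent (\<lambda>j. ilj j t)} \<union> {t. t > 0 \<and> \<not> convergent (\<lambda>j. irj j t)})"
    unfolding good_def by blast
  then show ?thesis by (rule countable_subset) (intro countable_Un bad incoming_left incoming_right)
qed

lemma good_measurable [measurable]: "Measurable.pred borel good"
proof -
  have "{t. t > 0 \<and> \<not> good t} \<in> sets borel" by (rule sets.countable[OF _ countable_not_good]) simp
  then have "{0<..} - {t. t > 0 \<and> \<not> good t} \<in> sets borel" by (intro sets.Diff) auto
  moreover have "{0<..} - {t. t > 0 \<and> \<not> good t} = {t. good t}" by (auto simp: good_def)
  ultimately show ?thesis by (simp add: pred_def)
qed

lemma AE_good: "AE t in lborel. t > 0 \<longrightarrow> good t"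
  using countable_AE_lborel[OF countable_not_good] by eventually_elim auto

definition "il t = (if good t then lim (\<lambda>j. ilj j t) else 0)"
definition "ir t = (if good t then lim (\<lambda>j. irj j t) else 0)"

end

text \<open>Each step contributes its length \<tau>. Counting the last, possibly incomplete, step in
  full is the reason for the inequality.\<close>

lemma integral_step_count:
  fixes \<tau> T :: real
  assumes tau: "\<tau> > 0" and T: "T > 0"
  shows "(LBINT t. indicator {0..T} t * (if Pr (Suc (step_index \<tau> t)) then 1 else 0 :: real))
    \<le> \<tau> * real (card {n \<in> {1..Suc (step_index \<tau> T)}. Pr n})"
proof -
  define N where "N = Suc (step_index \<tau> T)"
  define f where "f t = indicator {0..<real N * \<tau>} t * (if Pr (Suc (step_index \<tau> t)) then 1 else 0 :: real)" for t
  have i: "integrable lborel f"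
    by (rule integrable_bounded_Icc[of _ 1 0 "real N * \<tau>"]) (auto simp: f_def[abs_def] indicator_def)
  have "(LBINT t. indicator {0..T} t * (if Pr (Suc (step_index \<tau> t)) then 1 else 0 :: real)) \<le> (LBINT t. f t)"
  proof (rule integral_mono_AE'[OF i])
    have "T < real N * \<tau>" using step_index_bounds(2)[OF tau, of T] T by (simp add: N_def)
    then show "AE t in lborel. indicator {0..T} t * (if Pr (Suc (step_index \<tau> t)) then 1 else 0 :: real) \<le> f t"
      by (intro AE_I2) (auto simp: f_def indicator_def)
  qed (simp add: f_def)
  also have "\<dots> = (\<Sum>n<N. LBINT t. indicator (slab \<tau> n) t * f t)"
    by (rule set_integral_steps[OF tau i]) (simp add: f_def)
  also have "\<dots> = (\<Sum>n<N. \<tau> * (if Pr (Suc n) then 1 else 0))"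
  proof (rule sum.cong[OF refl])
    fix n assume n: "n \<in> {..<N}"
    have "indicator (slab \<tau> n) t * f t = indicator (slab \<tau> n) t * (if Pr (Suc n) then 1 else 0)" for t
    proof (cases "t \<in> slab \<tau> n")
      case True
      then have "real (Suc n) * \<tau> \<le> real N * \<tau>" "0 \<le> t" using n tau by (auto intro: mult_right_mono order_trans[of _ "real n * \<tau>"])
      then show ?thesis using True step_index_eq[OF tau, of n t] by (auto simp: f_def simp del: of_nat_Suc)
    qed simp
    then have "(LBINT t. indicator (slab \<tau> n) t * f t) = (LBINT t. indicator (slab \<tau> n) t * (if Pr (Suc n) then 1 else 0))" by presburger
    then show "(LBINT t. indicator (slab \<tau> n) t * f t) = \<tau> * (if Pr (Suc n) then 1 else 0)"
      using tau by (simp add: algebra_simps)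
  qed
  also have "\<dots> = \<tau> * (\<Sum>n\<in>{1..N}. if Pr n then 1 else 0)"
    by (simp add: sum_distrib_left sum.atLeast1_atMost_eq)
  also have "(\<Sum>n\<in>{1..N}. if Pr n then 1 else 0) = real (card {n \<in> {1..N}. Pr n})"
    using sum.inter_filter[of "{1..N}" "\<lambda>_. 1 :: real" Pr] by simp
  finally show ?thesis by (simp add: N_def)
qed

context glimm_traces
begin

definition "z t = (ir t - il t) / (c1 + c3)"
definition "wl t = (c3 + d t) / (c1 + d t) * z t"
text \<open>At d = c3 the right trace has no limit in general and 0 is a placeholder: the amplitude
  built from it is multiplied by d - c3 = 0.\<close>

definition "wr t = (if d t = c3 then 0 else (c1 - d t) / (c3 - d t) * z t)"

lemma il_measurable [measurable]: "il \<in> borel_measurable borel"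
  and ir_measurable [measurable]: "ir \<in> borel_measurable borel"
proof -
  have "(\<lambda>j. if good t then ilj j t else 0) \<longlonglongrightarrow> il t" "(\<lambda>j. if good t then irj j t else 0) \<longlonglongrightarrow> ir t" for t
    by (auto simp: il_def ir_def good_def convergent_LIMSEQ_iff)
  note l = this
  show "il \<in> borel_measurable borel" by (rule borel_measurable_LIMSEQ_real[OF l(1)]) measurable
  show "ir \<in> borel_measurable borel" by (rule borel_measurable_LIMSEQ_real[OF l(2)]) measurable
qed

lemma z_measurable [measurable]: "z \<in> borel_measurable borel" "wl \<in> borel_measurable borel" "wr \<in> borel_measurable borel"
  unfolding z_def[abs_def] wl_def[abs_def] wr_def[abs_def] by measurable

lemma not_good: "\<not> good t \<Longrightarrow> il t = 0 \<and> ir t = 0 \<and> z t = 0 \<and> wl t = 0 \<and> wr t = 0"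
  by (simp add: il_def ir_def z_def wl_def wr_def)

context
  fixes t assumes t: "good t"
begin

lemma V_lim: "(\<lambda>j. Vs j t) \<longlonglongrightarrow> d t"
  using t bad(3)[of t] unfolding good_def d_def by simp

lemma d_bounds: "- c3 < d t" "d t < c1"
  using t d_strict[of t] unfolding good_def by simp_all

lemma i_lim: "(\<lambda>j. ilj j t) \<longlonglongrightarrow> il t" "(\<lambda>j. irj j t) \<longlonglongrightarrow> ir t"
  using t unfolding il_def ir_def good_def by (simp_all add: convergent_LIMSEQ_iff)

lemma z_lim: "(\<lambda>j. zj j t) \<longlonglongrightarrow> z t"
  unfolding zj_def z_def by (intro tendsto_intros i_lim) (use c_pos in simp)

lemma wl_lim: "(\<lambda>j. snd (uml j t)) \<longlonglongrightarrow> wl t"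
proof -
  have "snd (uml j t) = (c3 + Vs j t) / (c1 + Vs j t) * zj j t" for j
  proof -
    have nz: "c1 + Vs j t \<noteq> 0" using Vs_bounds(1)[of j t] c_pos by linarith
    have "snd (uml j t) = ((c1 + Vs j t) * snd (uml j t)) / (c1 + Vs j t)" using nz by simp
    then show ?thesis unfolding trace_rel(1) by simp
  qed
  moreover have "c1 + d t \<noteq> 0" using d_bounds(1) c_pos by linarith
  ultimately show ?thesis unfolding wl_def by (auto intro!: tendsto_intros V_lim z_lim)
qed

lemma wr_lim:
  assumes "d t \<noteq> c3"
  shows "(\<lambda>j. snd (upl j t)) \<longlonglongrightarrow> wr t"
proof -
  have "(\<lambda>j. c3 - Vs j t) \<longlonglongrightarrow> c3 - d t" by (intro tendsto_intros V_lim)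
  then have ne: "eventually (\<lambda>j. c3 - Vs j t \<noteq> 0) sequentially" by (rule tendsto_imp_eventually_ne) (use assms in simp)
  have "(\<lambda>j. (c1 - Vs j t) / (c3 - Vs j t) * zj j t) \<longlonglongrightarrow> (c1 - d t) / (c3 - d t) * z t"
    by (intro tendsto_intros V_lim z_lim) (use assms in simp)
  moreover have "eventually (\<lambda>j. (c1 - Vs j t) / (c3 - Vs j t) * zj j t = snd (upl j t)) sequentially"
    using ne
  proof eventually_elim
    case (elim j)
    have "snd (upl j t) = ((c3 - Vs j t) * snd (upl j t)) / (c3 - Vs j t)" using elim by simp
    then show ?case unfolding trace_rel(2) by simp
  qed
  ultimately show ?thesis using assms unfolding wr_def by (auto intro: Lim_transform_eventually)
qed

text \<open>As w+ is bounded, (c3 - V) w+ tends to 0 when V tends to c3; hence (c1 - c3) z = 0, and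
  the remaining limits follow.\<close>

lemma z_c3:
  assumes "d t = c3"
  shows "z t = 0" "wl t = 0" "ir t = il t"
proof -
  have "(\<lambda>j. (c3 - Vs j t) * snd (upl j t)) \<longlonglongrightarrow> 0"
  proof (rule Lim_null_comparison)
    show "\<forall>\<^sub>F j in sequentially. norm ((c3 - Vs j t) * snd (upl j t)) \<le> \<bar>c3 - Vs j t\<bar> * R"
    proof (rule always_eventually, rule allI, simp only: real_norm_def abs_mult, rule mult_left_mono)
      fix j
      have "0 < snd (upl j t)" using trace_rel(8)[of j t] wMm wM_pos by linarith
      then show "\<bar>snd (upl j t)\<bar> \<le> R" using trace_rel(9)[of j t] by simp
    qed simp
    have "(\<lambda>j. \<bar>c3 - Vs j t\<bar> * R) \<longlonglongrightarrow> \<bar>c3 - d t\<bar> * R" by (intro tendsto_intros V_lim)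
    then show "(\<lambda>j. \<bar>c3 - Vs j t\<bar> * R) \<longlonglongrightarrow> 0" by (simp add: assms)
  qed
  moreover have "(\<lambda>j. (c1 - Vs j t) * zj j t) \<longlonglongrightarrow> (c1 - c3) * z t"
    unfolding assms[symmetric] by (intro tendsto_intros V_lim z_lim)
  ultimately have "(c1 - c3) * z t = 0" unfolding trace_rel(2) by (rule LIMSEQ_unique[rotated])
  then show z: "z t = 0" using c_pos by simp
  then show "wl t = 0" by (simp add: wl_def)
  show "ir t = il t" using z c_pos by (simp add: z_def)
qed

text \<open>Near d the speeds avoid 0 and stay below c3, so the set-valued relation is an equation
  there and \<phi> is continuous. At d = 0 a limit of the relation is dispensable since the
  production carries the factor d.\<close>

lemma dissipation_limit:
  assumes "d t < c3" "d t \<noteq> 0"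
  shows "K * (wM * wm - wl t * wr t) = \<phi> (d t)"
proof -
  have 1: "(\<lambda>j. K * (wM * wm - snd (uml j t) * snd (upl j t))) \<longlonglongrightarrow> K * (wM * wm - wl t * wr t)"
    by (intro tendsto_intros wl_lim wr_lim) (use assms in simp)
  have dD: "d t \<in> D" using assms d_bounds by auto
  have "open ({- c3<..<c3} - {0})" by (intro open_Diff) auto
  moreover have "d t \<in> {- c3<..<c3} - {0}" using assms d_bounds by auto
  ultimately have ev: "eventually (\<lambda>j. Vs j t \<in> {- c3<..<c3} - {0}) sequentially" by (rule topological_tendstoD[OF V_lim])
  then have evD: "eventually (\<lambda>j. Vs j t \<in> D) sequentially" by eventually_elim auto
  have "(\<lambda>j. \<phi> (Vs j t)) \<longlonglongrightarrow> \<phi> (d t)"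
    by (rule continuous_within_tendsto_compose[OF dissip_continuous[OF dD] evD V_lim])
  moreover have "eventually (\<lambda>j. \<phi> (Vs j t) = K * (wM * wm - snd (uml j t) * snd (upl j t))) sequentially"
    using ev
  proof eventually_elim
    case (elim j)
    then have "phi_value \<phi> (Vs j t) (K * (wM * wm - snd (uml j t) * snd (upl j t)))" by (intro trace_rel(3)) auto
    then show ?case using elim by (simp add: phi_value_def)
  qed
  ultimately have "(\<lambda>j. K * (wM * wm - snd (uml j t) * snd (upl j t))) \<longlonglongrightarrow> \<phi> (d t)" by (rule Lim_transform_eventually)
  from LIMSEQ_unique[OF 1 this] show ?thesis .
qed

end

definition "amp1 t = (il t)\<^sup>2"
definition "amp2 t = (il t + 2 * c1 * wl t)\<^sup>2"
definition "amp3 t = - ((ir t)\<^sup>2 + 2 * K0)"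
definition "amp4 t = - ((ir t - 2 * c3 * wr t)\<^sup>2 + 2 * K0)"

lemma amp_measurable [measurable]:
  "amp1 \<in> borel_measurable borel" "amp2 \<in> borel_measurable borel" "amp3 \<in> borel_measurable borel" "amp4 \<in> borel_measurable borel"
  unfolding amp1_def[abs_def] amp2_def[abs_def] amp3_def[abs_def] amp4_def[abs_def] by measurable

lemma amp_lim:
  assumes "good t"
  shows "(\<lambda>j. (riemann_inv c1 (G.um j (ix j t)))\<^sup>2) \<longlonglongrightarrow> amp1 t"
    "(\<lambda>j. (riemann_inv (- c1) (G.um j (ix j t)))\<^sup>2) \<longlonglongrightarrow> amp2 t"
    "(\<lambda>j. - ((riemann_inv (- c3) (G.up j (ix j t)))\<^sup>2 + 2 * K0)) \<longlonglongrightarrow> amp3 t"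
    "d t \<noteq> c3 \<Longrightarrow> (\<lambda>j. - ((riemann_inv c3 (G.up j (ix j t)))\<^sup>2 + 2 * K0)) \<longlonglongrightarrow> amp4 t"
proof -
  have e: "riemann_inv (- c1) (G.um j (ix j t)) = ilj j t + 2 * c1 * snd (uml j t)"
    "riemann_inv c3 (G.up j (ix j t)) = irj j t - 2 * c3 * snd (upl j t)" for j
    by (simp_all add: ilj_def uml_def irj_def upl_def riemann_inv_def)
  have i: "riemann_inv c1 (G.um j (ix j t)) = ilj j t" "riemann_inv (- c3) (G.up j (ix j t)) = irj j t" for j
    by (simp_all add: ilj_def uml_def irj_def upl_def)
  show "(\<lambda>j. (riemann_inv c1 (G.um j (ix j t)))\<^sup>2) \<longlonglongrightarrow> amp1 t" "(\<lambda>j. (riemann_inv (- c1) (G.um j (ix j t)))\<^sup>2) \<longlonglongrightarrow> amp2 t"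
    "(\<lambda>j. - ((riemann_inv (- c3) (G.up j (ix j t)))\<^sup>2 + 2 * K0)) \<longlonglongrightarrow> amp3 t"
    unfolding e i amp1_def amp2_def amp3_def by (intro tendsto_intros i_lim wl_lim assms)+
  show "(\<lambda>j. - ((riemann_inv c3 (G.up j (ix j t)))\<^sup>2 + 2 * K0)) \<longlonglongrightarrow> amp4 t" if "d t \<noteq> c3"
    unfolding e i amp4_def by (intro tendsto_intros i_lim wr_lim assms that)
qed

lemma trace_amplitude_bound:
  "\<bar>(riemann_inv c1 (G.um j n))\<^sup>2\<bar> \<le> QM M" "\<bar>(riemann_inv (- c1) (G.um j n))\<^sup>2\<bar> \<le> QM M"
  "\<bar>- ((riemann_inv (- c3) (G.up j n))\<^sup>2 + 2 * K0)\<bar> \<le> QM M" "\<bar>- ((riemann_inv c3 (G.up j n))\<^sup>2 + 2 * K0)\<bar> \<le> QM M"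
  using Q_bound[OF G.um_M[of j n]] Q_bound[OF G.up_M[of j n]]
  by (simp_all only: Q_phase(1)[OF G.um_phase] Q_phase(4)[OF G.up_phase] abs_minus_cancel)

lemma QM_ge: "2 * K0 \<le> QM M" "0 \<le> QM M" using K0_pos by (simp_all add: QM_def)

lemma amp_bound: "\<bar>amp1 t\<bar> \<le> QM M" "\<bar>amp2 t\<bar> \<le> QM M" "\<bar>amp3 t\<bar> \<le> QM M" "\<bar>amp4 t\<bar> \<le> QM M"
proof -
  have n: "\<not> good t \<Longrightarrow> amp1 t = 0 \<and> amp2 t = 0 \<and> amp3 t = - 2 * K0 \<and> amp4 t = - 2 * K0"
    using not_good[of t] by (simp add: amp1_def amp2_def amp3_def amp4_def)
  have K: "\<bar>2 * K0\<bar> \<le> QM M" using QM_ge K0_pos by simp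
  have lim: "\<bar>l\<bar> \<le> QM M" if "f \<longlonglongrightarrow> l" "\<And>j. \<bar>f j\<bar> \<le> QM M" for f :: "nat \<Rightarrow> real" and l
    by (rule LIMSEQ_le_const2[OF tendsto_rabs[OF that(1)]]) (use that(2) in auto)
  show "\<bar>amp1 t\<bar> \<le> QM M" using n K QM_ge lim[OF amp_lim(1) trace_amplitude_bound(1)] by (cases "good t") auto
  show "\<bar>amp2 t\<bar> \<le> QM M" using n K QM_ge lim[OF amp_lim(2) trace_amplitude_bound(2)] by (cases "good t") auto
  show 3: "\<bar>amp3 t\<bar> \<le> QM M" using n K QM_ge lim[OF amp_lim(3) trace_amplitude_bound(3)] by (cases "good t") auto
  show "\<bar>amp4 t\<bar> \<le> QM M"
  proof (cases "good t \<and> d t \<noteq> c3")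
    case True
    then show ?thesis using lim[OF amp_lim(4) trace_amplitude_bound(4)] by blast
  next
    case False
    then have "\<not> good t \<or> d t = c3" by blast
    then show ?thesis
    proof
      assume "\<not> good t"
      then show ?thesis using n K by simp
    next
      assume "d t = c3"
      then have "amp4 t = amp3 t" by (simp add: amp3_def amp4_def wr_def)
      then show ?thesis using 3 by simp
    qed
  qed
qed

definition "Zc = {t. good t \<and> d t = c3}"

lemma Zc_borel [measurable]: "Zc \<in> sets borel"
  unfolding Zc_def by measurable

text \<open>The samples within \<delta> of c3 have density \<delta> / q; the conditions on \<delta>
  keep the corresponding interval of a inside [-1, 1].\<close>

lemma near_c3_count:
  assumes \<delta>: "0 < \<delta>" "c3 + \<delta> < q" "\<delta> < c3" and \<eta>: "\<eta> > 0"
  shows "\<exists>K'\<ge>0. \<forall>N. real (card {n \<in> {1..N}. \<bar>a n * q - c3\<bar> \<le> \<delta>}) \<le> (\<delta> / q + \<eta>) * real N + K'"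
proof -
  define \<alpha> \<beta> where "\<alpha> = (c3 - \<delta>) / q" and "\<beta> = (c3 + \<delta>) / q"
  have ab: "-1 \<le> \<alpha>" "\<alpha> \<le> \<beta>" "\<beta> \<le> 1"
    using \<delta> q_gt c_pos by (simp_all add: \<alpha>_def \<beta>_def pos_le_divide_eq pos_divide_le_eq divide_right_mono)
  obtain K' where K': "K' \<ge> (0::real)" "\<And>N. \<bar>real (card {n\<in>{1..N}. \<alpha> \<le> a n \<and> a n \<le> \<beta>}) - (\<beta> - \<alpha>) / 2 * N\<bar> \<le> \<eta> * N + K'"
    using equidistributed_count[OF equi ab \<eta>] by blast
  have e: "(\<alpha> \<le> a n \<and> a n \<le> \<beta>) = (\<bar>a n * q - c3\<bar> \<le> \<delta>)" for n
    using q_gt by (auto simp: \<alpha>_def \<beta>_def pos_le_divide_eq pos_divide_le_eq abs_le_iff)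
  have ba: "(\<beta> - \<alpha>) / 2 = \<delta> / q" using q_gt by (simp add: \<alpha>_def \<beta>_def diff_divide_distrib add_divide_distrib)
  show ?thesis
  proof (intro exI conjI allI)
    fix N
    show "real (card {n \<in> {1..N}. \<bar>a n * q - c3\<bar> \<le> \<delta>}) \<le> (\<delta> / q + \<eta>) * real N + K'"
      using K'(2)[of N] unfolding e ba by (simp add: algebra_simps abs_le_iff)
  qed (rule K')
qed

text \<open>Where d = c3, a nonzero rate means that the sample lies between V and c3. Either V is
  still farther than \<delta> from c3, which happens on a set of times whose measure tends to 0, or
  the sample is within \<delta> of c3, which by equidistribution affects only a fraction \<delta> /
  q of the steps.\<close>

lemma rate_vanishes:
  assumes T: "T > 0"
  shows "(\<lambda>j. \<integral>t. indicator ({0..T} \<inter> Zc) t * \<bar>rt c3 j t\<bar> \<partial>lborel) \<longlonglongrightarrow> 0"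
proof (rule LIMSEQ_I)
  fix e :: real assume e: "e > 0"
  \<comment> \<open>With \<delta> / q \<le> \<epsilon> and counting error \<epsilon>, the frequent
    samples cost 2 q times 2 \<epsilon> (T + 1) = e / 2. A quarter of e is left for the late speeds
    X and a quarter for the constant of the count.\<close>
  define \<epsilon> where "\<epsilon> = e / (8 * q * (T + 1))"
  have \<epsilon>: "\<epsilon> > 0" "2 * q * (2 * \<epsilon> * (T + 1)) = e / 2"
  proof -
    have nz: "8 * q * (T + 1) \<noteq> 0" using q_gt T by auto
    show "\<epsilon> > 0" using e q_gt T by (simp add: \<epsilon>_def)
    have "\<epsilon> * (8 * q * (T + 1)) = e" using nz by (simp add: \<epsilon>_def)
    then show "2 * q * (2 * \<epsilon> * (T + 1)) = e / 2" by (simp add: algebra_simps)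
  qed
  define \<delta> where "\<delta> = min (q * \<epsilon>) (min ((q - c3) / 2) (c3 / 2))"
  have \<delta>: "0 < \<delta>" "c3 + \<delta> < q" "\<delta> < c3" "\<delta> / q \<le> \<epsilon>"
  proof -
    have "\<delta> \<le> (q - c3) / 2" "\<delta> \<le> c3 / 2" "\<delta> \<le> q * \<epsilon>" unfolding \<delta>_def by (simp_all only: min.cobounded1 min.coboundedI2[OF min.cobounded1] min.coboundedI2[OF min.cobounded2])
    then show "c3 + \<delta> < q" "\<delta> < c3" "\<delta> / q \<le> \<epsilon>" using q_gt c_pos by (auto simp: pos_divide_le_eq mult.commute)
    show "0 < \<delta>" using q_gt c_pos \<epsilon> by (simp add: \<delta>_def)
  qed
  obtain K' where K': "K' \<ge> 0" "\<And>N. real (card {n \<in> {1..N}. \<bar>a n * q - c3\<bar> \<le> \<delta>}) \<le> (\<delta> / q + \<epsilon>) * real N + K'"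
    using near_c3_count[OF \<delta>(1-3) \<epsilon>(1)] by blast
  define X where "X j t = indicator ({0..T} \<inter> Zc) t * (if \<bar>Vs j t - c3\<bar> > \<delta> then 1 else 0 :: real)" for j t
  define Y where "Y j t = indicator {0..T} t * (if \<bar>a (Suc (ix j t)) * q - c3\<bar> \<le> \<delta> then 1 else 0 :: real)" for j t
  have [measurable]: "X j \<in> borel_measurable borel" "Y j \<in> borel_measurable borel" for j
    unfolding X_def[abs_def] Y_def[abs_def] by measurable
  have emT: "emeasure lborel {0..T} < \<infinity>" by (rule emeasure_bounded_finite) simp
  have iT: "integrable lborel (indicat_real {0..T})" using emT by (intro integrable_real_indicator) auto
  have iX: "integrable lborel (X j)" and iY: "integrable lborel (Y j)" for j
    by (rule Bochner_Integration.integrable_bound[OF iT], simp, rule AE_I2, simp add: X_def Y_def indicator_def)+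
  have Xlim: "(\<lambda>j. \<integral>t. X j t \<partial>lborel) \<longlonglongrightarrow> (\<integral>t. 0 \<partial>(lborel :: real measure))"
  proof (rule integral_dominated_convergence[where w="indicat_real {0..T}", OF _ _ iT])
    show "AE t in lborel. (\<lambda>j. X j t) \<longlonglongrightarrow> 0"
    proof (rule AE_I2)
      fix t
      show "(\<lambda>j. X j t) \<longlonglongrightarrow> 0"
      proof (cases "t \<in> Zc")
        case True
        then have "(\<lambda>j. Vs j t) \<longlonglongrightarrow> c3" using V_lim[of t] by (simp add: Zc_def)
        then have "(\<lambda>j. \<bar>Vs j t - c3\<bar>) \<longlonglongrightarrow> \<bar>c3 - c3\<bar>" by (intro tendsto_intros)
        then have "eventually (\<lambda>j. \<bar>Vs j t - c3\<bar> < \<delta>) sequentially" using \<delta>(1) by (intro order_tendstoD(2)[of _ "\<bar>c3 - c3\<bar>"]) auto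
        then have "eventually (\<lambda>j. X j t = 0) sequentially" by eventually_elim (simp add: X_def)
        then show ?thesis by (rule tendsto_eventually)
      qed (simp add: X_def)
    qed
  qed (auto simp: X_def indicator_def)
  have "2 * q > 0" using q_gt by simp
  have ev1: "eventually (\<lambda>j. 2 * q * (LBINT t. X j t) < e / 4) sequentially"
  proof -
    have "(\<lambda>j. 2 * q * (LBINT t. X j t)) \<longlonglongrightarrow> 2 * q * (\<integral>t. 0 \<partial>(lborel :: real measure))" by (intro tendsto_intros Xlim)
    then show ?thesis using e by (intro order_tendstoD(2)[of _ "2 * q * (\<integral>t. 0 \<partial>(lborel :: real measure))"]) auto
  qed
  have ev2: "eventually (\<lambda>j. 2 * q * (K' * \<tau> j) < e / 4) sequentially"
  proof -
    have "(\<lambda>j. 2 * q * (K' * \<tau> j)) \<longlonglongrightarrow> 2 * q * (K' * 0)" by (intro tendsto_intros tau0)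
    then show ?thesis using e by (intro order_tendstoD(2)[of _ "2 * q * (K' * 0)"]) auto
  qed
  have ev3: "eventually (\<lambda>j. \<tau> j < 1) sequentially" by (rule order_tendstoD(2)[OF tau0]) simp
  have "eventually (\<lambda>j. norm ((LBINT t. indicator ({0..T} \<inter> Zc) t * \<bar>rt c3 j t\<bar>) - 0) < e) sequentially"
    using ev1 ev2 ev3
  proof eventually_elim
    case (elim j)
    have pt: "indicator ({0..T} \<inter> Zc) t * \<bar>rt c3 j t\<bar> \<le> 2 * q * (X j t + Y j t)" for t
    proof (cases "t \<in> {0..T} \<inter> Zc \<and> rt c3 j t \<noteq> 0")
      case True
      then have "\<bar>Vs j t - c3\<bar> > \<delta> \<or> \<bar>a (Suc (ix j t)) * q - c3\<bar> \<le> \<delta>"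
        unfolding rt_eq by (auto split: if_splits)
      then have "1 \<le> X j t + Y j t" using True by (auto simp: X_def Y_def)
      then have "2 * q * 1 \<le> 2 * q * (X j t + Y j t)" using q_gt by (intro mult_left_mono) auto
      then show ?thesis using True rt_bound[of c3 j t] by simp
    next
      case False
      have "0 \<le> 2 * q * (X j t + Y j t)" using q_gt by (intro mult_nonneg_nonneg) (auto simp: X_def Y_def)
      then show ?thesis using False by (auto simp: indicator_def)
    qed
    have "(LBINT t. indicator ({0..T} \<inter> Zc) t * \<bar>rt c3 j t\<bar>) \<le> (LBINT t. 2 * q * (X j t + Y j t))"
    proof (rule integral_mono_AE')
      show "AE t in lborel. 0 \<le> 2 * q * (X j t + Y j t)"
        using q_gt by (intro AE_I2 mult_nonneg_nonneg) (auto simp: X_def Y_def)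
    qed (use iX iY pt in auto)
    also have "\<dots> = 2 * q * (LBINT t. X j t) + 2 * q * (LBINT t. Y j t)" using iX iY by (simp add: algebra_simps)
    also have "(LBINT t. Y j t) \<le> \<tau> j * real (card {n \<in> {1..Suc (ix j T)}. \<bar>a n * q - c3\<bar> \<le> \<delta>})"
      unfolding Y_def by (rule integral_step_count[OF G.tau_pos T])
    also have "\<dots> \<le> \<tau> j * ((\<delta> / q + \<epsilon>) * real (Suc (ix j T)) + K')"
      by (rule mult_left_mono[OF K'(2) less_imp_le[OF G.tau_pos]])
    also have "\<dots> = (\<delta> / q + \<epsilon>) * (real (ix j T) * \<tau> j + \<tau> j) + K' * \<tau> j" by (simp add: algebra_simps)
    also have "\<dots> \<le> (2 * \<epsilon>) * (T + 1) + K' * \<tau> j"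
      using ix(1)[of T j] T elim(3) K'(1) \<delta>(1,4) \<epsilon>(1) q_gt G.tau_pos[of j] by (intro add_mono mult_mono) auto
    finally have "(LBINT t. indicator ({0..T} \<inter> Zc) t * \<bar>rt c3 j t\<bar>) \<le> 2 * q * (LBINT t. X j t) + 2 * q * (2 * \<epsilon> * (T + 1) + K' * \<tau> j)"
      using q_gt by (simp add: mult_left_mono)
    then have "(LBINT t. indicator ({0..T} \<inter> Zc) t * \<bar>rt c3 j t\<bar>) < e"
      using elim(1,2) \<epsilon>(2) unfolding distrib_left[of "2 * q"] by linarith
    moreover have "0 \<le> (LBINT t. indicator ({0..T} \<inter> Zc) t * \<bar>rt c3 j t\<bar>)" by (intro integral_nonneg_AE AE_I2) simp
    ultimately show ?case by simp
  qed
  then show "\<exists>no. \<forall>j\<ge>no. norm ((LBINT t. indicator ({0..T} \<inter> Zc) t * \<bar>rt c3 j t\<bar>) - 0) < e"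
    unfolding eventually_sequentially .
qed

end

section \<open>Entropy production\<close>

context phase_model
begin

text \<open>(v - c w)^2 + (v + c w)^2 = 2 v^2 + 2 c^2 w^2 gives the energy, and the same squares
  weighted with their speeds give the flux. Each phase thus splits into two quantities that are
  merely transported.\<close>

lemma entropy_decomposition:
  assumes "snd s \<le> wM \<or> wm \<le> snd s"
  shows "entropy k1 k3 wM wm s = (QL c1 s + QL (- c1) s + QR (- c3) s + QR c3 s) / 4" (is ?U)
    "entropy_flux k1 k3 wM wm s = (c1 * QL c1 s + (- c1) * QL (- c1) s + (- c3) * QR (- c3) s + c3 * QR c3 s) / 4" (is ?F)
proof -
  obtain v w where s: "s = (v, w)" by (cases s)
  have sq: "(v - c * w)\<^sup>2 + (v + c * w)\<^sup>2 = 2 * v\<^sup>2 + 2 * (c\<^sup>2 * w\<^sup>2)" "c * (v - c * w)\<^sup>2 - c * (v + c * w)\<^sup>2 = - 4 * (c\<^sup>2 * w) * v" for c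
    by (simp_all add: power2_eq_square algebra_simps)
  have "?U \<and> ?F"
  proof (cases "w \<le> wM")
    case True
    have e: "entropy k1 k3 wM wm (v, w) = k1 * w\<^sup>2 / 2 + v\<^sup>2 / 2"
      by (rule entropy_phases(1)) (use k3_pos k31 wM_pos wMm True in auto)
    have "w < wc" using True wMm by (simp add: wc_def)
    then have Q: "QL c1 (v, w) = (v - c1 * w)\<^sup>2" "QL (- c1) (v, w) = (v + c1 * w)\<^sup>2" "QR c (v, w) = 0" for c
      by (simp_all add: QL_def QR_def riemann_inv_def)
    have f: "entropy_flux k1 k3 wM wm (v, w) = - (k1 * w) * v" using True by (simp add: entropy_flux_def stress_def)
    show ?thesis unfolding s e f Q using sq[of c1] c_pos(4) by simp
  next
    case False
    then have w: "wm \<le> w" using assms by (simp add: s)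
    have e: "entropy k1 k3 wM wm (v, w) = k3 * w\<^sup>2 / 2 + (k1 - k3) / 2 * wM * wm + v\<^sup>2 / 2"
      by (rule entropy_phases(2)) (use k3_pos k31 wM_pos wMm w in auto)
    have "\<not> w < wc" using w wMm by (simp add: wc_def)
    then have Q: "QR c3 (v, w) = (v - c3 * w)\<^sup>2 + 2 * K0" "QR (- c3) (v, w) = (v + c3 * w)\<^sup>2 + 2 * K0" "QL c (v, w) = 0" for c
      by (simp_all add: QL_def QR_def riemann_inv_def)
    have f: "entropy_flux k1 k3 wM wm (v, w) = - (k3 * w) * v" using w wMm by (simp add: entropy_flux_def stress_def)
    have K: "(k1 - k3) / 2 * wM * wm = K0" by (simp add: K0_def K_def)
    show ?thesis unfolding s e f Q K using sq[of c3] c_pos(5) by (simp add: distrib_left)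
  qed
  then show ?U ?F by blast+
qed

end

context glimm_traces
begin

definition "prodn t = ((d t - c1) * amp1 t + (d t - (- c1)) * amp2 t + (d t - (- c3)) * amp3 t + (d t - c3) * amp4 t) / 4"

lemma prodn_measurable [measurable]: "prodn \<in> borel_measurable borel"
  unfolding prodn_def[abs_def] by measurable

lemma prodn_bound: "\<bar>prodn t\<bar> \<le> 2 * q * QM M"
proof -
  have *: "\<bar>(d t - c) * x\<bar> \<le> 2 * q * QM M" if "\<bar>x\<bar> \<le> QM M" "\<bar>c\<bar> \<le> c1" for c x
    unfolding abs_mult by (rule mult_mono[OF _ that(1)]) (use d_le(4)[of t] that(2) q_gt in auto)
  show ?thesis
    using *[OF amp_bound(1)[of t], of c1] *[OF amp_bound(2)[of t], of "- c1"] *[OF amp_bound(3)[of t], of "- c3"] *[OF amp_bound(4)[of t], of c3] c_pos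
    unfolding prodn_def by simp
qed

text \<open>Only the difference z of the incoming invariants matters: the common part i cancels by
  the linear trace relations. What remains is -d K (wM wm - w- w+), the dissipation of the kinetic
  relation.\<close>

lemma prodn_eq:
  assumes t: "good t" and c: "d t \<le> c3"
  shows "prodn t = - d t * \<phi> (d t)"
proof (cases "d t = c3")
  case True
  note z = z_c3[OF t True]
  \<comment> \<open>At z = 0 the four invariants entering the amplitudes are equal because w- = 0
    and the placeholder for w+ is 0; the squares cancel and only the constants 2 K0 are
    left.\<close>
  have "prodn t = - c3 * K0"
    unfolding prodn_def amp1_def amp2_def amp3_def amp4_def True z(2,3) by (simp add: field_simps)
  then show ?thesis by (simp add: True phi_c3)
next
  case False
  define e i where "e = d t" and "i = il t"
  define Z p r where "Z = z t" and "p = wl t" and "r = wr t"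
  have ir: "ir t = i + (c1 + c3) * Z" using c_pos by (simp add: i_def Z_def z_def)
  have nz: "c1 + e \<noteq> 0" "c3 - e \<noteq> 0" using False d_bounds[OF t] c_pos by (auto simp: e_def)
  have p: "(c1 + e) * p = (c3 + e) * Z" using nz by (simp add: p_def wl_def Z_def e_def)
  have r: "(c3 - e) * r = (c1 - e) * Z" using nz False by (simp add: r_def wr_def Z_def e_def)
  have K: "4 * K = 2 * (c1 * c1 - c3 * c3)" using c_pos(4,5) by (simp add: K_def power2_eq_square)
  have pr: "(c1 + e) * ((c3 - e) * (p * r)) = (c3 + e) * (c1 - e) * (Z * Z)"
  proof -
    have "(c1 + e) * ((c3 - e) * (p * r)) = ((c1 + e) * p) * ((c3 - e) * r)" by (simp add: algebra_simps)
    then show ?thesis unfolding p r by (simp add: algebra_simps)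
  qed
  \<comment> \<open>The amplitudes are expanded so that (c1 + e) p and (c3 - e) r appear as units;
    replacing these by multiples of Z removes every term that contains i.\<close>
  have expand: "4 * prodn t = - 2 * e * (c1 + c3)\<^sup>2 * (Z * Z) - 4 * c3 * (c1 + c3) * (c1 - e) * (Z * Z)
      + 4 * c1\<^sup>2 * (c3 + e) * (Z * p) + 4 * c3\<^sup>2 * (c1 - e) * (Z * r) - 4 * e * K0"
  proof -
    have "4 * prodn t = (d t - c1) * amp1 t + (d t - (- c1)) * amp2 t + (d t - (- c3)) * amp3 t + (d t - c3) * amp4 t"
      by (simp add: prodn_def)
    also have "\<dots> = (e - c1) * i\<^sup>2 + (e + c1) * (i + 2 * c1 * p)\<^sup>2
       - (e + c3) * ((i + (c1 + c3) * Z)\<^sup>2 + 2 * K0) - (e - c3) * ((i + (c1 + c3) * Z - 2 * c3 * r)\<^sup>2 + 2 * K0)"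
      unfolding amp1_def amp2_def amp3_def amp4_def ir e_def[symmetric] i_def[symmetric] p_def[symmetric] r_def[symmetric]
      by (simp only: diff_minus_eq_add mult_minus_right add_uminus_conv_diff)
    also have "\<dots> = (e - c1) * i\<^sup>2 + (e + c1) * i\<^sup>2 + 4 * c1 * i * ((c1 + e) * p) + 4 * c1\<^sup>2 * p * ((c1 + e) * p)
       - (e + c3) * (i + (c1 + c3) * Z)\<^sup>2 - (e - c3) * (i + (c1 + c3) * Z)\<^sup>2
       - 4 * c3 * (i + (c1 + c3) * Z) * ((c3 - e) * r) + 4 * c3\<^sup>2 * r * ((c3 - e) * r) - 4 * e * K0"
      by (simp add: power2_eq_square algebra_simps)
    also have "\<dots> = - 2 * e * (c1 + c3)\<^sup>2 * (Z * Z) - 4 * c3 * (c1 + c3) * (c1 - e) * (Z * Z)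
      + 4 * c1\<^sup>2 * (c3 + e) * (Z * p) + 4 * c3\<^sup>2 * (c1 - e) * (Z * r) - 4 * e * K0"
      unfolding p r by (simp add: power2_eq_square algebra_simps)
    finally show ?thesis .
  qed
  \<comment> \<open>Clearing the nonzero denominators makes the claim a polynomial identity: p, r
    and p r are replaced by multiples of Z and K by half the difference of the squared sound
    speeds.\<close>
  have "(c1 + e) * (c3 - e) * (4 * prodn t + 4 * e * (K0 - K * (p * r))) = 0"
  proof -
    have "(c1 + e) * (c3 - e) * (4 * prodn t + 4 * e * (K0 - K * (p * r)))
      = (c1 + e) * (c3 - e) * (- 2 * e * (c1 + c3)\<^sup>2 * (Z * Z) - 4 * c3 * (c1 + c3) * (c1 - e) * (Z * Z))
      + 4 * c1\<^sup>2 * (c3 + e) * (c3 - e) * Z * ((c1 + e) * p) + 4 * c3\<^sup>2 * (c1 - e) * (c1 + e) * Z * ((c3 - e) * r)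
      - e * (4 * K) * ((c1 + e) * ((c3 - e) * (p * r)))"
      unfolding expand by (simp add: algebra_simps)
    also have "\<dots> = 0" unfolding p r pr K by (simp add: power2_eq_square algebra_simps)
    finally show ?thesis .
  qed
  then have "prodn t = - e * (K0 - K * (p * r))" using nz by simp
  also have "K0 - K * (p * r) = K * (wM * wm - p * r)" by (simp add: K0_def algebra_simps)
  finally have f: "prodn t = - d t * (K * (wM * wm - wl t * wr t))" by (simp add: e_def p_def r_def)
  show ?thesis
  proof (cases "d t = 0")
    case True
    then show ?thesis by (simp add: f)
  next
    case 0: False
    have "d t < c3" using c False by simp
    from dissipation_limit[OF t this 0] show ?thesis unfolding f by simp
  qed
qed

lemma AE_amp_lim:
  "AE t in lborel. t > 0 \<longrightarrow> t \<notin> {} \<longrightarrow> (\<lambda>j. (riemann_inv c1 (G.um j (ix j t)))\<^sup>2) \<longlonglongrightarrow> amp1 t"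
  "AE t in lborel. t > 0 \<longrightarrow> t \<notin> {} \<longrightarrow> (\<lambda>j. (riemann_inv (- c1) (G.um j (ix j t)))\<^sup>2) \<longlonglongrightarrow> amp2 t"
  "AE t in lborel. t > 0 \<longrightarrow> t \<notin> {} \<longrightarrow> (\<lambda>j. - ((riemann_inv (- c3) (G.up j (ix j t)))\<^sup>2 + 2 * K0)) \<longlonglongrightarrow> amp3 t"
  "AE t in lborel. t > 0 \<longrightarrow> t \<notin> Zc \<longrightarrow> (\<lambda>j. - ((riemann_inv c3 (G.up j (ix j t)))\<^sup>2 + 2 * K0)) \<longlonglongrightarrow> amp4 t"
  using AE_good by (eventually_elim, use amp_lim in \<open>simp add: Zc_def\<close>)+

text \<open>Three of the four amplitudes converge almost everywhere, so the exceptional set is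
  empty. For the outgoing wave on the right it is the set where d = c3, on which
  \<open>rate_vanishes\<close> compensates.\<close>

lemma partial_balance:
  assumes test: "test_function \<psi> \<psi>t \<psi>x"
  shows "integrable lebesgue (\<lambda>p. QL c1 (u p) * (\<psi>t p + c1 * \<psi>x p))" (is ?A1)
    "(LINT p|lebesgue. QL c1 (u p) * (\<psi>t p + c1 * \<psi>x p)) = - (LBINT t. (d t - c1) * amp1 t * \<psi> (t, g t))" (is ?A2)
    "integrable lebesgue (\<lambda>p. QL (- c1) (u p) * (\<psi>t p + (- c1) * \<psi>x p))" (is ?B1)
    "(LINT p|lebesgue. QL (- c1) (u p) * (\<psi>t p + (- c1) * \<psi>x p)) = - (LBINT t. (d t - (- c1)) * amp2 t * \<psi> (t, g t))" (is ?B2)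
    "integrable lebesgue (\<lambda>p. QR (- c3) (u p) * (\<psi>t p + (- c3) * \<psi>x p))" (is ?C1)
    "(LINT p|lebesgue. QR (- c3) (u p) * (\<psi>t p + (- c3) * \<psi>x p)) = - (LBINT t. (d t - (- c3)) * amp3 t * \<psi> (t, g t))" (is ?C2)
    "integrable lebesgue (\<lambda>p. QR c3 (u p) * (\<psi>t p + c3 * \<psi>x p))" (is ?D1)
    "(LINT p|lebesgue. QR c3 (u p) * (\<psi>t p + c3 * \<psi>x p)) = - (LBINT t. (d t - c3) * amp4 t * \<psi> (t, g t))" (is ?D2)
proof -
  have Qc: "\<And>f s. f \<longlonglongrightarrow> s \<Longrightarrow> snd s \<noteq> wc \<Longrightarrow> (\<lambda>n. QL c (f n)) \<longlonglongrightarrow> QL c s"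
    "\<And>f s. f \<longlonglongrightarrow> s \<Longrightarrow> snd s \<noteq> wc \<Longrightarrow> (\<lambda>n. QR c (f n)) \<longlonglongrightarrow> QR c s" for c
    by (rule Q_continuous[OF _ _ refl]; assumption)+
  have cc: "\<bar>c1\<bar> \<le> c1" "\<bar>- c1\<bar> \<le> c1" "\<bar>- c3\<bar> \<le> c1" "\<bar>c3\<bar> \<le> c1" using c_pos by auto
  have "{} \<in> sets (borel :: real measure)" "\<And>T. (\<lambda>j. \<integral>t. indicator ({0..T} \<inter> {}) t * \<bar>rt c j t\<bar> \<partial>lborel) \<longlonglongrightarrow> 0" for c by simp_all
  note Z0 = this
  note tl = transport_limit[OF G.tracked_L_in cc(1) Q_measurable(1) Q_bound(1) Qc(1) trace_amplitude_bound(1) amp_measurable(1) amp_bound(1) AE_amp_lim(1) Z0 test]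
    transport_limit[OF G.tracked_L_out cc(2) Q_measurable(1) Q_bound(2) Qc(1) trace_amplitude_bound(2) amp_measurable(2) amp_bound(2) AE_amp_lim(2) Z0 test]
    transport_limit[OF G.tracked_R_in cc(3) Q_measurable(2) Q_bound(4) Qc(2) trace_amplitude_bound(3) amp_measurable(3) amp_bound(3) AE_amp_lim(3) Z0 test]
    transport_limit[OF G.tracked_R_out cc(4) Q_measurable(2) Q_bound(3) Qc(2) trace_amplitude_bound(4) amp_measurable(4) amp_bound(4) AE_amp_lim(4) Zc_borel rate_vanishes test]
  show ?A1 ?A2 ?B1 ?B2 ?C1 ?C2 ?D1 ?D2 by (rule tl; assumption)+
qed

lemma test_function_on_curve:
  assumes test: "test_function \<psi> \<psi>t \<psi>x" and f[measurable]: "f \<in> borel_measurable borel" and B: "\<And>t. \<bar>f t\<bar> \<le> B"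
  shows "integrable lborel (\<lambda>t. f t * \<psi> (t, g t))" "(\<lambda>t. \<psi> (t, g t)) \<in> borel_measurable borel"
    "\<psi> \<in> borel_measurable borel" "t \<le> 0 \<Longrightarrow> \<psi> (t, x) = 0"
proof -
  obtain S T where box: "test_box S T \<psi> \<psi>t \<psi>x" by (rule ex_test_box[OF test])
  note S = test_boxD[OF box] and cont = test_function_continuous[OF test]
  obtain L where L: "L \<ge> 0" "\<And>p. \<bar>\<psi> p\<bar> \<le> L" using compact_support_bounded[OF cont(1) S(1,4)] by blast
  have gm: "(\<lambda>t. (t, g t)) \<in> measurable borel (borel :: point measure)"
    by (intro borel_measurable_continuous_onI continuous_intros g_continuous)
  show \<psi>m: "\<psi> \<in> borel_measurable borel" by (rule borel_measurable_continuous_onI[OF cont(1)])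
  show m[measurable]: "(\<lambda>t. \<psi> (t, g t)) \<in> borel_measurable borel" by (rule measurable_compose[OF gm \<psi>m])
  show "integrable lborel (\<lambda>t. f t * \<psi> (t, g t))"
  proof (rule integrable_bounded_Icc[where a=0 and b=T and B="B * L"])
    have "0 \<le> B" using B[of 0] by simp
    then show "\<bar>f t * \<psi> (t, g t)\<bar> \<le> B * L" for t by (simp add: abs_mult mult_mono B L)
    show "f t * \<psi> (t, g t) = 0" if "t \<notin> {0..T}" for t
      using S(4)[of "(t, g t)"] S(7)[of t "g t"] that by (cases "(t, g t) \<in> S") auto
  qed measurable
  show "t \<le> 0 \<Longrightarrow> \<psi> (t, x) = 0" using S(4)[of "(t, x)"] S(7)[of t x] by auto
qed

lemma balance:
  assumes test: "test_function \<psi> \<psi>t \<psi>x"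
  shows "- (LINT p|lebesgue. entropy k1 k3 wM wm (u p) * \<psi>t p + entropy_flux k1 k3 wM wm (u p) * \<psi>x p)
     = (LBINT t. prodn t * \<psi> (t, g t))"
proof -
  obtain S T where box: "test_box S T \<psi> \<psi>t \<psi>x" by (rule ex_test_box[OF test])
  note S = test_boxD[OF box] and cont = test_function_continuous[OF test]
  note pb = partial_balance[OF test]
  let ?I = "\<lambda>p. (QL c1 (u p) * (\<psi>t p + c1 * \<psi>x p) + QL (- c1) (u p) * (\<psi>t p + (- c1) * \<psi>x p)
      + QR (- c3) (u p) * (\<psi>t p + (- c3) * \<psi>x p) + QR c3 (u p) * (\<psi>t p + c3 * \<psi>x p)) / 4"
  have int: "integrable lebesgue ?I" by (intro integrable_divide Bochner_Integration.integrable_add pb)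
  have ae: "AE p in lebesgue. entropy k1 k3 wM wm (u p) * \<psi>t p + entropy_flux k1 k3 wM wm (u p) * \<psi>x p = ?I p"
    using AE_in_half_plane[OF S(2)]
  proof eventually_elim
    case (elim p)
    show ?case
    proof (cases "p \<in> S")
      case True
      then have w: "snd (u p) \<le> wM \<or> wm \<le> snd (u p)" using elim unfolding regular_point_def by blast
      show ?thesis unfolding entropy_decomposition[OF w]
        by (simp add: algebra_simps add_divide_distrib diff_divide_distrib)
    next
      case False
      then show ?thesis using S by simp
    qed
  qed
  have "(LINT p|lebesgue. entropy k1 k3 wM wm (u p) * \<psi>t p + entropy_flux k1 k3 wM wm (u p) * \<psi>x p) = (LINT p|lebesgue. ?I p)"
  proof (rule integral_cong_AE[OF _ borel_measurable_integrable[OF int] ae])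
    have "AE p in lebesgue. ?I p = entropy k1 k3 wM wm (u p) * \<psi>t p + entropy_flux k1 k3 wM wm (u p) * \<psi>x p"
      using ae by eventually_elim simp
    then show "(\<lambda>p. entropy k1 k3 wM wm (u p) * \<psi>t p + entropy_flux k1 k3 wM wm (u p) * \<psi>x p) \<in> borel_measurable lebesgue"
      by (rule borel_measurable_AE[OF borel_measurable_integrable[OF int]])
  qed
  also have "\<dots> = ((LINT p|lebesgue. QL c1 (u p) * (\<psi>t p + c1 * \<psi>x p)) + (LINT p|lebesgue. QL (- c1) (u p) * (\<psi>t p + (- c1) * \<psi>x p))
      + (LINT p|lebesgue. QR (- c3) (u p) * (\<psi>t p + (- c3) * \<psi>x p)) + (LINT p|lebesgue. QR c3 (u p) * (\<psi>t p + c3 * \<psi>x p))) / 4"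
    using pb(1,3,5,7) by (simp only: integral_divide_zero Bochner_Integration.integral_add Bochner_Integration.integrable_add)
  also have "\<dots> = - ((LBINT t. (d t - c1) * amp1 t * \<psi> (t, g t)) + (LBINT t. (d t - (- c1)) * amp2 t * \<psi> (t, g t))
      + (LBINT t. (d t - (- c3)) * amp3 t * \<psi> (t, g t)) + (LBINT t. (d t - c3) * amp4 t * \<psi> (t, g t))) / 4"
    unfolding pb(2,4,6,8) by simp
  also have "\<dots> = - (\<integral>t. ((d t - c1) * amp1 t * \<psi> (t, g t) + (d t - (- c1)) * amp2 t * \<psi> (t, g t)
      + (d t - (- c3)) * amp3 t * \<psi> (t, g t) + (d t - c3) * amp4 t * \<psi> (t, g t)) / 4 \<partial>lborel)"
  proof -
    have i: "integrable lborel (\<lambda>t. (d t - c) * A t * \<psi> (t, g t))" if "\<bar>c\<bar> \<le> c1" "A \<in> borel_measurable borel" "\<And>t. \<bar>A t\<bar> \<le> QM M" for c A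
    proof (rule test_function_on_curve(1)[OF test])
      show "(\<lambda>t. (d t - c) * A t) \<in> borel_measurable borel" using that(2) by measurable
      show "\<bar>(d t - c) * A t\<bar> \<le> (2 * q) * QM M" for t
        unfolding abs_mult by (rule mult_mono[OF _ that(3)]) (use d_le(4)[of t] that(1) q_gt in auto)
    qed
    have "integrable lborel (\<lambda>t. (d t - c1) * amp1 t * \<psi> (t, g t))" "integrable lborel (\<lambda>t. (d t - (- c1)) * amp2 t * \<psi> (t, g t))"
      "integrable lborel (\<lambda>t. (d t - (- c3)) * amp3 t * \<psi> (t, g t))" "integrable lborel (\<lambda>t. (d t - c3) * amp4 t * \<psi> (t, g t))"
      by (rule i; use c_pos amp_bound in simp)+
    then show ?thesis
      by (simp only: integral_divide_zero Bochner_Integration.integral_add Bochner_Integration.integrable_add minus_divide_left)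
  qed
  also have "\<dots> = - (LBINT t. prodn t * \<psi> (t, g t))"
    by (simp add: prodn_def algebra_simps add_divide_distrib diff_divide_distrib)
  finally show ?thesis by simp
qed

text \<open>The solution is only known to be measurable and, almost everywhere, bounded and outside
  the spinodal strip; there entropy and flux coincide with bounded quadratic expressions, through
  which measurability is transferred.\<close>

lemma entropy_set_integrable:
  assumes S: "compact S" "S \<subseteq> half_plane"
  shows "set_integrable lebesgue S (\<lambda>p. entropy k1 k3 wM wm (u p))" "set_integrable lebesgue S (\<lambda>p. entropy_flux k1 k3 wM wm (u p))"
proof -
  have Sb[measurable]: "S \<in> sets borel" using S(1) by (simp add: compact_imp_closed)
  have Sl: "S \<in> sets lebesgue" using Sb by simp
  have um: "(\<lambda>p. indicator S p *\<^sub>R u p) \<in> borel_measurable lebesgue"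
    using L1 S unfolding L1_loc_limit_def set_integrable_def by (blast dest: borel_measurable_integrable)
  have emS: "emeasure lborel S < \<infinity>" by (rule emeasure_bounded_finite[OF compact_imp_bounded[OF S(1)]])
  define R' where "R' = M + M / c3"
  have inv: "\<bar>riemann_inv c s\<bar> \<le> (1 + c1) * R'" if "norm s \<le> R'" "\<bar>c\<bar> \<le> c1" for c s
    by (rule order_trans[OF riemann_inv_le[OF that(2)]]) (use that(1) c_pos in \<open>auto intro: mult_left_mono\<close>)
  define B where "B = ((1 + c1) * R')\<^sup>2 + 2 * K0"
  have QB: "\<bar>QL c s\<bar> \<le> B" "\<bar>QR c s\<bar> \<le> B" if "norm s \<le> R'" "\<bar>c\<bar> \<le> c1" for c s
    using power_mono[OF inv[OF that] abs_ge_zero, of 2] K0_pos by (auto simp: QL_def QR_def B_def)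
  have one: "set_integrable lebesgue S (\<lambda>p. f (u p))"
    if Qm: "Q \<in> borel_measurable borel" and Qb: "\<And>s. norm s \<le> R' \<Longrightarrow> \<bar>Q s\<bar> \<le> C" and fQ: "\<And>s. snd s \<le> wM \<or> wm \<le> snd s \<Longrightarrow> f s = Q s"
    for f Q :: "state \<Rightarrow> real" and C
    unfolding set_integrable_def
  proof (rule integrableI_bounded_set[where A=S and B=C])
    have "(\<lambda>p. indicator S p *\<^sub>R Q (indicator S p *\<^sub>R u p)) \<in> borel_measurable lebesgue"
      using measurable_compose[OF um Qm] Sl by (intro borel_measurable_scaleR borel_measurable_indicator)
    then show "(\<lambda>p. indicat_real S p *\<^sub>R f (u p)) \<in> borel_measurable lebesgue"
    proof (rule borel_measurable_AE)
      show "AE p in lebesgue. indicator S p *\<^sub>R Q (indicator S p *\<^sub>R u p) = indicator S p *\<^sub>R f (u p)"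
        using AE_in_half_plane[OF S(2)] by eventually_elim (auto simp: indicator_def regular_point_def fQ)
    qed
    show "AE p in lebesgue. p \<in> S \<longrightarrow> norm (indicat_real S p *\<^sub>R f (u p)) \<le> C"
      using AE_in_half_plane[OF S(2)]
    proof eventually_elim
      case (elim p)
      then show ?case using Qb[of "u p"] by (auto simp: regular_point_def R'_def fQ)
    qed
  qed (use emS Sl in auto)
  have cc: "\<bar>c1\<bar> \<le> c1" "\<bar>- c1\<bar> \<le> c1" "\<bar>- c3\<bar> \<le> c1" "\<bar>c3\<bar> \<le> c1" using c_pos by auto
  note [measurable] = Q_measurable
  show "set_integrable lebesgue S (\<lambda>p. entropy k1 k3 wM wm (u p))"
  proof (rule one[OF _ _ entropy_decomposition(1)])
    show "\<bar>(QL c1 s + QL (- c1) s + QR (- c3) s + QR c3 s) / 4\<bar> \<le> B" if "norm s \<le> R'" for s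
      using QB(1)[OF that cc(1)] QB(1)[OF that cc(2)] QB(2)[OF that cc(3)] QB(2)[OF that cc(4)] by simp
  qed measurable
  have cQ: "\<bar>c * x\<bar> \<le> c1 * B" if "\<bar>c\<bar> \<le> c1" "\<bar>x\<bar> \<le> B" for c x
    unfolding abs_mult using that c_pos by (intro mult_mono) auto
  show "set_integrable lebesgue S (\<lambda>p. entropy_flux k1 k3 wM wm (u p))"
  proof (rule one[OF _ _ entropy_decomposition(2)])
    show "\<bar>(c1 * QL c1 s + (- c1) * QL (- c1) s + (- c3) * QR (- c3) s + c3 * QR c3 s) / 4\<bar> \<le> c1 * B" if "norm s \<le> R'" for s
      using cQ[OF cc(1) QB(1)[OF that cc(1)]] cQ[OF cc(2) QB(1)[OF that cc(2)]]
        cQ[OF cc(3) QB(2)[OF that cc(3)]] cQ[OF cc(4) QB(2)[OF that cc(4)]] by simp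
  qed measurable
qed

section \<open>Entropy production as a measure on the curve\<close>

definition "curve_measure f = distr (density lborel (\<lambda>t. ennreal (f t))) borel (\<lambda>t. (t, g t))"

lemma curve_map_measurable [measurable]: "(\<lambda>t. (t, g t)) \<in> measurable borel (borel :: point measure)"
  by (intro borel_measurable_continuous_onI continuous_intros g_continuous)

lemma sets_curve_measure [simp]: "sets (curve_measure f) = sets borel"
  by (simp add: curve_measure_def)

lemma emeasure_curve_measure:
  assumes [measurable]: "f \<in> borel_measurable borel" and E[measurable]: "E \<in> sets borel"
  shows "emeasure (curve_measure f) E = (\<integral>\<^sup>+t. ennreal (f t) * indicator E (t, g t) \<partial>lborel)"
proof -
  have m: "(\<lambda>t. (t, g t)) \<in> measurable (density lborel (\<lambda>t. ennreal (f t))) (borel :: point measure)" by simp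
  have v: "(\<lambda>t. (t, g t)) -` E \<in> sets lborel" using measurable_sets[OF curve_map_measurable E] by simp
  have "emeasure (curve_measure f) E = emeasure (density lborel (\<lambda>t. ennreal (f t))) ((\<lambda>t. (t, g t)) -` E)"
    unfolding curve_measure_def by (subst emeasure_distr[OF m E]) simp
  also have "\<dots> = (\<integral>\<^sup>+t. ennreal (f t) * indicator ((\<lambda>t. (t, g t)) -` E) t \<partial>lborel)"
    by (rule emeasure_density[OF _ v]) simp
  finally show ?thesis by (simp add: indicator_def)
qed

lemma integral_curve_measure:
  assumes [measurable]: "f \<in> borel_measurable borel" and f0: "\<And>t. 0 \<le> f t"
    and F: "F \<in> borel_measurable (borel :: point measure)"
  shows "(\<integral>p. F p \<partial>curve_measure f) = (LBINT t. f t * F (t, g t))"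
    "integrable (curve_measure f) F \<longleftrightarrow> integrable lborel (\<lambda>t. f t * F (t, g t))"
proof -
  have m: "(\<lambda>t. (t, g t)) \<in> measurable (density lborel (\<lambda>t. ennreal (f t))) (borel :: point measure)" by simp
  have F2: "(\<lambda>t. F (t, g t)) \<in> borel_measurable lborel" using measurable_compose[OF curve_map_measurable F] by simp
  have "(\<integral>p. F p \<partial>curve_measure f) = (\<integral>t. F (t, g t) \<partial>density lborel (\<lambda>t. ennreal (f t)))"
    unfolding curve_measure_def by (rule integral_distr[OF m F])
  also have "\<dots> = (LBINT t. f t *\<^sub>R F (t, g t))"
    by (rule integral_density[OF F2]) (use f0 in auto)
  finally show "(\<integral>p. F p \<partial>curve_measure f) = (LBINT t. f t * F (t, g t))" by simp
  have "integrable (curve_measure f) F \<longleftrightarrow> integrable (density lborel (\<lambda>t. ennreal (f t))) (\<lambda>t. F (t, g t))"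
    unfolding curve_measure_def by (rule integrable_distr_eq[OF m F])
  also have "\<dots> \<longleftrightarrow> integrable lborel (\<lambda>t. f t *\<^sub>R F (t, g t))"
    by (rule integrable_density[OF F2]) (use f0 in auto)
  finally show "integrable (curve_measure f) F \<longleftrightarrow> integrable lborel (\<lambda>t. f t * F (t, g t))" by simp
qed

text \<open>The signed production is split in time, before it is mapped to the curve. Positive times
  only: the map sends the others outside the half-plane.\<close>

definition "pos_part t = indicat_real {0<..} t * max (prodn t) 0"
definition "neg_part t = indicat_real {0<..} t * max (- prodn t) 0"

lemma parts: "pos_part \<in> borel_measurable borel" "neg_part \<in> borel_measurable borel" "0 \<le> pos_part t" "0 \<le> neg_part t"
  "\<bar>pos_part t\<bar> \<le> 2 * q * QM M" "\<bar>neg_part t\<bar> \<le> 2 * q * QM M"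
  "pos_part t - neg_part t = indicator {0<..} t * prodn t"
proof -
  show "pos_part \<in> borel_measurable borel" "neg_part \<in> borel_measurable borel"
    unfolding pos_part_def[abs_def] neg_part_def[abs_def] by measurable
  have "0 \<le> 2 * q * QM M" using prodn_bound[of t] by (rule order_trans[OF abs_ge_zero])
  then show "\<bar>pos_part t\<bar> \<le> 2 * q * QM M" "\<bar>neg_part t\<bar> \<le> 2 * q * QM M"
    using prodn_bound[of t] by (auto simp: pos_part_def neg_part_def indicator_def max_def)
qed (auto simp: pos_part_def neg_part_def indicator_def max_def)

lemma integrable_on_curve:
  fixes f :: "real \<Rightarrow> real"
  assumes f[measurable]: "f \<in> borel_measurable borel" and B: "\<And>t. \<bar>f t\<bar> \<le> B" and E: "E \<in> sets borel" "bounded (E :: point set)"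
  shows "integrable lborel (\<lambda>t. f t * indicator E (t, g t))"
proof -
  obtain T where T: "\<And>p. p \<in> E \<Longrightarrow> norm p \<le> T" using E(2) unfolding bounded_iff by blast
  have "(\<lambda>p. indicator E p :: real) \<in> borel_measurable borel" using E(1) by simp
  from measurable_compose[OF curve_map_measurable this] have [measurable]: "(\<lambda>t. indicator E (t, g t) :: real) \<in> borel_measurable borel" .
  show ?thesis
  proof (rule integrable_bounded_Icc[where a="-T" and b=T and B=B])
    show "\<bar>f t * indicator E (t, g t)\<bar> \<le> B" for t
      using B[of t] order_trans[OF abs_ge_zero B[of t]] by (simp add: indicator_def)
    show "f t * indicator E (t, g t) = 0" if "t \<notin> {-T..T}" for t
      using T[of "(t, g t)"] norm_fst_le[of t "g t"] that by (cases "(t, g t) \<in> E") (auto simp: abs_le_iff)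
  qed measurable
qed

lemma measure_curve_measure:
  fixes f :: "real \<Rightarrow> real"
  assumes f: "f \<in> borel_measurable borel" and f0: "\<And>t. 0 \<le> f t" and B: "\<And>t. \<bar>f t\<bar> \<le> B" and E: "E \<in> sets borel" "bounded (E :: point set)"
  shows "emeasure (curve_measure f) E < \<infinity>" "measure (curve_measure f) E = (LBINT t. f t * indicator E (t, g t))"
proof -
  note int = integrable_on_curve[OF f B E]
  have "(\<integral>\<^sup>+t. ennreal (f t) * indicator E (t, g t) \<partial>lborel) = (\<integral>\<^sup>+t. ennreal (f t * indicator E (t, g t)) \<partial>lborel)"
    by (rule nn_integral_cong) (simp add: indicator_def)
  also have "\<dots> = ennreal (LBINT t. f t * indicator E (t, g t))"
    by (rule nn_integral_eq_integral[OF int]) (use f0 in auto)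
  finally have e: "emeasure (curve_measure f) E = ennreal (LBINT t. f t * indicator E (t, g t))"
    unfolding emeasure_curve_measure[OF f E(1)] .
  show "emeasure (curve_measure f) E < \<infinity>" unfolding e by simp
  have "0 \<le> (LBINT t. f t * indicator E (t, g t))" by (intro integral_nonneg_AE AE_I2) (use f0 in simp)
  then show "measure (curve_measure f) E = (LBINT t. f t * indicator E (t, g t))" unfolding measure_def e by simp
qed

lemma entropy_divergence:
  "divergence_measure (\<lambda>p. entropy k1 k3 wM wm (u p)) (\<lambda>p. entropy_flux k1 k3 wM wm (u p)) (curve_measure pos_part) (curve_measure neg_part)"
  unfolding divergence_measure_def
proof (intro conjI allI impI)
  fix S :: "point set" assume "compact S \<and> S \<subseteq> half_plane"
  then have S: "compact S" "S \<subseteq> half_plane" by blast+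
  have E: "S \<in> sets borel" "bounded S" using S(1) by (simp_all add: compact_imp_closed compact_imp_bounded)
  show "set_integrable lebesgue S (\<lambda>p. entropy k1 k3 wM wm (u p))" "set_integrable lebesgue S (\<lambda>p. entropy_flux k1 k3 wM wm (u p))"
    by (fact entropy_set_integrable[OF S])+
  show "emeasure (curve_measure pos_part) S < \<infinity>" by (rule measure_curve_measure(1)[OF parts(1,3,5) E])
  show "emeasure (curve_measure neg_part) S < \<infinity>" by (rule measure_curve_measure(1)[OF parts(2,4,6) E])
next
  fix \<psi> \<psi>t \<psi>x assume test: "test_function \<psi> \<psi>t \<psi>x"
  note pm = test_function_on_curve(1)[OF test parts(1) parts(5)] test_function_on_curve(1)[OF test parts(2) parts(6)]
  have "(\<integral>p. \<psi> p \<partial>curve_measure pos_part) - (\<integral>p. \<psi> p \<partial>curve_measure neg_part)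
     = (LBINT t. pos_part t * \<psi> (t, g t)) - (LBINT t. neg_part t * \<psi> (t, g t))"
    using integral_curve_measure(1)[OF parts(1,3) test_function_on_curve(3)[OF test parts(1) parts(5)]]
      integral_curve_measure(1)[OF parts(2,4) test_function_on_curve(3)[OF test parts(1) parts(5)]] by simp
  also have "\<dots> = (LBINT t. pos_part t * \<psi> (t, g t) - neg_part t * \<psi> (t, g t))"
    using pm by simp
  also have "\<dots> = (LBINT t. prodn t * \<psi> (t, g t))"
  proof (rule Bochner_Integration.integral_cong[OF refl])
    fix t
    have "pos_part t * \<psi> (t, g t) - neg_part t * \<psi> (t, g t) = indicator {0<..} t * prodn t * \<psi> (t, g t)"
      unfolding parts(7)[symmetric] by (simp add: left_diff_distrib)
    also have "\<dots> = prodn t * \<psi> (t, g t)"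
      using test_function_on_curve(4)[OF test parts(1) parts(5), of t "g t"] by (cases "t > 0") auto
    finally show "pos_part t * \<psi> (t, g t) - neg_part t * \<psi> (t, g t) = prodn t * \<psi> (t, g t)" .
  qed
  finally show "- (LINT p|lebesgue. entropy k1 k3 wM wm (u p) * \<psi>t p + entropy_flux k1 k3 wM wm (u p) * \<psi>x p)
     = (\<integral>p. \<psi> p \<partial>curve_measure pos_part) - (\<integral>p. \<psi> p \<partial>curve_measure neg_part)"
    using balance[OF test] by simp
qed simp_all

text \<open>\<phi> is monotone, hence Borel, on ]-c3, c3]; the extension by 0 provides a Borel
  function on the line that can be composed with d.\<close>

definition "phi_ext x = (if - c3 < x \<and> x \<le> c3 then \<phi> x else 0)"
text \<open>The production per unit length: -d / sqrt (1 + d^2) is the time component of the unit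
  normal. Multiplication by the arc length element \<open>speed\<close> returns the production per
  unit time.\<close>

definition "rho t = - (d t / sqrt (1 + (d t)\<^sup>2)) * phi_ext (d t)"
definition "speed t = indicat_real {0<..} t * sqrt (1 + (d t)\<^sup>2)"

lemma phi_ext_measurable [measurable]: "phi_ext \<in> borel_measurable borel"
proof -
  have "\<phi> \<in> borel_measurable (restrict_space borel {- c3<..c3})"
    by (rule borel_measurable_mono_on_fnc[OF dissip_mono])
  then have "(\<lambda>x. indicator {- c3<..c3} x *\<^sub>R \<phi> x) \<in> borel_measurable borel"
    by (subst (asm) borel_measurable_restrict_space_iff) auto
  moreover have "phi_ext = (\<lambda>x. indicator {- c3<..c3} x *\<^sub>R \<phi> x)" by (auto simp: phi_ext_def fun_eq_iff indicator_def)
  ultimately show ?thesis by simp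
qed

lemma rho_measurable [measurable]: "rho \<in> borel_measurable borel" "speed \<in> borel_measurable borel"
  unfolding rho_def[abs_def] speed_def[abs_def] by measurable

lemma rho_speed:
  assumes "good t" "d t \<le> c3"
  shows "speed t * rho t = prodn t" "dissipation_density \<phi> \<gamma> (t, \<gamma> t) = rho t"
proof -
  have t: "t > 0" and dt: "d t = deriv \<gamma> t" using assms(1) by (auto simp: good_def d_def)
  have s: "sqrt (1 + (d t)\<^sup>2) > 0" by (simp add: add_pos_nonneg)
  have p: "phi_ext (d t) = \<phi> (d t)" using assms(2) d_bounds[OF assms(1)] by (simp add: phi_ext_def)
  show "speed t * rho t = prodn t"
    unfolding prodn_eq[OF assms] speed_def rho_def p using t s by simp
  define r where "r = 1 / sqrt (1 + (d t)\<^sup>2)"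
  have "r \<noteq> 0" using s by (simp add: r_def)
  moreover have "rho t = r * - d t * \<phi> (d t)" by (simp add: rho_def p r_def)
  ultimately show "dissipation_density \<phi> \<gamma> (t, \<gamma> t) = rho t"
    unfolding dissipation_density_def curve_normal_def Let_def fst_conv dt[symmetric] r_def[symmetric] by simp
qed

lemma curve_borel [measurable]: "curve \<gamma> \<in> sets borel"
proof -
  have "curve \<gamma> = {p. 0 < fst p \<and> snd p = g (fst p)}"
    unfolding curve_def by (auto simp: g_eq)
  moreover have "{p. 0 < fst p \<and> snd p = g (fst p)} \<in> sets (borel :: point measure)" by measurable
  ultimately show ?thesis by simp
qed

context
  assumes ms: "measure_space UNIV (sets borel) hausdorff1_outer"
begin

lemma hausdorff1_curve:
  assumes "A \<in> sets borel"
  shows "emeasure hausdorff1 {p. fst p \<in> A \<and> snd p = g (fst p)} = (\<integral>\<^sup>+t\<in>A. ennreal (sqrt (1 + (d t)\<^sup>2)) \<partial>lborel)"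
  by (rule hausdorff1_graph[OF ms g_lipschitz g_AE_derivative d_measurable d_le(4) assms])

text \<open>This identifies Hausdorff measure on the curve with a density in time, so that an
  equality of measures on the curve becomes an equality of densities for almost every t.\<close>

lemma hausdorff1_on_curve: "density hausdorff1 (indicator (curve \<gamma>)) = curve_measure speed"
proof (rule measure_eqI)
  fix E assume "E \<in> sets (density hausdorff1 (indicator (curve \<gamma>)))"
  then have E[measurable]: "E \<in> sets borel" by simp
  define A where "A = {0<..} \<inter> (\<lambda>t. (t, g t)) -` E"
  have A: "A \<in> sets borel" unfolding A_def using measurable_sets[OF curve_map_measurable E] by simp
  have "emeasure (density hausdorff1 (indicator (curve \<gamma>))) E = (\<integral>\<^sup>+p. indicator (curve \<gamma>) p * indicator E p \<partial>hausdorff1)"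
    by (rule emeasure_density) (simp_all add: measurable_cong_sets[OF sets_hausdorff1 refl])
  also have "\<dots> = (\<integral>\<^sup>+p. indicator (curve \<gamma> \<inter> E) p \<partial>hausdorff1)"
    by (rule nn_integral_cong) (simp add: indicator_def)
  also have "\<dots> = emeasure hausdorff1 (curve \<gamma> \<inter> E)" by (rule nn_integral_indicator) simp
  also have "curve \<gamma> \<inter> E = {p. fst p \<in> A \<and> snd p = g (fst p)}"
    unfolding curve_def A_def by (auto simp: g_eq)
  also have "emeasure hausdorff1 \<dots> = (\<integral>\<^sup>+t\<in>A. ennreal (sqrt (1 + (d t)\<^sup>2)) \<partial>lborel)" by (rule hausdorff1_curve[OF A])
  also have "\<dots> = (\<integral>\<^sup>+t. ennreal (speed t) * indicator E (t, g t) \<partial>lborel)"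
    by (rule nn_integral_cong) (simp add: speed_def A_def indicator_def)
  also have "\<dots> = emeasure (curve_measure speed) E" by (rule emeasure_curve_measure[symmetric]) simp_all
  finally show "emeasure (density hausdorff1 (indicator (curve \<gamma>))) E = emeasure (curve_measure speed) E" .
qed simp

lemma integral_hausdorff1_curve:
  fixes F :: "point \<Rightarrow> real"
  assumes F: "F \<in> borel_measurable borel"
  shows "(\<integral>p. indicator (curve \<gamma>) p * F p \<partial>hausdorff1) = (LBINT t. speed t * F (t, g t))"
    "integrable hausdorff1 (\<lambda>p. indicator (curve \<gamma>) p * F p) \<longleftrightarrow> integrable lborel (\<lambda>t. speed t * F (t, g t))"
proof -
  have s0: "0 \<le> speed t" for t by (simp add: speed_def)
  have Fm: "F \<in> borel_measurable hausdorff1" using F by (simp add: measurable_cong_sets[OF sets_hausdorff1 refl])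
  have im: "(\<lambda>p. indicat_real (curve \<gamma>) p) \<in> borel_measurable hausdorff1" by (simp add: measurable_cong_sets[OF sets_hausdorff1 refl])
  have e: "(indicator (curve \<gamma>) :: point \<Rightarrow> ennreal) = (\<lambda>p. ennreal (indicat_real (curve \<gamma>) p))" by (auto simp: fun_eq_iff indicator_def)
  have "(\<integral>p. F p \<partial>density hausdorff1 (\<lambda>p. ennreal (indicat_real (curve \<gamma>) p))) = (\<integral>p. indicat_real (curve \<gamma>) p *\<^sub>R F p \<partial>hausdorff1)"
    by (rule integral_density[OF Fm im]) simp
  then show "(\<integral>p. indicator (curve \<gamma>) p * F p \<partial>hausdorff1) = (LBINT t. speed t * F (t, g t))"
    using integral_curve_measure(1)[OF rho_measurable(2) s0 F] unfolding e[symmetric] hausdorff1_on_curve by simp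
  have "integrable (density hausdorff1 (\<lambda>p. ennreal (indicat_real (curve \<gamma>) p))) F = integrable hausdorff1 (\<lambda>p. indicat_real (curve \<gamma>) p *\<^sub>R F p)"
    by (rule integrable_density[OF Fm im]) simp
  then show "integrable hausdorff1 (\<lambda>p. indicator (curve \<gamma>) p * F p) \<longleftrightarrow> integrable lborel (\<lambda>t. speed t * F (t, g t))"
    using integral_curve_measure(2)[OF rho_measurable(2) s0 F] unfolding e[symmetric] hausdorff1_on_curve by simp
qed

lemma bad_points_null: "{p. fst p \<in> {t. t > 0 \<and> \<not> good t} \<and> snd p = g (fst p)} \<in> null_sets hausdorff1"
proof -
  have N: "{t. t > 0 \<and> \<not> good t} \<in> sets borel" by measurable
  have "emeasure hausdorff1 {p. fst p \<in> {t. t > 0 \<and> \<not> good t} \<and> snd p = g (fst p)} = (\<integral>\<^sup>+t\<in>{t. t > 0 \<and> \<not> good t}. ennreal (sqrt (1 + (d t)\<^sup>2)) \<partial>lborel)"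
    by (rule hausdorff1_curve[OF N])
  also have "\<dots> = (\<integral>\<^sup>+t. 0 \<partial>(lborel :: real measure))"
  proof (rule nn_integral_cong_AE)
    show "AE t in lborel. ennreal (sqrt (1 + (d t)\<^sup>2)) * indicator {t. t > 0 \<and> \<not> good t} t = 0"
      using AE_good by eventually_elim (simp add: indicator_def)
  qed
  finally have 0: "emeasure hausdorff1 {p. fst p \<in> {t. t > 0 \<and> \<not> good t} \<and> snd p = g (fst p)} = 0" by simp
  have "{p. fst p \<in> {t. t > 0 \<and> \<not> good t} \<and> snd p = g (fst p)} \<in> sets (borel :: point measure)" by measurable
  then show ?thesis using 0 by (simp add: null_sets_def)
qed

end

text \<open>The slope of an approximate jump bounds the slope of the curve from above. That one
  inequality is enough here, because \<open>prodn_eq\<close> asks for d \<le> c3 only.\<close>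

lemma B_sub_speed:
  assumes p: "(t, \<gamma> t) \<in> B_sub k3 wM wm u" and t: "good t"
  shows "d t \<le> c3"
proof -
  obtain \<nu> um up where j: "approx_jump u (t, \<gamma> t) \<nu> um up" "snd \<nu> > 0"
    "um \<in> phase1 wM \<and> up \<in> phase3 wm \<or> um \<in> phase3 wm \<and> up \<in> phase1 wM" "\<bar>- fst \<nu> / snd \<nu>\<bar> \<le> sqrt k3"
    using p unfolding B_sub_def by blast
  have t0: "t > 0" "t \<notin> bad" using t by (auto simp: good_def)
  have ge: "g t = \<gamma> t" using t0 by (simp add: g_eq)
  have "d t \<le> - fst \<nu> / snd \<nu>"
  proof (rule jump_normal_slope[OF _ j(2,3) wMm g_has_derivative[OF t0]])
    show "approx_jump u (t, g t) \<nu> um up" unfolding ge by (rule j(1))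
    show "AE q in lebesgue. fst q > 0 \<longrightarrow> (snd q < g (fst q) \<longrightarrow> snd (u q) \<le> wM) \<and> (snd q > g (fst q) \<longrightarrow> wm \<le> snd (u q))"
      using AE_regular
    proof eventually_elim
      case (elim q)
      show ?case
      proof
        assume "fst q > 0"
        then have "q \<in> half_plane" by (simp add: half_plane_def mem_Times_iff)
        then have "regular_point q" using elim by blast
        then show "(snd q < g (fst q) \<longrightarrow> snd (u q) \<le> wM) \<and> (snd q > g (fst q) \<longrightarrow> wm \<le> snd (u q))"
          unfolding regular_point_def by fastforce
      qed
    qed
  qed
  also have "\<dots> \<le> c3" using j(4) unfolding c3_def by linarith
  finally show ?thesis .
qed

lemma dissipation_on_curve:
  "measures_equal_ae_on (B_sub k3 wM wm u) (curve_measure pos_part) (curve_measure neg_part) (dissipation_density \<phi> \<gamma>) (curve \<gamma>)"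
proof (cases "measure_space UNIV (sets borel) hausdorff1_outer")
  case False
  \<comment> \<open>Here \<open>hausdorff1\<close> is the zero measure by the convention of
    \<open>measure_of\<close>, and the whole plane may be discarded as a null set.\<close>
  then have "emeasure hausdorff1 UNIV = 0" by (simp add: emeasure_hausdorff1)
  then have "UNIV \<in> null_sets hausdorff1" by (simp add: null_sets_def)
  then show ?thesis unfolding measures_equal_ae_on_def by (intro bexI[of _ UNIV]) (auto simp: set_integrable_def set_lebesgue_integral_def)
next
  case ms: True
  \<comment> \<open>The points of the curve at exceptional times. They are removed so that every
    remaining point of the curve in E has a good time and a speed at most c3; away from the curve
    both measures vanish.\<close>
  define N where "N = {p. fst p \<in> {t. t > 0 \<and> \<not> good t} \<and> snd p = g (fst p)}"
  show ?thesis unfolding measures_equal_ae_on_def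
  proof (intro bexI[of _ N] ballI impI)
    show "N \<in> null_sets hausdorff1" unfolding N_def by (rule bad_points_null[OF ms])
    fix E :: "point set" assume Eb: "E \<in> sets borel" and "E \<subseteq> B_sub k3 wM wm u - N \<and> compact (closure E) \<and> closure E \<subseteq> half_plane"
    then have sub: "E \<subseteq> B_sub k3 wM wm u - N" and cE: "compact (closure E)" and hE: "closure E \<subseteq> half_plane" by blast+
    have bE: "bounded E" by (rule bounded_subset[OF compact_imp_bounded[OF cE] closure_subset])
    have good: "good t \<and> d t \<le> c3" if "(t, g t) \<in> E" "t > 0" for t
    proof -
      have ge: "g t = \<gamma> t" using that by (simp add: g_eq)
      have "(t, g t) \<notin> N" using that sub by blast
      then have gd: "good t" using that(2) by (simp add: N_def)
      have "(t, \<gamma> t) \<in> B_sub k3 wM wm u" using that(1) sub unfolding ge by blast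
      from B_sub_speed[OF this gd] gd show ?thesis by blast
    qed
    define F where "F p = indicator E p * rho (fst p)" for p :: point
    have Fm: "F \<in> borel_measurable borel" unfolding F_def using Eb measurable_compose[OF fst_snd_borel(1) rho_measurable(1)]
      by (intro borel_measurable_times borel_measurable_indicator)
    have F_eq: "indicat_real (E \<inter> curve \<gamma>) p *\<^sub>R dissipation_density \<phi> \<gamma> p = indicator (curve \<gamma>) p * F p" for p
    proof (cases "p \<in> E \<inter> curve \<gamma>")
      case True
      then obtain t where t: "t > 0" "p = (t, \<gamma> t)" by (auto simp: curve_def)
      then have "(t, g t) \<in> E" using True by (simp add: g_eq)
      from good[OF this t(1)] have "dissipation_density \<phi> \<gamma> p = rho t" unfolding t(2) by (intro rho_speed(2)) auto
      then show ?thesis using True t(2) by (simp add: F_def)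
    qed (auto simp: F_def indicator_def)
    have key: "speed t * F (t, g t) = indicator {0<..} t * prodn t * indicator E (t, g t)" for t
    proof (cases "t > 0 \<and> (t, g t) \<in> E")
      case True
      then have "speed t * rho t = prodn t" using good[of t] by (intro rho_speed(1)) auto
      then show ?thesis using True by (simp add: F_def)
    qed (auto simp: F_def speed_def indicator_def)
    have int: "integrable lborel (\<lambda>t. indicator {0<..} t * prodn t * indicator E (t, g t))"
    proof (rule integrable_on_curve[OF _ _ Eb bE])
      show "(\<lambda>t. indicator {0<..} t * prodn t) \<in> borel_measurable borel" by measurable
      show "\<bar>indicator {0<..} t * prodn t\<bar> \<le> 2 * q * QM M" for t
        using prodn_bound[of t] order_trans[OF abs_ge_zero prodn_bound[of t]] by (simp add: indicator_def)
    qed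
    show "set_integrable hausdorff1 (E \<inter> curve \<gamma>) (dissipation_density \<phi> \<gamma>) \<and>
      measure (curve_measure pos_part) E - measure (curve_measure neg_part) E = (LINT p:E \<inter> curve \<gamma>|hausdorff1. dissipation_density \<phi> \<gamma> p)"
    proof
      show "set_integrable hausdorff1 (E \<inter> curve \<gamma>) (dissipation_density \<phi> \<gamma>)"
        unfolding set_integrable_def F_eq integral_hausdorff1_curve(2)[OF ms Fm] key by (rule int)
      have "measure (curve_measure pos_part) E - measure (curve_measure neg_part) E
        = (LBINT t. pos_part t * indicator E (t, g t)) - (LBINT t. neg_part t * indicator E (t, g t))"
        using measure_curve_measure(2)[OF parts(1,3,5) Eb bE] measure_curve_measure(2)[OF parts(2,4,6) Eb bE] by simp
      also have "\<dots> = (LBINT t. pos_part t * indicator E (t, g t) - neg_part t * indicator E (t, g t))"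
        using integrable_on_curve[OF parts(1,5) Eb bE] integrable_on_curve[OF parts(2,6) Eb bE] by simp
      also have "\<dots> = (LBINT t. speed t * F (t, g t))"
        unfolding key parts(7)[symmetric] by (simp add: left_diff_distrib)
      also have "\<dots> = (LINT p:E \<inter> curve \<gamma>|hausdorff1. dissipation_density \<phi> \<gamma> p)"
        unfolding set_lebesgue_integral_def F_eq integral_hausdorff1_curve(1)[OF ms Fm] ..
      finally show "measure (curve_measure pos_part) E - measure (curve_measure neg_part) E = (LINT p:E \<inter> curve \<gamma>|hausdorff1. dissipation_density \<phi> \<gamma> p)" .
    qed
  qed
qed

end

section \<open>Initial data and conclusion\<close>

lemma BV_norm_finite:
  assumes BV: "BV_norm \<Omega> f < \<infinity>" and m: "f \<in> borel_measurable (lebesgue_on \<Omega>)" and \<Omega>: "open \<Omega>"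
  shows "set_integrable lebesgue \<Omega> f" "total_variation \<Omega> f < \<infinity>"
proof -
  have o: "\<Omega> \<in> sets lebesgue" using \<Omega> by simp
  have fin: "(\<integral>\<^sup>+x\<in>\<Omega>. ennreal (norm (f x)) \<partial>lebesgue) < \<infinity>" and tv: "total_variation \<Omega> f < \<infinity>"
    using BV unfolding BV_norm_def by (auto simp: ennreal_add_less_top)
  show "total_variation \<Omega> f < \<infinity>" by (rule tv)
  show "set_integrable lebesgue \<Omega> f"
    unfolding set_integrable_def
  proof (rule integrableI_bounded)
    show "(\<lambda>x. indicat_real \<Omega> x *\<^sub>R f x) \<in> borel_measurable lebesgue"
      using m o by (subst (asm) borel_measurable_restrict_space_iff) auto
    have "(\<integral>\<^sup>+x. ennreal (norm (indicat_real \<Omega> x *\<^sub>R f x)) \<partial>lebesgue) = (\<integral>\<^sup>+x\<in>\<Omega>. ennreal (norm (f x)) \<partial>lebesgue)"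
      by (rule nn_integral_cong) (simp add: indicator_def)
    then show "(\<integral>\<^sup>+x. ennreal (norm (indicat_real \<Omega> x *\<^sub>R f x)) \<partial>lebesgue) < \<infinity>" using fin by simp
  qed
qed

text \<open>Only the deviation from the constant state is integrable on the half-line; averages of
  the data are that constant plus averages of the deviation. The endpoints of the interval may lie
  outside \<Omega>, as for cells that touch 0.\<close>

lemma average_shifted:
  fixes f u0 :: "real \<Rightarrow> state"
  assumes f: "set_integrable lebesgue \<Omega> f" and ab: "a < b" "{a<..<b} \<subseteq> \<Omega>"
    and u0: "\<And>x. x \<in> \<Omega> \<Longrightarrow> u0 x = s + f x"
  shows "set_integrable lebesgue {a..b} u0" "average a b u0 = s + average a b f"
proof -
  have fi: "set_integrable lebesgue {a..b} f" by (rule integral_lebesgue_subinterval[OF f ab(2)])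
  have "emeasure lebesgue {a..b} < \<infinity>" using ab by simp
  then have ind: "integrable lebesgue (indicat_real {a..b})" by (intro integrable_real_indicator) auto
  have ci: "integrable lebesgue (\<lambda>x. indicat_real {a..b} x *\<^sub>R s)" using ind by (rule integrable_scaleR_left)
  have ae: "AE x in lebesgue. indicat_real {a..b} x *\<^sub>R u0 x = indicat_real {a..b} x *\<^sub>R s + indicat_real {a..b} x *\<^sub>R f x"
  proof -
    have "AE x in lebesgue. x \<notin> {a, b}"
      by (rule AE_not_in) (intro null_sets_completionI countable_imp_null_set_lborel, simp)
    then show ?thesis
    proof eventually_elim
      case (elim x)
      show ?case
      proof (cases "x \<in> {a..b}")
        case True
        then have "x \<in> \<Omega>" using elim ab(2) by auto
        then show ?thesis using u0 by (simp add: scaleR_add_right)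
      qed simp
    qed
  qed
  have si: "integrable lebesgue (\<lambda>x. indicat_real {a..b} x *\<^sub>R s + indicat_real {a..b} x *\<^sub>R f x)"
    using ci fi by (simp add: set_integrable_def)
  have ae': "AE x in lebesgue. indicat_real {a..b} x *\<^sub>R s + indicat_real {a..b} x *\<^sub>R f x = indicat_real {a..b} x *\<^sub>R u0 x"
    using ae by eventually_elim simp
  have um: "(\<lambda>x. indicat_real {a..b} x *\<^sub>R u0 x) \<in> borel_measurable lebesgue"
    by (rule borel_measurable_AE[OF borel_measurable_integrable[OF si] ae'])
  show "set_integrable lebesgue {a..b} u0"
    unfolding set_integrable_def by (rule integrable_cong_AE_imp[OF si um ae'])
  have "(LINT x|lebesgue. indicat_real {a..b} x *\<^sub>R u0 x) = (LINT x|lebesgue. indicat_real {a..b} x *\<^sub>R s + indicat_real {a..b} x *\<^sub>R f x)"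
    by (rule integral_cong_AE[OF um borel_measurable_integrable[OF si] ae])
  also have "\<dots> = (LINT x|lebesgue. indicat_real {a..b} x *\<^sub>R s) + (LINT x|lebesgue. indicat_real {a..b} x *\<^sub>R f x)"
    using ci fi by (intro Bochner_Integration.integral_add) (simp_all add: set_integrable_def)
  also have "(LINT x|lebesgue. indicat_real {a..b} x *\<^sub>R s) = (b - a) *\<^sub>R s"
    using ind ab by (subst integral_scaleR_left) auto
  finally show "average a b u0 = s + average a b f"
    using ab by (simp add: average_def set_lebesgue_integral_def scaleR_add_right)
qed

lemma average_converges_shifted:
  assumes f: "set_integrable lebesgue \<Omega> f" and "open \<Omega>" "y \<in> \<Omega>" and u0: "\<And>x. x \<in> \<Omega> \<Longrightarrow> u0 x = s + f x"
    and lim: "average_converges f y"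
  shows "average_converges u0 y"
proof -
  obtain l where "((\<lambda>(a, b). average a b f) \<longlongrightarrow> l) (intervals_at y)" using lim unfolding average_converges_def by blast
  then have "((\<lambda>p. s + (case p of (a, b) \<Rightarrow> average a b f)) \<longlongrightarrow> s + l) (intervals_at y)" by (intro tendsto_intros)
  moreover obtain d where d: "d > 0" "ball y d \<subseteq> \<Omega>" using assms(2,3) by (meson open_contains_ball)
  have "eventually (\<lambda>p. s + (case p of (a, b) \<Rightarrow> average a b f) = (case p of (a, b) \<Rightarrow> average a b u0)) (intervals_at y)"
    unfolding eventually_intervals_at prod.case
  proof (intro exI conjI allI impI, rule d(1), elim conjE)
    fix a b assume ab: "y - d < a" "a < b" "b < y + d"
    then have "{a<..<b} \<subseteq> ball y d" by (auto simp: dist_real_def)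
    then show "s + average a b f = average a b u0"
      using average_shifted(2)[where s=s, OF f ab(2) _ u0] d(2) by fastforce
  qed
  ultimately show ?thesis unfolding average_converges_def by (blast intro: Lim_transform_eventually)
qed

text \<open>The factor s = \<plusminus>1 covers the upper bound wM on the left and the lower bound
  wm on the right at once.\<close>

lemma snd_average_le:
  fixes u0 :: "real \<Rightarrow> state"
  assumes u0: "set_integrable lebesgue {a..b} u0" and ab: "a < b" and s: "\<bar>s\<bar> = 1"
    and ae: "AE x in lebesgue. x \<in> {a<..<b} \<longrightarrow> s * snd (u0 x) \<le> s * w"
  shows "s * snd (average a b u0) \<le> s * w"
proof -
  have i: "integrable lebesgue (\<lambda>x. indicat_real {a..b} x *\<^sub>R u0 x)" using u0 by (simp add: set_integrable_def)
  have si: "integrable lebesgue (\<lambda>x. snd (indicat_real {a..b} x *\<^sub>R u0 x))" by (rule integrable_snd[OF i])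
  have se: "snd (LINT x|lebesgue. indicat_real {a..b} x *\<^sub>R u0 x) = (LINT x|lebesgue. snd (indicat_real {a..b} x *\<^sub>R u0 x))"
    by (rule integral_snd[OF i, symmetric])
  have "emeasure lebesgue {a..b} < \<infinity>" using ab by simp
  then have ind: "integrable lebesgue (indicat_real {a..b})" by (intro integrable_real_indicator) auto
  have "(LINT x|lebesgue. s * snd (indicat_real {a..b} x *\<^sub>R u0 x)) \<le> (LINT x|lebesgue. indicat_real {a..b} x * (s * w))"
  proof (rule integral_mono_AE)
    have "AE x in lebesgue. x \<notin> {a, b}"
      by (rule AE_not_in) (intro null_sets_completionI countable_imp_null_set_lborel, simp)
    with ae show "AE x in lebesgue. s * snd (indicat_real {a..b} x *\<^sub>R u0 x) \<le> indicat_real {a..b} x * (s * w)"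
      by eventually_elim (auto simp: indicator_def)
  qed (use si ind in auto)
  also have "(LINT x|lebesgue. indicat_real {a..b} x * (s * w)) = (b - a) * (s * w)" using ab by simp
  also have "(LINT x|lebesgue. s * snd (indicat_real {a..b} x *\<^sub>R u0 x)) = s * snd (LINT x:{a..b}|lebesgue. u0 x)"
    using si by (simp add: se set_lebesgue_integral_def)
  finally have "s * snd (LINT x:{a..b}|lebesgue. u0 x) / (b - a) \<le> s * w" using ab by (simp add: pos_divide_le_eq mult.commute)
  then show ?thesis by (simp add: average_def)
qed

locale initial_data = phase_model +
  fixes uLs uRs :: state and uL0 uR0 :: "real \<Rightarrow> state"
  assumes BVl: "BV_loc {..<0} uL0" and phl: "AE x in lebesgue. x < 0 \<longrightarrow> uL0 x \<in> phase1 wM"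
    and BVr: "BV_loc {0<..} uR0" and phr: "AE x in lebesgue. x > 0 \<longrightarrow> uR0 x \<in> phase3 wm"
    and finl: "BV_norm {..<0} (\<lambda>x. uL0 x - uLs) < \<infinity>" and finr: "BV_norm {0<..} (\<lambda>x. uR0 x - uRs) < \<infinity>"
begin

definition "u0 x = (if x < 0 then uL0 x else uR0 x)"

abbreviation "fL \<equiv> \<lambda>x. uL0 x - uLs"
abbreviation "fR \<equiv> \<lambda>x. uR0 x - uRs"

lemma fL: "set_integrable lebesgue {..<0} fL" "total_variation {..<0} fL < \<infinity>"
proof -
  have "fL \<in> borel_measurable (lebesgue_on {..<0})"
    using BVl unfolding BV_loc_def by (intro borel_measurable_diff) auto
  then show "set_integrable lebesgue {..<0} fL" "total_variation {..<0} fL < \<infinity>"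
    by (rule BV_norm_finite[OF finl], simp)+
qed

lemma fR: "set_integrable lebesgue {0<..} fR" "total_variation {0<..} fR < \<infinity>"
proof -
  have "fR \<in> borel_measurable (lebesgue_on {0<..})"
    using BVr unfolding BV_loc_def by (intro borel_measurable_diff) auto
  then show "set_integrable lebesgue {0<..} fR" "total_variation {0<..} fR < \<infinity>"
    by (rule BV_norm_finite[OF finr], simp)+
qed

lemma snd_average:
  assumes "a < b"
  shows "b \<le> 0 \<Longrightarrow> snd (average a b u0) \<le> wM" "0 \<le> a \<Longrightarrow> wm \<le> snd (average a b u0)"
proof -
  assume b: "b \<le> 0"
  then have "{a<..<b} \<subseteq> {..<0}" by auto
  then have "set_integrable lebesgue {a..b} u0" by (rule average_shifted(1)[OF fL(1) assms, of _ uLs]) (simp add: u0_def)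
  then have "1 * snd (average a b u0) \<le> 1 * wM"
  proof (rule snd_average_le[OF _ assms])
    show "AE x in lebesgue. x \<in> {a<..<b} \<longrightarrow> 1 * snd (u0 x) \<le> 1 * wM"
      using phl by eventually_elim (use b in \<open>auto simp: u0_def phase1_def\<close>)
  qed simp
  then show "snd (average a b u0) \<le> wM" by simp
next
  assume a: "0 \<le> a"
  then have "{a<..<b} \<subseteq> {0<..}" by auto
  then have "set_integrable lebesgue {a..b} u0" by (rule average_shifted(1)[OF fR(1) assms, of _ uRs]) (simp add: u0_def)
  then have "(-1) * snd (average a b u0) \<le> (-1) * wm"
  proof (rule snd_average_le[OF _ assms])
    show "AE x in lebesgue. x \<in> {a<..<b} \<longrightarrow> (-1) * snd (u0 x) \<le> (-1) * wm"
      using phr by eventually_elim (use a in \<open>auto simp: u0_def phase3_def\<close>)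
  qed simp
  then show "wm \<le> snd (average a b u0)" by simp
qed

lemma averages_bounded: "\<exists>B. \<forall>a b. a < b \<and> (b \<le> 0 \<or> 0 \<le> a) \<longrightarrow> norm (average a b u0) \<le> B"
proof -
  obtain BL where BL: "\<And>a b. a < b \<Longrightarrow> {a<..<b} \<subseteq> {..<0} \<Longrightarrow> norm (average a b fL) \<le> BL"
    using BV_averages_bounded[OF fL is_interval_io] by blast
  obtain BR where BR: "\<And>a b. a < b \<Longrightarrow> {a<..<b} \<subseteq> {0<..} \<Longrightarrow> norm (average a b fR) \<le> BR"
    using BV_averages_bounded[OF fR is_interval_oi] by blast
  have "norm (average a b u0) \<le> max (norm uLs + BL) (norm uRs + BR)" if ab: "a < b" "b \<le> 0 \<or> 0 \<le> a" for a b
  proof (cases "b \<le> 0")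
    case True
    then have sub: "{a<..<b} \<subseteq> {..<0}" by auto
    have "average a b u0 = uLs + average a b fL" by (rule average_shifted(2)[OF fL(1) ab(1) sub]) (simp add: u0_def)
    then show ?thesis using BL[OF ab(1) sub] norm_triangle_ineq[of uLs "average a b fL"] by simp
  next
    case False
    then have sub: "{a<..<b} \<subseteq> {0<..}" using ab(2) by auto
    have "average a b u0 = uRs + average a b fR" by (rule average_shifted(2)[OF fR(1) ab(1) sub]) (simp add: u0_def)
    then show ?thesis using BR[OF ab(1) sub] norm_triangle_ineq[of uRs "average a b fR"] by simp
  qed
  then show ?thesis by blast
qed

lemma averages_converge: "countable {y. y \<noteq> 0 \<and> \<not> average_converges u0 y}"
proof -
  have l: "average_converges u0 y" if "y < 0" "average_converges fL y" for y
    by (rule average_converges_shifted[OF fL(1) open_lessThan _ _ that(2), of _ uLs]) (use that in \<open>auto simp: u0_def\<close>)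
  have r: "average_converges u0 y" if "y > 0" "average_converges fR y" for y
    by (rule average_converges_shifted[OF fR(1) open_greaterThan _ _ that(2), of _ uRs]) (use that in \<open>auto simp: u0_def\<close>)
  have "{y. y \<noteq> 0 \<and> \<not> average_converges u0 y}
      \<subseteq> {y \<in> {..<0}. \<not> average_converges fL y} \<union> {y \<in> {0<..}. \<not> average_converges fR y}"
    using l r by (auto simp: neq_iff)
  then show ?thesis
    by (rule countable_subset) (intro countable_Un BV_averages_converge fL fR open_lessThan open_greaterThan)
qed

text \<open>Initial cells start at even multiples of h, so none straddles 0, and all of them are
  averages over one side. This gives a bound A independent of the mesh, hence one M for the family,
  and places the initial boundary at 0.\<close>

lemma family_bounded:
  assumes gl: "\<And>j :: nat. glimm k1 k3 wM wm \<phi> (\<tau> j) (h j) q a u0 (uh j) (\<gamma>h j)"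
  shows "\<exists>M. \<forall>j. bounded_glimm k1 k3 wM wm \<phi> (\<tau> j) (h j) q a u0 (uh j) (\<gamma>h j) M"
    "glimm.b wM wm (\<tau> j) (h j) (uh j) (\<gamma>h j) 0 = 0"
proof -
  interpret G: glimm k1 k3 wM wm \<phi> "\<tau> j" "h j" q a u0 "uh j" "\<gamma>h j" for j by (rule gl)
  obtain B where B: "\<And>a b. a < b \<Longrightarrow> b \<le> 0 \<or> 0 \<le> a \<Longrightarrow> norm (average a b u0) \<le> B" using averages_bounded by blast
  have le: "of_int m * h j < of_int (m + 2) * h j" for j and m :: int
    using G.h_pos[of j] by (intro mult_strict_right_mono) auto
  have left: "of_int (m + 2) * h j \<le> 0" if "m \<le> - 2" for j and m :: int
    using that G.h_pos[of j] by (intro mult_nonpos_nonneg) auto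
  have right: "0 \<le> of_int m * h j" if "0 \<le> m" for j and m :: int
    using that G.h_pos[of j] by simp
  \<comment> \<open>The average satisfies w \<le> wM, which excludes phase 3; that it lies in one of
    the phases at all, and so above -1, is part of the solver having a solution for these
    data.\<close>
  have pl: "G.cell j 0 m \<in> phase1 wM" if "even m" "m \<le> - 2" for j m
  proof -
    have "snd (G.cell j 0 m) \<le> wM" unfolding G.cell_0[OF that(1)] by (rule snd_average(1)[OF le left[OF that(2)]])
    then have "G.cell j 0 m \<notin> phase3 wm" using wMm by (auto simp: phase3_def)
    then show ?thesis using G.cell_phase[of m 0 j] that(1) by simp
  qed
  have pr: "G.cell j 0 m \<in> phase3 wm" if "even m" "0 \<le> m" for j m
  proof -
    have "wm \<le> snd (G.cell j 0 m)" unfolding G.cell_0[OF that(1)] by (rule snd_average(2)[OF le right[OF that(2)]])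
    then have "G.cell j 0 m \<notin> phase1 wM" using wMm by (auto simp: phase1_def)
    then show ?thesis using G.cell_phase[of m 0 j] that(1) by simp
  qed
  define A where "A = (1 + c1) * B"
  have ini: "bounded_state A (G.cell j 0 m)" if m: "even m" for j m
  proof -
    have m2: "m \<le> - 2 \<or> 0 \<le> m" using m by presburger
    have "norm (G.cell j 0 m) \<le> B" unfolding G.cell_0[OF m]
      by (rule B[OF le]) (use m2 left[of m j] right[of m j] in blast)
    then have "(1 + c1) * norm (G.cell j 0 m) \<le> A" unfolding A_def using c_pos by (intro mult_left_mono) auto
    then have "\<bar>riemann_inv c (G.cell j 0 m)\<bar> \<le> A" if "\<bar>c\<bar> \<le> c1" for c
      using riemann_inv_le[OF that, of "G.cell j 0 m"] by linarith
    then show ?thesis using m2 pl[OF m, of j] pr[OF m, of j] c_pos unfolding bounded_state_def by auto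
  qed
  obtain W where W: "\<And>V um up. boundary_trace V um up \<Longrightarrow> V < c3 \<Longrightarrow> \<bar>riemann_inv c1 um\<bar> \<le> A \<Longrightarrow> \<bar>riemann_inv (- c3) up\<bar> \<le> A \<Longrightarrow> snd up \<le> W"
    using trace_right_bound[of A] by blast
  define M where "M = A + 2 * c1 * (1 + wM) + 2 * c3 * \<bar>W\<bar>"
  note st = G.states_bounded[OF ini W M_def]
  have "0 \<le> A" using ini[of 0 0] bounded_state_def[of A "G.cell 0 0 0"] by (auto intro: order_trans[OF abs_ge_zero])
  then have M0: "0 \<le> M" unfolding M_def using c_pos wM_pos by simp
  have "bounded_glimm k1 k3 wM wm \<phi> (\<tau> j) (h j) q a u0 (uh j) (\<gamma>h j) M" for j
    by unfold_locales (use M0 st in auto)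
  then show "\<exists>M. \<forall>j. bounded_glimm k1 k3 wM wm \<phi> (\<tau> j) (h j) q a u0 (uh j) (\<gamma>h j) M" by blast
  have ev: "even (G.b j 0)" using G.b_even[of j 0] by simp
  have "\<not> 0 < G.b j 0"
  proof
    assume "0 < G.b j 0"
    then have "G.cell j 0 0 \<in> phase1 wM" by (intro G.left_cell) auto
    then show False using pr[of 0 j] phases_disjoint by simp
  qed
  moreover have "\<not> G.b j 0 < 0"
  proof
    assume "G.b j 0 < 0"
    then have "G.b j 0 \<le> - 2" using ev by presburger
    then have "G.cell j 0 (- 2) \<in> phase3 wm" by (intro G.right_cell) auto
    then show False using pl[of "- 2" j] phases_disjoint by simp
  qed
  ultimately show "G.b j 0 = 0" by simp
qed

lemma limit_dissipation:
  assumes gl: "\<And>j :: nat. glimm k1 k3 wM wm \<phi> (\<tau> j) (h j) q a u0 (uh j) (\<gamma>h j)"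
    and eq: "equidistributed a" and h0: "h \<longlonglongrightarrow> 0" and L: "L1_loc_limit uh u" and lim: "phase_boundary_limit \<gamma>h \<gamma>"
  shows "\<exists>\<mu>p \<mu>n. divergence_measure (\<lambda>p. entropy k1 k3 wM wm (u p)) (\<lambda>p. entropy_flux k1 k3 wM wm (u p)) \<mu>p \<mu>n \<and>
     measures_equal_ae_on (B_sub k3 wM wm u) \<mu>p \<mu>n (dissipation_density \<phi> \<gamma>) (curve \<gamma>)"
proof -
  obtain M where M: "\<And>j. bounded_glimm k1 k3 wM wm \<phi> (\<tau> j) (h j) q a u0 (uh j) (\<gamma>h j) M"
    using family_bounded(1)[of \<tau> h q a uh \<gamma>h, OF gl] by blast
  interpret F: glimm_family k1 k3 wM wm \<phi> q a u0 \<tau> h uh \<gamma>h u \<gamma> M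
    by (rule glimm_family.intro[OF phase_model_axioms], rule glimm_family_axioms.intro) (fact M eq h0 L lim)+
  interpret F: glimm_traces k1 k3 wM wm \<phi> q a u0 \<tau> h uh \<gamma>h u \<gamma> M
    by unfold_locales (rule family_bounded(2)[of \<tau> h q a uh \<gamma>h, OF gl], rule averages_converge)
  show ?thesis using F.entropy_divergence F.dissipation_on_curve by blast
qed

end

theorem theorem4p2:
  fixes k1 k3 wM wm Vs :: real and \<phi> :: "real \<Rightarrow> real" and uLs uRs :: state
  assumes "0 < k3" and "k3 < k1" and "0 < wM" and "wM < wm"
    and "dissipation_function k1 k3 wM wm \<phi>"
    and "uLs \<in> phase1 wM" and "uRs \<in> phase3 wm"
    and "riemann_solution k1 k3 wM wm \<phi> uLs uRs (fan2 Vs uLs uRs)"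
    and "Vs = sqrt k3 \<Longrightarrow>
           snd uLs = 0 \<and> snd uRs = sqrt (deriv_phi k3 \<phi> (sqrt k3) / sqrt k3)"
    and "Vs \<noteq> 0"
  shows "\<exists>\<epsilon>>0. \<forall>uL0 uR0 :: real \<Rightarrow> state.
    BV_loc {..<0} uL0 \<and> (AE x in lebesgue. x < 0 \<longrightarrow> uL0 x \<in> phase1 wM) \<and>
    BV_loc {0<..} uR0 \<and> (AE x in lebesgue. x > 0 \<longrightarrow> uR0 x \<in> phase3 wm) \<and>
    BV_norm {..<0} (\<lambda>x. uL0 x - uLs) + BV_norm {0<..} (\<lambda>x. uR0 x - uRs) < ennreal \<epsilon> \<longrightarrow>
    (\<forall>(a :: nat \<Rightarrow> real) (q :: real) (h :: nat \<Rightarrow> real) (\<tau> :: nat \<Rightarrow> real)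
      (uh :: nat \<Rightarrow> point \<Rightarrow> state) (\<gamma>h :: nat \<Rightarrow> real \<Rightarrow> real) (u :: point \<Rightarrow> state) (\<gamma> :: real \<Rightarrow> real).
      equidistributed a \<and>
      (\<forall>j. h j > 0 \<and> \<tau> j > 0 \<and> h j / \<tau> j = q \<and> \<tau> j * sqrt k1 < h j) \<and> h \<longlonglongrightarrow> 0 \<and>
      (\<forall>j. glimm_scheme k1 k3 wM wm \<phi> (\<tau> j) (h j) a (\<lambda>x. if x < 0 then uL0 x else uR0 x) (uh j)) \<and>
      L1_loc_limit uh u \<and>
      (\<forall>j. approx_phase_boundary wM wm (uh j) (\<gamma>h j)) \<and>
      phase_boundary_limit \<gamma>h \<gamma> \<longrightarrow>
      (\<exists>\<mu>p \<mu>n :: point measure.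
         divergence_measure (\<lambda>p. entropy k1 k3 wM wm (u p)) (\<lambda>p. entropy_flux k1 k3 wM wm (u p)) \<mu>p \<mu>n \<and>
         measures_equal_ae_on (B_sub k3 wM wm u) \<mu>p \<mu>n (dissipation_density \<phi> \<gamma>) (curve \<gamma>)))"
proof (intro exI[of _ "1 :: real"] conjI allI impI, simp, elim conjE)
  fix uL0 uR0 :: "real \<Rightarrow> state" and a q h \<tau> uh \<gamma>h u \<gamma>
  assume l: "BV_loc {..<0} uL0" "AE x in lebesgue. x < 0 \<longrightarrow> uL0 x \<in> phase1 wM"
    and r: "BV_loc {0<..} uR0" "AE x in lebesgue. x > 0 \<longrightarrow> uR0 x \<in> phase3 wm"
    and small: "BV_norm {..<0} (\<lambda>x. uL0 x - uLs) + BV_norm {0<..} (\<lambda>x. uR0 x - uRs) < ennreal 1"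
    and eq: "equidistributed a" and mesh: "\<forall>j. h j > 0 \<and> \<tau> j > 0 \<and> h j / \<tau> j = q \<and> \<tau> j * sqrt k1 < h j" and h0: "h \<longlonglongrightarrow> 0"
    and sch: "\<forall>j. glimm_scheme k1 k3 wM wm \<phi> (\<tau> j) (h j) a (\<lambda>x. if x < 0 then uL0 x else uR0 x) (uh j)"
    and L: "L1_loc_limit uh u" and bd: "\<forall>j. approx_phase_boundary wM wm (uh j) (\<gamma>h j)"
    and lim: "phase_boundary_limit \<gamma>h \<gamma>"
  \<comment> \<open>The witness 1 for \<epsilon> makes both norms finite, which yields integrable
    deviations of finite total variation, and thereby bounded averages that converge off a countable
    set.\<close>
  have "BV_norm {..<0} (\<lambda>x. uL0 x - uLs) + BV_norm {0<..} (\<lambda>x. uR0 x - uRs) < \<infinity>"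
    using small by (rule order_less_trans) simp
  then have fin: "BV_norm {..<0} (\<lambda>x. uL0 x - uLs) < \<infinity>" "BV_norm {0<..} (\<lambda>x. uR0 x - uRs) < \<infinity>"
    by (auto simp: ennreal_add_less_top)
  interpret initial_data k1 k3 wM wm \<phi> uLs uRs uL0 uR0
    by unfold_locales (fact assms(1-5) l r fin)+
  have "glimm k1 k3 wM wm \<phi> (\<tau> j) (h j) q a u0 (uh j) (\<gamma>h j)" for j
  proof unfold_locales
    show "glimm_scheme k1 k3 wM wm \<phi> (\<tau> j) (h j) a u0 (uh j)" using sch unfolding u0_def by blast
    show "approx_phase_boundary wM wm (uh j) (\<gamma>h j)" using bd by blast
    show "0 < h j" "0 < \<tau> j" "h j / \<tau> j = q" "\<tau> j * c1 < h j" using mesh by (simp_all add: c1_def)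
    show "-1 < a n \<and> a n < 1" if "n \<ge> 1" for n
      using eq that unfolding equidistributed_def by blast
  qed
  from limit_dissipation[OF this eq h0 L lim]
  show "\<exists>\<mu>p \<mu>n. divergence_measure (\<lambda>p. entropy k1 k3 wM wm (u p)) (\<lambda>p. entropy_flux k1 k3 wM wm (u p)) \<mu>p \<mu>n \<and>
     measures_equal_ae_on (B_sub k3 wM wm u) \<mu>p \<mu>n (dissipation_density \<phi> \<gamma>) (curve \<gamma>)" .
qed

end
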